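(* Let $T>0$. If $\bar{\mathcal R}^n_0+\bar E^n\mathcal F\Rightarrow\bar{\mathcal R}_0+\bar E\mathcal F$ in $\mathbb D([0,T],\mathcal S')$ as $n\to\infty$ (with $\bar{\mathcal R}^n_0$, $\bar{\mathcal R}_0$ regarded as processes constant in time), then $$\bar{\mathcal R}^n\Rightarrow\bar{\mathcal R}\quad\text{in }\mathbb D([0,T],\mathcal S')\text{ as }n\to\infty,$$ where $\bar{\mathcal R}$ is the unique solution to the integral equation $$\langle\bar{\mathcal R}_t,\varphi\rangle=\langle\bar{\mathcal R}_0,\varphi\rangle+\bar E_t\langle\mathcal F,\varphi\rangle-\int_0^t\langle\bar{\mathcal R}_s,\varphi'\rangle\,ds,\qquad t\in[0,T],$$ for all $\varphi\in\mathcal S$.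
   Context: Spaces. $\mathcal S$ is the Schwartz space of rapidly decreasing $C^\infty$ functions $\mathbb R\to\mathbb R$, topologized by the seminorms $\|\varphi\|_{\alpha,\beta}=\sup_x|x^\alpha\varphi^{(\beta)}(x)|$, $\alpha,\beta\in\mathbb N$. $\mathcal S'$ is its topological dual with the strong topology, generated by the seminorms $q_B(\mu)=\sup_{\varphi\in B}|\langle\mu,\varphi\rangle|$, $B\subset\mathcal S$ bounded. $\mathbb D([0,T],\mathcal S')$ is the space of functions $[0,T]\to\mathcal S'$ that are right-continuous on $[0,T)$ with left limits on $(0,T]$, topologized by the pseudometrics $d^o_{q_B}(\mu,\nu)=\inf_{\lambda\in\Lambda}(\sup_{t\le T}q_B(\mu_t-\nu_{\lambda_t})+\gamma(\lambda))$, where $\Lambda$ is the set of strictly increasing continuous maps $\lambda$ of $[0,T]$ onto itself with $\gamma(\lambda)=\sup_{s<t}|\ln((\lambda_t-\lambda_s)/(t-s))|<\infty$. $\Rightarrow$ denotes weak convergence: expectations of every bounded continuous real functional converge. Model. For each $n\ge1$ consider a $G/GI/\infty$ queue. The arrival process $E^n=(E^n_t)_{t\ge0}$ is a counting process (nondecreasing, integer valued, right-continuous with left limits) with $E^n_0=0$ a.s. and $\mathbb E[(E^n_t)^2]<\infty$; $\tau^n_i=\inf\{t\ge0:E^n_t\ge i\}$. The service times $\eta_i$, $i\ge1$, of customers arriving after time $0$ are i.i.d., nonnegative, mean $1$, with c.d.f. $F$ and density $f$ (not depending on $n$), whose hazard rate $h=f/(1-F)$ is bounded and infinitely differentiable on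 $\mathbb R_+$ with all derivatives bounded. At time $0$ there are $R^n_0(y)$ customers with at most $y$ units of service time remaining (finitely many customers in total). The sequence $(\eta_i)$ is independent of $(R^n_0,E^n)$. Residual service time process. For $t\ge0$, $y\in\mathbb R$, $R^n_t(y)=R^n_0(t+y)+\sum_{i=1}^{E^n_t}\mathbf 1_{\{\eta_i-(t-\tau^n_i)\le y\}}$ (for $y<0$ this counts customers who departed by time $t+y$), and $\mathcal R^n$ is the $\mathcal S'$-valued process $\langle\mathcal R^n_t,\varphi\rangle=\int_{\mathbb R}\varphi(y)\,dR^n_t(y)$; $\mathcal R^n_0$ is its value at $t=0$. $\mathcal F\in\mathcal S'$ is given by $\langle\mathcal F,\varphi\rangle=\int_0^\infty\varphi\,dF$. Fluid scaling: $\bar{\mathcal R}^n=\mathcal R^n/n$, $\bar{\mathcal R}^n_0=\mathcal R^n_0/n$, $\bar E^n=E^n/n$. *)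

theory Defs
  imports "HOL-Probability.Probability"
begin

section \<open>The Schwartz space\<close>

definition schwartz_fun :: "(real \<Rightarrow> real) \<Rightarrow> bool" where
  "schwartz_fun \<phi> \<longleftrightarrow>
     (\<forall>k x. (deriv ^^ k) \<phi> field_differentiable at x) \<and>
     (\<forall>\<alpha> \<beta>. bounded (range (\<lambda>x. x ^ \<alpha> * (deriv ^^ \<beta>) \<phi> x)))"

lemma higher_deriv_zero: "(deriv ^^ k) (\<lambda>x::real. 0::real) = (\<lambda>x. 0)"
  by (induction k) auto

lemma schwartz_fun_zero: "schwartz_fun (\<lambda>x. 0)"
  by (simp add: schwartz_fun_def higher_deriv_zero)

typedef schwartz = "{\<phi>. schwartz_fun \<phi>}"
  morphisms sfun Abs_schwartz
  using schwartz_fun_zero by blast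

setup_lifting type_definition_schwartz

lemma higher_deriv_add:
  assumes "schwartz_fun f" "schwartz_fun g"
  shows "(deriv ^^ k) (\<lambda>x. f x + g x) = (\<lambda>x. (deriv ^^ k) f x + (deriv ^^ k) g x)"
proof (induction k)
  case (Suc k)
  show ?case
    using assms by (simp add: Suc schwartz_fun_def fun_eq_iff)
qed simp

lemma higher_deriv_scale:
  assumes "schwartz_fun f"
  shows "(deriv ^^ k) (\<lambda>x. c * f x) = (\<lambda>x. c * (deriv ^^ k) f x)"
proof (induction k)
  case (Suc k)
  show ?case
    using assms by (simp add: Suc schwartz_fun_def fun_eq_iff)
qed simp

lemma schwartz_fun_add:
  assumes "schwartz_fun f" "schwartz_fun g"
  shows "schwartz_fun (\<lambda>x. f x + g x)"
proof -
  have "bounded (range (\<lambda>x. x ^ \<alpha> * (deriv ^^ \<beta>) f x + x ^ \<alpha> * (deriv ^^ \<beta>) g x))" for \<alpha> \<beta>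
    using assms by (intro bounded_plus_comp) (auto simp: schwartz_fun_def)
  then show ?thesis
    using assms by (auto simp: schwartz_fun_def higher_deriv_add[OF assms] distrib_left
        intro!: field_differentiable_add)
qed

lemma schwartz_fun_scale:
  assumes "schwartz_fun f"
  shows "schwartz_fun (\<lambda>x. c * f x)"
proof -
  have "bounded (range (\<lambda>x. c *\<^sub>R (x ^ \<alpha> * (deriv ^^ \<beta>) f x)))" for \<alpha> \<beta>
    using assms by (intro bounded_scaleR_comp) (auto simp: schwartz_fun_def)
  then show ?thesis
    using assms by (auto simp: schwartz_fun_def higher_deriv_scale[OF assms] mult_ac
        intro!: field_differentiable_mult)
qed

lemma schwartz_fun_deriv:
  assumes "schwartz_fun f"
  shows "schwartz_fun (deriv f)"
proof -
  have "(deriv ^^ k) (deriv f) = (deriv ^^ Suc k) f" for k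
    by (simp add: funpow_swap1)
  then show ?thesis
    using assms unfolding schwartz_fun_def by metis
qed

instantiation schwartz :: real_vector
begin

lift_definition zero_schwartz :: schwartz is "\<lambda>x. 0"
  by (rule schwartz_fun_zero)

lift_definition plus_schwartz :: "schwartz \<Rightarrow> schwartz \<Rightarrow> schwartz" is "\<lambda>f g x. f x + g x"
  by (rule schwartz_fun_add)

lift_definition scaleR_schwartz :: "real \<Rightarrow> schwartz \<Rightarrow> schwartz" is "\<lambda>c f x. c * f x"
  by (rule schwartz_fun_scale)

lift_definition uminus_schwartz :: "schwartz \<Rightarrow> schwartz" is "\<lambda>f x. - f x"
  subgoal for f using schwartz_fun_scale[of f "-1"] by simp
  done

lift_definition minus_schwartz :: "schwartz \<Rightarrow> schwartz \<Rightarrow> schwartz" is "\<lambda>f g x. f x - g x"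
  subgoal for f g using schwartz_fun_add[of f "\<lambda>x. -1 * g x"] schwartz_fun_scale[of g "-1"] by simp
  done

instance
  by standard (transfer; simp add: algebra_simps fun_eq_iff)+

end

lift_definition schwartz_deriv :: "schwartz \<Rightarrow> schwartz" is deriv
  by (rule schwartz_fun_deriv)

definition schwartz_seminorm :: "nat \<Rightarrow> nat \<Rightarrow> schwartz \<Rightarrow> real" where
  "schwartz_seminorm \<alpha> \<beta> \<phi> = (SUP x. \<bar>x ^ \<alpha> * (deriv ^^ \<beta>) (sfun \<phi>) x\<bar>)"

instantiation schwartz :: topological_space
begin

definition open_schwartz :: "schwartz set \<Rightarrow> bool" where
  "open_schwartz =
     generate_topology {{\<psi>. schwartz_seminorm \<alpha> \<beta> (\<psi> - \<phi>) < e} |\<alpha> \<beta> \<phi> e. 0 < e}"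

instance
  by standard (auto simp: open_schwartz_def intro: generate_topology.intros)

end

definition schwartz_bounded :: "schwartz set \<Rightarrow> bool" where
  "schwartz_bounded B \<longleftrightarrow> (\<forall>\<alpha> \<beta>. bdd_above (schwartz_seminorm \<alpha> \<beta> ` B))"


section \<open>Tempered distributions with the strong topology\<close>

typedef tempered = "{\<mu> :: schwartz \<Rightarrow> real. linear \<mu> \<and> continuous_on UNIV \<mu>}"
  morphisms pairing Abs_tempered
proof
  show "(\<lambda>_. 0) \<in> {\<mu> :: schwartz \<Rightarrow> real. linear \<mu> \<and> continuous_on UNIV \<mu>}"
    by (simp add: linear_iff)
qed

setup_lifting type_definition_tempered

instantiation tempered :: real_vector
begin

lift_definition zero_tempered :: tempered is "\<lambda>\<phi>. 0"
  by (simp add: linear_iff)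

lift_definition plus_tempered :: "tempered \<Rightarrow> tempered \<Rightarrow> tempered" is "\<lambda>\<mu> \<nu> \<phi>. \<mu> \<phi> + \<nu> \<phi>"
  by (auto simp: linear_iff algebra_simps intro: continuous_on_add)

lift_definition scaleR_tempered :: "real \<Rightarrow> tempered \<Rightarrow> tempered" is "\<lambda>c \<mu> \<phi>. c * \<mu> \<phi>"
  by (auto simp: linear_iff algebra_simps intro: continuous_on_mult_left)

lift_definition uminus_tempered :: "tempered \<Rightarrow> tempered" is "\<lambda>\<mu> \<phi>. - \<mu> \<phi>"
  by (auto simp: linear_iff algebra_simps intro: continuous_on_minus)

lift_definition minus_tempered :: "tempered \<Rightarrow> tempered \<Rightarrow> tempered" is "\<lambda>\<mu> \<nu> \<phi>. \<mu> \<phi> - \<nu> \<phi>"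
  by (auto simp: linear_iff algebra_simps intro: continuous_on_diff)

instance
  by standard (transfer; simp add: algebra_simps fun_eq_iff)+

end

text \<open>The value is finite whenever \<open>B\<close> is bounded; taking the supremum in \<open>ennreal\<close> makes it
  \<open>0\<close> for empty \<open>B\<close>.\<close>

definition dual_seminorm :: "schwartz set \<Rightarrow> tempered \<Rightarrow> ennreal" where
  "dual_seminorm B \<mu> = (SUP \<phi>\<in>B. ennreal \<bar>pairing \<mu> \<phi>\<bar>)"

instantiation tempered :: topological_space
begin

definition open_tempered :: "tempered set \<Rightarrow> bool" where
  "open_tempered =
     generate_topology {{\<nu>. dual_seminorm B (\<nu> - \<mu>) < ennreal e} |B \<mu> e. schwartz_bounded B \<and> 0 < e}"

instance
  by standard (auto simp: open_tempered_def intro: generate_topology.intros)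

end


section \<open>The Skorokhod space of distribution-valued paths\<close>

definition cadlag_on :: "real \<Rightarrow> (real \<Rightarrow> 'a::topological_space) \<Rightarrow> bool" where
  "cadlag_on T x \<longleftrightarrow>
     (\<forall>t\<in>{0..<T}. (x \<longlongrightarrow> x t) (at_right t)) \<and>
     (\<forall>t\<in>{0<..T}. \<exists>l. (x \<longlongrightarrow> l) (at_left t))"

text \<open>Functions on \<open>[0,T]\<close> are represented by extensional functions on the reals.\<close>

definition skorokhod_paths :: "real \<Rightarrow> (real \<Rightarrow> tempered) set" where
  "skorokhod_paths T = {x \<in> extensional {0..T}. cadlag_on T x}"

definition time_change_size :: "real \<Rightarrow> (real \<Rightarrow> real) \<Rightarrow> ennreal" where
  "time_change_size T l =
     (SUP (s, t)\<in>{(s, t). 0 \<le> s \<and> s < t \<and> t \<le> T}. ennreal \<bar>ln ((l t - l s) / (t - s))\<bar>)"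

definition time_changes :: "real \<Rightarrow> (real \<Rightarrow> real) set" where
  "time_changes T = {l. strict_mono_on {0..T} l \<and> continuous_on {0..T} l \<and>
     l ` {0..T} = {0..T} \<and> time_change_size T l < \<infinity>}"

definition skorokhod_dist ::
    "real \<Rightarrow> schwartz set \<Rightarrow> (real \<Rightarrow> tempered) \<Rightarrow> (real \<Rightarrow> tempered) \<Rightarrow> ennreal" where
  "skorokhod_dist T B \<mu> \<nu> =
     (INF l\<in>time_changes T.
        (SUP t\<in>{0..T}. dual_seminorm B (\<mu> t - \<nu> (l t))) + time_change_size T l)"

definition skorokhod_topology :: "real \<Rightarrow> (real \<Rightarrow> tempered) topology" where
  "skorokhod_topology T = topology_generated_by
     {{\<nu> \<in> skorokhod_paths T. skorokhod_dist T B \<mu> \<nu> < ennreal e} |B \<mu> e.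
        schwartz_bounded B \<and> \<mu> \<in> skorokhod_paths T \<and> 0 < e}"

lemma id_in_time_changes: "(\<lambda>t. t) \<in> time_changes T"
  and time_change_size_id: "time_change_size T (\<lambda>t. t) = 0"
proof -
  show *: "time_change_size T (\<lambda>t. t) = 0"
    by (auto simp: time_change_size_def bot_ennreal[symmetric] intro!: SUP_bot_conv(2)[THEN iffD2])
  show "(\<lambda>t. t) \<in> time_changes T"
    by (auto simp: time_changes_def * strict_mono_on_def)
qed

lemma skorokhod_dist_self: "skorokhod_dist T B \<mu> \<mu> = 0"
proof -
  have "skorokhod_dist T B \<mu> \<mu> \<le>
      (SUP t\<in>{0..T}. dual_seminorm B (\<mu> t - \<mu> t)) + time_change_size T (\<lambda>t. t)"
    unfolding skorokhod_dist_def by (rule INF_lower[OF id_in_time_changes])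
  also have "dual_seminorm B 0 = 0"
    by (cases "B = {}") (simp_all add: dual_seminorm_def zero_tempered.rep_eq bot_ennreal)
  then have "(SUP t\<in>{0..T}. dual_seminorm B (\<mu> t - \<mu> t)) + time_change_size T (\<lambda>t. t) = 0"
    by (cases "{0..T} = {}") (simp_all add: time_change_size_id bot_ennreal)
  finally show ?thesis by simp
qed

lemma topspace_skorokhod_topology [simp]: "topspace (skorokhod_topology T) = skorokhod_paths T"
proof -
  have "\<mu> \<in> topspace (skorokhod_topology T)" if \<mu>: "\<mu> \<in> skorokhod_paths T" for \<mu>
  proof -
    let ?U = "{\<nu> \<in> skorokhod_paths T. skorokhod_dist T {} \<mu> \<nu> < ennreal 1}"
    have "schwartz_bounded {}" "(0::real) < 1"
      by (simp_all add: schwartz_bounded_def)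
    with \<mu> have "?U \<in> {{\<nu> \<in> skorokhod_paths T. skorokhod_dist T B \<mu> \<nu> < ennreal e} |B \<mu> e.
        schwartz_bounded B \<and> \<mu> \<in> skorokhod_paths T \<and> 0 < e}"
      by blast
    moreover have "\<mu> \<in> ?U"
      using \<mu> by (simp add: skorokhod_dist_self)
    ultimately show ?thesis
      unfolding skorokhod_topology_def topology_generated_by_topspace by (rule UnionI)
  qed
  then show ?thesis
    unfolding skorokhod_topology_def topology_generated_by_topspace by blast
qed


section \<open>Weak convergence\<close>

text \<open>Random elements are Borel measurable maps into the space; each may live on its own
  probability space. The index \<open>0\<close> is unconstrained, since sequences start at \<open>n = 1\<close>.\<close>

definition borel_of_top :: "'x topology \<Rightarrow> 'x measure" where
  "borel_of_top X = sigma (topspace X) {U. openin X U}"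

definition converges_weakly ::
    "'x topology \<Rightarrow> (nat \<Rightarrow> 'a measure) \<Rightarrow> (nat \<Rightarrow> 'a \<Rightarrow> 'x) \<Rightarrow> 'b measure \<Rightarrow> ('b \<Rightarrow> 'x) \<Rightarrow> bool" where
  "converges_weakly X M Y N Z \<longleftrightarrow>
     (\<forall>n\<ge>1. prob_space (M n) \<and> Y n \<in> measurable (M n) (borel_of_top X)) \<and>
     prob_space N \<and> Z \<in> measurable N (borel_of_top X) \<and>
     (\<forall>g. continuous_map X euclideanreal g \<and> bounded (g ` topspace X) \<longrightarrow>
        (\<lambda>n. \<integral>\<omega>. g (Y n \<omega>) \<partial>M n) \<longlonglongrightarrow> (\<integral>\<omega>. g (Z \<omega>) \<partial>N))"


section \<open>Measures as tempered distributions\<close>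

definition dist_of_measure :: "real measure \<Rightarrow> tempered" where
  "dist_of_measure m = Abs_tempered (\<lambda>\<phi>. \<integral>y. sfun \<phi> y \<partial>m)"

lemma schwartz_fun_sfun: "schwartz_fun (sfun \<phi>)"
  using sfun by simp

lemma sfun_measurable [measurable]: "sfun \<phi> \<in> borel_measurable borel"
proof -
  have "(deriv ^^ 0) (sfun \<phi>) field_differentiable at x" for x
    using schwartz_fun_sfun[of \<phi>] unfolding schwartz_fun_def by blast
  then have "continuous_on UNIV (sfun \<phi>)"
    by (auto intro!: continuous_at_imp_continuous_on field_differentiable_imp_continuous_at)
  then show ?thesis by (rule borel_measurable_continuous_onI)
qed

lemma sfun_le_seminorm: "\<bar>sfun \<phi> x\<bar> \<le> schwartz_seminorm 0 0 \<phi>"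
proof -
  have "bounded (range (\<lambda>x. x ^ 0 * (deriv ^^ 0) (sfun \<phi>) x))"
    using schwartz_fun_sfun[of \<phi>] unfolding schwartz_fun_def by blast
  then have "bdd_above (range (\<lambda>x. \<bar>sfun \<phi> x\<bar>))"
    by (auto simp: bounded_iff bdd_above_def)
  then show ?thesis
    by (auto simp: schwartz_seminorm_def intro: cSUP_upper)
qed

lemma pairing_dist_of_measure:
  assumes "finite_measure m" and sets [measurable_cong]: "sets m = sets borel"
  shows "pairing (dist_of_measure m) \<phi> = (\<integral>y. sfun \<phi> y \<partial>m)"
proof -
  interpret finite_measure m by fact
  have int: "integrable m (sfun \<phi>)" for \<phi>
    by (rule integrable_const_bound[of _ "schwartz_seminorm 0 0 \<phi>"])
      (simp_all add: sfun_le_seminorm)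
  let ?I = "\<lambda>\<phi>. \<integral>y. sfun \<phi> y \<partial>m"
  let ?c = "measure m (space m)"
  have lin: "linear ?I"
    by (auto simp: linear_iff plus_schwartz.rep_eq scaleR_schwartz.rep_eq int)
  have bound: "\<bar>?I \<psi> - ?I \<phi>\<bar> \<le> schwartz_seminorm 0 0 (\<psi> - \<phi>) * ?c" for \<phi> \<psi>
  proof -
    have "?I \<psi> - ?I \<phi> = ?I (\<psi> - \<phi>)"
      using int by (simp add: minus_schwartz.rep_eq)
    also have "\<bar>\<dots>\<bar> \<le> (\<integral>y. \<bar>sfun (\<psi> - \<phi>) y\<bar> \<partial>m)"
      by (rule integral_abs_bound)
    also have "\<dots> \<le> (\<integral>y. schwartz_seminorm 0 0 (\<psi> - \<phi>) \<partial>m)"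
      by (intro integral_mono integrable_abs int sfun_le_seminorm) simp
    finally show ?thesis by (simp add: mult_ac)
  qed
  have "(?I \<longlongrightarrow> ?I \<phi>) (at \<phi>)" for \<phi>
  proof (rule tendstoI)
    fix e :: real assume e: "0 < e"
    define d where "d = e / (?c + 1)"
    have c: "0 \<le> ?c" by simp
    have d: "0 < d"
      unfolding d_def using e c by (intro divide_pos_pos) linarith+
    have "?c + 1 \<noteq> 0"
      using c by linarith
    then have "d * (?c + 1) = e"
      by (simp add: d_def)
    then have dc: "d * ?c < e"
      using d by (simp add: distrib_left)
    let ?U = "{\<psi>. schwartz_seminorm 0 0 (\<psi> - \<phi>) < d}"
    have "open ?U"
      unfolding open_schwartz_def using d by (intro generate_topology.Basis) blast
    moreover have "\<phi> \<in> ?U"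
      using d by (simp add: schwartz_seminorm_def zero_schwartz.rep_eq higher_deriv_zero)
    moreover have "dist (?I \<psi>) (?I \<phi>) < e" if "\<psi> \<in> ?U" for \<psi>
    proof -
      have "\<bar>?I \<psi> - ?I \<phi>\<bar> \<le> d * ?c"
          using that c by (intro order_trans[OF bound] mult_right_mono) auto
      then show ?thesis using dc by (simp add: dist_real_def)
    qed
    ultimately show "\<forall>\<^sub>F \<psi> in at \<phi>. dist (?I \<psi>) (?I \<phi>) < e"
      unfolding eventually_at_topological by blast
  qed
  then have "continuous_on UNIV ?I"
    by (simp add: continuous_on_def)
  with lin show ?thesis
    by (simp add: dist_of_measure_def Abs_tempered_inverse)
qed


section \<open>The queueing model\<close>

text \<open>Smoothness on \<open>[0,\<infinity>)\<close>, with one-sided derivatives at \<open>0\<close>; \<open>D k\<close> is the \<open>k\<close>-th derivative.\<close>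

definition bounded_smooth_on_Rplus :: "(real \<Rightarrow> real) \<Rightarrow> bool" where
  "bounded_smooth_on_Rplus h \<longleftrightarrow>
     (\<exists>D :: nat \<Rightarrow> real \<Rightarrow> real. (\<forall>x\<ge>0. D 0 x = h x) \<and>
        (\<forall>k. \<forall>x\<ge>0. (D k has_real_derivative D (Suc k) x) (at x within {0..})) \<and>
        (\<forall>k. bounded (D k ` {0..})))"

text \<open>\<open>E \<omega> t\<close> is the number of arrivals in \<open>[0,t]\<close>, \<open>R0 \<omega> y\<close> the number of customers at time \<open>0\<close>
  with at most \<open>y\<close> units of service time remaining, \<open>\<eta> i\<close> (for \<open>i \<ge> 1\<close>) the service time of the
  \<open>i\<close>-th arriving customer, with c.d.f. \<open>F\<close> and density \<open>f\<close>.\<close>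

locale G_GI_infinity_queue = prob_space M
  for M :: "'a measure" +
  fixes E :: "'a \<Rightarrow> real \<Rightarrow> nat"
    and R0 :: "'a \<Rightarrow> real \<Rightarrow> nat"
    and \<eta> :: "nat \<Rightarrow> 'a \<Rightarrow> real"
    and F f :: "real \<Rightarrow> real"
  assumes E_measurable: "t \<ge> 0 \<Longrightarrow> (\<lambda>\<omega>. E \<omega> t) \<in> measurable M (count_space UNIV)"
    and E_mono: "\<omega> \<in> space M \<Longrightarrow> mono_on {0..} (E \<omega>)"
    and E_cadlag: "\<omega> \<in> space M \<Longrightarrow> cadlag_on t (E \<omega>)"
    and E_0: "AE \<omega> in M. E \<omega> 0 = 0"
    and E_square_integrable: "t \<ge> 0 \<Longrightarrow> integrable M (\<lambda>\<omega>. (real (E \<omega> t))\<^sup>2)"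
    and R0_measurable: "(\<lambda>\<omega>. R0 \<omega> y) \<in> measurable M (count_space UNIV)"
    and R0_mono: "\<omega> \<in> space M \<Longrightarrow> mono (R0 \<omega>)"
    and R0_right_continuous: "\<omega> \<in> space M \<Longrightarrow> continuous (at_right y) (R0 \<omega>)"
    and R0_at_bot: "\<omega> \<in> space M \<Longrightarrow> (R0 \<omega> \<longlongrightarrow> 0) at_bot"
    and R0_finite: "\<omega> \<in> space M \<Longrightarrow> \<exists>K. \<forall>y. R0 \<omega> y \<le> K"
    and \<eta>_indep: "indep_vars (\<lambda>_. borel) \<eta> {1..}"
    and \<eta>_nonneg: "i \<ge> 1 \<Longrightarrow> AE \<omega> in M. 0 \<le> \<eta> i \<omega>"
    and \<eta>_cdf: "i \<ge> 1 \<Longrightarrow> cdf (distr M borel (\<eta> i)) = F"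
    and f_nonneg: "0 \<le> f x"
    and \<eta>_density: "i \<ge> 1 \<Longrightarrow> distributed M lborel (\<eta> i) (\<lambda>x. ennreal (f x))"
    and \<eta>_mean: "i \<ge> 1 \<Longrightarrow> expectation (\<eta> i) = 1"
    and hazard_rate: "bounded_smooth_on_Rplus (\<lambda>x. f x / (1 - F x))"
    and independent: "indep_set
          (sets (vimage_algebra (space M)
            (\<lambda>\<omega>. \<lambda>i\<in>{1..}. \<eta> i \<omega>) (\<Pi>\<^sub>M i\<in>{1..}. borel)))
          (sets (vimage_algebra (space M)
            (\<lambda>\<omega>. (R0 \<omega>, \<lambda>t\<in>{0..}. E \<omega> t))
            ((\<Pi>\<^sub>M y\<in>UNIV. count_space UNIV) \<Otimes>\<^sub>M (\<Pi>\<^sub>M t\<in>{0..}. count_space UNIV))))"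

definition arrival_time :: "(real \<Rightarrow> nat) \<Rightarrow> nat \<Rightarrow> real" where
  "arrival_time e i = Inf {t. 0 \<le> t \<and> i \<le> e t}"

text \<open>The remaining definitions are pathwise: \<open>e\<close>, \<open>r0\<close> and \<open>s\<close> are realizations of the arrival
  process, the initial residual counts and the service times.\<close>

definition residual_count ::
    "(real \<Rightarrow> nat) \<Rightarrow> (real \<Rightarrow> nat) \<Rightarrow> (nat \<Rightarrow> real) \<Rightarrow> real \<Rightarrow> real \<Rightarrow> real" where
  "residual_count e r0 s t y =
     real (r0 (t + y)) + (\<Sum>i=1..e t. if s i - (t - arrival_time e i) \<le> y then 1 else 0)"

definition residual_dist ::
    "(real \<Rightarrow> nat) \<Rightarrow> (real \<Rightarrow> nat) \<Rightarrow> (nat \<Rightarrow> real) \<Rightarrow> real \<Rightarrow> tempered" where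
  "residual_dist e r0 s t = dist_of_measure (interval_measure (residual_count e r0 s t))"

context G_GI_infinity_queue
begin

lemma finite_residual_measure:
  assumes \<omega>: "\<omega> \<in> space M"
  shows "finite_borel_measure (interval_measure (residual_count (E \<omega>) (R0 \<omega>) (\<lambda>i. \<eta> i \<omega>) t))"
proof -
  let ?S = "\<lambda>y. \<Sum>i=1..E \<omega> t. if \<eta> i \<omega> - (t - arrival_time (E \<omega>) i) \<le> y then 1 else (0::real)"
  let ?R = "residual_count (E \<omega>) (R0 \<omega>) (\<lambda>i. \<eta> i \<omega>) t"
  have R: "?R = (\<lambda>y. real (R0 \<omega> (t + y)) + ?S y)"
    by (simp add: residual_count_def fun_eq_iff)
  have mono: "?R x \<le> ?R y" if "x \<le> y" for x y
    unfolding R using that R0_mono[OF \<omega>]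
    by (intro add_mono sum_mono) (auto simp: mono_def)
  have step: "((\<lambda>y. if a \<le> y then 1 else (0::real)) \<longlongrightarrow> (if a \<le> x then 1 else 0)) (at_right x)"
    "((\<lambda>y. if a \<le> y then 1 else (0::real)) \<longlongrightarrow> 0) at_bot"
    "((\<lambda>y. if a \<le> y then 1 else (0::real)) \<longlongrightarrow> 1) at_top" for a x :: real
  proof -
    have "\<forall>\<^sub>F y in at_right x. (if a \<le> y then 1 else 0) = (if a \<le> x then 1 else (0::real))"
      by (cases "a \<le> x") (auto simp: eventually_at_right_field not_le intro: exI[of _ a] exI[of _ "x + 1"])
    then show "((\<lambda>y. if a \<le> y then 1 else (0::real)) \<longlongrightarrow> (if a \<le> x then 1 else 0)) (at_right x)"
      by (rule tendsto_eventually)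
    show "((\<lambda>y. if a \<le> y then 1 else (0::real)) \<longlongrightarrow> 0) at_bot"
      by (rule tendsto_eventually) (auto simp: eventually_at_bot_dense not_le intro!: exI[of _ a])
    show "((\<lambda>y. if a \<le> y then 1 else (0::real)) \<longlongrightarrow> 1) at_top"
      by (rule tendsto_eventually) (auto simp: eventually_at_top_linorder)
  qed
  have shift: "filterlim (\<lambda>y. t + y) (at_right (t + x)) (at_right x)"
    "filterlim (\<lambda>y. t + y) at_bot at_bot" "filterlim (\<lambda>y. t + y) at_top at_top" for x :: real
  proof -
    have "\<forall>\<^sub>F y in at_right x. x < y"
      by (rule eventually_at_right_less)
    then show "filterlim (\<lambda>y. t + y) (at_right (t + x)) (at_right x)"
      unfolding filterlim_at by (auto intro!: tendsto_intros elim: eventually_mono)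
    have "\<forall>\<^sub>F y in at_bot. t + y \<le> Z" "\<forall>\<^sub>F y in at_top. Z \<le> t + y" for Z :: real
      by (rule eventually_mono[OF eventually_le_at_bot[of "Z - t"]], simp)
        (rule eventually_mono[OF eventually_ge_at_top[of "Z - t"]], simp)
    then show "filterlim (\<lambda>y. t + y) at_bot at_bot" "filterlim (\<lambda>y. t + y) at_top at_top"
      by (simp_all add: filterlim_at_bot filterlim_at_top)
  qed
  have of_nat: "((\<lambda>y. real (R0 \<omega> (t + y))) \<longlongrightarrow> real l) G"
    if "(R0 \<omega> \<longlongrightarrow> l) G'" "filterlim (\<lambda>y. t + y) G' G" for l G G'
  proof -
    have "((\<lambda>y. R0 \<omega> (t + y)) \<longlongrightarrow> l) G"
      using filterlim_compose[OF that] .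
    then have "\<forall>\<^sub>F y in G. R0 \<omega> (t + y) = l"
      by (simp add: tendsto_discrete)
    then show ?thesis
      by (intro tendsto_eventually) (auto elim: eventually_mono)
  qed
  have right: "continuous (at_right x) ?R" for x
  proof -
    have "(R0 \<omega> \<longlongrightarrow> R0 \<omega> (t + x)) (at_right (t + x))"
      using R0_right_continuous[OF \<omega>, of "t + x"] by (simp add: continuous_within)
    then show ?thesis
      unfolding R continuous_within
      by (intro tendsto_add tendsto_sum step of_nat[OF _ shift(1)])
  qed
  have bot: "(?R \<longlongrightarrow> 0) at_bot"
  proof -
    have "(?R \<longlongrightarrow> real 0 + (\<Sum>i=1..E \<omega> t. 0)) at_bot"
      unfolding R by (intro tendsto_add tendsto_sum step of_nat[OF R0_at_bot[OF \<omega>] shift(2)])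
    then show ?thesis by simp
  qed
  obtain l where l: "(R0 \<omega> \<longlongrightarrow> l) at_top"
  proof -
    obtain K where "\<forall>y. R0 \<omega> y \<le> K" using R0_finite[OF \<omega>] by blast
    then have "range (R0 \<omega>) \<subseteq> {..K}" by auto
    then have fin: "finite (range (R0 \<omega>))" by (rule finite_subset) simp
    then have "Max (range (R0 \<omega>)) \<in> range (R0 \<omega>)" by (intro Max_in) auto
    then obtain y0 where y0: "R0 \<omega> y0 = Max (range (R0 \<omega>))" by auto
    have "R0 \<omega> y = R0 \<omega> y0" if "y0 \<le> y" for y
    proof (rule antisym)
      show "R0 \<omega> y \<le> R0 \<omega> y0"
        unfolding y0 by (rule Max_ge[OF fin]) simp
      show "R0 \<omega> y0 \<le> R0 \<omega> y"
        using R0_mono[OF \<omega>] that by (rule monoD)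
    qed
    then have "(R0 \<omega> \<longlongrightarrow> R0 \<omega> y0) at_top"
      by (rule tendsto_eventually[OF eventually_at_top_linorderI])
    then show ?thesis by (rule that)
  qed
  have top: "(?R \<longlongrightarrow> real l + (\<Sum>i=1..E \<omega> t. 1)) at_top"
    unfolding R by (intro tendsto_add tendsto_sum step of_nat[OF l shift(3)])
  show ?thesis
    by (rule finite_borel_measure_interval_measure[OF mono right bot top]) auto
qed

lemma pairing_residual_dist:
  assumes "\<omega> \<in> space M"
  shows "pairing (residual_dist (E \<omega>) (R0 \<omega>) (\<lambda>i. \<eta> i \<omega>) t) \<phi> =
    (\<integral>y. sfun \<phi> y \<partial>interval_measure (residual_count (E \<omega>) (R0 \<omega>) (\<lambda>i. \<eta> i \<omega>) t))"
  unfolding residual_dist_def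
  using finite_residual_measure[OF assms, of t]
  by (intro pairing_dist_of_measure) (auto simp: finite_borel_measure_def)

end

definition service_dist :: "(real \<Rightarrow> real) \<Rightarrow> tempered" where
  "service_dist F = dist_of_measure (interval_measure F)"

text \<open>The range of integration may be taken to be \<open>[0,\<infinity>)\<close>, since service times are nonnegative.\<close>

lemma (in G_GI_infinity_queue) pairing_service_dist:
  "pairing (service_dist F) \<phi> = (LINT y:{0..}|interval_measure F. sfun \<phi> y)"
proof -
  let ?D = "distr M borel (\<eta> 1)"
  have \<eta>_meas: "\<eta> 1 \<in> borel_measurable M"
    using distributed_measurable[OF \<eta>_density[of 1]] by simp
  interpret D: real_distribution ?D
    using \<eta>_meas by (rule real_distribution_distr)
  have F: "F = cdf ?D"
    using \<eta>_cdf[of 1] by simp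
  have "real_distribution (interval_measure F)"
    unfolding F by (intro real_distribution_interval_measure D.cdf_nondecreasing
        D.cdf_is_right_cont D.cdf_lim_at_bot D.cdf_lim_at_top_prob)
  moreover have "cdf (interval_measure F) = cdf ?D"
    unfolding F by (intro cdf_interval_measure D.cdf_nondecreasing
        D.cdf_is_right_cont D.cdf_lim_at_bot)
  ultimately have eq: "interval_measure F = ?D"
    by (rule cdf_unique[OF _ D.real_distribution_axioms])
  have "AE y in ?D. 0 \<le> y"
    using \<eta>_nonneg[of 1] \<eta>_meas by (subst AE_distr_iff) auto
  then have "(\<integral>y. sfun \<phi> y \<partial>?D) = (LINT y:{0..}|?D. sfun \<phi> y)"
    unfolding set_lebesgue_integral_def
    by (intro integral_cong_AE) (auto elim!: eventually_mono)
  then show ?thesis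
    unfolding service_dist_def eq
    by (subst pairing_dist_of_measure[OF D.finite_measure_axioms]) simp_all
qed

text \<open>\<open>x\<close> solves the integral equation on \<open>[0,T]\<close> with initial value \<open>x0\<close>, arrivals \<open>e\<close> and
  service time c.d.f. \<open>F\<close>.\<close>

definition solves_fluid_equation ::
    "real \<Rightarrow> (real \<Rightarrow> real) \<Rightarrow> tempered \<Rightarrow> (real \<Rightarrow> real) \<Rightarrow> (real \<Rightarrow> tempered) \<Rightarrow> bool" where
  "solves_fluid_equation T F x0 e x \<longleftrightarrow>
     (\<forall>t\<in>{0..T}. \<forall>\<phi>. pairing (x t) \<phi> =
        pairing x0 \<phi> + e t * pairing (service_dist F) \<phi>
          - integral {0..t} (\<lambda>s. pairing (x s) (schwartz_deriv \<phi>)))"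

end

theory Submission
  imports Defs
begin

text \<open>The residual process solves \<open>R\<^sub>t = G\<^sub>t - \<integral>\<^sub>0\<^sup>t R\<^sub>s' ds\<close>, where \<open>G\<close> is \<open>\<R>\<^sub>0 + E \<F>\<close> perturbed by the
  centred sums of \<open>\<delta>\<^bsub>\<eta>\<^esub> - \<F>\<close>. On inputs of the form \<open>r + e m\<close> the solution of this equation is
  \<open>\<langle>z\<^sub>t, \<phi>\<rangle> = \<langle>r, S\<^sub>t \<phi>\<rangle> + e\<^sub>t \<langle>m, \<phi>\<rangle> - \<integral>\<^sub>0\<^sup>t e\<^sub>s \<langle>m, S\<^bsub>t-s\<^esub> \<phi>'\<rangle> ds\<close> with the shifts \<open>S\<^sub>u \<phi> = \<phi>(\<cdot> - u)\<close>, and it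
  depends continuously on the input in the Skorokhod topology. The perturbation vanishes in
  probability by a law of large numbers that is uniform over bounded sets of test functions, since
  these are totally bounded in each norm. As the Skorokhod space is not metrizable, a perturbation
  that vanishes in probability need not a priori preserve weak convergence; it does here because the
  limits \<open>r + e m\<close> range over a Lindeloef set.\<close>

section \<open>Norms and shifts on the Schwartz space\<close>

text \<open>The obstacle is that the Skorokhod topology is generated by an uncountable family of
  pseudometrics and that addition is not continuous in it. Two devices deal with this. A path
  \<open>r + e m\<close> jumps only in the fixed direction \<open>m\<close>, so pairing it with one
  test function \<theta> on which \<open>m\<close> does not vanish recovers the scalar path
  \<open>e\<close>. The solution formula thereby becomes a map on the whole space, and one time
  change that matches the jumps of \<open>e\<close> serves for input and output alike, the rest of
  the solution being Lipschitz in time. Countable codes take the place of a countable base: for each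
  precision a path gets a natural number, and equal codes at a suitable precision force closeness.
  Besides the Lindeloef property of the limit they give the Borel measurability of the residual
  process, as preimages of open sets become countable unions of code sets. The queue enters as a
  finite superposition of unit masses moving to the left at unit speed. It differs from the solution
  driven by its own arrivals only in that each arrival contributes a unit mass at its service time
  instead of the service distribution.\<close>

abbreviation sderiv :: "nat \<Rightarrow> schwartz \<Rightarrow> real \<Rightarrow> real" where
  "sderiv k \<phi> \<equiv> (deriv ^^ k) (sfun \<phi>)"

lemma sderiv_has_derivative:
  "(sderiv k \<phi> has_real_derivative sderiv (Suc k) \<phi> x) (at x)"
  using schwartz_fun_sfun[of \<phi>] unfolding schwartz_fun_def
  by (auto simp: field_differentiable_derivI)

lemma sderiv_reflect_has_derivative:
  "((\<lambda>w. sderiv k \<phi> (x - w)) has_real_derivative - sderiv (Suc k) \<phi> (x - w)) (at w)"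
proof -
  have "((-) x has_real_derivative - 1) (at w)"
    by (auto intro!: derivative_eq_intros)
  from DERIV_chain2[OF sderiv_has_derivative this] show ?thesis by simp
qed

lemma sderiv_add: "sderiv k (\<phi> + \<psi>) x = sderiv k \<phi> x + sderiv k \<psi> x"
  by (simp add: plus_schwartz.rep_eq higher_deriv_add schwartz_fun_sfun)

lemma sderiv_scaleR: "sderiv k (c *\<^sub>R \<phi>) x = c * sderiv k \<phi> x"
  by (simp add: scaleR_schwartz.rep_eq higher_deriv_scale schwartz_fun_sfun)

lemma sderiv_minus: "sderiv k (- \<phi>) x = - sderiv k \<phi> x"
  using sderiv_scaleR[of k "-1" \<phi> x] by simp

lemma sderiv_diff: "sderiv k (\<phi> - \<psi>) x = sderiv k \<phi> x - sderiv k \<psi> x"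
  using sderiv_add[of k \<phi> "- \<psi>" x] by (simp add: sderiv_minus)

lemma sderiv_schwartz_deriv: "sderiv k (schwartz_deriv \<phi>) = sderiv (Suc k) \<phi>"
  by (simp add: schwartz_deriv.rep_eq funpow_swap1)

lemma seminorm_upper: "\<bar>x ^ \<alpha> * sderiv \<beta> \<phi> x\<bar> \<le> schwartz_seminorm \<alpha> \<beta> \<phi>"
proof -
  have "bounded (range (\<lambda>x. x ^ \<alpha> * sderiv \<beta> \<phi> x))"
    using schwartz_fun_sfun[of \<phi>] unfolding schwartz_fun_def by blast
  then have "bdd_above (range (\<lambda>x. \<bar>x ^ \<alpha> * sderiv \<beta> \<phi> x\<bar>))"
    by (auto simp: bounded_iff bdd_above_def)
  then show ?thesis
    unfolding schwartz_seminorm_def by (auto intro: cSUP_upper)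
qed

lemma seminorm_least:
  "(\<And>x. \<bar>x ^ \<alpha> * sderiv \<beta> \<phi> x\<bar> \<le> c) \<Longrightarrow> schwartz_seminorm \<alpha> \<beta> \<phi> \<le> c"
  unfolding schwartz_seminorm_def by (rule cSUP_least) auto

lemma seminorm_nonneg: "0 \<le> schwartz_seminorm \<alpha> \<beta> \<phi>"
  by (rule order_trans[OF _ seminorm_upper[of 0]]) simp

lemma seminorm_triangle:
  "schwartz_seminorm \<alpha> \<beta> (\<phi> + \<psi>) \<le> schwartz_seminorm \<alpha> \<beta> \<phi> + schwartz_seminorm \<alpha> \<beta> \<psi>"
proof (rule seminorm_least)
  fix x
  have "\<bar>x ^ \<alpha> * sderiv \<beta> (\<phi> + \<psi>) x\<bar> \<le> \<bar>x ^ \<alpha> * sderiv \<beta> \<phi> x\<bar> + \<bar>x ^ \<alpha> * sderiv \<beta> \<psi> x\<bar>"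
    unfolding sderiv_add distrib_left by (rule abs_triangle_ineq)
  also have "\<dots> \<le> schwartz_seminorm \<alpha> \<beta> \<phi> + schwartz_seminorm \<alpha> \<beta> \<psi>"
    by (intro add_mono seminorm_upper)
  finally show "\<bar>x ^ \<alpha> * sderiv \<beta> (\<phi> + \<psi>) x\<bar> \<le> schwartz_seminorm \<alpha> \<beta> \<phi> + schwartz_seminorm \<alpha> \<beta> \<psi>" .
qed

lemma seminorm_scaleR_le:
  "schwartz_seminorm \<alpha> \<beta> (c *\<^sub>R \<phi>) \<le> \<bar>c\<bar> * schwartz_seminorm \<alpha> \<beta> \<phi>"
proof (rule seminorm_least)
  fix x
  have "\<bar>x ^ \<alpha> * sderiv \<beta> (c *\<^sub>R \<phi>) x\<bar> = \<bar>c\<bar> * \<bar>x ^ \<alpha> * sderiv \<beta> \<phi> x\<bar>"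
    by (simp add: sderiv_scaleR abs_mult)
  then show "\<bar>x ^ \<alpha> * sderiv \<beta> (c *\<^sub>R \<phi>) x\<bar> \<le> \<bar>c\<bar> * schwartz_seminorm \<alpha> \<beta> \<phi>"
    using seminorm_upper[of x \<alpha> \<beta> \<phi>] by (simp add: mult_left_mono)
qed

text \<open>One increasing sequence of norms in place of the doubly indexed seminorms. It has the
  same bounded sets and the same neighbourhoods (\<open>schwartz_bounded_norm\<close>,
  \<open>schwartz_open_contains_ball\<close>, \<open>schwartz_norm_ball_nhd\<close>), so each later
  estimate only tracks how many orders it loses.\<close>

definition schwartz_norm :: "nat \<Rightarrow> schwartz \<Rightarrow> real" where
  "schwartz_norm p \<phi> = (\<Sum>\<alpha>\<le>p. \<Sum>\<beta>\<le>p. schwartz_seminorm \<alpha> \<beta> \<phi>)"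

lemma schwartz_norm_nonneg: "0 \<le> schwartz_norm p \<phi>"
  unfolding schwartz_norm_def by (intro sum_nonneg seminorm_nonneg)

lemma schwartz_norm_scaleR_le: "schwartz_norm p (c *\<^sub>R \<phi>) \<le> \<bar>c\<bar> * schwartz_norm p \<phi>"
  unfolding schwartz_norm_def sum_distrib_left by (intro sum_mono seminorm_scaleR_le)

lemma seminorm_le_norm:
  assumes "\<alpha> \<le> p" "\<beta> \<le> p"
  shows "schwartz_seminorm \<alpha> \<beta> \<phi> \<le> schwartz_norm p \<phi>"
proof -
  have "schwartz_seminorm \<alpha> \<beta> \<phi> \<le> (\<Sum>\<beta>\<le>p. schwartz_seminorm \<alpha> \<beta> \<phi>)"
    using assms by (intro member_le_sum seminorm_nonneg) auto
  also have "\<dots> \<le> schwartz_norm p \<phi>"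
    unfolding schwartz_norm_def
    using assms by (intro member_le_sum[of _ _ "\<lambda>\<alpha>. \<Sum>\<beta>\<le>p. schwartz_seminorm \<alpha> \<beta> \<phi>"] sum_nonneg seminorm_nonneg) auto
  finally show ?thesis .
qed

lemma schwartz_norm_upper: 
  "\<alpha> \<le> p \<Longrightarrow> \<beta> \<le> p \<Longrightarrow> \<bar>x ^ \<alpha> * sderiv \<beta> \<phi> x\<bar> \<le> schwartz_norm p \<phi>"
  by (rule order_trans[OF seminorm_upper seminorm_le_norm])

lemma sderiv_le_norm: "\<beta> \<le> p \<Longrightarrow> \<bar>sderiv \<beta> \<phi> x\<bar> \<le> schwartz_norm p \<phi>"
  using schwartz_norm_upper[of 0 p \<beta> x \<phi>] by simp

lemma schwartz_norm_mono:
  assumes "p \<le> q"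
  shows "schwartz_norm p \<phi> \<le> schwartz_norm q \<phi>"
proof -
  have "schwartz_norm p \<phi> \<le> (\<Sum>\<alpha>\<le>p. \<Sum>\<beta>\<le>q. schwartz_seminorm \<alpha> \<beta> \<phi>)"
    unfolding schwartz_norm_def using assms by (intro sum_mono sum_mono2 seminorm_nonneg) auto
  also have "\<dots> \<le> schwartz_norm q \<phi>"
    unfolding schwartz_norm_def using assms by (intro sum_mono2 sum_nonneg seminorm_nonneg) auto
  finally show ?thesis .
qed

text \<open>The square counts the summands of the norm; the factors \<open>real (Suc p) ^ 2\<close>
  below come from here.\<close>

lemma schwartz_norm_least:
  assumes "\<And>\<alpha> \<beta> x. \<alpha> \<le> p \<Longrightarrow> \<beta> \<le> p \<Longrightarrow> \<bar>x ^ \<alpha> * sderiv \<beta> \<phi> x\<bar> \<le> c"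
  shows "schwartz_norm p \<phi> \<le> real (Suc p) ^ 2 * c"
proof -
  have "schwartz_norm p \<phi> \<le> (\<Sum>\<alpha>\<le>p. \<Sum>\<beta>\<le>p. c)"
    unfolding schwartz_norm_def by (intro sum_mono seminorm_least assms) auto
  then show ?thesis by (simp add: power2_eq_square mult_ac)
qed

lemma schwartz_bounded_norm: "schwartz_bounded B \<longleftrightarrow> (\<forall>p. \<exists>L. \<forall>\<phi>\<in>B. schwartz_norm p \<phi> \<le> L)"
proof
  assume B: "schwartz_bounded B"
  show "\<forall>p. \<exists>L. \<forall>\<phi>\<in>B. schwartz_norm p \<phi> \<le> L"
  proof
    fix p
    have "\<forall>\<alpha> \<beta>. \<exists>M. \<forall>\<phi>\<in>B. schwartz_seminorm \<alpha> \<beta> \<phi> \<le> M"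
      using B unfolding schwartz_bounded_def bdd_above_def by auto
    then obtain c where "\<And>\<alpha> \<beta> \<phi>. \<phi> \<in> B \<Longrightarrow> schwartz_seminorm \<alpha> \<beta> \<phi> \<le> c \<alpha> \<beta>" by metis
    then show "\<exists>L. \<forall>\<phi>\<in>B. schwartz_norm p \<phi> \<le> L"
      unfolding schwartz_norm_def
      by (intro exI[of _ "\<Sum>\<alpha>\<le>p. \<Sum>\<beta>\<le>p. c \<alpha> \<beta>"] ballI sum_mono)
  qed
next
  assume *: "\<forall>p. \<exists>L. \<forall>\<phi>\<in>B. schwartz_norm p \<phi> \<le> L"
  show "schwartz_bounded B"
    unfolding schwartz_bounded_def
  proof (intro allI)
    fix \<alpha> \<beta>
    from * obtain L where L: "\<forall>\<phi>\<in>B. schwartz_norm (max \<alpha> \<beta>) \<phi> \<le> L" by blast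
    show "bdd_above (schwartz_seminorm \<alpha> \<beta> ` B)"
      using L seminorm_le_norm[of \<alpha> "max \<alpha> \<beta>" \<beta>]
      by (intro bdd_aboveI[of _ L]) (auto intro: order_trans)
  qed
qed

lemma schwartz_bounded_obtain:
  assumes "schwartz_bounded B"
  obtains L where "0 < L" "\<And>\<phi>. \<phi> \<in> B \<Longrightarrow> schwartz_norm p \<phi> \<le> L"
proof -
  obtain L where L: "\<forall>\<phi>\<in>B. schwartz_norm p \<phi> \<le> L"
    using assms schwartz_bounded_norm by blast
  then show ?thesis
    by (intro that[of "max L 1"]) auto
qed

lemma schwartz_bounded_Un: "schwartz_bounded A \<Longrightarrow> schwartz_bounded B \<Longrightarrow> schwartz_bounded (A \<union> B)"
  unfolding schwartz_bounded_def by (simp add: image_Un)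

lemma schwartz_bounded_finite: "finite B \<Longrightarrow> schwartz_bounded B"
  unfolding schwartz_bounded_def by simp

lemma schwartz_norm_deriv_le: "schwartz_norm p (schwartz_deriv \<phi>) \<le> real (Suc p) ^ 2 * schwartz_norm (Suc p) \<phi>"
  by (rule schwartz_norm_least) (auto simp only: sderiv_schwartz_deriv intro!: schwartz_norm_upper)

section \<open>Translations of test functions\<close>

lemma deriv_shift: "deriv (\<lambda>x. f (x - u)) = (\<lambda>x. deriv f (x - u))" for f :: "real \<Rightarrow> real"
proof
  fix x
  have "DERIV (\<lambda>x. f (x - u)) x :> D \<longleftrightarrow> DERIV f (x - u) :> D" for D
    using DERIV_shift[of f D x "- u"] by simp
  then show "deriv (\<lambda>x. f (x - u)) x = deriv f (x - u)"
    by (simp add: deriv_def)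
qed

lemma higher_deriv_shift: "(deriv ^^ k) (\<lambda>x. f (x - u)) = (\<lambda>x. (deriv ^^ k) f (x - u))"
  for f :: "real \<Rightarrow> real"
  by (induction k) (simp_all add: deriv_shift)

text \<open>Since |x| is at most |x - u| + c, it is at most 2 (1 + c) times the larger of |x - u|
  and 1, and a power of that maximum is at most the sum of the two powers.\<close>

lemma abs_power_shift_le:
  fixes x u :: real
  assumes "\<bar>u\<bar> \<le> c"
  shows "\<bar>x\<bar> ^ \<alpha> \<le> (2 * (1 + c)) ^ \<alpha> * (\<bar>x - u\<bar> ^ \<alpha> + 1)"
proof -
  have c: "0 \<le> c" using assms by linarith
  have "\<bar>x\<bar> \<le> 2 * (1 + c) * max \<bar>x - u\<bar> 1"
  proof -
    have "\<bar>x\<bar> \<le> \<bar>x - u\<bar> + c" using assms by linarith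
    also have "\<dots> \<le> max \<bar>x - u\<bar> 1 + c * max \<bar>x - u\<bar> 1"
      using c mult_left_mono[of 1 "max \<bar>x - u\<bar> 1" c] by (intro add_mono) auto
    also have "\<dots> \<le> 2 * (1 + c) * max \<bar>x - u\<bar> 1"
      using c by (simp add: algebra_simps) 
    finally show ?thesis .
  qed
  then have "\<bar>x\<bar> ^ \<alpha> \<le> (2 * (1 + c) * max \<bar>x - u\<bar> 1) ^ \<alpha>"
    by (rule power_mono) simp
  also have "\<dots> = (2 * (1 + c)) ^ \<alpha> * max \<bar>x - u\<bar> 1 ^ \<alpha>"
    by (rule power_mult_distrib)
  also have "\<dots> \<le> (2 * (1 + c)) ^ \<alpha> * (\<bar>x - u\<bar> ^ \<alpha> + 1)"
    using c by (intro mult_left_mono) (auto simp: max_def)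
  finally show ?thesis .
qed

text \<open>The weight at x is traded for the weight at x - u, at a cost that is uniform in u for
  |u| <= c. The bounds on shifts, and on the remainders given by the mean value and Taylor theorems,
  all rest on this estimate.\<close>

lemma schwartz_shift_bound:
  assumes "\<bar>u\<bar> \<le> c" "\<alpha> \<le> p" "\<beta> \<le> p"
  shows "\<bar>x ^ \<alpha> * sderiv \<beta> \<phi> (x - u)\<bar> \<le> 2 * (2 * (1 + c)) ^ p * schwartz_norm p \<phi>"
proof -
  have c: "0 \<le> c" using assms by linarith
  let ?s = "\<bar>sderiv \<beta> \<phi> (x - u)\<bar>"
  have "\<bar>x ^ \<alpha> * sderiv \<beta> \<phi> (x - u)\<bar> = \<bar>x\<bar> ^ \<alpha> * ?s"
    by (simp add: abs_mult power_abs)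
  also have "\<dots> \<le> (2 * (1 + c)) ^ \<alpha> * (\<bar>x - u\<bar> ^ \<alpha> + 1) * ?s"
    by (intro mult_right_mono abs_power_shift_le assms) auto
  also have "\<dots> = (2 * (1 + c)) ^ \<alpha> * (\<bar>(x - u) ^ \<alpha> * sderiv \<beta> \<phi> (x - u)\<bar> + ?s)"
    by (simp add: abs_mult power_abs algebra_simps)
  also have "\<dots> \<le> (2 * (1 + c)) ^ \<alpha> * (schwartz_norm p \<phi> + schwartz_norm p \<phi>)"
    using c by (intro mult_left_mono add_mono schwartz_norm_upper sderiv_le_norm assms) auto
  also have "\<dots> \<le> (2 * (1 + c)) ^ p * (schwartz_norm p \<phi> + schwartz_norm p \<phi>)"
    using c assms(2) by (intro mult_right_mono power_increasing) (auto simp: schwartz_norm_nonneg)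
  finally show ?thesis by (simp add: algebra_simps)
qed

lemma schwartz_fun_shift:
  assumes "schwartz_fun f"
  shows "schwartz_fun (\<lambda>x. f (x - u))"
proof -
  have f: "f = sfun (Abs_schwartz f)"
    using assms by (simp add: Abs_schwartz_inverse)
  have "bounded (range (\<lambda>x. x ^ \<alpha> * (deriv ^^ \<beta>) f (x - u)))" for \<alpha> \<beta>
    unfolding bounded_iff
    using schwartz_shift_bound[of u "\<bar>u\<bar>" \<alpha> "max \<alpha> \<beta>" \<beta> _ "Abs_schwartz f", folded f] 
    by (auto simp del: f)
  moreover have "(\<lambda>x. (deriv ^^ k) f (x - u)) field_differentiable at x" for k x
  proof -
    have "\<exists>D. ((deriv ^^ k) f has_real_derivative D) (at (x - u))"
      using assms unfolding schwartz_fun_def field_differentiable_def by blast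
    then show ?thesis
      using DERIV_shift[of "(deriv ^^ k) f" _ x "- u"] unfolding field_differentiable_def by simp
  qed
  ultimately show ?thesis
    unfolding schwartz_fun_def higher_deriv_shift by blast
qed

lift_definition schwartz_shift :: "real \<Rightarrow> schwartz \<Rightarrow> schwartz" is "\<lambda>u f x. f (x - u)"
  by (rule schwartz_fun_shift)

lemma sderiv_shift: "sderiv k (schwartz_shift u \<phi>) x = sderiv k \<phi> (x - u)"
  by (simp add: schwartz_shift.rep_eq higher_deriv_shift)

lemma schwartz_eqI: "(\<And>x. sfun \<phi> x = sfun \<psi> x) \<Longrightarrow> \<phi> = \<psi>"
  by (simp add: sfun_inject[symmetric] fun_eq_iff)

lemma schwartz_shift_0: "schwartz_shift 0 \<phi> = \<phi>"
  by (rule schwartz_eqI) (simp add: schwartz_shift.rep_eq)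

lemma schwartz_shift_deriv: "schwartz_deriv (schwartz_shift u \<phi>) = schwartz_shift u (schwartz_deriv \<phi>)"
  by (rule schwartz_eqI) (simp add: schwartz_shift.rep_eq schwartz_deriv.rep_eq deriv_shift)

lemma schwartz_shift_add: "schwartz_shift u (\<phi> + \<psi>) = schwartz_shift u \<phi> + schwartz_shift u \<psi>"
  by (rule schwartz_eqI) (simp add: schwartz_shift.rep_eq plus_schwartz.rep_eq)

lemma schwartz_shift_scaleR: "schwartz_shift u (c *\<^sub>R \<phi>) = c *\<^sub>R schwartz_shift u \<phi>"
  by (rule schwartz_eqI) (simp add: schwartz_shift.rep_eq scaleR_schwartz.rep_eq)

lemma schwartz_deriv_add: "schwartz_deriv (\<phi> + \<psi>) = schwartz_deriv \<phi> + schwartz_deriv \<psi>"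
  by (rule schwartz_eqI)
    (use sderiv_add[of 1 \<phi> \<psi>] in \<open>simp add: schwartz_deriv.rep_eq plus_schwartz.rep_eq\<close>)

lemma schwartz_deriv_scaleR: "schwartz_deriv (c *\<^sub>R \<phi>) = c *\<^sub>R schwartz_deriv \<phi>"
  by (rule schwartz_eqI)
    (use sderiv_scaleR[of 1 c \<phi>] in \<open>simp add: schwartz_deriv.rep_eq scaleR_schwartz.rep_eq\<close>)

text \<open>The square counts the seminorms in \<open>schwartz_norm p\<close>; the other factor is
  the constant of \<open>schwartz_shift_bound\<close>.\<close>

definition shift_const :: "real \<Rightarrow> nat \<Rightarrow> real" where
  "shift_const c p = real (Suc p) ^ 2 * (2 * (2 * (1 + c)) ^ p)"

lemma shift_const_nonneg: "0 \<le> c \<Longrightarrow> 0 \<le> shift_const c p"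
  unfolding shift_const_def by simp

lemma schwartz_norm_shift_le:
  assumes "\<bar>u\<bar> \<le> c"
  shows "schwartz_norm p (schwartz_shift u \<phi>) \<le> shift_const c p * schwartz_norm p \<phi>"
  unfolding shift_const_def mult.assoc
  by (rule schwartz_norm_least)
    (use schwartz_shift_bound[OF assms] in \<open>simp add: sderiv_shift mult.assoc\<close>)

text \<open>Mean value theorem in the shift parameter: the intermediate shift is again bounded by c,
  and one derivative is lost.\<close>

lemma schwartz_norm_shift_diff_le:
  assumes "\<bar>u\<bar> \<le> c" "\<bar>v\<bar> \<le> c"
  shows "schwartz_norm p (schwartz_shift u \<phi> - schwartz_shift v \<phi>)
    \<le> shift_const c (Suc p) * \<bar>u - v\<bar> * schwartz_norm (Suc p) \<phi>"
proof -
  let ?c = "2 * (2 * (1 + c)) ^ Suc p * schwartz_norm (Suc p) \<phi>"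
  have c: "0 \<le> c" using assms by linarith
  have "schwartz_norm p (schwartz_shift u \<phi> - schwartz_shift v \<phi>) \<le> real (Suc p) ^ 2 * (?c * \<bar>u - v\<bar>)"
  proof (rule schwartz_norm_least)
    fix \<alpha> \<beta> x assume ab: "\<alpha> \<le> p" "\<beta> \<le> p"
    have "\<exists>w. \<bar>w\<bar> \<le> c \<and> sderiv \<beta> \<phi> (x - u) - sderiv \<beta> \<phi> (x - v) = (v - u) * sderiv (Suc \<beta>) \<phi> (x - w)"
    proof -
      have D: "DERIV (\<lambda>w. sderiv \<beta> \<phi> (x - w)) w :> - sderiv (Suc \<beta>) \<phi> (x - w)" for w
        by (rule sderiv_reflect_has_derivative)
      consider "u < v" | "v < u" | "u = v" by linarith
      then show ?thesis
      proof cases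
        case 1
        from MVT2[OF 1 D] obtain z where "u < z" "z < v"
          "sderiv \<beta> \<phi> (x - v) - sderiv \<beta> \<phi> (x - u) = (v - u) * - sderiv (Suc \<beta>) \<phi> (x - z)" by blast
        then show ?thesis using assms by (intro exI[of _ z]) (auto simp: algebra_simps)
      next
        case 2
        from MVT2[OF 2 D] obtain z where "v < z" "z < u"
          "sderiv \<beta> \<phi> (x - u) - sderiv \<beta> \<phi> (x - v) = (u - v) * - sderiv (Suc \<beta>) \<phi> (x - z)" by blast
        then show ?thesis using assms by (intro exI[of _ z]) (auto simp: algebra_simps)
      next
        case 3
        then show ?thesis using assms by auto
      qed
    qed
    then obtain w where w: "\<bar>w\<bar> \<le> c"
      "sderiv \<beta> \<phi> (x - u) - sderiv \<beta> \<phi> (x - v) = (v - u) * sderiv (Suc \<beta>) \<phi> (x - w)" by blast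
    have "\<bar>x ^ \<alpha> * sderiv \<beta> (schwartz_shift u \<phi> - schwartz_shift v \<phi>) x\<bar>
        = \<bar>u - v\<bar> * \<bar>x ^ \<alpha> * sderiv (Suc \<beta>) \<phi> (x - w)\<bar>"
      unfolding sderiv_diff sderiv_shift w(2) by (simp add: abs_mult abs_minus_commute)
    also have "\<dots> \<le> \<bar>u - v\<bar> * ?c"
      using ab by (intro mult_left_mono schwartz_shift_bound w) auto
    finally show "\<bar>x ^ \<alpha> * sderiv \<beta> (schwartz_shift u \<phi> - schwartz_shift v \<phi>) x\<bar> \<le> ?c * \<bar>u - v\<bar>"
      by (simp add: mult_ac)
  qed
  \<comment> \<open>Enlarging the count of seminorms brings the constant into the form
    \<open>shift_const c (Suc p)\<close>.\<close>
  also have "\<dots> \<le> real (Suc (Suc p)) ^ 2 * (?c * \<bar>u - v\<bar>)"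
    using c by (intro mult_right_mono power_mono mult_nonneg_nonneg) (auto simp: schwartz_norm_nonneg)
  finally show ?thesis
    by (simp add: shift_const_def mult_ac)
qed

text \<open>Second-order expansion in the shift parameter. The linear term is added rather than
  subtracted because the derivative of \<phi>(x - u) in u is -\<phi>'(x - u); two derivatives are
  lost.\<close>

lemma schwartz_norm_shift_taylor:
  assumes "\<bar>u\<bar> \<le> c" "\<bar>v\<bar> \<le> c"
  shows "schwartz_norm p (schwartz_shift u \<phi> - schwartz_shift v \<phi> + (u - v) *\<^sub>R schwartz_shift v (schwartz_deriv \<phi>))
    \<le> shift_const c (Suc (Suc p)) * (u - v)\<^sup>2 * schwartz_norm (Suc (Suc p)) \<phi>"
proof -
  let ?c = "2 * (2 * (1 + c)) ^ Suc (Suc p) * schwartz_norm (Suc (Suc p)) \<phi>"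
  have c: "0 \<le> c" using assms by linarith
  have "schwartz_norm p (schwartz_shift u \<phi> - schwartz_shift v \<phi> + (u - v) *\<^sub>R schwartz_shift v (schwartz_deriv \<phi>))
      \<le> real (Suc p) ^ 2 * (?c * (u - v)\<^sup>2)"
  proof (rule schwartz_norm_least)
    fix \<alpha> \<beta> x assume ab: "\<alpha> \<le> p" "\<beta> \<le> p"
    \<comment> \<open>\<open>d i\<close> is the i-th derivative in w of
      \<open>sderiv \<beta> \<phi> (x - w)\<close>; each differentiation contributes a factor
      -1.\<close>
    define d where "d i w = (- 1) ^ i * sderiv (\<beta> + i) \<phi> (x - w)" for i w
    have D: "DERIV (d i) w :> d (Suc i) w" for i w
      unfolding d_def
      using DERIV_cmult[OF sderiv_reflect_has_derivative[of "\<beta> + i" \<phi> x w], of "(- 1) ^ i"] by simp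
    have "\<exists>w. \<bar>w\<bar> \<le> c \<and> d 0 u = d 0 v + d 1 v * (u - v) + d 2 w / 2 * (u - v)\<^sup>2"
    proof (cases "u = v")
      case False
      then have "\<exists>t. (if u < v then u < t \<and> t < v else v < t \<and> t < u) \<and>
          d 0 u = (\<Sum>m<2. d m v / fact m * (u - v) ^ m) + d 2 t / fact 2 * (u - v) ^ 2"
        using assms D by (intro Taylor[of 2 d "d 0" "-c" c]) auto
      then obtain t where "if u < v then u < t \<and> t < v else v < t \<and> t < u"
        "d 0 u = d 0 v + d 1 v * (u - v) + d 2 t / 2 * (u - v) ^ 2"
        by (auto simp: eval_nat_numeral)
      then show ?thesis using assms by (intro exI[of _ t]) (auto split: if_splits)
    qed (use assms in auto)
    then obtain w where w: "\<bar>w\<bar> \<le> c"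
      "d 0 u = d 0 v + d 1 v * (u - v) + d 2 w / 2 * (u - v)\<^sup>2" by blast
    have eq: "sderiv \<beta> \<phi> (x - u) - sderiv \<beta> \<phi> (x - v) + (u - v) * sderiv (Suc \<beta>) \<phi> (x - v)
        = (u - v)\<^sup>2 / 2 * sderiv (Suc (Suc \<beta>)) \<phi> (x - w)"
      using w(2) by (simp add: d_def algebra_simps)
    have "\<bar>x ^ \<alpha> * sderiv \<beta> (schwartz_shift u \<phi> - schwartz_shift v \<phi> + (u - v) *\<^sub>R schwartz_shift v (schwartz_deriv \<phi>)) x\<bar>
        = \<bar>x ^ \<alpha> * ((u - v)\<^sup>2 / 2 * sderiv (Suc (Suc \<beta>)) \<phi> (x - w))\<bar>"
      unfolding eq[symmetric] sderiv_add sderiv_diff sderiv_scaleR sderiv_shift sderiv_schwartz_deriv by simp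
    also have "\<dots> = (u - v)\<^sup>2 / 2 * \<bar>x ^ \<alpha> * sderiv (Suc (Suc \<beta>)) \<phi> (x - w)\<bar>"
      by (simp add: abs_mult)
    also have "\<dots> \<le> (u - v)\<^sup>2 * ?c"
      using ab by (intro mult_mono schwartz_shift_bound w) auto
    finally show "\<bar>x ^ \<alpha> * sderiv \<beta> (schwartz_shift u \<phi> - schwartz_shift v \<phi> + (u - v) *\<^sub>R schwartz_shift v (schwartz_deriv \<phi>)) x\<bar> \<le> ?c * (u - v)\<^sup>2"
      by (simp add: mult_ac)
  qed
  also have "\<dots> \<le> real (Suc (Suc (Suc p))) ^ 2 * (?c * (u - v)\<^sup>2)"
    using c by (intro mult_right_mono power_mono mult_nonneg_nonneg) (auto simp: schwartz_norm_nonneg)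
  finally show ?thesis
    by (simp add: shift_const_def mult_ac)
qed

lemma schwartz_bounded_shift:
  assumes "schwartz_bounded B"
  shows "schwartz_bounded {schwartz_shift u \<phi> | u \<phi>. \<phi> \<in> B \<and> \<bar>u\<bar> \<le> c}"
  unfolding schwartz_bounded_norm
proof
  fix p
  obtain L where L: "0 < L" "\<And>\<phi>. \<phi> \<in> B \<Longrightarrow> schwartz_norm p \<phi> \<le> L"
    using schwartz_bounded_obtain[OF assms] by blast
  have "schwartz_norm p (schwartz_shift u \<phi>) \<le> shift_const c p * L" if "\<phi> \<in> B" "\<bar>u\<bar> \<le> c" for u \<phi>
    using that by (intro order_trans[OF schwartz_norm_shift_le[of u c]] mult_left_mono L shift_const_nonneg) auto
  then show "\<exists>K. \<forall>\<psi>\<in>{schwartz_shift u \<phi> | u \<phi>. \<phi> \<in> B \<and> \<bar>u\<bar> \<le> c}. schwartz_norm p \<psi> \<le> K"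
    by (intro exI[of _ "shift_const c p * L"]) auto
qed

lemma schwartz_bounded_deriv:
  assumes "schwartz_bounded B"
  shows "schwartz_bounded (schwartz_deriv ` B)"
  unfolding schwartz_bounded_norm
proof
  fix p
  obtain L where L: "0 < L" "\<And>\<phi>. \<phi> \<in> B \<Longrightarrow> schwartz_norm (Suc p) \<phi> \<le> L"
    using schwartz_bounded_obtain[OF assms] by blast
  then have "schwartz_norm p (schwartz_deriv \<phi>) \<le> real (Suc p) ^ 2 * L" if "\<phi> \<in> B" for \<phi>
    using that by (intro order_trans[OF schwartz_norm_deriv_le] mult_left_mono) auto
  then show "\<exists>K. \<forall>\<psi>\<in>schwartz_deriv ` B. schwartz_norm p \<psi> \<le> K"
    by (intro exI[of _ "real (Suc p) ^ 2 * L"]) auto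
qed

text \<open>Induction on the polynomial with the power n left free: \<open>pCons a q\<close> with
  weight x^n splits into the monomial a x^n and \<open>q\<close> with weight x^(n+1). The monomial
  is controlled by |x|^n <= n! exp |x| and |x| - x^2 <= 1.\<close>

lemma gaussian_poly_bounded: "bounded (range (\<lambda>x::real. x ^ n * poly q x * exp (- x\<^sup>2)))"
proof (induction q arbitrary: n)
  case 0
  then show ?case by simp
next
  case (pCons a q)
  have "\<bar>a * (x ^ n * exp (- x\<^sup>2))\<bar> \<le> \<bar>a\<bar> * (fact n * exp 1)" for x
  proof -
    have "\<bar>x\<bar> ^ n / fact n \<le> exp \<bar>x\<bar>"
      using sum_le_suminf[OF summable_exp[of "\<bar>x\<bar>"], of "{n}"]
      by (simp add: exp_def divide_inverse mult.commute summable_exp_generic)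
    then have "\<bar>x\<bar> ^ n \<le> fact n * exp \<bar>x\<bar>"
      by (simp add: field_simps)
    moreover have "\<bar>x\<bar> - x\<^sup>2 \<le> 1"
    proof (cases "\<bar>x\<bar> \<le> 1")
      case False
      then have "\<bar>x\<bar> * 1 \<le> \<bar>x\<bar> * \<bar>x\<bar>" by (intro mult_left_mono) auto
      then show ?thesis by (simp add: power2_eq_square)
    qed (use zero_le_power2[of x] in linarith)
    ultimately have "\<bar>x\<bar> ^ n * exp (- x\<^sup>2) \<le> fact n * exp \<bar>x\<bar> * exp (- x\<^sup>2)"
      by (intro mult_right_mono) auto
    also have "\<dots> = fact n * exp (\<bar>x\<bar> - x\<^sup>2)"
      by (simp add: exp_diff exp_minus field_simps)
    also have "\<dots> \<le> fact n * exp 1"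
      using \<open>\<bar>x\<bar> - x\<^sup>2 \<le> 1\<close> by simp
    finally show ?thesis
      by (simp add: abs_mult power_abs mult_left_mono)
  qed
  then have "bounded (range (\<lambda>x. a * (x ^ n * exp (- x\<^sup>2))))"
    unfolding bounded_iff by auto
  moreover have "bounded (range (\<lambda>x. x ^ Suc n * poly q x * exp (- x\<^sup>2)))"
    by (rule pCons.IH)
  ultimately have "bounded (range (\<lambda>x. a * (x ^ n * exp (- x\<^sup>2)) + x ^ Suc n * poly q x * exp (- x\<^sup>2)))"
    by (rule bounded_plus_comp)
  moreover have "(\<lambda>x. a * (x ^ n * exp (- x\<^sup>2)) + x ^ Suc n * poly q x * exp (- x\<^sup>2))
      = (\<lambda>x. x ^ n * poly (pCons a q) x * exp (- x\<^sup>2))"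
    by (simp add: algebra_simps fun_eq_iff)
  ultimately show ?case by (simp only:)
qed

text \<open>Every derivative stays a polynomial times the Gaussian: differentiation replaces the
  factor q by q' - 2 x q.\<close>

lemma schwartz_fun_gaussian: "schwartz_fun (\<lambda>x. exp (- x\<^sup>2))"
proof -
  have *: "\<exists>q. (deriv ^^ k) (\<lambda>x::real. exp (- x\<^sup>2)) = (\<lambda>x. poly q x * exp (- x\<^sup>2))" for k
  proof (induction k)
    case 0
    show ?case by (rule exI[of _ 1]) simp
  next
    case (Suc k)
    then obtain q where q: "(deriv ^^ k) (\<lambda>x::real. exp (- x\<^sup>2)) = (\<lambda>x. poly q x * exp (- x\<^sup>2))" by blast
    have "deriv (\<lambda>x. poly q x * exp (- x\<^sup>2)) x = poly (pderiv q - [:0, 2:] * q) x * exp (- x\<^sup>2)" for x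
      by (rule DERIV_imp_deriv) (auto intro!: derivative_eq_intros simp: algebra_simps)
    then show ?case
      unfolding funpow.simps o_apply q by (intro exI[of _ "pderiv q - [:0, 2:] * q"] ext)
  qed
  have "(\<lambda>x. poly q x * exp (- x\<^sup>2)) field_differentiable at x" for q and x :: real
    unfolding field_differentiable_def by (rule exI) (auto intro!: derivative_eq_intros)
  moreover have "bounded (range (\<lambda>x. x ^ \<alpha> * (poly q x * exp (- x\<^sup>2))))" for q :: "real poly" and \<alpha>
    using gaussian_poly_bounded[of \<alpha> q] by (simp add: mult.assoc)
  ultimately show ?thesis
    unfolding schwartz_fun_def using * by metis
qed

text \<open>A strictly positive test function. Its pairing with the service distribution is
  therefore positive, which later allows the arrivals to be read off from a path.\<close>

lift_definition gaussian :: schwartz is "\<lambda>x. exp (- x\<^sup>2)"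
  by (rule schwartz_fun_gaussian)

text \<open>Two functions with the same discretisation on a sufficiently fine finite grid are close:
  on the grid interval by the Lipschitz bound, and outside by the decay given by the extra power
  of \<open>x\<close>.\<close>

lemma schwartz_norm_totally_bounded:
  assumes "0 < e"
  shows "\<exists>\<Phi>. finite \<Phi> \<and> (\<forall>\<phi>. schwartz_norm (Suc p) \<phi> \<le> 1 \<longrightarrow> (\<exists>\<psi>\<in>\<Phi>. schwartz_norm p (\<phi> - \<psi>) < e))"
proof -
  define U where "U = {\<phi>. schwartz_norm (Suc p) \<phi> \<le> 1}"
  define d where "d = e / (2 * real (Suc p) ^ 2)"
  have d: "0 < d" and d2: "real (Suc p) ^ 2 * d < e"
    using assms by (auto simp: d_def field_simps)
  define s where "s = d / (4 * real (p + 2))"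
  \<comment> \<open>The error d on the grid interval is made up of d / 4 from the rounded values and
    (p + 2) s = d / 4 from each of two Lipschitz steps. Beyond |x| = 2 / d the extra power of x
    leaves at most d / 2 for each of the two functions.\<close>
  have s: "0 < s" using d by (simp add: s_def)
  have s4: "4 * (real (p + 2) * s) = d" by (simp add: s_def field_simps)
  define J where "J = \<lceil>2 / (d * s)\<rceil> + 1"
  define V where "V = \<lceil>4 / d\<rceil> + 1"
  define g where "g \<alpha> \<beta> \<phi> x = x ^ \<alpha> * sderiv \<beta> \<phi> x" for \<alpha> \<beta> \<phi> and x :: real
  define code where "code \<phi> = (\<lambda>(\<alpha>, \<beta>, j)\<in>{..p} \<times> {..p} \<times> {-J..J}. \<lfloor>g \<alpha> \<beta> \<phi> (of_int j * s) / (d / 4)\<rfloor>)" for \<phi>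
  have le1: "\<bar>x ^ \<alpha> * sderiv \<beta> \<phi> x\<bar> \<le> 1" if "\<phi> \<in> U" "\<alpha> \<le> Suc p" "\<beta> \<le> Suc p" for \<alpha> \<beta> \<phi> x
    using schwartz_norm_upper[OF that(2,3)] that(1) unfolding U_def
    by (metis mem_Collect_eq order_trans)
  have lip: "\<bar>g \<alpha> \<beta> \<phi> x - g \<alpha> \<beta> \<phi> y\<bar> \<le> real (p + 2) * \<bar>x - y\<bar>"
    if "\<phi> \<in> U" "\<alpha> \<le> p" "\<beta> \<le> p" for \<alpha> \<beta> \<phi> x y
  proof -
    have D: "(g \<alpha> \<beta> \<phi> has_real_derivative real \<alpha> * (x ^ (\<alpha> - 1) * sderiv \<beta> \<phi> x) + x ^ \<alpha> * sderiv (Suc \<beta>) \<phi> x) (at x)" for x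
      unfolding g_def
      by (rule derivative_eq_intros sderiv_has_derivative refl)+ (simp add: algebra_simps)
    have "norm (g \<alpha> \<beta> \<phi> x - g \<alpha> \<beta> \<phi> y) \<le> real (p + 2) * norm (x - y)"
    proof (rule field_differentiable_bound[of UNIV])
      fix x
      have "\<bar>real \<alpha> * (x ^ (\<alpha> - 1) * sderiv \<beta> \<phi> x) + x ^ \<alpha> * sderiv (Suc \<beta>) \<phi> x\<bar>
          \<le> real \<alpha> * \<bar>x ^ (\<alpha> - 1) * sderiv \<beta> \<phi> x\<bar> + \<bar>x ^ \<alpha> * sderiv (Suc \<beta>) \<phi> x\<bar>"
        using abs_triangle_ineq[of "real \<alpha> * (x ^ (\<alpha> - 1) * sderiv \<beta> \<phi> x)" "x ^ \<alpha> * sderiv (Suc \<beta>) \<phi> x"]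
        by (simp only: abs_mult abs_of_nat)
      also have "\<dots> \<le> real \<alpha> * 1 + 1"
        using that by (intro add_mono mult_left_mono le1) auto
      also have "\<dots> \<le> real (p + 2)" using that by simp
      finally show "norm (real \<alpha> * (x ^ (\<alpha> - 1) * sderiv \<beta> \<phi> x) + x ^ \<alpha> * sderiv (Suc \<beta>) \<phi> x) \<le> real (p + 2)"
        by simp
    qed (use D in auto)
    then show ?thesis by simp
  qed
  have "code ` U \<subseteq> ({..p} \<times> {..p} \<times> {-J..J}) \<rightarrow>\<^sub>E {-V..V}"
  proof (rule image_subsetI, rule PiE_I)
    fix \<phi> x assume U: "\<phi> \<in> U" and x: "x \<in> {..p} \<times> {..p} \<times> {-J..J}"
    obtain \<alpha> \<beta> j where xj: "x = (\<alpha>, \<beta>, j)" "\<alpha> \<le> p" "\<beta> \<le> p" using x by (cases x) auto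
    have "\<bar>g \<alpha> \<beta> \<phi> (of_int j * s)\<bar> \<le> 1"
      unfolding g_def using xj by (intro le1 U) auto
    then have "\<bar>g \<alpha> \<beta> \<phi> (of_int j * s) / (d / 4)\<bar> \<le> 4 / d"
      using d by (simp add: field_simps)
    moreover have "\<lfloor>z\<rfloor> \<in> {-V..V}" if "\<bar>z\<bar> \<le> 4 / d" for z
      using that unfolding V_def abs_le_iff atLeastAtMost_iff by linarith
    ultimately have "\<lfloor>g \<alpha> \<beta> \<phi> (of_int j * s) / (d / 4)\<rfloor> \<in> {-V..V}"
      by blast
    then show "code \<phi> x \<in> {-V..V}" using x xj by (simp add: code_def)
  next
    fix \<phi> x assume "x \<notin> {..p} \<times> {..p} \<times> {-J..J}"
    then show "code \<phi> x = undefined" unfolding code_def by (simp only: restrict_def if_False)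
  qed
  then have "finite (code ` U)"
    by (rule finite_subset) (intro finite_PiE finite_cartesian_product; simp)
  \<comment> \<open>One function of U is kept for each of the finitely many attained codes.\<close>
  then obtain \<Phi> where \<Phi>: "\<Phi> \<subseteq> U" "finite \<Phi>" "code ` U = code ` \<Phi>"
    by (meson finite_subset_image order_refl)
  have "\<exists>\<psi>\<in>\<Phi>. schwartz_norm p (\<phi> - \<psi>) < e" if \<phi>: "\<phi> \<in> U" for \<phi>
  proof -
    from \<phi> \<Phi>(3) have "code \<phi> \<in> code ` \<Phi>" by blast
    then obtain \<psi> where \<psi>: "\<psi> \<in> \<Phi>" "code \<phi> = code \<psi>" by blast
    with \<Phi> have \<psi>U: "\<psi> \<in> U" by blast
    have "schwartz_norm p (\<phi> - \<psi>) \<le> real (Suc p) ^ 2 * d"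
    proof (rule schwartz_norm_least)
      fix \<alpha> \<beta> x assume ab: "\<alpha> \<le> p" "\<beta> \<le> p"
      have eq: "x ^ \<alpha> * sderiv \<beta> (\<phi> - \<psi>) x = g \<alpha> \<beta> \<phi> x - g \<alpha> \<beta> \<psi> x"
        by (simp add: sderiv_diff g_def algebra_simps)
      show "\<bar>x ^ \<alpha> * sderiv \<beta> (\<phi> - \<psi>) x\<bar> \<le> d"
      proof (cases "\<bar>x\<bar> \<le> 2 / d")
        case True
        define j where "j = \<lfloor>x / s\<rfloor>"
        have "\<bar>x / s\<bar> \<le> 2 / (d * s)"
          using True s d by (simp add: abs_divide field_simps)
        then have jJ: "j \<in> {-J..J}"
          unfolding j_def J_def abs_le_iff atLeastAtMost_iff by linarith
        have "of_int j \<le> x / s" "x / s < of_int j + 1" unfolding j_def by linarith+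
        then have close: "\<bar>x - of_int j * s\<bar> \<le> s"
          using s by (auto simp: field_simps abs_le_iff)
        let ?y = "of_int j * s"
        have "code \<phi> (\<alpha>, \<beta>, j) = code \<psi> (\<alpha>, \<beta>, j)" using \<psi>(2) by simp
        then have "\<lfloor>g \<alpha> \<beta> \<phi> ?y / (d / 4)\<rfloor> = \<lfloor>g \<alpha> \<beta> \<psi> ?y / (d / 4)\<rfloor>"
          using jJ ab by (simp add: code_def)
        then have "\<bar>g \<alpha> \<beta> \<phi> ?y / (d / 4) - g \<alpha> \<beta> \<psi> ?y / (d / 4)\<bar> \<le> 1" by linarith
        then have "\<bar>g \<alpha> \<beta> \<phi> ?y - g \<alpha> \<beta> \<psi> ?y\<bar> \<le> d / 4"
          using d by (simp only: diff_divide_distrib[symmetric] abs_divide) (simp add: pos_divide_le_eq)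
        moreover have "\<bar>g \<alpha> \<beta> \<phi> x - g \<alpha> \<beta> \<phi> ?y\<bar> \<le> real (p + 2) * s"
          using close by (intro order_trans[OF lip[OF \<phi> ab]] mult_left_mono) auto
        moreover have "\<bar>g \<alpha> \<beta> \<psi> x - g \<alpha> \<beta> \<psi> ?y\<bar> \<le> real (p + 2) * s"
          using close by (intro order_trans[OF lip[OF \<psi>U ab]] mult_left_mono) auto
        ultimately show ?thesis unfolding eq using s4 d by linarith
      next
        case False
        have *: "\<bar>g \<alpha> \<beta> \<theta> x\<bar> \<le> d / 2" if "\<theta> \<in> U" for \<theta>
        proof -
          have "\<bar>x\<bar> * \<bar>g \<alpha> \<beta> \<theta> x\<bar> = \<bar>x ^ Suc \<alpha> * sderiv \<beta> \<theta> x\<bar>"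
            by (simp add: g_def abs_mult mult_ac)
          also have "\<dots> \<le> 1" using ab that by (intro le1) auto
          finally have "\<bar>x\<bar> * \<bar>g \<alpha> \<beta> \<theta> x\<bar> \<le> 1" .
          moreover have "2 / d * \<bar>g \<alpha> \<beta> \<theta> x\<bar> \<le> \<bar>x\<bar> * \<bar>g \<alpha> \<beta> \<theta> x\<bar>"
            using False by (intro mult_right_mono) auto
          ultimately have "2 / d * \<bar>g \<alpha> \<beta> \<theta> x\<bar> \<le> 1" by linarith
          then show ?thesis using d by (simp add: field_simps)
        qed
        show ?thesis unfolding eq using *[OF \<phi>] *[OF \<psi>U] by linarith
      qed
    qed
    then show ?thesis using d2 \<psi>(1) by (intro bexI[of _ \<psi>]) auto
  qed
  then show ?thesis using \<Phi>(2) unfolding U_def by blast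
qed

section \<open>Tempered distributions\<close>

lemma linear_pairing: "linear (pairing \<mu>)"
  using pairing[of \<mu>] by simp

lemma pairing_add: "pairing \<mu> (\<phi> + \<psi>) = pairing \<mu> \<phi> + pairing \<mu> \<psi>"
  and pairing_diff: "pairing \<mu> (\<phi> - \<psi>) = pairing \<mu> \<phi> - pairing \<mu> \<psi>"
  and pairing_scaleR: "pairing \<mu> (c *\<^sub>R \<phi>) = c * pairing \<mu> \<phi>"
  using linear_add[OF linear_pairing] linear_diff[OF linear_pairing] linear_scale[OF linear_pairing]
  by simp_all

lemma tempered_eqI: "(\<And>\<phi>. pairing \<mu> \<phi> = pairing \<nu> \<phi>) \<Longrightarrow> \<mu> = \<nu>"
  by (simp add: pairing_inject[symmetric] fun_eq_iff)

text \<open>A subbasic set contains a norm ball around each of its points, and the norms increase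
  with their index, so a finite intersection contains a ball in the norm of the larger
  index.\<close>

lemma schwartz_open_contains_ball:
  assumes "open U" "\<phi> \<in> U"
  shows "\<exists>p e. 0 < e \<and> (\<forall>\<psi>. schwartz_norm p (\<psi> - \<phi>) < e \<longrightarrow> \<psi> \<in> U)"
  using assms unfolding open_schwartz_def
proof (induction arbitrary: \<phi> rule: generate_topology.induct)
  case UNIV
  then show ?case by (intro exI[of _ 0] exI[of _ 1]) auto
next
  case (Int A B)
  from Int.IH(1)[of \<phi>] Int.prems obtain p e where
    "0 < e" "\<forall>\<psi>. schwartz_norm p (\<psi> - \<phi>) < e \<longrightarrow> \<psi> \<in> A" by auto
  moreover from Int.IH(2)[of \<phi>] Int.prems obtain q d where
    "0 < d" "\<forall>\<psi>. schwartz_norm q (\<psi> - \<phi>) < d \<longrightarrow> \<psi> \<in> B" by auto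
  moreover have "schwartz_norm p \<psi> \<le> schwartz_norm (max p q) \<psi>"
    "schwartz_norm q \<psi> \<le> schwartz_norm (max p q) \<psi>" for \<psi>
    by (auto intro: schwartz_norm_mono)
  ultimately have "\<psi> \<in> A \<inter> B" if "schwartz_norm (max p q) (\<psi> - \<phi>) < min e d" for \<psi>
    using that by (meson IntI le_less_trans min_less_iff_conj)
  then show ?case
    using \<open>0 < e\<close> \<open>0 < d\<close> by (intro exI[of _ "max p q"] exI[of _ "min e d"]) auto
next
  case (UN K)
  then obtain A where "A \<in> K" "\<phi> \<in> A" by blast
  then show ?case using UN.IH[of A \<phi>] by blast
next
  case (Basis A)
  then obtain \<alpha> \<beta> \<phi>0 e where A: "A = {\<psi>. schwartz_seminorm \<alpha> \<beta> (\<psi> - \<phi>0) < e}" by blast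
  define d where "d = e - schwartz_seminorm \<alpha> \<beta> (\<phi> - \<phi>0)"
  have "\<psi> \<in> A" if "schwartz_norm (max \<alpha> \<beta>) (\<psi> - \<phi>) < d" for \<psi>
  proof -
    have "schwartz_seminorm \<alpha> \<beta> (\<psi> - \<phi>0)
        \<le> schwartz_seminorm \<alpha> \<beta> (\<psi> - \<phi>) + schwartz_seminorm \<alpha> \<beta> (\<phi> - \<phi>0)"
      using seminorm_triangle[of \<alpha> \<beta> "\<psi> - \<phi>" "\<phi> - \<phi>0"] by simp
    moreover have "schwartz_seminorm \<alpha> \<beta> (\<psi> - \<phi>) \<le> schwartz_norm (max \<alpha> \<beta>) (\<psi> - \<phi>)"
      by (rule seminorm_le_norm) auto
    ultimately show ?thesis using that unfolding A d_def by simp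
  qed
  moreover have "0 < d" using Basis(2) unfolding A d_def by simp
  ultimately show ?case by blast
qed

text \<open>A finite intersection of subbasic sets: with e divided by the number of seminorms their
  sum stays below e.\<close>

lemma schwartz_norm_ball_nhd:
  assumes "0 < e"
  shows "\<exists>U. open U \<and> \<phi> \<in> U \<and> (\<forall>\<psi>\<in>U. schwartz_norm p (\<psi> - \<phi>) < e)"
proof -
  define d where "d = e / real (Suc p) ^ 2"
  have d: "0 < d" using assms by (simp add: d_def)
  define U where "U = (\<Inter>\<alpha>\<le>p. \<Inter>\<beta>\<le>p. {\<psi>. schwartz_seminorm \<alpha> \<beta> (\<psi> - \<phi>) < d})"
  have "open {\<psi>. schwartz_seminorm \<alpha> \<beta> (\<psi> - \<phi>) < d}" for \<alpha> \<beta>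
    unfolding open_schwartz_def using d by (intro generate_topology.Basis) blast
  then have "open U"
    unfolding U_def by (intro open_INT ballI) auto
  moreover have "schwartz_seminorm \<alpha> \<beta> 0 = 0" for \<alpha> \<beta>
    using seminorm_scaleR_le[of \<alpha> \<beta> 0 0] seminorm_nonneg[of \<alpha> \<beta> 0] by simp
  then have "\<phi> \<in> U" unfolding U_def using d by simp
  moreover have "schwartz_norm p (\<psi> - \<phi>) < e" if "\<psi> \<in> U" for \<psi>
  proof -
    have "schwartz_norm p (\<psi> - \<phi>) < (\<Sum>\<alpha>\<le>p. \<Sum>\<beta>\<le>p. d)"
      unfolding schwartz_norm_def using that
      by (intro sum_strict_mono) (auto simp: U_def)
    also have "\<dots> = e" by (simp add: d_def power2_eq_square)
    finally show ?thesis .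
  qed
  ultimately show ?thesis by blast
qed

text \<open>Finite order of a tempered distribution: continuity at 0 gives a norm ball on which
  |\<mu>| < 1, and scaling does the rest.\<close>

lemma pairing_norm_bound: "\<exists>p C. 0 < C \<and> (\<forall>\<phi>. \<bar>pairing \<mu> \<phi>\<bar> \<le> C * schwartz_norm p \<phi>)"
proof -
  have "continuous_on UNIV (pairing \<mu>)" using pairing[of \<mu>] by simp
  then have "open (pairing \<mu> -` {-1<..<1})"
    by (rule open_vimage[rotated]) simp
  moreover have "0 \<in> pairing \<mu> -` {-1<..<1}"
    using pairing_scaleR[of \<mu> 0 0] by simp
  ultimately obtain p e where e: "0 < e"
    "\<And>\<psi>. schwartz_norm p (\<psi> - 0) < e \<Longrightarrow> \<psi> \<in> pairing \<mu> -` {-1<..<1}"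
    using schwartz_open_contains_ball by blast
  have "\<bar>pairing \<mu> \<phi>\<bar> \<le> (2 / e) * schwartz_norm p \<phi>" for \<phi>
  proof (rule field_le_epsilon)
    fix d :: real assume d: "0 < d"
    \<comment> \<open>The scaling brings \<phi> strictly inside the ball of radius e. The summand d
      e / 2 keeps the denominator positive when the norm of \<phi> is 0, and turns into the error d
      at the end.\<close>
    define k where "k = e / (2 * (schwartz_norm p \<phi> + d * e / 2))"
    have pos: "0 < schwartz_norm p \<phi> + d * e / 2"
      using d e schwartz_norm_nonneg[of p \<phi>] by (simp add: add_nonneg_pos)
    have k: "0 < k" unfolding k_def using pos e by simp
    have "schwartz_norm p (k *\<^sub>R \<phi>) \<le> k * schwartz_norm p \<phi>"
      using schwartz_norm_scaleR_le[of p k \<phi>] k by simp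
    also have "\<dots> \<le> k * (schwartz_norm p \<phi> + d * e / 2)"
      using k d e by (intro mult_left_mono) auto
    also have "\<dots> = e / 2"
      using pos unfolding k_def by (simp add: field_simps)
    also have "\<dots> < e" using e by simp
    finally have "\<bar>pairing \<mu> (k *\<^sub>R \<phi>)\<bar> < 1" using e(2)[of "k *\<^sub>R \<phi>"] by (auto simp: abs_less_iff)
    then have "\<bar>pairing \<mu> \<phi>\<bar> < 1 / k"
      using k by (simp add: pairing_scaleR abs_mult field_simps)
    also have "1 / k = 2 / e * schwartz_norm p \<phi> + d"
      unfolding k_def using e by (simp add: add_divide_distrib distrib_left)
    finally show "\<bar>pairing \<mu> \<phi>\<bar> \<le> 2 / e * schwartz_norm p \<phi> + d" by simp
  qed
  moreover have "0 < 2 / e" using e by simp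
  ultimately show ?thesis by blast
qed

text \<open>The converse of \<open>pairing_norm_bound\<close>. Each distribution defined below
  through \<open>Abs_tempered\<close> is justified by an explicit bound of this kind.\<close>

lemma pairing_Abs_tempered:
  assumes "linear f" "\<And>\<phi>. \<bar>f \<phi>\<bar> \<le> C * schwartz_norm p \<phi>"
  shows "pairing (Abs_tempered f) = f"
proof -
  have "(f \<longlongrightarrow> f \<phi>) (at \<phi>)" for \<phi>
  proof (rule tendstoI)
    fix e :: real assume e: "0 < e"
    define d where "d = e / (\<bar>C\<bar> + 1)"
    have d: "0 < d" using e by (simp add: d_def add_nonneg_pos)
    obtain U where U: "open U" "\<phi> \<in> U" "\<And>\<psi>. \<psi> \<in> U \<Longrightarrow> schwartz_norm p (\<psi> - \<phi>) < d"
      using schwartz_norm_ball_nhd[OF d, of \<phi> p] by blast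
    have "dist (f \<psi>) (f \<phi>) < e" if "\<psi> \<in> U" for \<psi>
    proof -
      have "\<bar>f \<psi> - f \<phi>\<bar> = \<bar>f (\<psi> - \<phi>)\<bar>" using assms(1) by (simp add: linear_diff)
      also have "\<dots> \<le> \<bar>C\<bar> * schwartz_norm p (\<psi> - \<phi>)"
        by (rule order_trans[OF assms(2)]) (intro mult_right_mono schwartz_norm_nonneg, simp)
      also have "\<dots> \<le> \<bar>C\<bar> * d"
        using U(3)[OF that] by (intro mult_left_mono) auto
      also have "\<dots> < (\<bar>C\<bar> + 1) * d" using d by (simp add: distrib_right)
      also have "\<dots> = e" by (simp add: d_def)
      finally show ?thesis by (simp add: dist_real_def)
    qed
    then show "\<forall>\<^sub>F \<psi> in at \<phi>. dist (f \<psi>) (f \<phi>) < e"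
      unfolding eventually_at_topological using U by blast
  qed
  then have "continuous_on UNIV f" by (simp add: continuous_on_def)
  then show ?thesis using assms(1) by (simp add: Abs_tempered_inverse)
qed

section \<open>Dual seminorms and strong convergence\<close>

lemma dual_seminorm_le_iff:
  "0 \<le> c \<Longrightarrow> dual_seminorm B \<mu> \<le> ennreal c \<longleftrightarrow> (\<forall>\<phi>\<in>B. \<bar>pairing \<mu> \<phi>\<bar> \<le> c)"
  by (simp add: dual_seminorm_def SUP_le_iff)

lemma dual_seminorm_upper: "\<phi> \<in> B \<Longrightarrow> ennreal \<bar>pairing \<mu> \<phi>\<bar> \<le> dual_seminorm B \<mu>"
  unfolding dual_seminorm_def by (rule SUP_upper)

lemma dual_seminorm_lessD:
  assumes "dual_seminorm B \<mu> < ennreal e" "\<phi> \<in> B"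
  shows "\<bar>pairing \<mu> \<phi>\<bar> < e"
  using le_less_trans[OF dual_seminorm_upper[OF assms(2)] assms(1)]
  by (simp add: ennreal_less_iff)

lemma dual_seminorm_triangle:
  "dual_seminorm B (\<mu> + \<nu>) \<le> dual_seminorm B \<mu> + dual_seminorm B \<nu>"
  unfolding dual_seminorm_def[of B "\<mu> + \<nu>"]
proof (rule SUP_least)
  fix \<phi> assume \<phi>: "\<phi> \<in> B"
  have "ennreal \<bar>pairing (\<mu> + \<nu>) \<phi>\<bar> \<le> ennreal (\<bar>pairing \<mu> \<phi>\<bar> + \<bar>pairing \<nu> \<phi>\<bar>)"
    by (intro ennreal_leI) (simp add: plus_tempered.rep_eq)
  also have "\<dots> \<le> dual_seminorm B \<mu> + dual_seminorm B \<nu>"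
    using \<phi> by (simp add: ennreal_plus add_mono dual_seminorm_upper)
  finally show "ennreal \<bar>pairing (\<mu> + \<nu>) \<phi>\<bar> \<le> dual_seminorm B \<mu> + dual_seminorm B \<nu>" .
qed

lemma dual_seminorm_zero: "dual_seminorm B 0 = 0"
  using dual_seminorm_le_iff[of 0 B 0] by (simp add: zero_tempered.rep_eq)

text \<open>The seminorm balls around l form a neighbourhood base: a union of two bounded sets is
  bounded, which handles intersections, and a ball with another centre contains one centred at l by
  the triangle inequality.\<close>

lemma tendsto_tempered_iff:
  "(x \<longlongrightarrow> l) G \<longleftrightarrow>
    (\<forall>B e. schwartz_bounded B \<longrightarrow> 0 < e \<longrightarrow> (\<forall>\<^sub>F t in G. dual_seminorm B (x t - l) < ennreal e))"
proof
  assume x: "(x \<longlongrightarrow> l) G"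
  show "\<forall>B e. schwartz_bounded B \<longrightarrow> 0 < e \<longrightarrow> (\<forall>\<^sub>F t in G. dual_seminorm B (x t - l) < ennreal e)"
  proof (intro allI impI)
    fix B :: "schwartz set" and e :: real
    assume "schwartz_bounded B" "0 < e"
    then have "open {\<nu>. dual_seminorm B (\<nu> - l) < ennreal e}"
      unfolding open_tempered_def by (intro generate_topology.Basis) blast
    from topological_tendstoD[OF x this] show "\<forall>\<^sub>F t in G. dual_seminorm B (x t - l) < ennreal e"
      using \<open>0 < e\<close> by (simp add: dual_seminorm_zero)
  qed
next
  assume *: "\<forall>B e. schwartz_bounded B \<longrightarrow> 0 < e \<longrightarrow> (\<forall>\<^sub>F t in G. dual_seminorm B (x t - l) < ennreal e)"
  show "(x \<longlongrightarrow> l) G"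
  proof (rule topological_tendstoI)
    fix S assume "open S" "l \<in> S"
    then have "\<exists>B e. schwartz_bounded B \<and> 0 < e \<and> (\<forall>\<nu>. dual_seminorm B (\<nu> - l) < ennreal e \<longrightarrow> \<nu> \<in> S)"
      unfolding open_tempered_def
    proof (induction rule: generate_topology.induct)
      case UNIV
      then show ?case using schwartz_bounded_finite[of "{}"] by (intro exI[of _ "{}"] exI[of _ 1]) auto
    next
      case (Int a b)
      from Int.IH(1) Int.prems obtain A e where "schwartz_bounded A" "0 < e"
        "\<forall>\<nu>. dual_seminorm A (\<nu> - l) < ennreal e \<longrightarrow> \<nu> \<in> a" by auto
      moreover from Int.IH(2) Int.prems obtain B d where "schwartz_bounded B" "0 < d"
        "\<forall>\<nu>. dual_seminorm B (\<nu> - l) < ennreal d \<longrightarrow> \<nu> \<in> b" by auto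
      moreover have "dual_seminorm A \<nu> \<le> dual_seminorm (A \<union> B) \<nu>" "dual_seminorm B \<nu> \<le> dual_seminorm (A \<union> B) \<nu>" for \<nu>
        unfolding dual_seminorm_def by (auto intro!: SUP_subset_mono)
      moreover have "ennreal (min e d) \<le> ennreal e" "ennreal (min e d) \<le> ennreal d"
        by (intro ennreal_leI; simp)+
      ultimately have "\<nu> \<in> a \<inter> b" if "dual_seminorm (A \<union> B) (\<nu> - l) < ennreal (min e d)" for \<nu>
        using that by (meson IntI le_less_trans less_le_trans)
      then show ?case
        using \<open>0 < e\<close> \<open>0 < d\<close> \<open>schwartz_bounded A\<close> \<open>schwartz_bounded B\<close>
        by (intro exI[of _ "A \<union> B"] exI[of _ "min e d"]) (auto simp: schwartz_bounded_Un)
    next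
      case (UN K)
      then show ?case by blast
    next
      case (Basis a)
      then obtain B \<mu> e where a: "a = {\<nu>. dual_seminorm B (\<nu> - \<mu>) < ennreal e}" "schwartz_bounded B" "0 < e" by blast
      with Basis have "dual_seminorm B (l - \<mu>) < ennreal e" by simp
      moreover then obtain c where c: "dual_seminorm B (l - \<mu>) = ennreal c" "0 \<le> c"
        by (cases "dual_seminorm B (l - \<mu>)") auto
      ultimately have ce: "c < e" by (simp add: ennreal_less_iff)
      have "\<nu> \<in> a" if "dual_seminorm B (\<nu> - l) < ennreal (e - c)" for \<nu>
      proof -
        have "dual_seminorm B (\<nu> - \<mu>) \<le> dual_seminorm B (\<nu> - l) + dual_seminorm B (l - \<mu>)"
          using dual_seminorm_triangle[of B "\<nu> - l" "l - \<mu>"] by simp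
        also have "\<dots> < ennreal (e - c) + ennreal c"
          unfolding c(1) using that c(2) ce
          by (cases "dual_seminorm B (\<nu> - l)")
            (auto simp: ennreal_less_iff ennreal_plus[symmetric] simp del: ennreal_plus)
        also have "\<dots> = ennreal e" using c ce by (simp add: ennreal_plus[symmetric])
        finally show ?thesis unfolding a by simp
      qed
      then show ?case using a ce by (intro exI[of _ B] exI[of _ "e - c"]) auto
    qed
    then obtain B e where "schwartz_bounded B" "0 < e" "\<And>\<nu>. dual_seminorm B (\<nu> - l) < ennreal e \<Longrightarrow> \<nu> \<in> S" by blast
    then have "\<forall>\<^sub>F t in G. dual_seminorm B (x t - l) < ennreal e"
      using * by blast
    then show "\<forall>\<^sub>F t in G. x t \<in> S"
      by (rule eventually_mono) fact
  qed
qed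

lemma tendsto_temperedI:
  assumes "\<And>B e. schwartz_bounded B \<Longrightarrow> 0 < e \<Longrightarrow> \<forall>\<^sub>F t in G. \<forall>\<phi>\<in>B. \<bar>pairing (x t) \<phi> - pairing l \<phi>\<bar> \<le> e"
  shows "(x \<longlongrightarrow> l) G"
  unfolding tendsto_tempered_iff
proof (intro allI impI)
  fix B :: "schwartz set" and e :: real
  assume B: "schwartz_bounded B" and e: "0 < e"
  from assms[OF B, of "e / 2"] e
  have "\<forall>\<^sub>F t in G. \<forall>\<phi>\<in>B. \<bar>pairing (x t) \<phi> - pairing l \<phi>\<bar> \<le> e / 2" by simp
  then show "\<forall>\<^sub>F t in G. dual_seminorm B (x t - l) < ennreal e"
  proof (rule eventually_mono)
    fix t assume "\<forall>\<phi>\<in>B. \<bar>pairing (x t) \<phi> - pairing l \<phi>\<bar> \<le> e / 2"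
    then have "dual_seminorm B (x t - l) \<le> ennreal (e / 2)"
      using e by (subst dual_seminorm_le_iff) (auto simp: minus_tempered.rep_eq)
    also have "\<dots> < ennreal e" using e by (simp add: ennreal_less_iff)
    finally show "dual_seminorm B (x t - l) < ennreal e" .
  qed
qed

lemma tendsto_temperedD:
  assumes "(x \<longlongrightarrow> l) G" "schwartz_bounded B" "0 < e"
  shows "\<forall>\<^sub>F t in G. \<forall>\<phi>\<in>B. \<bar>pairing (x t) \<phi> - pairing l \<phi>\<bar> < e"
proof -
  have "\<forall>\<^sub>F t in G. dual_seminorm B (x t - l) < ennreal e"
    using assms unfolding tendsto_tempered_iff by blast
  then show ?thesis
    by (rule eventually_mono) (auto dest: dual_seminorm_lessD simp: minus_tempered.rep_eq)
qed

lemma tendsto_pairing: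
  assumes "(x \<longlongrightarrow> l) G"
  shows "((\<lambda>t. pairing (x t) \<phi>) \<longlongrightarrow> pairing l \<phi>) G"
proof (rule tendstoI)
  fix e :: real assume "0 < e"
  from tendsto_temperedD[OF assms schwartz_bounded_finite[of "{\<phi>}"] this]
  show "\<forall>\<^sub>F t in G. dist (pairing (x t) \<phi>) (pairing l \<phi>) < e"
    by (simp add: dist_real_def)
qed

section \<open>Distributions paired with shifted test functions\<close>

lemma has_derivative_of_quadratic_remainder:
  fixes f :: "real \<Rightarrow> real"
  assumes "\<And>v. \<bar>v - u\<bar> \<le> 1 \<Longrightarrow> \<bar>f v - f u - D * (v - u)\<bar> \<le> K * (v - u)\<^sup>2"
  shows "(f has_real_derivative D) (at u)"
  unfolding DERIV_def
proof (rule LIM_I)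
  fix e :: real assume e: "0 < e"
  have "norm ((f (u + h) - f u) / h - D) < e" if h: "h \<noteq> 0" "norm (h - 0) < min 1 (e / (\<bar>K\<bar> + 1))" for h
  proof -
    have "(f (u + h) - f u) / h - D = (f (u + h) - f u - D * h) / h" using h by (simp add: field_simps)
    then have "\<bar>(f (u + h) - f u) / h - D\<bar> = \<bar>f (u + h) - f u - D * h\<bar> / \<bar>h\<bar>" by simp
    also have "\<dots> \<le> K * h\<^sup>2 / \<bar>h\<bar>"
      using assms[of "u + h"] h by (intro divide_right_mono) auto
    also have "\<dots> = K * \<bar>h\<bar>" using h by (simp add: power2_eq_square field_simps abs_if)
    also have "\<dots> \<le> (\<bar>K\<bar> + 1) * \<bar>h\<bar>" by (intro mult_right_mono) auto
    also have "\<dots> < e" using h by (simp add: less_divide_eq mult.commute)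
    finally show ?thesis by simp
  qed
  moreover have "0 < min 1 (e / (\<bar>K\<bar> + 1))" using e by simp
  ultimately show "\<exists>s>0. \<forall>h. h \<noteq> 0 \<and> norm (h - 0) < s \<longrightarrow> norm ((f (u + h) - f u) / h - D) < e"
    by blast
qed

text \<open>Finite order of r turns the quadratic Taylor bound in a Schwartz norm into a quadratic
  bound for the pairing.\<close>

lemma pairing_shift_has_derivative:
  "((\<lambda>u. pairing r (schwartz_shift u \<phi>)) has_real_derivative
      - pairing r (schwartz_shift u (schwartz_deriv \<phi>))) (at u)"
proof -
  obtain p C where C: "0 < C" "\<And>\<phi>. \<bar>pairing r \<phi>\<bar> \<le> C * schwartz_norm p \<phi>"
    using pairing_norm_bound[of r] by blast
  let ?K = "C * (shift_const (\<bar>u\<bar> + 1) (Suc (Suc p)) * schwartz_norm (Suc (Suc p)) \<phi>)"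
  show ?thesis
  proof (rule has_derivative_of_quadratic_remainder)
    fix v assume v: "\<bar>v - u\<bar> \<le> 1"
    let ?\<psi> = "schwartz_shift v \<phi> - schwartz_shift u \<phi> + (v - u) *\<^sub>R schwartz_shift u (schwartz_deriv \<phi>)"
    have "pairing r (schwartz_shift v \<phi>) - pairing r (schwartz_shift u \<phi>)
        - - pairing r (schwartz_shift u (schwartz_deriv \<phi>)) * (v - u) = pairing r ?\<psi>"
      by (simp add: pairing_add pairing_diff pairing_scaleR)
    also have "\<bar>\<dots>\<bar> \<le> C * (shift_const (\<bar>u\<bar> + 1) (Suc (Suc p)) * (v - u)\<^sup>2 * schwartz_norm (Suc (Suc p)) \<phi>)"
      using v C(1) by (intro order_trans[OF C(2)] mult_left_mono schwartz_norm_shift_taylor) auto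
    finally show "\<bar>pairing r (schwartz_shift v \<phi>) - pairing r (schwartz_shift u \<phi>)
        - - pairing r (schwartz_shift u (schwartz_deriv \<phi>)) * (v - u)\<bar> \<le> ?K * (v - u)\<^sup>2"
      by (simp add: mult_ac)
  qed
qed

lemma continuous_on_pairing_shift: "continuous_on S (\<lambda>u. pairing r (schwartz_shift u \<phi>))"
  by (intro continuous_at_imp_continuous_on ballI DERIV_isCont[OF pairing_shift_has_derivative])

lemma pairing_shift_bound:
  "\<exists>p K. 0 \<le> K \<and> (\<forall>\<phi> u. \<bar>u\<bar> \<le> c \<longrightarrow> \<bar>pairing r (schwartz_shift u \<phi>)\<bar> \<le> K * schwartz_norm p \<phi>)"
proof (cases "0 \<le> c")
  case True
  obtain p C where C: "0 < C" "\<And>\<phi>. \<bar>pairing r \<phi>\<bar> \<le> C * schwartz_norm p \<phi>"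
    using pairing_norm_bound[of r] by blast
  have "\<bar>pairing r (schwartz_shift u \<phi>)\<bar> \<le> C * (shift_const c p * schwartz_norm p \<phi>)" if "\<bar>u\<bar> \<le> c" for u \<phi>
    using that C(1) by (intro order_trans[OF C(2)] mult_left_mono schwartz_norm_shift_le) auto
  then show ?thesis
    using shift_const_nonneg[OF True, of p] C(1) by (intro exI[of _ p] exI[of _ "C * shift_const c p"]) (auto simp: mult_ac)
qed (auto intro!: exI[of _ 0])

lemma pairing_shift_bounded:
  assumes "schwartz_bounded B"
  shows "\<exists>K\<ge>0. \<forall>\<phi>\<in>B. \<forall>u. \<bar>u\<bar> \<le> c \<longrightarrow> \<bar>pairing r (schwartz_shift u \<phi>)\<bar> \<le> K"
proof -
  obtain p K where K: "0 \<le> K" "\<And>\<phi> u. \<bar>u\<bar> \<le> c \<Longrightarrow> \<bar>pairing r (schwartz_shift u \<phi>)\<bar> \<le> K * schwartz_norm p \<phi>"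
    using pairing_shift_bound[of c r] by blast
  obtain L where L: "0 < L" "\<And>\<phi>. \<phi> \<in> B \<Longrightarrow> schwartz_norm p \<phi> \<le> L"
    using schwartz_bounded_obtain[OF assms] by blast
  have "\<bar>pairing r (schwartz_shift u \<phi>)\<bar> \<le> K * L" if "\<phi> \<in> B" "\<bar>u\<bar> \<le> c" for u \<phi>
    using that K(1) by (intro order_trans[OF K(2)] mult_left_mono L) auto
  then show ?thesis using K(1) L(1) by (intro exI[of _ "K * L"]) auto
qed

text \<open>Finite order of r combined with the mean value bound for shifts. The constant is uniform
  over a bounded set, which is what the strong topology asks for.\<close>

lemma pairing_shift_Lipschitz:
  assumes "schwartz_bounded B"
  shows "\<exists>K\<ge>0. \<forall>\<phi>\<in>B. \<forall>u v. \<bar>u\<bar> \<le> c \<longrightarrow> \<bar>v\<bar> \<le> c \<longrightarrow>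
    \<bar>pairing r (schwartz_shift u \<phi>) - pairing r (schwartz_shift v \<phi>)\<bar> \<le> K * \<bar>u - v\<bar>"
proof (cases "0 \<le> c")
  case True
  obtain p C where C: "0 < C" "\<And>\<phi>. \<bar>pairing r \<phi>\<bar> \<le> C * schwartz_norm p \<phi>"
    using pairing_norm_bound[of r] by blast
  obtain L where L: "0 < L" "\<And>\<phi>. \<phi> \<in> B \<Longrightarrow> schwartz_norm (Suc p) \<phi> \<le> L"
    using schwartz_bounded_obtain[OF assms] by blast
  have "\<bar>pairing r (schwartz_shift u \<phi>) - pairing r (schwartz_shift v \<phi>)\<bar>
      \<le> C * (shift_const c (Suc p) * \<bar>u - v\<bar> * L)" if "\<phi> \<in> B" "\<bar>u\<bar> \<le> c" "\<bar>v\<bar> \<le> c" for u v \<phi>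
  proof -
    have "\<bar>pairing r (schwartz_shift u \<phi> - schwartz_shift v \<phi>)\<bar>
        \<le> C * (shift_const c (Suc p) * \<bar>u - v\<bar> * schwartz_norm (Suc p) \<phi>)"
      using that C(1) by (intro order_trans[OF C(2)] mult_left_mono schwartz_norm_shift_diff_le) auto
    also have "\<dots> \<le> C * (shift_const c (Suc p) * \<bar>u - v\<bar> * L)"
      using that C(1) L True by (intro mult_left_mono) (auto simp: shift_const_nonneg)
    finally show ?thesis by (simp add: pairing_diff)
  qed
  then show ?thesis
    using C(1) L(1) shift_const_nonneg[OF True, of "Suc p"] by (intro exI[of _ "C * (shift_const c (Suc p) * L)"]) (auto simp: mult_ac)
qed auto

section \<open>The Skorokhod topology as a gauge topology\<close>

lemma time_change_size_le_iff:
  "0 \<le> c \<Longrightarrow> time_change_size T l \<le> ennreal c \<longleftrightarrow>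
    (\<forall>s t. 0 \<le> s \<longrightarrow> s < t \<longrightarrow> t \<le> T \<longrightarrow> \<bar>ln ((l t - l s) / (t - s))\<bar> \<le> c)"
  by (auto simp: time_change_size_def SUP_le_iff)

lemma time_changesD:
  assumes "l \<in> time_changes T"
  shows "strict_mono_on {0..T} l" "continuous_on {0..T} l" "l ` {0..T} = {0..T}"
    "\<exists>c\<ge>0. time_change_size T l = ennreal c"
  using assms unfolding time_changes_def
  by (auto simp: less_top[symmetric]) (cases "time_change_size T l"; auto)

lemma time_change_mem: "l \<in> time_changes T \<Longrightarrow> t \<in> {0..T} \<Longrightarrow> l t \<in> {0..T}"
  using time_changesD(3) by blast

lemma time_change_less_iff:
  assumes "l \<in> time_changes T" "s \<in> {0..T}" "t \<in> {0..T}"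
  shows "l s < l t \<longleftrightarrow> s < t" "l s \<le> l t \<longleftrightarrow> s \<le> t"
  using strict_mono_onD[OF time_changesD(1)[OF assms(1)], of s t]
    strict_mono_onD[OF time_changesD(1)[OF assms(1)], of t s] assms(2,3)
  by (metis less_imp_not_less linorder_less_linear, metis leD le_less_linear le_less linorder_less_linear)

lemma time_change_0:
  assumes "l \<in> time_changes T" "0 \<le> T"
  shows "l 0 = 0"
proof -
  have "0 \<in> l ` {0..T}" using time_changesD(3)[OF assms(1)] assms(2) by auto
  then obtain s where s: "s \<in> {0..T}" "l s = 0" by auto
  then have "l 0 \<le> l s" using time_change_less_iff(2)[OF assms(1), of 0 s] by auto
  moreover have "0 \<le> l 0" using time_change_mem[OF assms(1), of 0] assms(2) by auto
  ultimately show ?thesis using s by simp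
qed

lemma time_change_T:
  assumes "l \<in> time_changes T" "0 \<le> T"
  shows "l T = T"
proof -
  have "T \<in> l ` {0..T}" using time_changesD(3)[OF assms(1)] assms(2) by auto
  then obtain s where s: "s \<in> {0..T}" "l s = T" by auto
  then have "l s \<le> l T" using time_change_less_iff(2)[OF assms(1), of s T] by auto
  moreover have "l T \<le> T" using time_change_mem[OF assms(1), of T] assms(2) by auto
  ultimately show ?thesis using s by simp
qed

lemma abs_ln_le_iff:
  fixes q c :: real
  assumes "0 < q"
  shows "\<bar>ln q\<bar> \<le> c \<longleftrightarrow> exp (- c) \<le> q \<and> q \<le> exp c"
  using assms ln_ge_iff[of q "- c"] ln_le_cancel_iff[of q "exp c"] by (auto simp: abs_le_iff)

text \<open>As l fixes 0, the slope bound on [0, t] reads exp (-c) <= l t / t <= exp c, and 1 - exp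
  (-c) <= exp c - 1.\<close>

lemma time_change_close:
  assumes l: "l \<in> time_changes T" and c: "0 \<le> c" "time_change_size T l \<le> ennreal c"
    and t: "t \<in> {0..T}"
  shows "\<bar>l t - t\<bar> \<le> T * (exp c - 1)"
proof (cases "t = 0")
  case True
  then show ?thesis using time_change_0[OF l] t c by auto
next
  case False
  with t have t0: "0 < t" "t \<le> T" by auto
  have l0: "l 0 = 0" using time_change_0[OF l] t by auto
  have "0 < l t" using time_change_less_iff(1)[OF l, of 0 t] t0 l0 by auto
  moreover have "\<bar>ln ((l t - l 0) / (t - 0))\<bar> \<le> c"
    using c time_change_size_le_iff[OF c(1), of T l] t0 by blast
  ultimately have "exp (- c) \<le> l t / t" "l t / t \<le> exp c"
    using abs_ln_le_iff[of "l t / t" c] t0 l0 by auto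
  then have "t * exp (- c) \<le> l t" "l t \<le> t * exp c"
    using t0 by (auto simp: field_simps)
  then have "- (t * (1 - exp (- c))) \<le> l t - t" "l t - t \<le> t * (exp c - 1)"
    by (auto simp: algebra_simps)
  moreover have "t * (1 - exp (- c)) \<le> T * (exp c - 1)"
  proof (rule mult_mono)
    have "2 \<le> exp c + exp (- c)"
    proof -
      have "exp c + exp (- c) - 2 = (exp (c / 2) - exp (- c / 2))\<^sup>2"
        by (simp add: power2_diff exp_double[symmetric] mult_exp_exp flip: exp_add)
      then show ?thesis using zero_le_power2[of "exp (c / 2) - exp (- c / 2)"] by linarith
    qed
    then show "1 - exp (- c) \<le> exp c - 1" by simp
  qed (use t0 c in auto)
  moreover have "t * (exp c - 1) \<le> T * (exp c - 1)"
    using t0 c by (intro mult_right_mono) auto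
  ultimately show ?thesis by (simp add: abs_le_iff)
qed

text \<open>A slope of the composition is a product of two slopes, so the logarithms add.\<close>

lemma time_changes_compose:
  assumes l: "l \<in> time_changes T" and m: "m \<in> time_changes T"
    and c: "0 \<le> c" "time_change_size T l \<le> ennreal c" and d: "0 \<le> d" "time_change_size T m \<le> ennreal d"
  shows "(\<lambda>t. m (l t)) \<in> time_changes T" "time_change_size T (\<lambda>t. m (l t)) \<le> ennreal (c + d)"
proof -
  show size: "time_change_size T (\<lambda>t. m (l t)) \<le> ennreal (c + d)"
  proof (subst time_change_size_le_iff, use c d in simp, intro allI impI)
    fix s t assume st: "0 \<le> s" "s < t" "t \<le> T"
    then have "s \<in> {0..T}" "t \<in> {0..T}" by auto
    then have lm: "l s \<in> {0..T}" "l t \<in> {0..T}" and ll: "l s < l t" and mm: "m (l s) < m (l t)"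
      using time_change_mem[OF l] time_change_less_iff(1)[OF l] time_change_less_iff(1)[OF m] st(2) by auto
    have "(m (l t) - m (l s)) / (t - s)
        = ((m (l t) - m (l s)) / (l t - l s)) * ((l t - l s) / (t - s))"
      using ll by simp
    also have "ln \<dots> = ln ((m (l t) - m (l s)) / (l t - l s)) + ln ((l t - l s) / (t - s))"
      using ll mm st by (intro ln_mult_pos) auto
    finally have "ln ((m (l t) - m (l s)) / (t - s))
        = ln ((m (l t) - m (l s)) / (l t - l s)) + ln ((l t - l s) / (t - s))" .
    moreover have "\<bar>ln ((l t - l s) / (t - s))\<bar> \<le> c"
      using c st time_change_size_le_iff[OF c(1)] by blast
    moreover have "\<bar>ln ((m (l t) - m (l s)) / (l t - l s))\<bar> \<le> d"
      using d time_change_size_le_iff[OF d(1)] lm ll by auto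
    ultimately show "\<bar>ln ((m (l t) - m (l s)) / (t - s))\<bar> \<le> c + d" by linarith
  qed
  have "strict_mono_on {0..T} (\<lambda>t. m (l t))"
    using time_change_mem[OF l] time_change_less_iff(1)[OF l] time_change_less_iff(1)[OF m]
    by (auto simp: strict_mono_on_def)
  moreover have "continuous_on {0..T} (\<lambda>t. m (l t))"
    by (rule continuous_on_compose2[OF time_changesD(2)[OF m] time_changesD(2)[OF l]])
      (simp add: time_changesD(3)[OF l])
  moreover have "(\<lambda>t. m (l t)) ` {0..T} = {0..T}"
    using time_changesD(3)[OF l] time_changesD(3)[OF m] by (metis image_image)
  moreover have "time_change_size T (\<lambda>t. m (l t)) < \<infinity>"
    using size by (rule le_less_trans) simp
  ultimately show "(\<lambda>t. m (l t)) \<in> time_changes T"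
    unfolding time_changes_def by blast
qed

text \<open>Each slope of the inverse is the reciprocal of a slope of l, which leaves the absolute
  value of the logarithm unchanged.\<close>

lemma time_changes_inverse:
  assumes l: "l \<in> time_changes T" and c: "0 \<le> c" "time_change_size T l \<le> ennreal c"
  obtains k where "k \<in> time_changes T" "time_change_size T k \<le> ennreal c"
    "\<And>t. t \<in> {0..T} \<Longrightarrow> l (k t) = t" "\<And>t. t \<in> {0..T} \<Longrightarrow> k (l t) = t"
proof -
  define k where "k = inv_into {0..T} l"
  have inj: "inj_on l {0..T}"
    using time_changesD(1)[OF l] by (rule strict_mono_on_imp_inj_on)
  have kl: "k (l t) = t" if "t \<in> {0..T}" for t
    unfolding k_def using inj that by (rule inv_into_f_f)
  have lk: "l (k t) = t" and km: "k t \<in> {0..T}" if "t \<in> {0..T}" for t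
    using that f_inv_into_f[of t l "{0..T}"] inv_into_into[of t l "{0..T}"] time_changesD(3)[OF l]
    unfolding k_def by auto
  have less: "k s < k t" if "s < t" "s \<in> {0..T}" "t \<in> {0..T}" for s t
    using time_change_less_iff(1)[OF l km[OF that(2)] km[OF that(3)]] that lk by simp
  have size: "time_change_size T k \<le> ennreal c"
  proof (subst time_change_size_le_iff[OF c(1)], intro allI impI)
    fix s t assume st: "0 \<le> s" "s < t" "t \<le> T"
    then have m: "s \<in> {0..T}" "t \<in> {0..T}" by auto
    have kk: "k s < k t" using less st m by auto
    have "\<bar>ln ((l (k t) - l (k s)) / (k t - k s))\<bar> \<le> c"
      using c time_change_size_le_iff[OF c(1)] km[OF m(1)] km[OF m(2)] kk by auto
    then have "\<bar>ln ((t - s) / (k t - k s))\<bar> \<le> c" using lk m by simp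
    then show "\<bar>ln ((k t - k s) / (t - s))\<bar> \<le> c"
      using kk st by (simp add: ln_div)
  qed
  have "strict_mono_on {0..T} k" using less by (auto simp: strict_mono_on_def)
  moreover have "continuous_on {0..T} k"
    using continuous_on_inv[OF time_changesD(2)[OF l] compact_Icc, of k] kl time_changesD(3)[OF l] by simp
  moreover have "k ` {0..T} = {0..T}"
  proof
    show "k ` {0..T} \<subseteq> {0..T}" using km by blast
    show "{0..T} \<subseteq> k ` {0..T}"
    proof
      fix t assume t: "t \<in> {0..T}"
      show "t \<in> k ` {0..T}" using kl[OF t] time_change_mem[OF l t] by (metis imageI)
    qed
  qed
  moreover have "time_change_size T k < \<infinity>"
    using size by (rule le_less_trans) simp
  ultimately have "k \<in> time_changes T" unfolding time_changes_def by blast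
  then show ?thesis using that size lk kl by blast
qed

section \<open>Pseudometrics truncated at one\<close>

lemma skorokhod_dist_le:
  assumes "l \<in> time_changes T" "0 \<le> a" "0 \<le> c" "time_change_size T l \<le> ennreal c"
    "\<And>t \<phi>. t \<in> {0..T} \<Longrightarrow> \<phi> \<in> B \<Longrightarrow> \<bar>pairing (\<mu> t) \<phi> - pairing (\<nu> (l t)) \<phi>\<bar> \<le> a"
  shows "skorokhod_dist T B \<mu> \<nu> \<le> ennreal (a + c)"
proof -
  have "skorokhod_dist T B \<mu> \<nu> \<le> (SUP t\<in>{0..T}. dual_seminorm B (\<mu> t - \<nu> (l t))) + time_change_size T l"
    unfolding skorokhod_dist_def using assms(1) by (rule INF_lower)
  also have "(SUP t\<in>{0..T}. dual_seminorm B (\<mu> t - \<nu> (l t))) \<le> ennreal a"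
    using assms(2,5) by (intro SUP_least) (simp add: dual_seminorm_le_iff minus_tempered.rep_eq)
  then have "(SUP t\<in>{0..T}. dual_seminorm B (\<mu> t - \<nu> (l t))) + time_change_size T l \<le> ennreal a + ennreal c"
    using assms(4) by (intro add_mono)
  finally show ?thesis using assms(2,3) by (simp add: ennreal_plus)
qed

lemma skorokhod_dist_lessE:
  assumes "skorokhod_dist T B \<mu> \<nu> < ennreal e"
  obtains l a c where "l \<in> time_changes T" "0 \<le> a" "0 \<le> c" "a + c < e" "time_change_size T l \<le> ennreal c"
    "\<And>t \<phi>. t \<in> {0..T} \<Longrightarrow> \<phi> \<in> B \<Longrightarrow> \<bar>pairing (\<mu> t) \<phi> - pairing (\<nu> (l t)) \<phi>\<bar> \<le> a"
proof -
  from assms obtain l where l: "l \<in> time_changes T"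
    and less: "(SUP t\<in>{0..T}. dual_seminorm B (\<mu> t - \<nu> (l t))) + time_change_size T l < ennreal e"
    unfolding skorokhod_dist_def INF_less_iff by blast
  obtain c where c: "0 \<le> c" "time_change_size T l = ennreal c" using time_changesD(4)[OF l] by blast
  let ?S = "SUP t\<in>{0..T}. dual_seminorm B (\<mu> t - \<nu> (l t))"
  have "?S \<le> ?S + time_change_size T l" by simp
  then have "?S < ennreal e" using less by (rule le_less_trans)
  then have "?S \<noteq> \<infinity>" by (metis ennreal_less_top infinity_ennreal_def less_asym)
  then obtain a where a: "0 \<le> a" "?S = ennreal a" by (cases ?S) auto
  have "ennreal (a + c) < ennreal e" using less a c by (simp add: ennreal_plus)
  then have "a + c < e" using add_nonneg_nonneg[OF a(1) c(1)] by (metis ennreal_less_iff)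
  moreover have "\<bar>pairing (\<mu> t) \<phi> - pairing (\<nu> (l t)) \<phi>\<bar> \<le> a" if "t \<in> {0..T}" "\<phi> \<in> B" for t \<phi>
  proof -
    have "dual_seminorm B (\<mu> t - \<nu> (l t)) \<le> ennreal a"
      unfolding a(2)[symmetric] using that(1) by (rule SUP_upper)
    then show ?thesis using that(2) a(1) by (auto simp: dual_seminorm_le_iff minus_tempered.rep_eq)
  qed
  ultimately show ?thesis using that l a c by auto
qed

text \<open>Truncation at 1 gives a real number without a proof that the distance is finite, and
  leaves the balls of radius at most 1 unchanged.\<close>

definition skorokhod_gauge ::
    "real \<Rightarrow> schwartz set \<Rightarrow> (real \<Rightarrow> tempered) \<Rightarrow> (real \<Rightarrow> tempered) \<Rightarrow> real" where
  "skorokhod_gauge T B \<mu> \<nu> = enn2real (min 1 (skorokhod_dist T B \<mu> \<nu>))"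

lemma skorokhod_gauge_ennreal: "ennreal (skorokhod_gauge T B \<mu> \<nu>) = min 1 (skorokhod_dist T B \<mu> \<nu>)"
  unfolding skorokhod_gauge_def by (rule ennreal_enn2real) (simp add: min_less_iff_disj)

lemma skorokhod_gauge_nonneg: "0 \<le> skorokhod_gauge T B \<mu> \<nu>"
  unfolding skorokhod_gauge_def by simp

lemma skorokhod_gauge_le_1: "skorokhod_gauge T B \<mu> \<nu> \<le> 1"
proof -
  have "ennreal (skorokhod_gauge T B \<mu> \<nu>) \<le> ennreal 1" by (simp add: skorokhod_gauge_ennreal)
  then show ?thesis by (subst (asm) ennreal_le_iff) auto
qed

lemma skorokhod_gauge_less_iff:
  assumes "0 < e" "e \<le> 1"
  shows "skorokhod_gauge T B \<mu> \<nu> < e \<longleftrightarrow> skorokhod_dist T B \<mu> \<nu> < ennreal e"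
proof -
  have "skorokhod_gauge T B \<mu> \<nu> < e \<longleftrightarrow> ennreal (skorokhod_gauge T B \<mu> \<nu>) < ennreal e"
    by (simp add: ennreal_less_iff skorokhod_gauge_nonneg)
  also have "\<dots> \<longleftrightarrow> skorokhod_dist T B \<mu> \<nu> < ennreal e"
    unfolding skorokhod_gauge_ennreal min_less_iff_disj using assms(2)
    by (metis ennreal_1 ennreal_leI not_less)
  finally show ?thesis .
qed

lemma skorokhod_gauge_self: "skorokhod_gauge T B \<mu> \<mu> = 0"
  by (simp add: skorokhod_gauge_def skorokhod_dist_self)

lemma skorokhod_gauge_le:
  assumes "l \<in> time_changes T" "0 \<le> a" "0 \<le> c" "time_change_size T l \<le> ennreal c"
    "\<And>t \<phi>. t \<in> {0..T} \<Longrightarrow> \<phi> \<in> B \<Longrightarrow> \<bar>pairing (\<mu> t) \<phi> - pairing (\<nu> (l t)) \<phi>\<bar> \<le> a"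
  shows "skorokhod_gauge T B \<mu> \<nu> \<le> a + c"
proof -
  have "ennreal (skorokhod_gauge T B \<mu> \<nu>) \<le> ennreal (a + c)"
    unfolding skorokhod_gauge_ennreal
    by (rule min.coboundedI2, rule skorokhod_dist_le[OF assms(1-4)]) (rule assms(5))
  then show ?thesis using assms(2,3) by (subst (asm) ennreal_le_iff) auto
qed

lemma skorokhod_gauge_lessE:
  assumes "skorokhod_gauge T B \<mu> \<nu> < e" "e \<le> 1"
  obtains l a c where "l \<in> time_changes T" "0 \<le> a" "0 \<le> c" "a + c < e" "time_change_size T l \<le> ennreal c"
    "\<And>t \<phi>. t \<in> {0..T} \<Longrightarrow> \<phi> \<in> B \<Longrightarrow> \<bar>pairing (\<mu> t) \<phi> - pairing (\<nu> (l t)) \<phi>\<bar> \<le> a"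
proof -
  have "0 < e" using assms(1) skorokhod_gauge_nonneg[of T B \<mu> \<nu>] by linarith
  then have "skorokhod_dist T B \<mu> \<nu> < ennreal e"
    using skorokhod_gauge_less_iff assms by blast
  then show ?thesis using that by (rule skorokhod_dist_lessE)
qed

text \<open>The time changes of the two legs are composed. If one of the gauges is within e / 2 of 1
  there may be no such time change, but then the truncation makes the claim trivial.\<close>

lemma skorokhod_gauge_triangle:
  "skorokhod_gauge T B \<mu> \<rho> \<le> skorokhod_gauge T B \<mu> \<nu> + skorokhod_gauge T B \<nu> \<rho>"
proof (rule field_le_epsilon)
  fix e :: real assume e: "0 < e"
  let ?x = "skorokhod_gauge T B \<mu> \<nu> + e / 2" and ?y = "skorokhod_gauge T B \<nu> \<rho> + e / 2"
  show "skorokhod_gauge T B \<mu> \<rho> \<le> skorokhod_gauge T B \<mu> \<nu> + skorokhod_gauge T B \<nu> \<rho> + e"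
  proof (cases "?x \<le> 1 \<and> ?y \<le> 1")
    case True
    from True e obtain l a c where l: "l \<in> time_changes T" "0 \<le> a" "0 \<le> c" "a + c < ?x" "time_change_size T l \<le> ennreal c"
      "\<And>t \<phi>. t \<in> {0..T} \<Longrightarrow> \<phi> \<in> B \<Longrightarrow> \<bar>pairing (\<mu> t) \<phi> - pairing (\<nu> (l t)) \<phi>\<bar> \<le> a"
      using skorokhod_gauge_lessE[of T B \<mu> \<nu> ?x] by auto
    from True e obtain m b d where m: "m \<in> time_changes T" "0 \<le> b" "0 \<le> d" "b + d < ?y" "time_change_size T m \<le> ennreal d"
      "\<And>t \<phi>. t \<in> {0..T} \<Longrightarrow> \<phi> \<in> B \<Longrightarrow> \<bar>pairing (\<nu> t) \<phi> - pairing (\<rho> (m t)) \<phi>\<bar> \<le> b"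
      using skorokhod_gauge_lessE[of T B \<nu> \<rho> ?y] by auto
    have "skorokhod_gauge T B \<mu> \<rho> \<le> (a + b) + (c + d)"
    proof (rule skorokhod_gauge_le[OF time_changes_compose(1)[OF l(1) m(1) l(3,5) m(3,5)]])
      show "time_change_size T (\<lambda>t. m (l t)) \<le> ennreal (c + d)"
        by (rule time_changes_compose(2)[OF l(1) m(1) l(3,5) m(3,5)])
      fix t \<phi> assume t: "t \<in> {0..T}" and \<phi>: "\<phi> \<in> B"
      show "\<bar>pairing (\<mu> t) \<phi> - pairing (\<rho> (m (l t))) \<phi>\<bar> \<le> a + b"
        using l(6)[OF t \<phi>] m(6)[OF time_change_mem[OF l(1) t] \<phi>] by linarith
    qed (use l m in auto)
    then show ?thesis using l m by linarith
  next
    case False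
    then show ?thesis
      using e skorokhod_gauge_le_1[of T B \<mu> \<rho>] skorokhod_gauge_nonneg[of T B \<mu> \<nu>]
        skorokhod_gauge_nonneg[of T B \<nu> \<rho>] by linarith
  qed
qed

text \<open>A time change from one path to the other can be inverted at no cost in size.\<close>

lemma skorokhod_gauge_commute: "skorokhod_gauge T B \<mu> \<nu> = skorokhod_gauge T B \<nu> \<mu>"
proof -
  have "skorokhod_gauge T B \<mu> \<nu> \<le> skorokhod_gauge T B \<nu> \<mu>" for \<mu> \<nu>
  proof (rule field_le_epsilon)
    fix e :: real assume e: "0 < e"
    show "skorokhod_gauge T B \<mu> \<nu> \<le> skorokhod_gauge T B \<nu> \<mu> + e"
    proof (cases "skorokhod_gauge T B \<nu> \<mu> + e \<le> 1")
      case True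
      with e obtain l a c where l: "l \<in> time_changes T" "0 \<le> a" "0 \<le> c" "a + c < skorokhod_gauge T B \<nu> \<mu> + e"
        "time_change_size T l \<le> ennreal c"
        "\<And>t \<phi>. t \<in> {0..T} \<Longrightarrow> \<phi> \<in> B \<Longrightarrow> \<bar>pairing (\<nu> t) \<phi> - pairing (\<mu> (l t)) \<phi>\<bar> \<le> a"
        using skorokhod_gauge_lessE[of T B \<nu> \<mu> "skorokhod_gauge T B \<nu> \<mu> + e"] by auto
      obtain k where k: "k \<in> time_changes T" "time_change_size T k \<le> ennreal c"
        "\<And>t. t \<in> {0..T} \<Longrightarrow> l (k t) = t" "\<And>t. t \<in> {0..T} \<Longrightarrow> k (l t) = t"
        using time_changes_inverse[OF l(1,3,5)] by blast
      have "skorokhod_gauge T B \<mu> \<nu> \<le> a + c"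
      proof (rule skorokhod_gauge_le[OF k(1) l(2,3) k(2)])
        fix t \<phi> assume t: "t \<in> {0..T}" and \<phi>: "\<phi> \<in> B"
        show "\<bar>pairing (\<mu> t) \<phi> - pairing (\<nu> (k t)) \<phi>\<bar> \<le> a"
          using l(6)[OF time_change_mem[OF k(1) t] \<phi>] k(3)[OF t] by (simp add: abs_minus_commute)
      qed
      then show ?thesis using l by linarith
    next
      case False
      then show ?thesis using skorokhod_gauge_le_1[of T B \<mu> \<nu>] by linarith
    qed
  qed
  from this[of \<mu> \<nu>] this[of \<nu> \<mu>] show ?thesis by (rule antisym)
qed

lemma skorokhod_gauge_mono:
  assumes "A \<subseteq> B"
  shows "skorokhod_gauge T A \<mu> \<nu> \<le> skorokhod_gauge T B \<mu> \<nu>"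
proof -
  have "dual_seminorm A \<kappa> \<le> dual_seminorm B \<kappa>" for \<kappa>
    unfolding dual_seminorm_def using assms by (rule SUP_subset_mono) auto
  then have "skorokhod_dist T A \<mu> \<nu> \<le> skorokhod_dist T B \<mu> \<nu>"
    unfolding skorokhod_dist_def by (intro INF_mono' add_mono SUP_mono') auto
  then have "ennreal (skorokhod_gauge T A \<mu> \<nu>) \<le> ennreal (skorokhod_gauge T B \<mu> \<nu>)"
    unfolding skorokhod_gauge_ennreal by (intro min.mono) auto
  then show ?thesis by (simp add: skorokhod_gauge_nonneg)
qed

text \<open>The gauges form a directed family, as \<open>A \<union> B\<close> dominates both A and
  B, and a subbasic ball can be recentred at each of its points by composing time changes. Hence
  single gauge balls form a neighbourhood base.\<close>

lemma openin_skorokhod_iff: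
  "openin (skorokhod_topology T) U \<longleftrightarrow> U \<subseteq> skorokhod_paths T \<and>
    (\<forall>x\<in>U. \<exists>B e. schwartz_bounded B \<and> 0 < e \<and>
      (\<forall>y\<in>skorokhod_paths T. skorokhod_gauge T B x y < e \<longrightarrow> y \<in> U))"
  (is "_ \<longleftrightarrow> _ \<and> ?nhd U")
proof (intro iffI conjI)
  assume U: "openin (skorokhod_topology T) U"
  then show "U \<subseteq> skorokhod_paths T" using openin_subset by fastforce
  have "generate_topology_on {{\<nu> \<in> skorokhod_paths T. skorokhod_dist T B \<mu> \<nu> < ennreal e} |B \<mu> e.
        schwartz_bounded B \<and> \<mu> \<in> skorokhod_paths T \<and> 0 < e} U"
    using U unfolding skorokhod_topology_def openin_topology_generated_by_iff .
  then show "?nhd U"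
  proof (induction rule: generate_topology_on.induct)
    case (Int a b)
    show ?case
    proof
      fix x assume "x \<in> a \<inter> b"
      then have xa: "x \<in> a" and xb: "x \<in> b" by auto
      from bspec[OF Int.IH(1) xa] obtain A d where "schwartz_bounded A" "0 < d"
        "\<forall>y\<in>skorokhod_paths T. skorokhod_gauge T A x y < d \<longrightarrow> y \<in> a" by auto
      moreover from bspec[OF Int.IH(2) xb] obtain B e where "schwartz_bounded B" "0 < e"
        "\<forall>y\<in>skorokhod_paths T. skorokhod_gauge T B x y < e \<longrightarrow> y \<in> b" by auto
      ultimately show "\<exists>B e. schwartz_bounded B \<and> 0 < e \<and>
          (\<forall>y\<in>skorokhod_paths T. skorokhod_gauge T B x y < e \<longrightarrow> y \<in> a \<inter> b)"
        using skorokhod_gauge_mono[of A "A \<union> B" T x] skorokhod_gauge_mono[of B "A \<union> B" T x]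
        by (intro exI[of _ "A \<union> B"] exI[of _ "min d e"])
          (simp add: schwartz_bounded_Un, meson Un_upper1 Un_upper2 le_less_trans)
    qed
  next
    case (UN K)
    then show ?case by (meson UnionE UnionI)
  next
    case (Basis s)
    then obtain B \<mu> e where s: "s = {\<nu> \<in> skorokhod_paths T. skorokhod_dist T B \<mu> \<nu> < ennreal e}"
      "schwartz_bounded B" "\<mu> \<in> skorokhod_paths T" "0 < e" by blast
    show ?case
    proof
      fix x assume x: "x \<in> s"
      from x s obtain l a c where l: "l \<in> time_changes T" "0 \<le> a" "0 \<le> c" "a + c < e" "time_change_size T l \<le> ennreal c"
        "\<And>t \<phi>. t \<in> {0..T} \<Longrightarrow> \<phi> \<in> B \<Longrightarrow> \<bar>pairing (\<mu> t) \<phi> - pairing (x (l t)) \<phi>\<bar> \<le> a"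
        using skorokhod_dist_lessE[of T B \<mu> x e] by blast
      \<comment> \<open>The cap at 1 is there because the truncated gauge carries information only
        below 1.\<close>
      define d where "d = min 1 (e - (a + c))"
      have d: "0 < d" "d \<le> 1" using l by (auto simp: d_def)
      have "y \<in> s" if y: "y \<in> skorokhod_paths T" "skorokhod_gauge T B x y < d" for y
      proof -
        obtain m b f where m: "m \<in> time_changes T" "0 \<le> b" "0 \<le> f" "b + f < d" "time_change_size T m \<le> ennreal f"
          "\<And>t \<phi>. t \<in> {0..T} \<Longrightarrow> \<phi> \<in> B \<Longrightarrow> \<bar>pairing (x t) \<phi> - pairing (y (m t)) \<phi>\<bar> \<le> b"
          using skorokhod_gauge_lessE[OF y(2) d(2)] by blast
        have "skorokhod_dist T B \<mu> y \<le> ennreal ((a + b) + (c + f))"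
        proof (rule skorokhod_dist_le[OF time_changes_compose(1)[OF l(1) m(1) l(3,5) m(3,5)]])
          show "time_change_size T (\<lambda>t. m (l t)) \<le> ennreal (c + f)"
            by (rule time_changes_compose(2)[OF l(1) m(1) l(3,5) m(3,5)])
          fix t \<phi> assume t: "t \<in> {0..T}" and \<phi>: "\<phi> \<in> B"
          show "\<bar>pairing (\<mu> t) \<phi> - pairing (y (m (l t))) \<phi>\<bar> \<le> a + b"
            using l(6)[OF t \<phi>] m(6)[OF time_change_mem[OF l(1) t] \<phi>] by linarith
        qed (use l m in auto)
        also have "\<dots> < ennreal e"
          using m l by (intro ennreal_lessI) (auto simp: d_def)
        finally show ?thesis using y unfolding s by simp
      qed
      then show "\<exists>B e. schwartz_bounded B \<and> 0 < e \<and>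
          (\<forall>y\<in>skorokhod_paths T. skorokhod_gauge T B x y < e \<longrightarrow> y \<in> s)"
        using s d by blast
    qed
  qed simp
next
  assume U: "U \<subseteq> skorokhod_paths T \<and> ?nhd U"
  show "openin (skorokhod_topology T) U"
  proof (subst openin_subopen, intro ballI)
    fix x assume x: "x \<in> U"
    with U obtain B e where B: "schwartz_bounded B" "0 < e"
      "\<And>y. y \<in> skorokhod_paths T \<Longrightarrow> skorokhod_gauge T B x y < e \<Longrightarrow> y \<in> U" by meson
    define d where "d = min e 1"
    have d: "0 < d" "d \<le> 1" "d \<le> e" using B by (auto simp: d_def)
    let ?S = "{y \<in> skorokhod_paths T. skorokhod_dist T B x y < ennreal d}"
    have "openin (skorokhod_topology T) ?S"
      unfolding skorokhod_topology_def using B U x d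
      by (intro topology_generated_by_Basis) blast
    moreover have "x \<in> ?S" using x U d by (auto simp: skorokhod_dist_self)
    moreover have "?S \<subseteq> U"
      using B(3) d by (auto simp: skorokhod_gauge_less_iff[OF d(1,2), symmetric])
    ultimately show "\<exists>S. openin (skorokhod_topology T) S \<and> x \<in> S \<and> S \<subseteq> U" by blast
  qed
qed

section \<open>Continuity in terms of gauges\<close>

lemma continuous_map_skorokhod_realI:
  fixes g :: "(real \<Rightarrow> tempered) \<Rightarrow> real"
  assumes "\<And>x e. x \<in> skorokhod_paths T \<Longrightarrow> 0 < e \<Longrightarrow> \<exists>B d. schwartz_bounded B \<and> 0 < d \<and>
    (\<forall>y\<in>skorokhod_paths T. skorokhod_gauge T B x y < d \<longrightarrow> \<bar>g x - g y\<bar> < e)"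
  shows "continuous_map (skorokhod_topology T) euclideanreal g"
  unfolding continuous_map_def
proof (intro conjI allI impI)
  fix U :: "real set" assume "openin euclideanreal U"
  then have U: "open U" by simp
  show "openin (skorokhod_topology T) {x \<in> topspace (skorokhod_topology T). g x \<in> U}"
    unfolding openin_skorokhod_iff topspace_skorokhod_topology
  proof (intro conjI ballI)
    fix x assume "x \<in> {x \<in> skorokhod_paths T. g x \<in> U}"
    then have x: "x \<in> skorokhod_paths T" "g x \<in> U" by auto
    obtain e where e: "0 < e" "\<And>z. dist z (g x) < e \<Longrightarrow> z \<in> U"
      using U x(2) unfolding open_dist by blast
    show "\<exists>B d. schwartz_bounded B \<and> 0 < d \<and>
        (\<forall>y\<in>skorokhod_paths T. skorokhod_gauge T B x y < d \<longrightarrow> y \<in> {x \<in> skorokhod_paths T. g x \<in> U})"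
      using assms[OF x(1) e(1)] e(2) by (fastforce simp: dist_real_def abs_minus_commute)
  qed auto
qed auto

lemma continuous_map_skorokhod_realD:
  fixes g :: "(real \<Rightarrow> tempered) \<Rightarrow> real"
  assumes g: "continuous_map (skorokhod_topology T) euclideanreal g"
    and x: "x \<in> skorokhod_paths T" and e: "0 < e"
  shows "\<exists>B d. schwartz_bounded B \<and> 0 < d \<and>
    (\<forall>y\<in>skorokhod_paths T. skorokhod_gauge T B x y < d \<longrightarrow> \<bar>g x - g y\<bar> < e)"
proof -
  have "openin (skorokhod_topology T) {y \<in> topspace (skorokhod_topology T). g y \<in> ball (g x) e}"
    by (rule openin_continuous_map_preimage[OF g]) simp
  moreover have "x \<in> {y \<in> topspace (skorokhod_topology T). g y \<in> ball (g x) e}" using x e by simp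
  ultimately show ?thesis
    unfolding openin_skorokhod_iff by (fastforce simp: dist_real_def)
qed

lemma continuous_map_skorokhodI:
  assumes "\<And>x. x \<in> skorokhod_paths T \<Longrightarrow> \<Psi> x \<in> skorokhod_paths T"
    and "\<And>x B e. x \<in> skorokhod_paths T \<Longrightarrow> schwartz_bounded B \<Longrightarrow> 0 < e \<Longrightarrow> \<exists>A d. schwartz_bounded A \<and> 0 < d \<and>
    (\<forall>y\<in>skorokhod_paths T. skorokhod_gauge T A x y < d \<longrightarrow> skorokhod_gauge T B (\<Psi> x) (\<Psi> y) < e)"
  shows "continuous_map (skorokhod_topology T) (skorokhod_topology T) \<Psi>"
  unfolding continuous_map_def
proof (intro conjI allI impI)
  show "\<Psi> \<in> topspace (skorokhod_topology T) \<rightarrow> topspace (skorokhod_topology T)"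
    using assms(1) by auto
  fix U assume U: "openin (skorokhod_topology T) U"
  show "openin (skorokhod_topology T) {x \<in> topspace (skorokhod_topology T). \<Psi> x \<in> U}"
    unfolding openin_skorokhod_iff topspace_skorokhod_topology
  proof (intro conjI ballI)
    fix x assume "x \<in> {x \<in> skorokhod_paths T. \<Psi> x \<in> U}"
    then have x: "x \<in> skorokhod_paths T" "\<Psi> x \<in> U" by auto
    obtain B e where B: "schwartz_bounded B" "0 < e"
      "\<And>y. y \<in> skorokhod_paths T \<Longrightarrow> skorokhod_gauge T B (\<Psi> x) y < e \<Longrightarrow> y \<in> U"
      using U x(2) unfolding openin_skorokhod_iff by meson
    show "\<exists>A d. schwartz_bounded A \<and> 0 < d \<and>
        (\<forall>y\<in>skorokhod_paths T. skorokhod_gauge T A x y < d \<longrightarrow> y \<in> {x \<in> skorokhod_paths T. \<Psi> x \<in> U})"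
      using assms(2)[OF x(1) B(1,2)] B(3) assms(1) by blast
  qed auto
qed

text \<open>Displacing finitely many \<open>g\<close>-separated points by a superposition of tents of radius \<open>g\<close>.\<close>

lemma time_change_through_points:
  assumes fin: "finite A" and A: "0 \<in> A" "T \<in> A" and T: "0 \<le> T"
    and g: "0 < g" "\<And>a a'. a \<in> A \<Longrightarrow> a' \<in> A \<Longrightarrow> a \<noteq> a' \<Longrightarrow> g \<le> \<bar>a - a'\<bar>"
    and b: "b 0 = 0" "b T = T" and \<rho>: "\<rho> \<le> 1 / 2" "(\<Sum>a\<in>A. \<bar>b a - a\<bar>) \<le> \<rho> * g"
  obtains l where "l \<in> time_changes T" "\<And>a. a \<in> A \<Longrightarrow> l a = b a" "time_change_size T l \<le> ennreal (2 * \<rho>)"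
proof -
  define h where "h a t = max 0 (1 - \<bar>t - a\<bar> / g)" for a t
  define l where "l t = t + (\<Sum>a\<in>A. (b a - a) * h a t)" for t
  have \<rho>0: "0 \<le> \<rho>"
  proof -
    have "0 \<le> \<rho> * g" using \<rho>(2) by (rule order_trans[rotated]) (simp add: sum_nonneg)
    then show ?thesis using g(1) by (simp add: zero_le_mult_iff)
  qed
  have h: "\<bar>h a t - h a s\<bar> \<le> \<bar>t - s\<bar> / g" for a t s
  proof -
    have "\<bar>h a t - h a s\<bar> \<le> \<bar>\<bar>t - a\<bar> / g - \<bar>s - a\<bar> / g\<bar>" unfolding h_def by linarith
    also have "\<dots> = \<bar>\<bar>t - a\<bar> - \<bar>s - a\<bar>\<bar> / g"
      using g(1) by (simp add: diff_divide_distrib[symmetric])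
    also have "\<dots> \<le> \<bar>t - s\<bar> / g" using g(1) by (intro divide_right_mono) auto
    finally show ?thesis .
  qed
  \<comment> \<open>Each tent is Lipschitz with constant 1 / g, so displacements of total size at
    most \<open>\<rho> * g\<close> perturb the identity by a map with Lipschitz constant \<rho>. The
    slopes of l then lie between 1 - \<rho> and 1 + \<rho>.\<close>
  have lip: "\<bar>l t - l s - (t - s)\<bar> \<le> \<rho> * \<bar>t - s\<bar>" for s t
  proof -
    have "l t - l s - (t - s) = (\<Sum>a\<in>A. (b a - a) * (h a t - h a s))"
      unfolding l_def by (simp add: right_diff_distrib sum_subtractf)
    also have "\<bar>\<dots>\<bar> \<le> (\<Sum>a\<in>A. \<bar>b a - a\<bar> * (\<bar>t - s\<bar> / g))"
      by (rule order_trans[OF sum_abs], rule sum_mono) (simp only: abs_mult mult_left_mono h abs_ge_zero)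
    also have "\<dots> = (\<Sum>a\<in>A. \<bar>b a - a\<bar>) * (\<bar>t - s\<bar> / g)" by (rule sum_distrib_right[symmetric])
    also have "\<dots> \<le> (\<rho> * g) * (\<bar>t - s\<bar> / g)" using \<rho>(2) g(1) by (intro mult_right_mono) auto
    finally show ?thesis using g(1) by simp
  qed
  \<comment> \<open>Distinct points are at least g apart, so at a only the tent centred at a is
    nonzero.\<close>
  have la: "l a = b a" if a: "a \<in> A" for a
  proof -
    have "(\<Sum>a'\<in>A. (b a' - a') * h a' a) = (\<Sum>a'\<in>A. if a' = a then b a - a else 0)"
    proof (rule sum.cong[OF refl])
      fix a' assume a': "a' \<in> A"
      show "(b a' - a') * h a' a = (if a' = a then b a - a else 0)"
      proof (cases "a' = a")
        case False
        then have "g \<le> \<bar>a - a'\<bar>" using g(2)[OF a a'] by simp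
        then have "h a' a = 0" unfolding h_def using g(1) by (simp add: max_def field_simps)
        then show ?thesis using False by simp
      qed (simp add: h_def)
    qed
    also have "\<dots> = b a - a" using fin a by simp
    finally show ?thesis unfolding l_def by simp
  qed
  have mono: "(1 - \<rho>) * (t - s) \<le> l t - l s" "l t - l s \<le> (1 + \<rho>) * (t - s)" if "s \<le> t" for s t
    using lip[of t s] that unfolding abs_le_iff by (auto simp: algebra_simps)
  have strict: "l s < l t" if "s < t" for s t
  proof -
    have "0 < (1 - \<rho>) * (t - s)" using that \<rho>(1) by simp
    then show ?thesis using mono(1)[of s t] that by linarith
  qed
  have cont: "continuous_on {0..T} l"
    unfolding l_def h_def by (intro continuous_intros) (use g in auto)
  have img: "l ` {0..T} = {0..T}"
  proof
    show "l ` {0..T} \<subseteq> {0..T}"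
    proof
      fix y assume "y \<in> l ` {0..T}"
      then obtain t where "0 \<le> t" "t \<le> T" "y = l t" by auto
      then have "l 0 \<le> y" "y \<le> l T" using strict[of 0 t] strict[of t T] by (auto simp: le_less)
      then show "y \<in> {0..T}" using la[OF A(1)] la[OF A(2)] b by simp
    qed
    show "{0..T} \<subseteq> l ` {0..T}"
    proof
      fix y assume "y \<in> {0..T}"
      then have "l 0 \<le> y" "y \<le> l T" using la[OF A(1)] la[OF A(2)] b by auto
      then obtain t where "0 \<le> t" "t \<le> T" "l t = y" using IVT'[of l 0 y T] T cont by auto
      then show "y \<in> l ` {0..T}" by auto
    qed
  qed
  have size: "time_change_size T l \<le> ennreal (2 * \<rho>)"
  proof (subst time_change_size_le_iff, use \<rho>0 in simp, intro allI impI)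
    fix s t assume st: "0 \<le> s" "s < t" "t \<le> T"
    let ?q = "(l t - l s) / (t - s)"
    have q: "1 - \<rho> \<le> ?q" "?q \<le> 1 + \<rho>" using mono[of s t] st by (auto simp: field_simps)
    then have q0: "0 < ?q" using \<rho>(1) by linarith
    have "ln ?q \<le> ?q - 1" by (rule ln_le_minus_one[OF q0])
    \<comment> \<open>The bound 1 / (1 - \<rho>) - 1 <= 2 \<rho> uses \<rho> <= 1 / 2; it is the
      origin of the factor 2 in the size of l.\<close>
    moreover have "- ln ?q \<le> 2 * \<rho>"
    proof -
      have "- ln ?q = ln (inverse ?q)" using ln_inverse[of ?q] q0 by (simp only:)
      also have "\<dots> \<le> inverse ?q - 1" using q0 by (intro ln_le_minus_one positive_imp_inverse_positive)
      also have "\<dots> \<le> inverse (1 - \<rho>) - 1" using \<rho>(1) by (intro diff_right_mono le_imp_inverse_le q(1)) simp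
      also have "\<dots> \<le> 2 * \<rho>"
      proof -
        have "1 \<le> (1 + 2 * \<rho>) * (1 - \<rho>)"
          using \<rho>0 \<rho>(1) mult_left_mono[of "2 * \<rho>" 1 \<rho>] by (simp add: algebra_simps)
        then show ?thesis using \<rho>(1) by (simp add: field_simps)
      qed
      finally show ?thesis .
    qed
    ultimately show "\<bar>ln ?q\<bar> \<le> 2 * \<rho>" using q \<rho>0 by (simp add: abs_le_iff)
  qed
  have "l \<in> time_changes T"
    unfolding time_changes_def using strict cont img le_less_trans[OF size ennreal_less_top]
    by (auto simp: strict_mono_on_def)
  then show ?thesis using that la size by blast
qed

section \<open>Real cadlag functions\<close>

lemma cadlag_onD_right:
  assumes "cadlag_on T (x :: real \<Rightarrow> real)" "0 \<le> t" "t < T" "0 < e"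
  obtains d where "t < d" "d \<le> T" "\<And>s. s \<in> {t..<d} \<Longrightarrow> \<bar>x s - x t\<bar> < e"
proof -
  have "(x \<longlongrightarrow> x t) (at_right t)" using assms unfolding cadlag_on_def by auto
  then have "\<forall>\<^sub>F s in at_right t. dist (x s) (x t) < e" using assms(4) by (rule tendstoD)
  then obtain b where b: "b > t" "\<And>s. t < s \<Longrightarrow> s < b \<Longrightarrow> dist (x s) (x t) < e"
    unfolding eventually_at_right_field by blast
  show ?thesis
  proof (rule that[of "min b T"])
    fix s assume "s \<in> {t..<min b T}"
    then show "\<bar>x s - x t\<bar> < e"
      using b(2)[of s] assms(4) by (cases "s = t") (auto simp: dist_real_def)
  qed (use b assms in auto)
qed

lemma cadlag_onD_left:
  assumes "cadlag_on T (x :: real \<Rightarrow> real)" "0 < t" "t \<le> T" "0 < e"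
  obtains d l where "0 \<le> d" "d < t" "\<And>s. s \<in> {d<..<t} \<Longrightarrow> \<bar>x s - l\<bar> < e"
proof -
  have "\<exists>l. (x \<longlongrightarrow> l) (at_left t)" using assms unfolding cadlag_on_def by simp
  then obtain l where "(x \<longlongrightarrow> l) (at_left t)" by blast
  then have "\<forall>\<^sub>F s in at_left t. dist (x s) l < e" using assms(4) by (rule tendstoD)
  then obtain b where b: "b < t" "\<And>s. b < s \<Longrightarrow> s < t \<Longrightarrow> dist (x s) l < e"
    unfolding eventually_at_left_field by blast
  show ?thesis
    by (rule that[of "max b 0" l]) (use b assms in \<open>auto simp: dist_real_def\<close>)
qed

text \<open>The pieces are half open, so a jump may sit at any partition point, and the value at T
  is left free.\<close>

definition osc_partition :: "(real \<Rightarrow> real) \<Rightarrow> real \<Rightarrow> real \<Rightarrow> nat \<Rightarrow> (nat \<Rightarrow> real) \<Rightarrow> bool" where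
  "osc_partition x e T k t \<longleftrightarrow> t 0 = 0 \<and> t k = T \<and> (\<forall>i<k. t i < t (Suc i)) \<and>
    (\<forall>i<k. \<forall>s\<in>{t i..<t (Suc i)}. \<forall>u\<in>{t i..<t (Suc i)}. \<bar>x s - x u\<bar> < e)"

lemma osc_partition_extend:
  assumes "osc_partition x e c k t" "c < d" "\<And>s u. s \<in> {c..<d} \<Longrightarrow> u \<in> {c..<d} \<Longrightarrow> \<bar>x s - x u\<bar> < e"
  shows "osc_partition x e d (Suc k) (t(Suc k := d))"
  using assms unfolding osc_partition_def by (auto simp: less_Suc_eq)

text \<open>Supremum argument over the right ends of initial intervals that admit a partition: the
  left limit shows that the supremum is attained, and right continuity that it cannot lie below
  T.\<close>

lemma cadlag_osc_partition:
  assumes x: "cadlag_on T x" and T: "0 \<le> T" and e: "0 < e"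
  shows "\<exists>k t. osc_partition x e T k t"
proof -
  define G where "G = {c \<in> {0..T}. \<exists>k t. osc_partition x e c k t}"
  have "osc_partition x e 0 0 (\<lambda>_. 0)" by (simp add: osc_partition_def)
  then have G0: "0 \<in> G" using T unfolding G_def by auto
  have bdd: "bdd_above G" unfolding G_def by (rule bdd_aboveI[of _ T]) auto
  define c where "c = Sup G"
  have c: "0 \<le> c" "c \<le> T"
    unfolding c_def using cSup_upper[OF G0 bdd] G0 by (auto intro!: cSup_least simp: G_def)
  have cG: "c \<in> G"
  proof (cases "c = 0")
    case False
    with c have "0 < c" by simp
    then obtain d l where d: "0 \<le> d" "d < c" "\<And>s. s \<in> {d<..<c} \<Longrightarrow> \<bar>x s - l\<bar> < e / 2"
      using cadlag_onD_left[OF x _ c(2), of "e / 2"] e by auto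
    obtain b where b: "b \<in> G" "d < b"
      using less_cSup_iff[of G d] G0 bdd d(2) unfolding c_def by blast
    have "b \<le> c" unfolding c_def using b bdd by (intro cSup_upper)
    show ?thesis
    proof (cases "b = c")
      case False
      with \<open>b \<le> c\<close> have "b < c" by simp
      obtain k t where kt: "osc_partition x e b k t" using b unfolding G_def by blast
      have "\<bar>x s - x u\<bar> < e" if "s \<in> {b..<c}" "u \<in> {b..<c}" for s u
      proof -
        have "\<bar>x s - l\<bar> < e / 2" "\<bar>x u - l\<bar> < e / 2" using d(3)[of s] d(3)[of u] that b by auto
        then show ?thesis by linarith
      qed
      then have "osc_partition x e c (Suc k) (t(Suc k := c))"
        using osc_partition_extend[OF kt \<open>b < c\<close>] by blast
      then show ?thesis using c unfolding G_def by auto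
    qed (use b in simp)
  qed (use G0 in simp)
  have "c = T"
  proof (rule ccontr)
    assume "c \<noteq> T"
    with c have "c < T" by simp
    then obtain d where d: "c < d" "d \<le> T" "\<And>s. s \<in> {c..<d} \<Longrightarrow> \<bar>x s - x c\<bar> < e / 2"
      using cadlag_onD_right[OF x c(1), of "e / 2"] e by auto
    obtain k t where kt: "osc_partition x e c k t" using cG unfolding G_def by blast
    have "\<bar>x s - x u\<bar> < e" if "s \<in> {c..<d}" "u \<in> {c..<d}" for s u
      using d(3)[OF that(1)] d(3)[OF that(2)] by linarith
    then have "osc_partition x e d (Suc k) (t(Suc k := d))"
      using osc_partition_extend[OF kt d(1)] by blast
    then have "d \<in> G" using c d unfolding G_def by auto
    then have "d \<le> c" unfolding c_def using bdd by (intro cSup_upper)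
    then show False using d by simp
  qed
  then show ?thesis using cG unfolding G_def by blast
qed

lemma osc_partition_mono:
  assumes "osc_partition x e T k t" "i \<le> j" "j \<le> k"
  shows "t i \<le> t j" "i < j \<Longrightarrow> t i < t j"
proof -
  have *: "t i \<le> t j" if "i \<le> j" "j \<le> k" for i j
    using that
  proof (induction rule: dec_induct)
    case (step n)
    then have "t n < t (Suc n)" using assms(1) unfolding osc_partition_def by auto
    then show ?case using step by simp
  qed simp
  show "t i \<le> t j" using * assms(2,3) by blast
  assume "i < j"
  then have "t i < t (Suc i)" using assms unfolding osc_partition_def by auto
  also have "t (Suc i) \<le> t j" using * \<open>i < j\<close> assms(3) by simp
  finally show "t i < t j" .
qed

lemma osc_partition_mem:
  assumes p: "osc_partition x e T k t" and s: "0 \<le> s" "s < T"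
  obtains i where "i < k" "s \<in> {t i..<t (Suc i)}"
proof -
  have "t 0 \<le> s" "s < t k" using assms unfolding osc_partition_def by auto
  define j where "j = (LEAST j. s < t j)"
  have j: "s < t j" unfolding j_def using \<open>s < t k\<close> by (rule LeastI)
  then have "j \<noteq> 0" using \<open>t 0 \<le> s\<close> by (metis leD)
  then obtain i where i: "j = Suc i" by (cases j) auto
  have "\<not> s < t i" using not_less_Least[of i "\<lambda>j. s < t j"] i unfolding j_def by simp
  moreover have "j \<le> k" unfolding j_def using \<open>s < t k\<close> by (rule Least_le)
  ultimately show ?thesis using that[of i] i j by auto
qed

section \<open>Uniform approximation by right-continuous steps\<close>

abbreviation heaviside :: "real \<Rightarrow> real \<Rightarrow> real" where
  "heaviside a s \<equiv> (if a \<le> s then 1 else 0)"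

definition step_fun :: "nat \<Rightarrow> (nat \<Rightarrow> real) \<Rightarrow> (nat \<Rightarrow> real) \<Rightarrow> real \<Rightarrow> real" where
  "step_fun k a c s = (\<Sum>i<k. c i * heaviside (a i) s)"

text \<open>This regularity is enough for integration against continuous kernels, and it reduces
  computations with such integrals to single jumps.\<close>

definition step_approximable :: "real \<Rightarrow> (real \<Rightarrow> real) \<Rightarrow> bool" where
  "step_approximable T x \<longleftrightarrow> (\<forall>e>0. \<exists>(k::nat) a c. (\<forall>i<k. 0 \<le> a i) \<and>
     (\<forall>s\<in>{0..T}. \<bar>x s - step_fun k a c s\<bar> \<le> e))"

lemma step_approximableD:
  assumes "step_approximable T x" "0 < e"
  shows "\<exists>(k::nat) a c. (\<forall>i<k. 0 \<le> a i) \<and>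
    (\<forall>s\<in>{0..T}. \<bar>x s - step_fun k a c s\<bar> \<le> e)"
  using assms(1)[unfolded step_approximable_def] assms(2) by (elim allE impE)

lemma cadlag_step_approximable:
  assumes "cadlag_on T x"
  shows "step_approximable T x"
proof (cases "0 \<le> T")
  case True
  show ?thesis
    unfolding step_approximable_def
  proof (intro allI impI)
    fix e :: real assume e: "0 < e"
    obtain k t where p: "osc_partition x e T k t" using cadlag_osc_partition[OF assms True e] by blast
    \<comment> \<open>The increments telescope to x (t j). There are \<open>Suc k\<close> terms
      because the last piece stops short of T and the value at T needs a jump of its own.\<close>
    define a c where "a i = t i" and "c i = (if i = 0 then x (t 0) else x (t i) - x (t (i - 1)))" for i
    have step: "step_fun (Suc k) a c s = x (t j)"
      if "j \<le> k" "t j \<le> s" "\<And>i. j < i \<Longrightarrow> i \<le> k \<Longrightarrow> s < t i" for s j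
    proof -
      have "step_fun (Suc k) a c s = (\<Sum>i<Suc k. if i \<in> {..j} then c i else 0)"
        unfolding step_fun_def
      proof (rule sum.cong[OF refl])
        fix i assume "i \<in> {..<Suc k}"
        then show "c i * heaviside (a i) s = (if i \<in> {..j} then c i else 0)"
          using that(1,2) that(3)[of i] osc_partition_mono(1)[OF p, of i j]
          by (cases "i \<le> j") (auto simp: a_def not_le)
      qed
      also have "\<dots> = (\<Sum>i\<in>{..j}. c i)"
        using that(1) by (subst sum.inter_restrict[symmetric]) (auto intro!: sum.cong)
      also have "\<dots> = x (t j)"
        by (induction j) (auto simp: c_def)
      finally show ?thesis .
    qed
    have "\<bar>x s - step_fun (Suc k) a c s\<bar> \<le> e" if "s \<in> {0..T}" for s
    proof (cases "s = T")
      case True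
      then have "step_fun (Suc k) a c s = x s"
        using p step[of k s] unfolding osc_partition_def by auto
      then show ?thesis using e by simp
    next
      case False
      with that have "0 \<le> s" "s < T" by auto
      then obtain i where i: "i < k" "s \<in> {t i..<t (Suc i)}" using osc_partition_mem[OF p] by blast
      have "step_fun (Suc k) a c s = x (t i)"
      proof (rule step)
        fix j assume "i < j" "j \<le> k"
        then show "s < t j" using i osc_partition_mono(1)[OF p, of "Suc i" j] by auto
      qed (use i in auto)
      moreover have "\<bar>x s - x (t i)\<bar> < e" using i p unfolding osc_partition_def by auto
      ultimately show ?thesis by simp
    qed
    moreover have "0 \<le> a i" if "i < Suc k" for i
      using osc_partition_mono(1)[OF p, of 0 i] that p unfolding a_def osc_partition_def by simp
    ultimately show "\<exists>(k::nat) a c. (\<forall>i<k. 0 \<le> a i) \<and>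
        (\<forall>s\<in>{0..T}. \<bar>x s - step_fun k a c s\<bar> \<le> e)" by blast
  qed
next
  case False
  then show ?thesis unfolding step_approximable_def
    by (auto intro!: exI[of _ 0])
qed

lemma step_approximable_step:
  "(\<And>i. i < k \<Longrightarrow> 0 \<le> a i) \<Longrightarrow> step_approximable T (step_fun k a c)"
  unfolding step_approximable_def
  by (intro allI impI, rule exI[of _ k], rule exI[of _ a], rule exI[of _ c]) auto

lemma step_approximable_bounded:
  assumes "step_approximable T x"
  obtains K where "0 \<le> K" "\<And>s. s \<in> {0..T} \<Longrightarrow> \<bar>x s\<bar> \<le> K"
proof -
  obtain k :: nat and a c where "\<forall>i<k. 0 \<le> a i"
    and *: "\<forall>s\<in>{0..T}. \<bar>x s - step_fun k a c s\<bar> \<le> 1"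
    using step_approximableD[OF assms zero_less_one] by blast
  have step: "\<bar>step_fun k a c s\<bar> \<le> (\<Sum>i<k. \<bar>c i\<bar>)" for s
    unfolding step_fun_def by (rule order_trans[OF sum_abs]) (auto intro!: sum_mono)
  have "\<bar>x s\<bar> \<le> (\<Sum>i<k. \<bar>c i\<bar>) + 1" if "s \<in> {0..T}" for s
    using bspec[OF * that] step[of s] by linarith
  then show ?thesis
    using that[of "(\<Sum>i<k. \<bar>c i\<bar>) + 1"] by (auto simp: sum_nonneg add_nonneg_nonneg)
qed

lemma integrable_heaviside:
  fixes g :: "real \<Rightarrow> real"
  assumes "continuous_on {u..v} g"
  shows "(\<lambda>s. heaviside a s * g s) integrable_on {u..v}"
proof -
  have "{a..} \<inter> {u..v} = {max a u..v}" by auto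
  moreover have "g integrable_on {max a u..v}"
    by (intro integrable_continuous_interval continuous_on_subset[OF assms]) auto
  ultimately have "g integrable_on ({a..} \<inter> {u..v})" by simp
  then have "(\<lambda>s. if s \<in> {a..} then g s else 0) integrable_on {u..v}"
    by (subst integrable_restrict_Int)
  then show ?thesis
    by (rule integrable_eq) auto
qed

text \<open>A single step times g is integrable, and the bound on g makes the approximation of the
  product uniform.\<close>

lemma step_approximable_integrable:
  fixes g :: "real \<Rightarrow> real"
  assumes x: "step_approximable T x" and g: "continuous_on {u..v} g" and uv: "0 \<le> u" "v \<le> T"
  shows "(\<lambda>s. x s * g s) integrable_on {u..v}"
proof -
  have "bounded (g ` {u..v})" by (rule compact_imp_bounded[OF compact_continuous_image[OF g compact_Icc]])
  then obtain G where G: "0 < G" "\<And>s. s \<in> {u..v} \<Longrightarrow> \<bar>g s\<bar> \<le> G"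
    unfolding bounded_pos by auto
  show ?thesis
    unfolding cbox_interval[symmetric]
  proof (rule integrable_uniform_limit)
    fix e :: real assume e: "0 < e"
    have "0 < e / G" using e G by simp
    obtain k :: nat and a c where "\<forall>i<k. 0 \<le> a i"
      and *: "\<forall>s\<in>{0..T}. \<bar>x s - step_fun k a c s\<bar> \<le> e / G"
      using step_approximableD[OF x \<open>0 < e / G\<close>] by blast
    have close: "norm (x s * g s - (\<Sum>i<k. c i * (heaviside (a i) s * g s))) \<le> e" if "s \<in> {u..v}" for s
    proof -
      have "x s * g s - (\<Sum>i<k. c i * (heaviside (a i) s * g s)) = (x s - step_fun k a c s) * g s"
        unfolding left_diff_distrib step_fun_def sum_distrib_right by (simp only: mult.assoc)
      also have "\<bar>\<dots>\<bar> \<le> e / G * G"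
        unfolding abs_mult using that uv e G by (intro mult_mono *[rule_format] G) auto
      finally show ?thesis using G by simp
    qed
    have "(\<lambda>s. \<Sum>i<k. c i * (heaviside (a i) s * g s)) integrable_on cbox u v"
      unfolding cbox_interval
      by (intro integrable_sum integrable_on_mult_right integrable_heaviside g) auto
    then show "\<exists>h. (\<forall>s\<in>cbox u v. norm (x s * g s - h s) \<le> e) \<and> h integrable_on cbox u v"
      by (intro exI[of _ "\<lambda>s. \<Sum>i<k. c i * (heaviside (a i) s * g s)"] conjI ballI close)
        (simp_all only: cbox_interval)
  qed
qed

lemma step_approximable_integrable':
  "step_approximable T x \<Longrightarrow> 0 \<le> u \<Longrightarrow> v \<le> T \<Longrightarrow> x integrable_on {u..v}"
  using step_approximable_integrable[of T x u v "\<lambda>_. 1"] by simp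

lemma integral_abs_le_const:
  fixes f :: "real \<Rightarrow> real"
  assumes "f integrable_on {u..v}" "u \<le> v" "\<And>s. s \<in> {u..v} \<Longrightarrow> \<bar>f s\<bar> \<le> B"
  shows "\<bar>integral {u..v} f\<bar> \<le> B * (v - u)"
  using integral_norm_bound_integral[OF assms(1) integrable_const_ivl[of B u v]] assms(2,3)
  by (simp add: mult.commute)

section \<open>The solution map of the fluid equation\<close>

text \<open>Variation of constants after an integration by parts: the transported r plus the
  Stieltjes integral of <m, S_(t-s) \<phi>> against de(s), with the mass of e at 0 included. The
  derivative is put on the test function because e has jumps.\<close>

definition fluid_path :: "tempered \<Rightarrow> tempered \<Rightarrow> (real \<Rightarrow> real) \<Rightarrow> real \<Rightarrow> tempered" where
  "fluid_path m r e t = Abs_tempered (\<lambda>\<phi>. pairing r (schwartz_shift t \<phi>) + e t * pairing m \<phi>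
     - integral {0..t} (\<lambda>s. e s * pairing m (schwartz_shift (t - s) (schwartz_deriv \<phi>))))"

lemma continuous_on_pairing_shift_diff:
  "continuous_on S (\<lambda>s. pairing m (schwartz_shift (t - s) \<phi>))"
  by (rule continuous_on_compose2[OF continuous_on_pairing_shift[of UNIV]]) (auto intro!: continuous_intros)

lemma fluid_integrable:
  assumes "step_approximable T e" "0 \<le> u" "v \<le> T"
  shows "(\<lambda>s. e s * pairing m (schwartz_shift (t - s) \<phi>)) integrable_on {u..v}"
  using assms by (intro step_approximable_integrable continuous_on_pairing_shift_diff)

text \<open>Linearity and an explicit bound justify the use of \<open>Abs_tempered\<close>. The
  order is the larger of that of r and one more than that of m, since the integrand contains
  \<phi>'.\<close>

lemma pairing_fluid_path:
  assumes e: "step_approximable T e" and t: "t \<in> {0..T}"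
  shows "pairing (fluid_path m r e t) \<phi> = pairing r (schwartz_shift t \<phi>) + e t * pairing m \<phi>
     - integral {0..t} (\<lambda>s. e s * pairing m (schwartz_shift (t - s) (schwartz_deriv \<phi>)))"
proof -
  let ?f = "\<lambda>\<phi>. pairing r (schwartz_shift t \<phi>) + e t * pairing m \<phi>
     - integral {0..t} (\<lambda>s. e s * pairing m (schwartz_shift (t - s) (schwartz_deriv \<phi>)))"
  have int: "(\<lambda>s. e s * pairing m (schwartz_shift (t - s) \<phi>)) integrable_on {0..t}" for \<phi>
    using t by (intro fluid_integrable[OF e]) auto
  have lin: "linear ?f"
  proof (rule linearI)
    fix \<phi> \<psi>
    have "integral {0..t} (\<lambda>s. e s * pairing m (schwartz_shift (t - s) (schwartz_deriv (\<phi> + \<psi>))))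
        = integral {0..t} (\<lambda>s. e s * pairing m (schwartz_shift (t - s) (schwartz_deriv \<phi>))
          + e s * pairing m (schwartz_shift (t - s) (schwartz_deriv \<psi>)))"
      by (simp add: schwartz_deriv_add schwartz_shift_add pairing_add distrib_left)
    also have "\<dots> = integral {0..t} (\<lambda>s. e s * pairing m (schwartz_shift (t - s) (schwartz_deriv \<phi>)))
        + integral {0..t} (\<lambda>s. e s * pairing m (schwartz_shift (t - s) (schwartz_deriv \<psi>)))"
      by (rule integral_add[OF int int])
    finally show "?f (\<phi> + \<psi>) = ?f \<phi> + ?f \<psi>"
      by (simp add: schwartz_shift_add pairing_add distrib_left)
  next
    fix c \<phi>
    have "integral {0..t} (\<lambda>s. e s * pairing m (schwartz_shift (t - s) (schwartz_deriv (c *\<^sub>R \<phi>))))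
        = integral {0..t} (\<lambda>s. c * (e s * pairing m (schwartz_shift (t - s) (schwartz_deriv \<phi>))))"
      by (simp add: schwartz_deriv_scaleR schwartz_shift_scaleR pairing_scaleR mult_ac)
    also have "\<dots> = c * integral {0..t} (\<lambda>s. e s * pairing m (schwartz_shift (t - s) (schwartz_deriv \<phi>)))"
      by (rule integral_mult_right)
    finally show "?f (c *\<^sub>R \<phi>) = c *\<^sub>R ?f \<phi>"
      by (simp add: schwartz_shift_scaleR pairing_scaleR algebra_simps)
  qed
  obtain K where K: "0 \<le> K" "\<And>s. s \<in> {0..T} \<Longrightarrow> \<bar>e s\<bar> \<le> K"
    using step_approximable_bounded[OF e] by blast
  obtain p A where A: "0 \<le> A" "\<And>\<phi> u. \<bar>u\<bar> \<le> T \<Longrightarrow> \<bar>pairing r (schwartz_shift u \<phi>)\<bar> \<le> A * schwartz_norm p \<phi>"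
    using pairing_shift_bound[of T r] by blast
  obtain q C where C: "0 \<le> C" "\<And>\<phi> u. \<bar>u\<bar> \<le> T \<Longrightarrow> \<bar>pairing m (schwartz_shift u \<phi>)\<bar> \<le> C * schwartz_norm q \<phi>"
    using pairing_shift_bound[of T m] by blast
  define n where "n = max p (Suc q)"
  have "\<bar>?f \<phi>\<bar> \<le> (A + K * C + K * (C * real (Suc q) ^ 2) * T) * schwartz_norm n \<phi>" for \<phi>
  proof -
    have np: "schwartz_norm p \<phi> \<le> schwartz_norm n \<phi>" "schwartz_norm q \<phi> \<le> schwartz_norm n \<phi>"
      "schwartz_norm (Suc q) \<phi> \<le> schwartz_norm n \<phi>"
      unfolding n_def by (auto intro!: schwartz_norm_mono)
    have 1: "\<bar>pairing r (schwartz_shift t \<phi>)\<bar> \<le> A * schwartz_norm n \<phi>"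
      using t by (intro order_trans[OF A(2)] mult_left_mono np A(1)) auto
    have "\<bar>pairing m (schwartz_shift 0 \<phi>)\<bar> \<le> C * schwartz_norm q \<phi>"
      using t by (intro C(2)) auto
    then have "\<bar>e t * pairing m \<phi>\<bar> \<le> K * (C * schwartz_norm q \<phi>)"
      unfolding abs_mult schwartz_shift_0 using t K by (intro mult_mono) auto
    also have "\<dots> \<le> K * (C * schwartz_norm n \<phi>)"
      by (intro mult_left_mono np K C)
    finally have 2: "\<bar>e t * pairing m \<phi>\<bar> \<le> K * (C * schwartz_norm n \<phi>)" .
    have b: "norm (e s * pairing m (schwartz_shift (t - s) (schwartz_deriv \<phi>)))
        \<le> K * (C * (real (Suc q) ^ 2 * schwartz_norm n \<phi>))" if "s \<in> {0..t}" for s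
    proof -
      have "\<bar>pairing m (schwartz_shift (t - s) (schwartz_deriv \<phi>))\<bar> \<le> C * schwartz_norm q (schwartz_deriv \<phi>)"
        using that t by (intro C(2)) auto
      also have "\<dots> \<le> C * (real (Suc q) ^ 2 * schwartz_norm (Suc q) \<phi>)"
        by (intro mult_left_mono schwartz_norm_deriv_le C)
      also have "\<dots> \<le> C * (real (Suc q) ^ 2 * schwartz_norm n \<phi>)"
        by (intro mult_left_mono np C) auto
      finally show ?thesis
        unfolding real_norm_def abs_mult using that t K C by (intro mult_mono K) auto
    qed
    have "\<bar>integral {0..t} (\<lambda>s. e s * pairing m (schwartz_shift (t - s) (schwartz_deriv \<phi>)))\<bar>
        \<le> K * (C * (real (Suc q) ^ 2 * schwartz_norm n \<phi>)) * (t - 0)"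
      using t by (intro integral_abs_le_const int) (use b in auto)
    also have "\<dots> \<le> K * (C * (real (Suc q) ^ 2 * schwartz_norm n \<phi>)) * T"
      using t K C by (intro mult_left_mono mult_nonneg_nonneg schwartz_norm_nonneg) auto
    finally show ?thesis using 1 2 by (simp add: algebra_simps abs_le_iff)
  qed
  from pairing_Abs_tempered[OF lin this] show ?thesis
    unfolding fluid_path_def by (simp only:)
qed

text \<open>Fundamental theorem of calculus in the shift parameter. The kernel with t - s belongs to
  the solution formula, the one with s - a to the time integral in the fluid equation.\<close>

lemma integral_pairing_shift_deriv:
  assumes "0 \<le> a" "a \<le> t"
  shows "integral {a..t} (\<lambda>s. pairing m (schwartz_shift (t - s) (schwartz_deriv \<phi>)))
    = pairing m \<phi> - pairing m (schwartz_shift (t - a) \<phi>)"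
    and "integral {a..t} (\<lambda>s. pairing m (schwartz_shift (s - a) (schwartz_deriv \<phi>)))
    = pairing m \<phi> - pairing m (schwartz_shift (t - a) \<phi>)"
proof -
  have d: "((-) t has_real_derivative - 1) (at s)" for s
    by (auto intro!: derivative_eq_intros)
  have "((\<lambda>s. pairing m (schwartz_shift (t - s) \<phi>)) has_real_derivative
      pairing m (schwartz_shift (t - s) (schwartz_deriv \<phi>))) (at s)" for s
    using DERIV_chain2[OF pairing_shift_has_derivative d, of m \<phi> s] by simp
  then have "((\<lambda>s. pairing m (schwartz_shift (t - s) (schwartz_deriv \<phi>))) has_integral
      pairing m (schwartz_shift (t - t) \<phi>) - pairing m (schwartz_shift (t - a) \<phi>)) {a..t}"
    using assms by (intro fundamental_theorem_of_calculus)
      (auto simp: has_real_derivative_iff_has_vector_derivative[symmetric] intro: has_field_derivative_at_within)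
  then show "integral {a..t} (\<lambda>s. pairing m (schwartz_shift (t - s) (schwartz_deriv \<phi>)))
    = pairing m \<phi> - pairing m (schwartz_shift (t - a) \<phi>)"
    by (simp add: schwartz_shift_0 integral_unique)
  have d: "((\<lambda>s. s - a) has_real_derivative 1) (at s)" for s
    by (auto intro!: derivative_eq_intros)
  have "((\<lambda>s. - pairing m (schwartz_shift (s - a) \<phi>)) has_real_derivative
      pairing m (schwartz_shift (s - a) (schwartz_deriv \<phi>))) (at s)" for s
    using DERIV_minus[OF DERIV_chain2[OF pairing_shift_has_derivative d, of m \<phi> s]] by simp
  then have "((\<lambda>s. pairing m (schwartz_shift (s - a) (schwartz_deriv \<phi>))) has_integral
      - pairing m (schwartz_shift (t - a) \<phi>) - - pairing m (schwartz_shift (a - a) \<phi>)) {a..t}"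
    using assms by (intro fundamental_theorem_of_calculus)
      (auto simp: has_real_derivative_iff_has_vector_derivative[symmetric] intro: has_field_derivative_at_within)
  then show "integral {a..t} (\<lambda>s. pairing m (schwartz_shift (s - a) (schwartz_deriv \<phi>)))
    = pairing m \<phi> - pairing m (schwartz_shift (t - a) \<phi>)"
    by (simp add: schwartz_shift_0 integral_unique)
qed

section \<open>Inputs that are finite sums of steps\<close>

lemma integral_heaviside:
  fixes g :: "real \<Rightarrow> real"
  assumes "0 \<le> a"
  shows "integral {0..t} (\<lambda>s. heaviside a s * g s) = (if a \<le> t then integral {a..t} g else 0)"
proof -
  have "integral {0..t} (\<lambda>s. heaviside a s * g s) = integral {0..t} (\<lambda>s. if s \<in> {a..} then g s else 0)"
    by (rule integral_cong) auto
  also have "\<dots> = integral ({a..} \<inter> {0..t}) g" by (rule integral_restrict_Int)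
  also have "{a..} \<inter> {0..t} = {a..t}" using assms by auto
  finally show ?thesis by simp
qed

lemma fluid_integral_heaviside:
  assumes "0 \<le> a"
  shows "integral {0..t} (\<lambda>s. heaviside a s * pairing m (schwartz_shift (t - s) (schwartz_deriv \<phi>)))
    = heaviside a t * (pairing m \<phi> - pairing m (schwartz_shift (t - a) \<phi>))"
  unfolding integral_heaviside[OF assms] using integral_pairing_shift_deriv(1)[OF assms, of t m \<phi>] by simp

lemma fluid_integral_step:
  assumes "\<And>i. i < k \<Longrightarrow> 0 \<le> a i"
  shows "integral {0..t} (\<lambda>s. step_fun k a c s * pairing m (schwartz_shift (t - s) (schwartz_deriv \<phi>)))
    = (\<Sum>i<k. c i * heaviside (a i) t * (pairing m \<phi> - pairing m (schwartz_shift (t - a i) \<phi>)))"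
proof -
  let ?g = "\<lambda>s. pairing m (schwartz_shift (t - s) (schwartz_deriv \<phi>))"
  have "integral {0..t} (\<lambda>s. step_fun k a c s * ?g s)
      = integral {0..t} (\<lambda>s. \<Sum>i<k. c i * (heaviside (a i) s * ?g s))"
    unfolding step_fun_def sum_distrib_right by (simp only: mult.assoc)
  also have "\<dots> = (\<Sum>i<k. integral {0..t} (\<lambda>s. c i * (heaviside (a i) s * ?g s)))"
    by (intro integral_sum integrable_on_mult_right integrable_heaviside continuous_on_pairing_shift_diff) auto
  also have "\<dots> = (\<Sum>i<k. c i * (heaviside (a i) t * (pairing m \<phi> - pairing m (schwartz_shift (t - a i) \<phi>))))"
    unfolding integral_mult_right using assms by (intro sum.cong refl) (simp only: fluid_integral_heaviside lessThan_iff)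
  finally show ?thesis by (simp only: mult.assoc)
qed

text \<open>For step inputs the terms with <m, \<phi>> cancel, leaving one copy of m per jump,
  transported since its jump time. In this form the fluid path is directly comparable with a
  superposition of customers.\<close>

lemma pairing_fluid_path_step:
  assumes "\<And>i. i < k \<Longrightarrow> 0 \<le> a i" "0 \<le> t"
  shows "pairing (fluid_path m r (step_fun k a c) t) \<phi>
    = pairing r (schwartz_shift t \<phi>) + (\<Sum>i<k. c i * heaviside (a i) t * pairing m (schwartz_shift (t - a i) \<phi>))"
proof -
  have sa: "step_approximable t (step_fun k a c)"
    using assms(1) by (rule step_approximable_step)
  have "step_fun k a c t * pairing m \<phi>
      - (\<Sum>i<k. c i * heaviside (a i) t * (pairing m \<phi> - pairing m (schwartz_shift (t - a i) \<phi>)))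
      = (\<Sum>i<k. c i * heaviside (a i) t * pairing m (schwartz_shift (t - a i) \<phi>))"
    unfolding step_fun_def sum_distrib_right right_diff_distrib sum_subtractf by simp
  then show ?thesis
    using assms(2) pairing_fluid_path[OF sa, of t m r \<phi>] fluid_integral_step[of k a t c m \<phi>] assms(1) by simp
qed

section \<open>Stability of the solution formula\<close>

lemma fluid_kernel_bound:
  assumes "schwartz_bounded B"
  obtains K where "0 \<le> K" "\<And>\<phi> u. \<phi> \<in> B \<Longrightarrow> \<bar>u\<bar> \<le> T \<Longrightarrow> \<bar>pairing m (schwartz_shift u \<phi>)\<bar> \<le> K"
    "\<And>\<phi> u v. \<phi> \<in> B \<Longrightarrow> \<bar>u\<bar> \<le> T \<Longrightarrow> \<bar>v\<bar> \<le> T \<Longrightarrow>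
      \<bar>pairing m (schwartz_shift u \<phi>) - pairing m (schwartz_shift v \<phi>)\<bar> \<le> K * \<bar>u - v\<bar>"
proof -
  obtain K where K: "0 \<le> K" "\<And>\<phi> u. \<phi> \<in> B \<Longrightarrow> \<bar>u\<bar> \<le> T \<Longrightarrow> \<bar>pairing m (schwartz_shift u \<phi>)\<bar> \<le> K"
    using pairing_shift_bounded[OF assms, of T m] by blast
  obtain L where L: "0 \<le> L" "\<And>\<phi> u v. \<phi> \<in> B \<Longrightarrow> \<bar>u\<bar> \<le> T \<Longrightarrow> \<bar>v\<bar> \<le> T \<Longrightarrow>
      \<bar>pairing m (schwartz_shift u \<phi>) - pairing m (schwartz_shift v \<phi>)\<bar> \<le> L * \<bar>u - v\<bar>"
    using pairing_shift_Lipschitz[OF assms, of T m] by blast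
  show ?thesis
  proof (rule that[of "K + L"])
    show "0 \<le> K + L" using K L by simp
  next
    fix \<phi> u assume "\<phi> \<in> B" "\<bar>u\<bar> \<le> T"
    from K(2)[OF this] show "\<bar>pairing m (schwartz_shift u \<phi>)\<bar> \<le> K + L" using L(1) by linarith
  next
    fix \<phi> u v assume a: "\<phi> \<in> B" "\<bar>u\<bar> \<le> T" "\<bar>v\<bar> \<le> T"
    have "L * \<bar>u - v\<bar> \<le> (K + L) * \<bar>u - v\<bar>" using K(1) by (intro mult_right_mono) auto
    then show "\<bar>pairing m (schwartz_shift u \<phi>) - pairing m (schwartz_shift v \<phi>)\<bar> \<le> (K + L) * \<bar>u - v\<bar>"
      using L(2)[OF a] by linarith
  qed
qed

text \<open>Up to the earlier of the two times the kernel moves by a Lipschitz amount, which costs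
  at most E K T |t - t'|; the interval between the two times contributes at most E K |t -
  t'|.\<close>

lemma fluid_integral_Lipschitz:
  assumes e: "step_approximable T e" "\<And>s. s \<in> {0..T} \<Longrightarrow> \<bar>e s\<bar> \<le> E" and E: "0 \<le> E"
    and K: "0 \<le> K" "\<And>u. \<bar>u\<bar> \<le> T \<Longrightarrow> \<bar>pairing m (schwartz_shift u \<phi>)\<bar> \<le> K"
    "\<And>u v. \<bar>u\<bar> \<le> T \<Longrightarrow> \<bar>v\<bar> \<le> T \<Longrightarrow> \<bar>pairing m (schwartz_shift u \<phi>) - pairing m (schwartz_shift v \<phi>)\<bar> \<le> K * \<bar>u - v\<bar>"
    and t: "t \<in> {0..T}" "t' \<in> {0..T}"
  shows "\<bar>integral {0..t} (\<lambda>s. e s * pairing m (schwartz_shift (t - s) \<phi>))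
    - integral {0..t'} (\<lambda>s. e s * pairing m (schwartz_shift (t' - s) \<phi>))\<bar> \<le> E * K * (1 + T) * \<bar>t - t'\<bar>"
  using t
proof (induction t t' rule: linorder_wlog)
  case (sym t t')
  then show ?case by (simp add: abs_minus_commute)
next
  case (le t t')
  let ?g = "\<lambda>t s. e s * pairing m (schwartz_shift (t - s) \<phi>)"
  have int: "?g a integrable_on {u..v}" if "0 \<le> u" "v \<le> T" for a u v
    by (rule fluid_integrable[OF e(1) that])
  have "integral {0..t'} (?g t') = integral {0..t} (?g t') + integral {t..t'} (?g t')"
    using le int by (intro Henstock_Kurzweil_Integration.integral_combine[symmetric]) auto
  moreover have "integral {0..t} (?g t) - integral {0..t} (?g t') = integral {0..t} (\<lambda>s. ?g t s - ?g t' s)"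
    using le int by (intro integral_diff[symmetric]) auto
  moreover have "\<bar>integral {0..t} (\<lambda>s. ?g t s - ?g t' s)\<bar> \<le> (E * (K * \<bar>t - t'\<bar>)) * (t - 0)"
  proof (rule integral_abs_le_const)
    fix s assume s: "s \<in> {0..t}"
    have "?g t s - ?g t' s = e s * (pairing m (schwartz_shift (t - s) \<phi>) - pairing m (schwartz_shift (t' - s) \<phi>))"
      by (simp add: algebra_simps)
    also have "\<bar>\<dots>\<bar> \<le> E * (K * \<bar>(t - s) - (t' - s)\<bar>)"
      unfolding abs_mult using s le E by (intro mult_mono e K(3)) auto
    finally show "\<bar>?g t s - ?g t' s\<bar> \<le> E * (K * \<bar>t - t'\<bar>)" by simp
  qed (use le int in \<open>auto intro!: integrable_diff\<close>)
  moreover have "\<bar>integral {t..t'} (?g t')\<bar> \<le> E * K * (t' - t)"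
  proof (rule integral_abs_le_const)
    fix s assume "s \<in> {t..t'}"
    then show "\<bar>?g t' s\<bar> \<le> E * K" unfolding abs_mult using le E by (intro mult_mono e K(2)) auto
  qed (use le int in auto)
  moreover have "E * (K * \<bar>t - t'\<bar>) * (t - 0) \<le> E * (K * \<bar>t - t'\<bar>) * T"
    using le E K(1) by (intro mult_left_mono) auto
  ultimately show ?case using le by (simp add: algebra_simps)
qed

text \<open>Only the jump term compares e and e' at the two matched times t and t'. In the integral
  they are compared at the same time, through a majorant D. This is the form needed under a time
  change, where e and e' at the same time may differ by a whole jump, but only near the jumps, so
  that the integral of D is still small.\<close>

lemma fluid_path_difference:
  assumes e: "step_approximable T e" "\<And>s. s \<in> {0..T} \<Longrightarrow> \<bar>e s\<bar> \<le> E" and E: "0 \<le> E"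
    and K: "0 \<le> K"
    "\<And>u. \<bar>u\<bar> \<le> T \<Longrightarrow> \<bar>pairing m (schwartz_shift u (schwartz_deriv \<phi>))\<bar> \<le> K"
    "\<And>u v. \<bar>u\<bar> \<le> T \<Longrightarrow> \<bar>v\<bar> \<le> T \<Longrightarrow> \<bar>pairing m (schwartz_shift u (schwartz_deriv \<phi>))
        - pairing m (schwartz_shift v (schwartz_deriv \<phi>))\<bar> \<le> K * \<bar>u - v\<bar>"
    "\<bar>pairing m \<phi>\<bar> \<le> K"
    "\<And>u v. \<bar>u\<bar> \<le> T \<Longrightarrow> \<bar>v\<bar> \<le> T \<Longrightarrow> \<bar>pairing r (schwartz_shift u \<phi>) - pairing r (schwartz_shift v \<phi>)\<bar> \<le> K * \<bar>u - v\<bar>"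
    and t: "t \<in> {0..T}" "t' \<in> {0..T}"
    and e': "step_approximable T e'" "D integrable_on {0..T}" "\<And>s. s \<in> {0..T} \<Longrightarrow> \<bar>e s - e' s\<bar> \<le> D s"
    and r': "\<bar>pairing r (schwartz_shift t' \<phi>) - pairing r' (schwartz_shift t' \<phi>)\<bar> \<le> d"
    and d: "\<bar>e t - e' t'\<bar> \<le> d"
  shows "\<bar>pairing (fluid_path m r e t) \<phi> - pairing (fluid_path m r' e' t') \<phi>\<bar>
    \<le> (K + E * K * (1 + T)) * \<bar>t - t'\<bar> + (1 + K) * d + K * integral {0..T} D"
proof -
  let ?g = "\<lambda>t s. pairing m (schwartz_shift (t - s) (schwartz_deriv \<phi>))"
  have D0: "0 \<le> D s" if "s \<in> {0..T}" for s using e'(3)[OF that] by linarith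
  have 1: "\<bar>pairing r (schwartz_shift t \<phi>) - pairing r (schwartz_shift t' \<phi>)\<bar> \<le> K * \<bar>t - t'\<bar>"
    using t by (intro K) auto
  have "\<bar>e t * pairing m \<phi> - e' t' * pairing m \<phi>\<bar> \<le> d * K"
    unfolding left_diff_distrib[symmetric] abs_mult using d K by (intro mult_mono) auto
  moreover have "\<bar>integral {0..t} (\<lambda>s. e s * ?g t s) - integral {0..t'} (\<lambda>s. e s * ?g t' s)\<bar> \<le> E * K * (1 + T) * \<bar>t - t'\<bar>"
    using e E K t by (intro fluid_integral_Lipschitz) auto
  moreover have "\<bar>integral {0..t'} (\<lambda>s. e s * ?g t' s) - integral {0..t'} (\<lambda>s. e' s * ?g t' s)\<bar> \<le> K * integral {0..T} D"
  proof -
    have i: "(\<lambda>s. e s * ?g t' s) integrable_on {0..t'}" "(\<lambda>s. e' s * ?g t' s) integrable_on {0..t'}"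
      using t by (auto intro!: fluid_integrable e e')
    have Dt: "D integrable_on {0..t'}"
      using t by (intro integrable_subinterval_real[OF e'(2)]) auto
    have "integral {0..t'} (\<lambda>s. e s * ?g t' s) - integral {0..t'} (\<lambda>s. e' s * ?g t' s)
        = integral {0..t'} (\<lambda>s. e s * ?g t' s - e' s * ?g t' s)"
      by (rule integral_diff[OF i, symmetric])
    also have "norm \<dots> \<le> integral {0..t'} (\<lambda>s. D s * K)"
    proof (rule integral_norm_bound_integral)
      fix s assume s: "s \<in> {0..t'}"
      show "norm (e s * ?g t' s - e' s * ?g t' s) \<le> D s * K"
        unfolding left_diff_distrib[symmetric] real_norm_def abs_mult
        using s t D0[of s] by (intro mult_mono e' K) auto
    qed (use i Dt in \<open>auto intro!: integrable_diff integrable_on_mult_left\<close>)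
    also have "\<dots> = K * integral {0..t'} D" by (simp add: mult.commute)
    also have "\<dots> \<le> K * integral {0..T} D"
      using t D0 by (intro mult_left_mono integral_subset_le Dt e' K) auto
    finally show ?thesis by simp
  qed
  ultimately show ?thesis
    unfolding pairing_fluid_path[OF e(1) t(1)] pairing_fluid_path[OF e'(1) t(2)]
    using 1 r' by (simp add: algebra_simps abs_le_iff)
qed

lemma fluid_bounds:
  assumes "schwartz_bounded B"
  obtains K where "0 \<le> K"
    "\<And>\<phi> u. \<phi> \<in> B \<Longrightarrow> \<bar>u\<bar> \<le> T \<Longrightarrow> \<bar>pairing m (schwartz_shift u (schwartz_deriv \<phi>))\<bar> \<le> K"
    "\<And>\<phi> u v. \<phi> \<in> B \<Longrightarrow> \<bar>u\<bar> \<le> T \<Longrightarrow> \<bar>v\<bar> \<le> T \<Longrightarrow> \<bar>pairing m (schwartz_shift u (schwartz_deriv \<phi>))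
        - pairing m (schwartz_shift v (schwartz_deriv \<phi>))\<bar> \<le> K * \<bar>u - v\<bar>"
    "\<And>\<phi>. \<phi> \<in> B \<Longrightarrow> \<bar>pairing m \<phi>\<bar> \<le> K"
    "\<And>\<phi> u v. \<phi> \<in> B \<Longrightarrow> \<bar>u\<bar> \<le> T \<Longrightarrow> \<bar>v\<bar> \<le> T \<Longrightarrow>
      \<bar>pairing r (schwartz_shift u \<phi>) - pairing r (schwartz_shift v \<phi>)\<bar> \<le> K * \<bar>u - v\<bar>"
proof -
  obtain K1 where K1: "0 \<le> K1"
    "\<And>\<phi> u. \<phi> \<in> schwartz_deriv ` B \<Longrightarrow> \<bar>u\<bar> \<le> T \<Longrightarrow> \<bar>pairing m (schwartz_shift u \<phi>)\<bar> \<le> K1"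
    "\<And>\<phi> u v. \<phi> \<in> schwartz_deriv ` B \<Longrightarrow> \<bar>u\<bar> \<le> T \<Longrightarrow> \<bar>v\<bar> \<le> T \<Longrightarrow>
      \<bar>pairing m (schwartz_shift u \<phi>) - pairing m (schwartz_shift v \<phi>)\<bar> \<le> K1 * \<bar>u - v\<bar>"
    by (fact fluid_kernel_bound[OF schwartz_bounded_deriv[OF assms]])
  obtain K2 where K2: "0 \<le> K2"
    "\<And>\<phi> u. \<phi> \<in> B \<Longrightarrow> \<bar>u\<bar> \<le> 0 \<Longrightarrow> \<bar>pairing m (schwartz_shift u \<phi>)\<bar> \<le> K2"
    "\<And>\<phi> u v. \<phi> \<in> B \<Longrightarrow> \<bar>u\<bar> \<le> 0 \<Longrightarrow> \<bar>v\<bar> \<le> 0 \<Longrightarrow>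
      \<bar>pairing m (schwartz_shift u \<phi>) - pairing m (schwartz_shift v \<phi>)\<bar> \<le> K2 * \<bar>u - v\<bar>"
    by (fact fluid_kernel_bound[OF assms])
  obtain K3 where K3: "0 \<le> K3"
    "\<And>\<phi> u. \<phi> \<in> B \<Longrightarrow> \<bar>u\<bar> \<le> T \<Longrightarrow> \<bar>pairing r (schwartz_shift u \<phi>)\<bar> \<le> K3"
    "\<And>\<phi> u v. \<phi> \<in> B \<Longrightarrow> \<bar>u\<bar> \<le> T \<Longrightarrow> \<bar>v\<bar> \<le> T \<Longrightarrow>
      \<bar>pairing r (schwartz_shift u \<phi>) - pairing r (schwartz_shift v \<phi>)\<bar> \<le> K3 * \<bar>u - v\<bar>"
    by (fact fluid_kernel_bound[OF assms])
  define K where "K = K1 + K2 + K3"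
  have K: "K1 \<le> K" "K2 \<le> K" "K3 \<le> K" "0 \<le> K" using K1(1) K2(1) K3(1) by (auto simp: K_def)
  have mult: "K1 * \<bar>u - v\<bar> \<le> K * \<bar>u - v\<bar>" "K3 * \<bar>u - v\<bar> \<le> K * \<bar>u - v\<bar>" for u v :: real
    using K by (auto intro!: mult_right_mono)
  show ?thesis
  proof (rule that[OF K(4)])
    fix \<phi> u assume "\<phi> \<in> B" "\<bar>u\<bar> \<le> T"
    from K1(2)[OF imageI[OF this(1)] this(2)] show "\<bar>pairing m (schwartz_shift u (schwartz_deriv \<phi>))\<bar> \<le> K" using K by linarith
  next
    fix \<phi> u v assume "\<phi> \<in> B" "\<bar>u\<bar> \<le> T" "\<bar>v\<bar> \<le> T"
    from K1(3)[OF imageI[OF this(1)] this(2,3)] show "\<bar>pairing m (schwartz_shift u (schwartz_deriv \<phi>))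
        - pairing m (schwartz_shift v (schwartz_deriv \<phi>))\<bar> \<le> K * \<bar>u - v\<bar>" using mult(1) by (rule order_trans)
  next
    fix \<phi> assume "\<phi> \<in> B"
    from K2(2)[OF this, of 0] show "\<bar>pairing m \<phi>\<bar> \<le> K" using K by (simp add: schwartz_shift_0)
  next
    fix \<phi> u v assume "\<phi> \<in> B" "\<bar>u\<bar> \<le> T" "\<bar>v\<bar> \<le> T"
    from K3(3)[OF this] show "\<bar>pairing r (schwartz_shift u \<phi>) - pairing r (schwartz_shift v \<phi>)\<bar> \<le> K * \<bar>u - v\<bar>"
      using mult(2) by (rule order_trans)
  qed
qed

text \<open>Apart from the term \<open>e t * pairing m \<phi>\<close> the fluid path is Lipschitz in
  time, uniformly over a bounded set. Its jumps are therefore those of e, in the direction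
  m.\<close>

lemma fluid_path_modulus:
  assumes e: "step_approximable T e" and B: "schwartz_bounded B"
  obtains C where "0 \<le> C" "\<And>\<phi> t t'. \<phi> \<in> B \<Longrightarrow> t \<in> {0..T} \<Longrightarrow> t' \<in> {0..T} \<Longrightarrow>
    \<bar>pairing (fluid_path m r e t) \<phi> - pairing (fluid_path m r e t') \<phi> - (e t - e t') * pairing m \<phi>\<bar> \<le> C * \<bar>t - t'\<bar>"
    "\<And>\<phi>. \<phi> \<in> B \<Longrightarrow> \<bar>pairing m \<phi>\<bar> \<le> C"
proof -
  obtain K where K: "0 \<le> K"
    "\<And>\<phi> u. \<phi> \<in> B \<Longrightarrow> \<bar>u\<bar> \<le> T \<Longrightarrow> \<bar>pairing m (schwartz_shift u (schwartz_deriv \<phi>))\<bar> \<le> K"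
    "\<And>\<phi> u v. \<phi> \<in> B \<Longrightarrow> \<bar>u\<bar> \<le> T \<Longrightarrow> \<bar>v\<bar> \<le> T \<Longrightarrow> \<bar>pairing m (schwartz_shift u (schwartz_deriv \<phi>))
        - pairing m (schwartz_shift v (schwartz_deriv \<phi>))\<bar> \<le> K * \<bar>u - v\<bar>"
    "\<And>\<phi>. \<phi> \<in> B \<Longrightarrow> \<bar>pairing m \<phi>\<bar> \<le> K"
    "\<And>\<phi> u v. \<phi> \<in> B \<Longrightarrow> \<bar>u\<bar> \<le> T \<Longrightarrow> \<bar>v\<bar> \<le> T \<Longrightarrow>
      \<bar>pairing r (schwartz_shift u \<phi>) - pairing r (schwartz_shift v \<phi>)\<bar> \<le> K * \<bar>u - v\<bar>"
    by (fact fluid_bounds[OF B])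
  obtain E where E: "0 \<le> E" "\<And>s. s \<in> {0..T} \<Longrightarrow> \<bar>e s\<bar> \<le> E"
    using step_approximable_bounded[OF e] by blast
  show ?thesis
  proof (cases "0 \<le> T")
    case True
    show ?thesis
    proof (rule that[of "K + E * K * (1 + T)"])
      show "0 \<le> K + E * K * (1 + T)" using K E True by simp
      fix \<phi> assume \<phi>: "\<phi> \<in> B"
      have "0 \<le> E * K * (1 + T)" using K E True by simp
      then show "\<bar>pairing m \<phi>\<bar> \<le> K + E * K * (1 + T)" using K(4)[OF \<phi>] by linarith
      fix t t' assume t: "t \<in> {0..T}" "t' \<in> {0..T}"
      let ?I = "\<lambda>t. integral {0..t} (\<lambda>s. e s * pairing m (schwartz_shift (t - s) (schwartz_deriv \<phi>)))"
      have "\<bar>?I t - ?I t'\<bar> \<le> E * K * (1 + T) * \<bar>t - t'\<bar>"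
        using e E K \<phi> t by (intro fluid_integral_Lipschitz) auto
      moreover have "\<bar>pairing r (schwartz_shift t \<phi>) - pairing r (schwartz_shift t' \<phi>)\<bar> \<le> K * \<bar>t - t'\<bar>"
        using t \<phi> by (intro K) auto
      ultimately show "\<bar>pairing (fluid_path m r e t) \<phi> - pairing (fluid_path m r e t') \<phi> - (e t - e t') * pairing m \<phi>\<bar>
          \<le> (K + E * K * (1 + T)) * \<bar>t - t'\<bar>"
        unfolding pairing_fluid_path[OF e t(1)] pairing_fluid_path[OF e t(2)]
        by (simp add: algebra_simps abs_le_iff)
    qed
  next
    case False
    show ?thesis
      by (rule that[OF K(1)]) (use False K in auto)
  qed
qed

lemma fluid_path_cadlag:
  assumes e: "cadlag_on T e"
  shows "cadlag_on T (fluid_path m r e)"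
  unfolding cadlag_on_def
proof (intro conjI ballI)
  note sa = cadlag_step_approximable[OF e]
  fix t assume t: "t \<in> {0..<T}"
  then have et: "(e \<longlongrightarrow> e t) (at_right t)" using e unfolding cadlag_on_def by auto
  show "(fluid_path m r e \<longlongrightarrow> fluid_path m r e t) (at_right t)"
  proof (rule tendsto_temperedI)
    fix B :: "schwartz set" and d :: real assume B: "schwartz_bounded B" and d: "0 < d"
    obtain C where C: "0 \<le> C" "\<And>\<phi> t t'. \<phi> \<in> B \<Longrightarrow> t \<in> {0..T} \<Longrightarrow> t' \<in> {0..T} \<Longrightarrow>
      \<bar>pairing (fluid_path m r e t) \<phi> - pairing (fluid_path m r e t') \<phi> - (e t - e t') * pairing m \<phi>\<bar> \<le> C * \<bar>t - t'\<bar>"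
      "\<And>\<phi>. \<phi> \<in> B \<Longrightarrow> \<bar>pairing m \<phi>\<bar> \<le> C"
      by (fact fluid_path_modulus[OF sa B])
    have "((\<lambda>s. C * \<bar>s - t\<bar> + \<bar>e s - e t\<bar> * C) \<longlongrightarrow> C * \<bar>t - t\<bar> + \<bar>e t - e t\<bar> * C) (at_right t)"
      by (intro tendsto_intros et)
    then have "\<forall>\<^sub>F s in at_right t. C * \<bar>s - t\<bar> + \<bar>e s - e t\<bar> * C < d"
      using d by (intro order_tendstoD(2)) auto
    moreover have "\<forall>\<^sub>F s in at_right t. s \<in> {t<..<T}"
      using t by (intro eventually_at_right_real) auto
    ultimately show "\<forall>\<^sub>F s in at_right t. \<forall>\<phi>\<in>B. \<bar>pairing (fluid_path m r e s) \<phi> - pairing (fluid_path m r e t) \<phi>\<bar> \<le> d"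
    proof eventually_elim
      case (elim s)
      show ?case
      proof
        fix \<phi> assume \<phi>: "\<phi> \<in> B"
        have "\<bar>(e s - e t) * pairing m \<phi>\<bar> \<le> \<bar>e s - e t\<bar> * C"
          unfolding abs_mult using C(3)[OF \<phi>] by (intro mult_left_mono) auto
        then show "\<bar>pairing (fluid_path m r e s) \<phi> - pairing (fluid_path m r e t) \<phi>\<bar> \<le> d"
          using C(2)[OF \<phi>, of s t] elim t by (auto simp: abs_le_iff)
      qed
    qed
  qed
next
  note sa = cadlag_step_approximable[OF e]
  fix t assume t: "t \<in> {0<..T}"
  then have "\<exists>c. (e \<longlongrightarrow> c) (at_left t)" using e unfolding cadlag_on_def by simp
  then obtain c where et: "(e \<longlongrightarrow> c) (at_left t)" by blast
  show "\<exists>l. (fluid_path m r e \<longlongrightarrow> l) (at_left t)"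
  proof (rule exI, rule tendsto_temperedI)
    \<comment> \<open>The left limit is obtained by replacing \<open>e t\<close> with the left limit
      c of e in the jump term.\<close>
    let ?l = "fluid_path m r e t + (c - e t) *\<^sub>R m"
    fix B :: "schwartz set" and d :: real assume B: "schwartz_bounded B" and d: "0 < d"
    obtain C where C: "0 \<le> C" "\<And>\<phi> t t'. \<phi> \<in> B \<Longrightarrow> t \<in> {0..T} \<Longrightarrow> t' \<in> {0..T} \<Longrightarrow>
      \<bar>pairing (fluid_path m r e t) \<phi> - pairing (fluid_path m r e t') \<phi> - (e t - e t') * pairing m \<phi>\<bar> \<le> C * \<bar>t - t'\<bar>"
      "\<And>\<phi>. \<phi> \<in> B \<Longrightarrow> \<bar>pairing m \<phi>\<bar> \<le> C"
      by (fact fluid_path_modulus[OF sa B])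
    have "((\<lambda>s. C * \<bar>s - t\<bar> + \<bar>e s - c\<bar> * C) \<longlongrightarrow> C * \<bar>t - t\<bar> + \<bar>c - c\<bar> * C) (at_left t)"
      by (intro tendsto_intros et)
    then have "\<forall>\<^sub>F s in at_left t. C * \<bar>s - t\<bar> + \<bar>e s - c\<bar> * C < d"
      using d by (intro order_tendstoD(2)) auto
    moreover have "\<forall>\<^sub>F s in at_left t. s \<in> {0<..<t}"
      using t by (intro eventually_at_left_real) auto
    ultimately show "\<forall>\<^sub>F s in at_left t. \<forall>\<phi>\<in>B. \<bar>pairing (fluid_path m r e s) \<phi> - pairing ?l \<phi>\<bar> \<le> d"
    proof eventually_elim
      case (elim s)
      show ?case
      proof
        fix \<phi> assume \<phi>: "\<phi> \<in> B"
        have "\<bar>(e s - c) * pairing m \<phi>\<bar> \<le> \<bar>e s - c\<bar> * C"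
          unfolding abs_mult using C(3)[OF \<phi>] by (intro mult_left_mono) auto
        moreover have "pairing (fluid_path m r e s) \<phi> - pairing ?l \<phi>
            = (pairing (fluid_path m r e s) \<phi> - pairing (fluid_path m r e t) \<phi> - (e s - e t) * pairing m \<phi>)
              + (e s - c) * pairing m \<phi>"
          unfolding plus_tempered.rep_eq scaleR_tempered.rep_eq by (simp add: algebra_simps)
        ultimately show "\<bar>pairing (fluid_path m r e s) \<phi> - pairing ?l \<phi>\<bar> \<le> d"
          using C(2)[OF \<phi>, of s t] elim t by (auto simp: abs_le_iff)
      qed
    qed
  qed
qed

lemma cadlag_pairing: "cadlag_on T x \<Longrightarrow> cadlag_on T (\<lambda>t. pairing (x t) \<phi>)"
  unfolding cadlag_on_def by (blast intro: tendsto_pairing)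

lemma cadlag_restrict:
  assumes "cadlag_on T x"
  shows "cadlag_on T (restrict x {0..T})"
  unfolding cadlag_on_def
proof (intro conjI ballI)
  fix t assume t: "t \<in> {0..<T}"
  have "\<forall>\<^sub>F s in at_right t. restrict x {0..T} s = x s"
    using eventually_at_right_real[of t T] t by (auto elim!: eventually_mono)
  then show "(restrict x {0..T} \<longlongrightarrow> restrict x {0..T} t) (at_right t)"
    using assms t unfolding cadlag_on_def by (subst tendsto_cong) auto
next
  fix t assume t: "t \<in> {0<..T}"
  have "\<forall>\<^sub>F s in at_left t. restrict x {0..T} s = x s"
    using eventually_at_left_real[of 0 t] t by (auto elim!: eventually_mono)
  moreover have "\<exists>l. (x \<longlongrightarrow> l) (at_left t)" using assms t unfolding cadlag_on_def by simp
  ultimately show "\<exists>l. (restrict x {0..T} \<longlongrightarrow> l) (at_left t)" by (simp cong: tendsto_cong)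
qed

lemma cadlag_onI:
  assumes "\<And>t. 0 \<le> t \<Longrightarrow> t < T \<Longrightarrow> (x \<longlongrightarrow> x t) (at_right t)"
    and "\<And>t. 0 < t \<Longrightarrow> t \<le> T \<Longrightarrow> \<exists>l. (x \<longlongrightarrow> l) (at_left t)"
  shows "cadlag_on T x"
  using assms unfolding cadlag_on_def by simp

lemma cadlag_real_diff_scale:
  fixes x :: "real \<Rightarrow> real"
  assumes "cadlag_on T x"
  shows "cadlag_on T (\<lambda>t. (x t - c) / d)"
proof (rule cadlag_onI)
  fix t assume "0 \<le> t" "t < T"
  then have "(x \<longlongrightarrow> x t) (at_right t)" using assms unfolding cadlag_on_def by simp
  then show "((\<lambda>t. (x t - c) / d) \<longlongrightarrow> (x t - c) / d) (at_right t)"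
    unfolding divide_inverse by (intro tendsto_intros)
next
  fix t assume "0 < t" "t \<le> T"
  then have "\<exists>l. (x \<longlongrightarrow> l) (at_left t)" using assms unfolding cadlag_on_def by simp
  then obtain l where "(x \<longlongrightarrow> l) (at_left t)" by blast
  then have "((\<lambda>t. (x t - c) / d) \<longlongrightarrow> (l - c) / d) (at_left t)"
    unfolding divide_inverse by (intro tendsto_intros)
  then show "\<exists>l. ((\<lambda>t. (x t - c) / d) \<longlongrightarrow> l) (at_left t)" by blast
qed

text \<open>Each jump is treated separately: the time integral of the copy of m that starts at
  \<open>a i\<close> is the difference between its initial and its transported value.\<close>

lemma fluid_equation_step:
  assumes a: "\<And>i. i < k \<Longrightarrow> 0 \<le> a i" and t: "0 \<le> t"
  shows "(\<lambda>s. pairing (fluid_path m r (step_fun k a c) s) (schwartz_deriv \<phi>)) integrable_on {0..t}"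
    and "pairing (fluid_path m r (step_fun k a c) t) \<phi> = pairing r \<phi> + step_fun k a c t * pairing m \<phi>
      - integral {0..t} (\<lambda>s. pairing (fluid_path m r (step_fun k a c) s) (schwartz_deriv \<phi>))"
proof -
  let ?h = "\<lambda>i s. pairing m (schwartz_shift (s - a i) (schwartz_deriv \<phi>))"
  have cont: "continuous_on {0..t} (?h i)" for i
    by (rule continuous_on_compose2[OF continuous_on_pairing_shift[of UNIV]]) (auto intro!: continuous_intros)
  have i1: "(\<lambda>s. pairing r (schwartz_shift s (schwartz_deriv \<phi>))) integrable_on {0..t}"
    by (intro integrable_continuous_interval continuous_on_pairing_shift)
  have i2: "(\<lambda>s. c i * (heaviside (a i) s * ?h i s)) integrable_on {0..t}" for i
    by (intro integrable_on_mult_right integrable_heaviside cont)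
  have i3: "(\<lambda>s. \<Sum>i<k. c i * (heaviside (a i) s * ?h i s)) integrable_on {0..t}"
    by (intro integrable_sum i2) auto
  have eq: "pairing (fluid_path m r (step_fun k a c) s) (schwartz_deriv \<phi>)
      = pairing r (schwartz_shift s (schwartz_deriv \<phi>)) + (\<Sum>i<k. c i * (heaviside (a i) s * ?h i s))"
    if "s \<in> {0..t}" for s
    using pairing_fluid_path_step[of k a s m r c "schwartz_deriv \<phi>"] a that by (simp add: mult.assoc)
  show "(\<lambda>s. pairing (fluid_path m r (step_fun k a c) s) (schwartz_deriv \<phi>)) integrable_on {0..t}"
    by (rule integrable_eq[OF integrable_add[OF i1 i3]]) (simp add: eq)
  have "integral {0..t} (\<lambda>s. pairing (fluid_path m r (step_fun k a c) s) (schwartz_deriv \<phi>))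
      = integral {0..t} (\<lambda>s. pairing r (schwartz_shift s (schwartz_deriv \<phi>)) + (\<Sum>i<k. c i * (heaviside (a i) s * ?h i s)))"
    by (rule integral_cong) (rule eq)
  also have "\<dots> = integral {0..t} (\<lambda>s. pairing r (schwartz_shift s (schwartz_deriv \<phi>)))
      + (\<Sum>i<k. c i * integral {0..t} (\<lambda>s. heaviside (a i) s * ?h i s))"
    using i2 by (subst integral_add[OF i1 i3], subst integral_sum) (simp_all only: integral_mult_right finite_lessThan)
  also have "integral {0..t} (\<lambda>s. pairing r (schwartz_shift s (schwartz_deriv \<phi>)))
      = pairing r \<phi> - pairing r (schwartz_shift t \<phi>)"
    using integral_pairing_shift_deriv(2)[of 0 t r \<phi>] t by simp
  also have "(\<Sum>i<k. c i * integral {0..t} (\<lambda>s. heaviside (a i) s * ?h i s))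
      = (\<Sum>i<k. c i * (heaviside (a i) t * (pairing m \<phi> - pairing m (schwartz_shift (t - a i) \<phi>))))"
  proof (rule sum.cong[OF refl])
    fix i assume "i \<in> {..<k}"
    then have ai: "0 \<le> a i" using a by simp
    show "c i * integral {0..t} (\<lambda>s. heaviside (a i) s * ?h i s)
        = c i * (heaviside (a i) t * (pairing m \<phi> - pairing m (schwartz_shift (t - a i) \<phi>)))"
      unfolding integral_heaviside[OF ai] using integral_pairing_shift_deriv(2)[OF ai, of t m \<phi>] by simp
  qed
  finally have I: "integral {0..t} (\<lambda>s. pairing (fluid_path m r (step_fun k a c) s) (schwartz_deriv \<phi>))
      = pairing r \<phi> - pairing r (schwartz_shift t \<phi>)
        + (\<Sum>i<k. c i * (heaviside (a i) t * (pairing m \<phi> - pairing m (schwartz_shift (t - a i) \<phi>))))" .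
  have "(\<Sum>i<k. c i * (heaviside (a i) t * (pairing m \<phi> - pairing m (schwartz_shift (t - a i) \<phi>))))
      = step_fun k a c t * pairing m \<phi> - (\<Sum>i<k. c i * heaviside (a i) t * pairing m (schwartz_shift (t - a i) \<phi>))"
    unfolding step_fun_def sum_distrib_right sum_subtractf[symmetric]
    by (rule sum.cong[OF refl]) (simp only: mult.assoc right_diff_distrib)
  then show "pairing (fluid_path m r (step_fun k a c) t) \<phi> = pairing r \<phi> + step_fun k a c t * pairing m \<phi>
      - integral {0..t} (\<lambda>s. pairing (fluid_path m r (step_fun k a c) s) (schwartz_deriv \<phi>))"
    unfolding I using pairing_fluid_path_step[of k a t m r c \<phi>] a t by simp
qed

text \<open>Both sides depend on e in a Lipschitz way for the sup norm, so the identity passes from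
  step functions to their uniform limits.\<close>

lemma fluid_equation:
  assumes e: "cadlag_on T e" and t: "t \<in> {0..T}"
  shows "pairing (fluid_path m r e t) \<phi> = pairing r \<phi> + e t * pairing m \<phi>
    - integral {0..t} (\<lambda>s. pairing (fluid_path m r e s) (schwartz_deriv \<phi>))"
proof -
  note sa = cadlag_step_approximable[OF e]
  let ?B = "{\<phi>, schwartz_deriv \<phi>}"
  have T: "0 \<le> T" using t by simp
  obtain K where K: "0 \<le> K"
    "\<And>\<phi> u. \<phi> \<in> ?B \<Longrightarrow> \<bar>u\<bar> \<le> T \<Longrightarrow> \<bar>pairing m (schwartz_shift u (schwartz_deriv \<phi>))\<bar> \<le> K"
    "\<And>\<phi> u v. \<phi> \<in> ?B \<Longrightarrow> \<bar>u\<bar> \<le> T \<Longrightarrow> \<bar>v\<bar> \<le> T \<Longrightarrow> \<bar>pairing m (schwartz_shift u (schwartz_deriv \<phi>))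
        - pairing m (schwartz_shift v (schwartz_deriv \<phi>))\<bar> \<le> K * \<bar>u - v\<bar>"
    "\<And>\<phi>. \<phi> \<in> ?B \<Longrightarrow> \<bar>pairing m \<phi>\<bar> \<le> K"
    "\<And>\<phi> u v. \<phi> \<in> ?B \<Longrightarrow> \<bar>u\<bar> \<le> T \<Longrightarrow> \<bar>v\<bar> \<le> T \<Longrightarrow>
      \<bar>pairing r (schwartz_shift u \<phi>) - pairing r (schwartz_shift v \<phi>)\<bar> \<le> K * \<bar>u - v\<bar>"
    by (fact fluid_bounds[OF schwartz_bounded_finite[of ?B, simplified]])
  obtain E where E: "0 \<le> E" "\<And>s. s \<in> {0..T} \<Longrightarrow> \<bar>e s\<bar> \<le> E"
    using step_approximable_bounded[OF sa] by blast
  \<comment> \<open>The constant of \<open>fluid_path_difference\<close> at equal times and equal r,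
    with a constant majorant.\<close>
  define C where "C = (1 + K) + K * T"
  have C0: "0 \<le> C" using K T by (simp add: C_def)
  let ?z = "\<lambda>e s. pairing (fluid_path m r e s) (schwartz_deriv \<phi>)"
  have zint: "?z e integrable_on {0..t}"
    using t by (intro step_approximable_integrable'[where T=T] cadlag_step_approximable cadlag_pairing fluid_path_cadlag)
      (use e in auto)
  let ?rhs = "pairing r \<phi> + e t * pairing m \<phi> - integral {0..t} (?z e)"
  have "\<bar>pairing (fluid_path m r e t) \<phi> - ?rhs\<bar> \<le> (C + K + C * T) * d" if d: "0 < d" for d
  proof -
    obtain k :: nat and a c where a: "\<forall>i<k. 0 \<le> a i"
      and g: "\<forall>s\<in>{0..T}. \<bar>e s - step_fun k a c s\<bar> \<le> d"
      using step_approximableD[OF sa d] by blast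
    let ?g = "step_fun k a c"
    have sg: "step_approximable T ?g" using a by (intro step_approximable_step) auto
    have diff: "\<bar>pairing (fluid_path m r e s) \<psi> - pairing (fluid_path m r ?g s) \<psi>\<bar> \<le> C * d"
      if \<psi>: "\<psi> \<in> ?B" and s: "s \<in> {0..T}" for s \<psi>
    proof -
      have "\<bar>pairing (fluid_path m r e s) \<psi> - pairing (fluid_path m r ?g s) \<psi>\<bar>
          \<le> (K + E * K * (1 + T)) * \<bar>s - s\<bar> + (1 + K) * d + K * integral {0..T} (\<lambda>_. d)"
        using sa E K \<psi> s sg g d by (intro fluid_path_difference) auto
      also have "\<dots> = C * d" using T by (simp add: C_def algebra_simps)
      finally show ?thesis .
    qed
    have gint: "?z ?g integrable_on {0..t}" and
      geq: "pairing (fluid_path m r ?g t) \<phi> = pairing r \<phi> + ?g t * pairing m \<phi> - integral {0..t} (?z ?g)"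
      using a t by (auto intro!: fluid_equation_step)
    have "\<bar>integral {0..t} (\<lambda>s. ?z e s - ?z ?g s)\<bar> \<le> C * d * (t - 0)"
      using t by (intro integral_abs_le_const integrable_diff zint gint diff) auto
    also have "\<dots> \<le> C * d * T" using t C0 d by (intro mult_left_mono) auto
    finally have "\<bar>integral {0..t} (?z e) - integral {0..t} (?z ?g)\<bar> \<le> C * d * T"
      unfolding integral_diff[OF zint gint] .
    moreover have "\<bar>e t * pairing m \<phi> - ?g t * pairing m \<phi>\<bar> \<le> d * K"
      unfolding left_diff_distrib[symmetric] abs_mult using g t K d by (intro mult_mono) auto
    moreover have "\<bar>pairing (fluid_path m r e t) \<phi> - pairing (fluid_path m r ?g t) \<phi>\<bar> \<le> C * d"
      using t by (intro diff) auto
    ultimately show ?thesis unfolding geq by (simp add: algebra_simps abs_le_iff)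
  qed
  note * = this
  have "\<bar>pairing (fluid_path m r e t) \<phi> - ?rhs\<bar> \<le> 0"
  proof (rule field_le_epsilon)
    fix d :: real assume d: "0 < d"
    let ?c = "C + K + C * T"
    have c: "0 \<le> ?c" using C0 K T by simp
    have "\<bar>pairing (fluid_path m r e t) \<phi> - ?rhs\<bar> \<le> ?c * (d / (?c + 1))"
      using c d by (intro *) auto
    also have "\<dots> \<le> d" using c d by (simp add: field_simps)
    finally show "\<bar>pairing (fluid_path m r e t) \<phi> - ?rhs\<bar> \<le> 0 + d" by simp
  qed
  then show ?thesis by simp
qed

section \<open>Uniqueness for the fluid equation\<close>

lemma tendsto_tempered_diff:
  fixes x y :: "'a \<Rightarrow> tempered"
  assumes "(x \<longlongrightarrow> a) G" "(y \<longlongrightarrow> b) G"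
  shows "((\<lambda>t. x t - y t) \<longlongrightarrow> a - b) G"
proof (rule tendsto_temperedI)
  fix B :: "schwartz set" and e :: real assume "schwartz_bounded B" "0 < e"
  then have "\<forall>\<^sub>F t in G. \<forall>\<phi>\<in>B. \<bar>pairing (x t) \<phi> - pairing a \<phi>\<bar> < e / 2"
    "\<forall>\<^sub>F t in G. \<forall>\<phi>\<in>B. \<bar>pairing (y t) \<phi> - pairing b \<phi>\<bar> < e / 2"
    by (intro tendsto_temperedD assms; simp)+
  then show "\<forall>\<^sub>F t in G. \<forall>\<phi>\<in>B. \<bar>pairing (x t - y t) \<phi> - pairing (a - b) \<phi>\<bar> \<le> e"
  proof eventually_elim
    case (elim t)
    show ?case
    proof
      fix \<phi> assume "\<phi> \<in> B"
      then have "\<bar>pairing (x t) \<phi> - pairing a \<phi>\<bar> < e / 2" "\<bar>pairing (y t) \<phi> - pairing b \<phi>\<bar> < e / 2"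
        using elim by auto
      then show "\<bar>pairing (x t - y t) \<phi> - pairing (a - b) \<phi>\<bar> \<le> e"
        unfolding minus_tempered.rep_eq by linarith
    qed
  qed
qed

text \<open>The test functions S_(t-u) \<phi> for u in [0, t] form a bounded set, so strong
  convergence of W is uniform over them and both arguments of the pairing may move at once.\<close>

lemma continuous_on_pairing_shift_path:
  assumes W: "\<And>s. s \<in> {0..T} \<Longrightarrow> (W \<longlongrightarrow> W s) (at s within {0..T})" and t: "t \<in> {0..T}"
  shows "continuous_on {0..t} (\<lambda>s. pairing (W s) (schwartz_shift (t - s) \<phi>))"
  unfolding continuous_on_def
proof
  fix s assume s: "s \<in> {0..t}"
  let ?F = "at s within {0..t}"
  have Ws: "(W \<longlongrightarrow> W s) ?F"
    using s t by (intro tendsto_within_subset[OF W]) auto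
  have B: "schwartz_bounded {schwartz_shift u \<psi> |u \<psi>. \<psi> \<in> {\<phi>} \<and> \<bar>u\<bar> \<le> T}" (is "schwartz_bounded ?B")
    by (rule schwartz_bounded_shift[OF schwartz_bounded_finite]) simp
  have "((\<lambda>u. pairing (W u) (schwartz_shift (t - u) \<phi>) - pairing (W s) (schwartz_shift (t - u) \<phi>)) \<longlongrightarrow> 0) ?F"
  proof (rule tendstoI)
    fix e :: real assume e: "0 < e"
    have "\<forall>\<^sub>F u in ?F. u \<in> {0..t}" by (auto simp: eventually_at_filter)
    with tendsto_temperedD[OF Ws B e]
    show "\<forall>\<^sub>F u in ?F. dist (pairing (W u) (schwartz_shift (t - u) \<phi>) - pairing (W s) (schwartz_shift (t - u) \<phi>)) 0 < e"
    proof eventually_elim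
      case (elim u)
      have "schwartz_shift (t - u) \<phi> \<in> ?B" using elim(2) t by (auto intro!: exI[of _ "t - u"])
      with elim(1) show ?case unfolding dist_real_def by auto
    qed
  qed
  moreover have "((\<lambda>u. pairing (W s) (schwartz_shift (t - u) \<phi>)) \<longlongrightarrow> pairing (W s) (schwartz_shift (t - s) \<phi>)) ?F"
    using continuous_on_pairing_shift_diff[of "{0..t}" "W s" t \<phi>] s unfolding continuous_on_def by blast
  ultimately have "((\<lambda>u. (pairing (W u) (schwartz_shift (t - u) \<phi>) - pairing (W s) (schwartz_shift (t - u) \<phi>))
      + pairing (W s) (schwartz_shift (t - u) \<phi>)) \<longlongrightarrow> 0 + pairing (W s) (schwartz_shift (t - s) \<phi>)) ?F"
    by (rule tendsto_add)
  then show "((\<lambda>s. pairing (W s) (schwartz_shift (t - s) \<phi>)) \<longlongrightarrow> pairing (W s) (schwartz_shift (t - s) \<phi>)) ?F"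
    by simp
qed

text \<open>Strong continuity makes the cross term of the product rule negligible.\<close>

lemma pairing_shift_path_derivative:
  assumes W: "(W \<longlongrightarrow> W s) (at s)"
    and D: "((\<lambda>u. pairing (W u) (schwartz_shift (t - s) \<phi>)) has_real_derivative d) (at s)"
  shows "((\<lambda>u. pairing (W u) (schwartz_shift (t - u) \<phi>)) has_real_derivative
    d + pairing (W s) (schwartz_shift (t - s) (schwartz_deriv \<phi>))) (at s)"
proof -
  let ?S = "\<lambda>u. schwartz_shift (t - u) \<phi>"
  let ?G = "\<lambda>u. pairing (W u - W s) (?S u - ?S s)"
  \<comment> \<open>By the mean value bound these difference quotients of shifts form a bounded set.
    The cross term divided by u - s is W u - W s evaluated on them, hence tends to 0.\<close>
  let ?B = "{(1 / (u - s)) *\<^sub>R (?S u - ?S s) |u. u \<noteq> s \<and> \<bar>u - s\<bar> \<le> 1}"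
  have B: "schwartz_bounded ?B"
    unfolding schwartz_bounded_norm
  proof
    fix p
    let ?c = "\<bar>t - s\<bar> + 1"
    have "schwartz_norm p ((1 / (u - s)) *\<^sub>R (?S u - ?S s)) \<le> shift_const ?c (Suc p) * schwartz_norm (Suc p) \<phi>"
      if u: "u \<noteq> s" "\<bar>u - s\<bar> \<le> 1" for u
    proof -
      have "schwartz_norm p ((1 / (u - s)) *\<^sub>R (?S u - ?S s)) \<le> \<bar>1 / (u - s)\<bar> * schwartz_norm p (?S u - ?S s)"
        by (rule schwartz_norm_scaleR_le)
      also have "\<dots> \<le> \<bar>1 / (u - s)\<bar> * (shift_const ?c (Suc p) * \<bar>(t - u) - (t - s)\<bar> * schwartz_norm (Suc p) \<phi>)"
        using u by (intro mult_left_mono schwartz_norm_shift_diff_le) auto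
      also have "\<dots> = shift_const ?c (Suc p) * schwartz_norm (Suc p) \<phi>"
        using u by (simp add: abs_minus_commute)
      finally show ?thesis .
    qed
    then show "\<exists>L. \<forall>\<psi>\<in>?B. schwartz_norm p \<psi> \<le> L" by blast
  qed
  have "((\<lambda>u. (?G u - ?G s) / (u - s)) \<longlongrightarrow> 0) (at s)"
  proof (rule tendstoI)
    fix e :: real assume e: "0 < e"
    have "\<forall>\<^sub>F u in at s. u \<noteq> s \<and> \<bar>u - s\<bar> \<le> 1"
      unfolding eventually_at by (rule exI[of _ 1]) (auto simp: dist_real_def)
    with tendsto_temperedD[OF W B e]
    show "\<forall>\<^sub>F u in at s. dist ((?G u - ?G s) / (u - s)) 0 < e"
    proof eventually_elim
      case (elim u)
      have "(1 / (u - s)) *\<^sub>R (?S u - ?S s) \<in> ?B" using elim(2) by blast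
      then have "\<bar>pairing (W u) ((1 / (u - s)) *\<^sub>R (?S u - ?S s)) - pairing (W s) ((1 / (u - s)) *\<^sub>R (?S u - ?S s))\<bar> < e"
        using elim(1) by blast
      moreover have "(?G u - ?G s) / (u - s)
          = pairing (W u) ((1 / (u - s)) *\<^sub>R (?S u - ?S s)) - pairing (W s) ((1 / (u - s)) *\<^sub>R (?S u - ?S s))"
        by (simp add: minus_tempered.rep_eq zero_tempered.rep_eq pairing_scaleR diff_divide_distrib)
      ultimately show ?case by (simp add: dist_real_def)
    qed
  qed
  then have 1: "(?G has_real_derivative 0) (at s)" by (simp add: has_field_derivative_iff)
  have "((-) t has_real_derivative - 1) (at s)" by (auto intro!: derivative_eq_intros)
  from DERIV_chain2[OF pairing_shift_has_derivative this, of "W s" \<phi>]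
  have 2: "((\<lambda>u. pairing (W s) (?S u)) has_real_derivative pairing (W s) (schwartz_shift (t - s) (schwartz_deriv \<phi>))) (at s)"
    by simp
  have "((\<lambda>u. ?G u + (pairing (W u) (?S s) + (pairing (W s) (?S u) - pairing (W s) (?S s)))) has_real_derivative
      0 + (d + (pairing (W s) (schwartz_shift (t - s) (schwartz_deriv \<phi>)) - 0))) (at s)"
    by (intro DERIV_add DERIV_diff 1 2 D DERIV_const)
  then show ?thesis by (simp add: minus_tempered.rep_eq pairing_diff)
qed

text \<open>The difference W of two solutions is paired with a test function transported backwards
  from time t: the derivative of <W_s, S_(t-s) \<phi>> in s is -<W_s, S_(t-s) \<phi>'> + <W_s,
  S_(t-s) \<phi>'> = 0. The pairing vanishes at s = 0 and equals <W_t, \<phi>> at s = t.\<close>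

lemma fluid_equation_unique:
  fixes x y :: "real \<Rightarrow> tempered"
  assumes x: "cadlag_on T x" and y: "cadlag_on T y"
    and xeq: "\<And>t \<phi>. t \<in> {0..T} \<Longrightarrow> pairing (x t) \<phi> = b t \<phi> - integral {0..t} (\<lambda>s. pairing (x s) (schwartz_deriv \<phi>))"
    and yeq: "\<And>t \<phi>. t \<in> {0..T} \<Longrightarrow> pairing (y t) \<phi> = b t \<phi> - integral {0..t} (\<lambda>s. pairing (y s) (schwartz_deriv \<phi>))"
    and t: "t \<in> {0..T}"
  shows "x t = y t"
proof -
  define W where "W s = x s - y s" for s
  have int: "(\<lambda>s. pairing (x s) \<phi>) integrable_on {0..u}" "(\<lambda>s. pairing (y s) \<phi>) integrable_on {0..u}"
    "(\<lambda>s. pairing (W s) \<phi>) integrable_on {0..u}" if "u \<le> T" for u \<phi>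
  proof -
    show *: "(\<lambda>s. pairing (x s) \<phi>) integrable_on {0..u}" "(\<lambda>s. pairing (y s) \<phi>) integrable_on {0..u}"
      using that by (auto intro!: step_approximable_integrable' cadlag_step_approximable cadlag_pairing x y)
    show "(\<lambda>s. pairing (W s) \<phi>) integrable_on {0..u}"
      using integrable_diff[OF *] by (simp add: W_def minus_tempered.rep_eq)
  qed
  have Weq: "pairing (W u) \<phi> = - integral {0..u} (\<lambda>s. pairing (W s) (schwartz_deriv \<phi>))" if u: "u \<in> {0..T}" for u \<phi>
  proof -
    have "integral {0..u} (\<lambda>s. pairing (W s) (schwartz_deriv \<phi>))
        = integral {0..u} (\<lambda>s. pairing (x s) (schwartz_deriv \<phi>)) - integral {0..u} (\<lambda>s. pairing (y s) (schwartz_deriv \<phi>))"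
      unfolding W_def minus_tempered.rep_eq using u by (intro integral_diff int) auto
    then show ?thesis using xeq[OF u, of \<phi>] yeq[OF u, of \<phi>] by (simp add: W_def minus_tempered.rep_eq)
  qed
  have Wcont: "continuous_on {0..T} (\<lambda>u. pairing (W u) \<phi>)" for \<phi>
  proof -
    have "continuous_on {0..T} (\<lambda>u. - integral {0..u} (\<lambda>s. pairing (W s) (schwartz_deriv \<phi>)))"
      by (intro continuous_on_minus indefinite_integral_continuous_1 int) simp
    then show ?thesis by (rule continuous_on_eq) (simp add: Weq)
  qed
  \<comment> \<open>The product rule needs strong continuity. Strong one-sided limits exist because
    x and y are cadlag, and the weak continuity given by the integral equation identifies the left
    limit with the value.\<close>
  have Wstrong: "(W \<longlongrightarrow> W s) (at s within {0..T})" if s: "s \<in> {0..T}" for s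
  proof -
    have right: "(W \<longlongrightarrow> W s) (at_right s)" if "s < T"
      unfolding W_def using x y s that unfolding cadlag_on_def by (intro tendsto_tempered_diff) auto
    have left: "(W \<longlongrightarrow> W s) (at_left s)" if "0 < s"
    proof -
      have "\<exists>l. (x \<longlongrightarrow> l) (at_left s)" "\<exists>l. (y \<longlongrightarrow> l) (at_left s)"
        using x y s that unfolding cadlag_on_def by auto
      then obtain k l where "(x \<longlongrightarrow> k) (at_left s)" "(y \<longlongrightarrow> l) (at_left s)" by blast
      then have lim: "(W \<longlongrightarrow> k - l) (at_left s)" unfolding W_def by (rule tendsto_tempered_diff)
      have "pairing (k - l) \<phi> = pairing (W s) \<phi>" for \<phi>
      proof (rule tendsto_unique[OF _ tendsto_pairing[OF lim]])
        have "((\<lambda>u. pairing (W u) \<phi>) \<longlongrightarrow> pairing (W s) \<phi>) (at s within {0..s})"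
          using Wcont[of \<phi>] s unfolding continuous_on_def by (intro tendsto_within_subset[where T="{0..s}" and S="{0..T}"]) auto
        then show "((\<lambda>u. pairing (W u) \<phi>) \<longlongrightarrow> pairing (W s) \<phi>) (at_left s)"
          using that by (simp add: at_within_Icc_at_left)
      qed simp
      then have "k - l = W s" by (rule tempered_eqI)
      then show ?thesis using lim by simp
    qed
    consider "0 < s" "s < T" | "s = 0" "0 < T" | "s = T" "0 < T" | "s = 0" "T = 0" using s by fastforce
    then show ?thesis
    proof cases
      case 1
      then show ?thesis using left right by (simp add: at_within_Icc_at filterlim_split_at)
    next
      case 2
      then show ?thesis using right by (simp add: at_within_Icc_at_right)
    next
      case 3
      then show ?thesis using left by (simp add: at_within_Icc_at_left)
    next
      case 4
      then have "at s within {0..T} = bot" by (simp add: at_within_eq_bot_iff)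
      then show ?thesis by simp
    qed
  qed
  have "pairing (W t) \<phi> = 0" for \<phi>
  proof (cases "t = 0")
    case True
    then show ?thesis using Weq[OF t, of \<phi>] by simp
  next
    case False
    let ?f = "\<lambda>s. pairing (W s) (schwartz_shift (t - s) \<phi>)"
    have "?f t = ?f 0"
    proof (rule DERIV_isconst_end[where f="?f"])
      show "0 < t" using False t by simp
      show "continuous_on {0..t} ?f" by (rule continuous_on_pairing_shift_path[OF Wstrong t])
      fix s assume s: "0 < s" "s < t"
      then have sT: "0 < s" "s < T" using t by auto
      have at: "at s within {0..T} = at s" using sT by (rule at_within_Icc_at)
      let ?\<psi> = "schwartz_shift (t - s) \<phi>"
      have "((\<lambda>u. integral {0..u} (\<lambda>v. pairing (W v) (schwartz_deriv ?\<psi>))) has_real_derivative pairing (W s) (schwartz_deriv ?\<psi>)) (at s)"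
        using integral_has_real_derivative[OF Wcont, of s "schwartz_deriv ?\<psi>"] sT unfolding at by simp
      then have "((\<lambda>u. - integral {0..u} (\<lambda>v. pairing (W v) (schwartz_deriv ?\<psi>))) has_real_derivative - pairing (W s) (schwartz_deriv ?\<psi>)) (at s)"
        by (rule DERIV_minus)
      then have "((\<lambda>u. pairing (W u) ?\<psi>) has_real_derivative - pairing (W s) (schwartz_deriv ?\<psi>)) (at s)"
        by (rule has_field_derivative_transform_within_open[where S="{0<..<T}"]) (use sT Weq in auto)
      moreover have "(W \<longlongrightarrow> W s) (at s)" using Wstrong[of s] sT unfolding at by simp
      ultimately show "(?f has_real_derivative 0) (at s)"
        using pairing_shift_path_derivative[of W s t \<phi>] by (fastforce simp: schwartz_shift_deriv)
    qed
    moreover have "?f 0 = 0" using Weq[of 0] t by simp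
    ultimately show ?thesis by (simp add: schwartz_shift_0)
  qed
  then have "W t = 0" by (intro tempered_eqI) (simp add: zero_tempered.rep_eq)
  then show ?thesis by (simp add: W_def)
qed

text \<open>Write s = l u, so that e' s is close to e u. A step of the approximation separates s
  from u only if its jump time lies between them, hence within \<open>\<eta>\<close> of s; this is
  where the windows come from.\<close>

lemma time_changed_step_difference:
  assumes l: "l \<in> time_changes T" "\<And>t. t \<in> {0..T} \<Longrightarrow> \<bar>l t - t\<bar> \<le> \<eta>"
    and g: "\<And>s. s \<in> {0..T} \<Longrightarrow> \<bar>e s - step_fun k a c s\<bar> \<le> \<epsilon>"
    and d: "\<And>t. t \<in> {0..T} \<Longrightarrow> \<bar>e t - e' (l t)\<bar> \<le> d" and s: "s \<in> {0..T}"
  shows "\<bar>e s - e' s\<bar> \<le> d + 2 * \<epsilon> + (\<Sum>i<k. \<bar>c i\<bar> * (if s \<in> {a i - \<eta>..a i + \<eta>} then 1 else 0))"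
proof -
  have "s \<in> l ` {0..T}" using s time_changesD(3)[OF l(1)] by simp
  then obtain u where u: "u \<in> {0..T}" "s = l u" by blast
  have "step_fun k a c s - step_fun k a c u = (\<Sum>i<k. c i * (heaviside (a i) s - heaviside (a i) u))"
    unfolding step_fun_def by (simp only: sum_subtractf right_diff_distrib)
  also have "\<bar>\<dots>\<bar> \<le> (\<Sum>i<k. \<bar>c i\<bar> * (if s \<in> {a i - \<eta>..a i + \<eta>} then 1 else 0))"
    by (rule order_trans[OF sum_abs], rule sum_mono, unfold abs_mult, rule mult_left_mono)
      (use l(2)[OF u(1)] u(2) in auto)
  finally have "\<bar>step_fun k a c s - step_fun k a c u\<bar> \<le> (\<Sum>i<k. \<bar>c i\<bar> * (if s \<in> {a i - \<eta>..a i + \<eta>} then 1 else 0))" .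
  moreover have "\<bar>e u - e' s\<bar> \<le> d" using d[OF u(1)] u(2) by simp
  ultimately show ?thesis using g[OF s] g[OF u(1)] by linarith
qed

lemma integral_window_le:
  fixes c \<eta> T :: real
  assumes "0 \<le> \<eta>"
  shows "(\<lambda>s. if s \<in> {c - \<eta>..c + \<eta>} then 1 else (0::real)) integrable_on {0..T}"
    "integral {0..T} (\<lambda>s. if s \<in> {c - \<eta>..c + \<eta>} then 1 else (0::real)) \<le> 2 * \<eta>"
proof -
  have i: "{c - \<eta>..c + \<eta>} \<inter> {0..T} = {max (c - \<eta>) 0..min (c + \<eta>) T}" by auto
  have "(\<lambda>_. 1::real) integrable_on {c - \<eta>..c + \<eta>} \<inter> {0..T}" unfolding i by (rule integrable_const_ivl)
  then show "(\<lambda>s. if s \<in> {c - \<eta>..c + \<eta>} then 1 else (0::real)) integrable_on {0..T}"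
    by (simp only: integrable_restrict_Int)
  have "integral {0..T} (\<lambda>s. if s \<in> {c - \<eta>..c + \<eta>} then 1 else (0::real)) = integral ({c - \<eta>..c + \<eta>} \<inter> {0..T}) (\<lambda>_. 1)"
    by (rule integral_restrict_Int)
  also have "\<dots> \<le> integral {c - \<eta>..c + \<eta>} (\<lambda>_. 1)"
    unfolding i by (intro integral_subset_le) auto
  also have "\<dots> = 2 * \<eta>" using assms by simp
  finally show "integral {0..T} (\<lambda>s. if s \<in> {c - \<eta>..c + \<eta>} then 1 else (0::real)) \<le> 2 * \<eta>" .
qed

text \<open>On a path r + e m this returns \<open>e t - e 0\<close> when <m, \<theta>> is nonzero.
  It makes sense for every path, so that a solution map can be defined on the whole Skorokhod
  space.\<close>

definition arrival_part :: "tempered \<Rightarrow> schwartz \<Rightarrow> (real \<Rightarrow> tempered) \<Rightarrow> real \<Rightarrow> real" where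
  "arrival_part m \<theta> x t = (pairing (x t) \<theta> - pairing (x 0) \<theta>) / pairing m \<theta>"

text \<open>The initial value \<open>x 0\<close> takes up the part of the input at time 0 that
  \<open>arrival_part\<close> subtracts.\<close>

definition fluid_map :: "real \<Rightarrow> tempered \<Rightarrow> schwartz \<Rightarrow> (real \<Rightarrow> tempered) \<Rightarrow> real \<Rightarrow> tempered" where
  "fluid_map T m \<theta> x = restrict (fluid_path m (x 0) (arrival_part m \<theta> x)) {0..T}"

lemma cadlag_arrival_part: "cadlag_on T x \<Longrightarrow> cadlag_on T (arrival_part m \<theta> x)"
  unfolding arrival_part_def[abs_def] by (intro cadlag_real_diff_scale cadlag_pairing)

lemma skorokhod_paths_cadlag: "x \<in> skorokhod_paths T \<Longrightarrow> cadlag_on T x"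
  unfolding skorokhod_paths_def by simp

lemma fluid_map_paths:
  assumes "x \<in> skorokhod_paths T"
  shows "fluid_map T m \<theta> x \<in> skorokhod_paths T"
  using cadlag_restrict[OF fluid_path_cadlag[OF cadlag_arrival_part[OF skorokhod_paths_cadlag[OF assms]]], of m "x 0" m \<theta>]
  unfolding skorokhod_paths_def fluid_map_def by simp

text \<open>One time change serves for input and output: it matches the jump terms, the remaining
  terms are Lipschitz in time, and inside the integral a displaced jump costs only the length of a
  short window. The order of choices matters: the step approximation of e is fixed by x, B and
  \<epsilon>, and \<delta> is then chosen in terms of its jumps.\<close>

lemma continuous_map_fluid_map:
  assumes T: "0 \<le> T" and m: "pairing m \<theta> \<noteq> 0"
  shows "continuous_map (skorokhod_topology T) (skorokhod_topology T) (fluid_map T m \<theta>)"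
proof (rule continuous_map_skorokhodI)
  fix x B and \<epsilon> :: real
  assume x: "x \<in> skorokhod_paths T" and B: "schwartz_bounded B" and \<epsilon>: "0 < \<epsilon>"
  define e where "e = arrival_part m \<theta> x"
  have sa: "step_approximable T (arrival_part m \<theta> y)" if "y \<in> skorokhod_paths T" for y
    by (intro cadlag_step_approximable cadlag_arrival_part skorokhod_paths_cadlag that)
  have e: "step_approximable T e" unfolding e_def by (rule sa[OF x])
  obtain K where K: "0 \<le> K"
    "\<And>\<phi> u. \<phi> \<in> B \<Longrightarrow> \<bar>u\<bar> \<le> T \<Longrightarrow> \<bar>pairing m (schwartz_shift u (schwartz_deriv \<phi>))\<bar> \<le> K"
    "\<And>\<phi> u v. \<phi> \<in> B \<Longrightarrow> \<bar>u\<bar> \<le> T \<Longrightarrow> \<bar>v\<bar> \<le> T \<Longrightarrow> \<bar>pairing m (schwartz_shift u (schwartz_deriv \<phi>))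
        - pairing m (schwartz_shift v (schwartz_deriv \<phi>))\<bar> \<le> K * \<bar>u - v\<bar>"
    "\<And>\<phi>. \<phi> \<in> B \<Longrightarrow> \<bar>pairing m \<phi>\<bar> \<le> K"
    "\<And>\<phi> u v. \<phi> \<in> B \<Longrightarrow> \<bar>u\<bar> \<le> T \<Longrightarrow> \<bar>v\<bar> \<le> T \<Longrightarrow>
      \<bar>pairing (x 0) (schwartz_shift u \<phi>) - pairing (x 0) (schwartz_shift v \<phi>)\<bar> \<le> K * \<bar>u - v\<bar>"
    by (fact fluid_bounds[OF B])
  obtain E where E: "0 \<le> E" "\<And>s. s \<in> {0..T} \<Longrightarrow> \<bar>e s\<bar> \<le> E"
    using step_approximable_bounded[OF e] by blast
  \<comment> \<open>The approximation error enters the majorant twice and so costs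
    \<open>K * T * (2 * \<epsilon>1)\<close>, which is allotted half of \<epsilon>.\<close>
  define \<epsilon>1 where "\<epsilon>1 = \<epsilon> / (4 * (K * T + 1))"
  have KT: "0 \<le> K * T" using K T by simp
  have \<epsilon>1: "0 < \<epsilon>1" using \<epsilon> KT by (simp add: \<epsilon>1_def)
  have \<epsilon>1K: "K * T * (2 * \<epsilon>1) \<le> \<epsilon> / 2"
    using KT \<epsilon> unfolding \<epsilon>1_def by (simp add: field_simps)
  obtain k :: nat and a c where a: "\<forall>i<k. 0 \<le> a i"
    and g: "\<forall>s\<in>{0..T}. \<bar>e s - step_fun k a c s\<bar> \<le> \<epsilon>1"
    using step_approximableD[OF e \<epsilon>1] by blast
  define S where "S = (\<Sum>i<k. \<bar>c i\<bar>)"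
  have S0: "0 \<le> S" by (simp add: S_def sum_nonneg)
  \<comment> \<open>The quotient has numerator 2 because \<open>arrival_part\<close> uses two
    pairings with \<theta>; the summand 1 lets the same q bound the difference of the initial
    values.\<close>
  define q where "q = 2 / \<bar>pairing m \<theta>\<bar> + 1"
  have q: "1 \<le> q" by (simp add: q_def)
  \<comment> \<open>The factor \<open>2 * T\<close> is the time displacement per unit of \<delta>,
    and S is the total jump size of the approximation, each jump with a window of length
    \<open>2 * \<eta>\<close>. The final 1 ensures C >= 1, so that the size of the time change is
    also covered.\<close>
  define C where "C = (K + E * K * (1 + T) + 2 * K * S) * (2 * T) + (1 + K + K * T) * q + 1"
  have C: "1 \<le> C" unfolding C_def using K E S0 T q by simp
  define \<delta> where "\<delta> = min 1 (\<epsilon> / (6 * C))"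
  have \<delta>: "0 < \<delta>" "\<delta> \<le> 1" unfolding \<delta>_def using \<epsilon> C by auto
  have C\<delta>: "C * \<delta> \<le> \<epsilon> / 6"
  proof -
    have "C * \<delta> \<le> C * (\<epsilon> / (6 * C))" unfolding \<delta>_def using C by (intro mult_left_mono) auto
    then show ?thesis using C by simp
  qed
  \<comment> \<open>\<theta> controls the arrival parts, the shifts of B control the transported
    initial values.\<close>
  define A where "A = insert \<theta> {schwartz_shift u \<phi> |u \<phi>. \<phi> \<in> B \<and> \<bar>u\<bar> \<le> T}"
  have A: "schwartz_bounded A"
    unfolding A_def using schwartz_bounded_Un[OF schwartz_bounded_finite[of "{\<theta>}"] schwartz_bounded_shift[OF B, of T]] by simp
  have "skorokhod_gauge T B (fluid_map T m \<theta> x) (fluid_map T m \<theta> y) < \<epsilon>"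
    if y: "y \<in> skorokhod_paths T" and dist: "skorokhod_gauge T A x y < \<delta>" for y
  proof -
    obtain l b f where l: "l \<in> time_changes T" "0 \<le> b" "0 \<le> f" "b + f < \<delta>" "time_change_size T l \<le> ennreal f"
      "\<And>t \<phi>. t \<in> {0..T} \<Longrightarrow> \<phi> \<in> A \<Longrightarrow> \<bar>pairing (x t) \<phi> - pairing (y (l t)) \<phi>\<bar> \<le> b"
      by (fact skorokhod_gauge_lessE[OF dist \<delta>(2)])
    have l0: "l 0 = 0" by (rule time_change_0[OF l(1) T])
    define e' where "e' = arrival_part m \<theta> y"
    have e': "step_approximable T e'" unfolding e'_def by (rule sa[OF y])
    define \<eta> where "\<eta> = T * (2 * \<delta>)"
    have \<eta>: "0 \<le> \<eta>" using T \<delta> by (simp add: \<eta>_def)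
    have lt: "\<bar>l t - t\<bar> \<le> \<eta>" if "t \<in> {0..T}" for t
    proof -
      have "\<bar>l t - t\<bar> \<le> T * (exp f - 1)" by (rule time_change_close[OF l(1,3,5) that])
      also have "exp f \<le> 1 + f + f\<^sup>2" using l \<delta> by (intro exp_bound) auto
      then have "exp f - 1 \<le> 2 * \<delta>"
        using l \<delta> mult_left_mono[of f 1 f] by (simp add: power2_eq_square)
      then have "T * (exp f - 1) \<le> \<eta>" unfolding \<eta>_def using T by (intro mult_left_mono)
      finally show ?thesis .
    qed
    have de: "\<bar>e t - e' (l t)\<bar> \<le> q * \<delta>" if t: "t \<in> {0..T}" for t
    proof -
      have "\<theta> \<in> A" by (simp add: A_def)
      then have "\<bar>pairing (x t) \<theta> - pairing (y (l t)) \<theta>\<bar> \<le> b" "\<bar>pairing (x 0) \<theta> - pairing (y 0) \<theta>\<bar> \<le> b"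
        using l(6)[OF t] l(6)[of 0] T l0 by auto
      then have *: "\<bar>(pairing (x t) \<theta> - pairing (x 0) \<theta>) - (pairing (y (l t)) \<theta> - pairing (y 0) \<theta>)\<bar> \<le> 2 * \<delta>"
        using l by linarith
      have "\<bar>e t - e' (l t)\<bar> = \<bar>(pairing (x t) \<theta> - pairing (x 0) \<theta>) - (pairing (y (l t)) \<theta> - pairing (y 0) \<theta>)\<bar> / \<bar>pairing m \<theta>\<bar>"
        unfolding e_def e'_def arrival_part_def diff_divide_distrib[symmetric] abs_divide ..
      also have "\<dots> \<le> 2 * \<delta> / \<bar>pairing m \<theta>\<bar>" using * by (intro divide_right_mono) auto
      also have "\<dots> \<le> q * \<delta>" using \<delta> by (simp add: q_def distrib_right)
      finally show ?thesis .
    qed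
    let ?D = "\<lambda>s. q * \<delta> + 2 * \<epsilon>1 + (\<Sum>i<k. \<bar>c i\<bar> * (if s \<in> {a i - \<eta>..a i + \<eta>} then 1 else 0))"
    have wi: "(\<lambda>s. \<bar>c i\<bar> * (if s \<in> {a i - \<eta>..a i + \<eta>} then 1 else 0)) integrable_on {0..T}" for i
      by (intro integrable_on_mult_right integral_window_le \<eta>)
    have Di: "(\<lambda>s. \<Sum>i<k. \<bar>c i\<bar> * (if s \<in> {a i - \<eta>..a i + \<eta>} then 1 else 0)) integrable_on {0..T}"
      by (intro integrable_sum wi) auto
    have Dint: "?D integrable_on {0..T}"
      by (intro integrable_add Di integrable_const_ivl)
    have "integral {0..T} ?D = integral {0..T} (\<lambda>_. q * \<delta> + 2 * \<epsilon>1)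
        + (\<Sum>i<k. \<bar>c i\<bar> * integral {0..T} (\<lambda>s. if s \<in> {a i - \<eta>..a i + \<eta>} then 1 else 0))"
      by (subst integral_add[OF integrable_const_ivl Di], subst integral_sum) (simp_all only: wi finite_lessThan integral_mult_right)
    also have "integral {0..T} (\<lambda>_. q * \<delta> + 2 * \<epsilon>1) = (q * \<delta> + 2 * \<epsilon>1) * T"
      using T by simp
    also have "(q * \<delta> + 2 * \<epsilon>1) * T + (\<Sum>i<k. \<bar>c i\<bar> * integral {0..T} (\<lambda>s. if s \<in> {a i - \<eta>..a i + \<eta>} then 1 else 0))
        \<le> (q * \<delta> + 2 * \<epsilon>1) * T + (\<Sum>i<k. \<bar>c i\<bar> * (2 * \<eta>))"
      by (intro add_left_mono sum_mono mult_left_mono integral_window_le \<eta>) auto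
    also have "\<dots> = (q * \<delta> + 2 * \<epsilon>1) * T + S * (2 * \<eta>)" by (simp add: S_def sum_distrib_right)
    finally have Dle: "integral {0..T} ?D \<le> (q * \<delta> + 2 * \<epsilon>1) * T + S * (2 * \<eta>)" .
    have "\<bar>pairing (fluid_path m (x 0) e t) \<phi> - pairing (fluid_path m (y 0) e' (l t)) \<phi>\<bar> \<le> C * \<delta> + \<epsilon> / 2"
      if t: "t \<in> {0..T}" and \<phi>: "\<phi> \<in> B" for t \<phi>
    proof -
      have lT: "l t \<in> {0..T}" by (rule time_change_mem[OF l(1) t])
      have \<phi>A: "schwartz_shift (l t) \<phi> \<in> A"
        unfolding A_def using lT \<phi> by (intro insertI2 CollectI exI[of _ "l t"] exI[of _ \<phi>]) auto
      have "\<bar>pairing (x 0) (schwartz_shift (l t) \<phi>) - pairing (y 0) (schwartz_shift (l t) \<phi>)\<bar> \<le> q * \<delta>"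
      proof -
        have "\<bar>pairing (x 0) (schwartz_shift (l t) \<phi>) - pairing (y 0) (schwartz_shift (l t) \<phi>)\<bar> \<le> b"
          using l(6)[of 0, OF _ \<phi>A] l0 T by simp
        also have "b \<le> 1 * \<delta>" using l by simp
        also have "\<dots> \<le> q * \<delta>" using q \<delta> by (intro mult_right_mono) auto
        finally show ?thesis .
      qed
      moreover have "\<bar>e s - e' s\<bar> \<le> ?D s" if "s \<in> {0..T}" for s
        by (rule time_changed_step_difference[where l=l and T=T]) (use l(1) lt g de that in auto)
      ultimately have "\<bar>pairing (fluid_path m (x 0) e t) \<phi> - pairing (fluid_path m (y 0) e' (l t)) \<phi>\<bar>
          \<le> (K + E * K * (1 + T)) * \<bar>t - l t\<bar> + (1 + K) * (q * \<delta>) + K * integral {0..T} ?D"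
        using e E K \<phi> t lT e' Dint de by (intro fluid_path_difference) auto
      also have "\<dots> \<le> (K + E * K * (1 + T)) * \<eta> + (1 + K) * (q * \<delta>) + K * ((q * \<delta> + 2 * \<epsilon>1) * T + S * (2 * \<eta>))"
        using lt[OF t] K E T by (intro add_mono mult_left_mono Dle order_refl) (auto simp: abs_minus_commute)
      also have "\<dots> = (C - 1) * \<delta> + K * T * (2 * \<epsilon>1)"
        unfolding \<eta>_def C_def by (simp add: algebra_simps)
      also have "\<dots> \<le> C * \<delta> + \<epsilon> / 2" using \<epsilon>1K \<delta> by (simp add: algebra_simps)
      finally show ?thesis .
    qed
    then have "skorokhod_gauge T B (fluid_map T m \<theta> x) (fluid_map T m \<theta> y) \<le> (C * \<delta> + \<epsilon> / 2) + f"
      using \<epsilon> C \<delta> time_change_mem[OF l(1)]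
      by (intro skorokhod_gauge_le[OF l(1) _ l(3,5)]) (auto simp: fluid_map_def e_def e'_def)
    also have "\<dots> \<le> (C * \<delta> + \<epsilon> / 2) + (C * \<delta> - b)"
    proof -
      have "1 * \<delta> \<le> C * \<delta>" using C \<delta> by (intro mult_right_mono) auto
      then show ?thesis using l by linarith
    qed
    finally show ?thesis using C\<delta> l \<epsilon> by linarith
  qed
  then show "\<exists>A d. schwartz_bounded A \<and> 0 < d \<and>
      (\<forall>y\<in>skorokhod_paths T. skorokhod_gauge T A x y < d \<longrightarrow>
        skorokhod_gauge T B (fluid_map T m \<theta> x) (fluid_map T m \<theta> y) < \<epsilon>)"
    using A \<delta>(1) by blast
qed (rule fluid_map_paths)

section \<open>Countable codes\<close>

lemma exists_schwartz_net:
  "\<exists>net :: nat \<Rightarrow> nat \<Rightarrow> schwartz list. \<forall>p j \<phi>. schwartz_norm (Suc p) \<phi> \<le> 1 \<longrightarrow>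
    (\<exists>\<psi>\<in>set (net p j). schwartz_norm p (\<phi> - \<psi>) < 1 / real (Suc j))"
proof -
  have "\<exists>xs. \<forall>\<phi>. schwartz_norm (Suc p) \<phi> \<le> 1 \<longrightarrow>
      (\<exists>\<psi>\<in>set xs. schwartz_norm p (\<phi> - \<psi>) < 1 / real (Suc j))" for p j
  proof -
    have "0 < 1 / real (Suc j)" by simp
    then obtain \<Phi> where \<Phi>: "finite \<Phi>" "\<forall>\<phi>. schwartz_norm (Suc p) \<phi> \<le> 1 \<longrightarrow>
        (\<exists>\<psi>\<in>\<Phi>. schwartz_norm p (\<phi> - \<psi>) < 1 / real (Suc j))"
      using schwartz_norm_totally_bounded[of "1 / real (Suc j)" p] by blast
    obtain xs where "set xs = \<Phi>" using finite_list[OF \<Phi>(1)] by blast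
    then show ?thesis using \<Phi>(2) by (intro exI[of _ xs]) simp
  qed
  then show ?thesis by (intro choice allI)
qed

lemma floor_eq_imp_close:
  fixes x y :: real
  assumes "\<lfloor>real (Suc j) * x\<rfloor> = \<lfloor>real (Suc j) * y\<rfloor>"
  shows "\<bar>x - y\<bar> \<le> 1 / real (Suc j)"
proof -
  have "\<bar>real (Suc j) * x - real (Suc j) * y\<bar> \<le> 1" using assms by linarith
  then have "real (Suc j) * \<bar>x - y\<bar> \<le> 1" by (simp only: right_diff_distrib[symmetric] abs_mult abs_of_nat)
  then show ?thesis by (simp add: field_simps)
qed

lemma exists_inverse_Suc_le:
  fixes c \<epsilon> :: real
  assumes "0 < \<epsilon>"
  shows "\<exists>j0. \<forall>j\<ge>j0. c / real (Suc j) \<le> \<epsilon>"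
proof -
  obtain j0 :: nat where j0: "\<bar>c\<bar> / \<epsilon> \<le> real j0" using real_arch_simple by blast
  have "c / real (Suc j) \<le> \<epsilon>" if "j0 \<le> j" for j
  proof -
    have "\<bar>c\<bar> / \<epsilon> \<le> real (Suc j)" using j0 that by simp
    then have "\<bar>c\<bar> \<le> \<epsilon> * real (Suc j)" using assms by (simp add: field_simps)
    then have "c \<le> \<epsilon> * real (Suc j)" by linarith
    then show ?thesis by (simp add: pos_divide_le_eq)
  qed
  then show ?thesis by blast
qed

text \<open>The code at precision j consists of an order and an integer bound for \<mu>, and of the
  rounded values of \<mu> on a finite net. Because order and bound are part of the code, two
  distributions with equal codes are controlled by the same norm, and closeness on the net extends
  to the unit ball of the next norm, which is totally bounded in the given one.\<close>

lemma tempered_codes: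
  "\<exists>c :: nat \<Rightarrow> tempered \<Rightarrow> nat. \<forall>\<mu> B \<epsilon>. schwartz_bounded B \<longrightarrow> 0 < \<epsilon> \<longrightarrow>
    (\<exists>j. \<forall>\<nu>. c j \<nu> = c j \<mu> \<longrightarrow> (\<forall>\<phi>\<in>B. \<bar>pairing \<mu> \<phi> - pairing \<nu> \<phi>\<bar> \<le> \<epsilon>))"
proof -
  obtain net :: "nat \<Rightarrow> nat \<Rightarrow> schwartz list" where
    net: "\<forall>p j \<phi>. schwartz_norm (Suc p) \<phi> \<le> 1 \<longrightarrow>
      (\<exists>\<psi>\<in>set (net p j). schwartz_norm p (\<phi> - \<psi>) < 1 / real (Suc j))"
    using exists_schwartz_net by blast
  have "\<exists>p C. \<forall>\<phi>. \<bar>pairing \<mu> \<phi>\<bar> \<le> real C * schwartz_norm p \<phi>" for \<mu>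
  proof -
    obtain p C where C: "\<forall>\<phi>. \<bar>pairing \<mu> \<phi>\<bar> \<le> C * schwartz_norm p \<phi>"
      using pairing_norm_bound[of \<mu>] by blast
    obtain n :: nat where "C \<le> real n" using real_arch_simple by blast
    then have "C * schwartz_norm p \<phi> \<le> real n * schwartz_norm p \<phi>" for \<phi>
      by (intro mult_right_mono schwartz_norm_nonneg)
    then show ?thesis using C order_trans by blast
  qed
  then obtain p C where pC: "\<And>\<mu> \<phi>. \<bar>pairing \<mu> \<phi>\<bar> \<le> real (C \<mu>) * schwartz_norm (p \<mu>) \<phi>" by metis
  define c where "c j \<mu> = to_nat (p \<mu>, C \<mu>, map (\<lambda>\<psi>. \<lfloor>real (Suc j) * pairing \<mu> \<psi>\<rfloor>) (net (p \<mu>) j))" for j \<mu>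
  have "\<exists>j. \<forall>\<nu>. c j \<nu> = c j \<mu> \<longrightarrow> (\<forall>\<phi>\<in>B. \<bar>pairing \<mu> \<phi> - pairing \<nu> \<phi>\<bar> \<le> \<epsilon>)"
    if B: "schwartz_bounded B" and \<epsilon>: "0 < \<epsilon>" for \<mu> B \<epsilon>
  proof -
    obtain L where L: "0 < L" "\<And>\<phi>. \<phi> \<in> B \<Longrightarrow> schwartz_norm (Suc (p \<mu>)) \<phi> \<le> L"
      using schwartz_bounded_obtain[OF B, of "Suc (p \<mu>)"] by blast
    \<comment> \<open>Passing to the net costs C / (j + 1) for each of the two distributions,
      rounding costs 1 / (j + 1), and L undoes the normalisation of \<phi>.\<close>
    obtain j where j: "(L * (2 * real (C \<mu>) + 1)) / real (Suc j) \<le> \<epsilon>"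
      using exists_inverse_Suc_le[OF \<epsilon>, of "L * (2 * real (C \<mu>) + 1)"] by blast
    have "\<bar>pairing \<mu> \<phi> - pairing \<nu> \<phi>\<bar> \<le> \<epsilon>" if eq: "c j \<nu> = c j \<mu>" and \<phi>: "\<phi> \<in> B" for \<nu> \<phi>
    proof -
      have codes: "p \<nu> = p \<mu>" "C \<nu> = C \<mu>"
        "map (\<lambda>\<psi>. \<lfloor>real (Suc j) * pairing \<nu> \<psi>\<rfloor>) (net (p \<nu>) j) = map (\<lambda>\<psi>. \<lfloor>real (Suc j) * pairing \<mu> \<psi>\<rfloor>) (net (p \<mu>) j)"
        using eq unfolding c_def to_nat_split prod.inject by blast+
      define \<phi>' where "\<phi>' = (1 / L) *\<^sub>R \<phi>"
      have \<phi>\<phi>': "\<phi> = L *\<^sub>R \<phi>'" using L by (simp add: \<phi>'_def)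
      have "schwartz_norm (Suc (p \<mu>)) \<phi>' \<le> \<bar>1 / L\<bar> * schwartz_norm (Suc (p \<mu>)) \<phi>"
        unfolding \<phi>'_def by (rule schwartz_norm_scaleR_le)
      also have "\<dots> \<le> \<bar>1 / L\<bar> * L" using L(2)[OF \<phi>] by (intro mult_left_mono) auto
      also have "\<dots> = 1" using L by simp
      finally obtain \<psi> where \<psi>: "\<psi> \<in> set (net (p \<mu>) j)" "schwartz_norm (p \<mu>) (\<phi>' - \<psi>) < 1 / real (Suc j)"
        using net by blast
      have "\<lfloor>real (Suc j) * pairing \<nu> \<psi>\<rfloor> = \<lfloor>real (Suc j) * pairing \<mu> \<psi>\<rfloor>"
        using codes(3) \<psi>(1) unfolding codes(1) by (simp only: map_eq_conv)
      then have 1: "\<bar>pairing \<nu> \<psi> - pairing \<mu> \<psi>\<bar> \<le> 1 / real (Suc j)" by (rule floor_eq_imp_close)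
      have bd: "\<bar>pairing \<kappa> (\<phi>' - \<psi>)\<bar> \<le> real (C \<mu>) * (1 / real (Suc j))" if "p \<kappa> = p \<mu>" "C \<kappa> = C \<mu>" for \<kappa>
        using pC[of \<kappa> "\<phi>' - \<psi>"] \<psi>(2) mult_left_mono[of "schwartz_norm (p \<mu>) (\<phi>' - \<psi>)" "1 / real (Suc j)" "real (C \<mu>)"]
        unfolding that by linarith
      have "\<bar>pairing \<mu> \<phi>' - pairing \<nu> \<phi>'\<bar> \<le> real (C \<mu>) * (1 / real (Suc j)) + real (C \<mu>) * (1 / real (Suc j)) + 1 / real (Suc j)"
        using 1 bd[of \<mu>] bd[of \<nu>] codes(1,2) unfolding pairing_diff by linarith
      also have "\<dots> = (2 * real (C \<mu>) + 1) / real (Suc j)" by (simp add: add_divide_distrib)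
      finally have "L * \<bar>pairing \<mu> \<phi>' - pairing \<nu> \<phi>'\<bar> \<le> L * ((2 * real (C \<mu>) + 1) / real (Suc j))"
        using L(1) by (intro mult_left_mono) auto
      moreover have "\<bar>pairing \<mu> \<phi> - pairing \<nu> \<phi>\<bar> = L * \<bar>pairing \<mu> \<phi>' - pairing \<nu> \<phi>'\<bar>"
        unfolding \<phi>\<phi>' pairing_scaleR right_diff_distrib[symmetric] abs_mult using L(1) by simp
      ultimately show ?thesis using j by simp
    qed
    then show ?thesis by blast
  qed
  then show ?thesis by blast
qed

text \<open>The indexed points may coincide, so the displacement is defined on their set of values
  through a chosen index, and \<open>tie\<close> makes it independent of the choice. With card I
  displacements of at most d, the condition on \<rho> becomes that of
  \<open>time_change_through_points\<close>.\<close>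

lemma time_change_of_close_points:
  fixes s s' :: "nat \<Rightarrow> real"
  assumes fin: "finite I" and zero: "i0 \<in> I" "s i0 = 0" "s' i0 = 0"
    and final: "i1 \<in> I" "s i1 = T" "s' i1 = T"
    and range: "\<And>i. i \<in> I \<Longrightarrow> s i \<in> {0..T}"
    and tie: "\<And>i j. i \<in> I \<Longrightarrow> j \<in> I \<Longrightarrow> s i = s j \<Longrightarrow> s' i = s' j"
    and gap: "0 < g" "\<And>i j. i \<in> I \<Longrightarrow> j \<in> I \<Longrightarrow> s i \<noteq> s j \<Longrightarrow> g \<le> \<bar>s i - s j\<bar>"
    and close: "\<And>i. i \<in> I \<Longrightarrow> \<bar>s i - s' i\<bar> \<le> d" and \<rho>: "real (card I) * d \<le> \<rho> * g" "\<rho> \<le> 1 / 2"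
  obtains l where "l \<in> time_changes T" "\<And>i. i \<in> I \<Longrightarrow> l (s i) = s' i" "time_change_size T l \<le> ennreal (2 * \<rho>)"
proof -
  define ix where "ix a = (SOME i. i \<in> I \<and> s i = a)" for a
  have ix: "ix (s i) \<in> I \<and> s (ix (s i)) = s i" if "i \<in> I" for i
    unfolding ix_def by (rule someI[of _ i]) (use that in simp)
  define b where "b a = s' (ix a)" for a
  have b: "b (s i) = s' i" if "i \<in> I" for i
    unfolding b_def using ix[OF that] that tie by blast
  have T: "0 \<le> T" using range[OF final(1)] by simp
  have d: "0 \<le> d" using close[OF final(1)] by linarith
  have "(\<Sum>a\<in>s ` I. \<bar>b a - a\<bar>) \<le> (\<Sum>a\<in>s ` I. d)"
    using b close by (intro sum_mono) (auto simp: abs_minus_commute)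
  also have "\<dots> \<le> real (card I) * d"
    using card_image_le[OF fin, of s] d by (simp add: mult_right_mono)
  finally have sum: "(\<Sum>a\<in>s ` I. \<bar>b a - a\<bar>) \<le> \<rho> * g" using \<rho>(1) by linarith
  have "\<exists>l. l \<in> time_changes T \<and> (\<forall>a\<in>s ` I. l a = b a) \<and> time_change_size T l \<le> ennreal (2 * \<rho>)"
  proof (rule time_change_through_points[of "s ` I" T g b \<rho>])
    show "finite (s ` I)" using fin by simp
    show "0 \<in> s ` I" "T \<in> s ` I" using zero final by (metis imageI)+
    show "b 0 = 0" "b T = T" using b[OF zero(1)] b[OF final(1)] zero final by simp_all
  qed (use T gap sum \<rho> in \<open>auto simp del: imageE\<close>)
  then obtain l where l: "l \<in> time_changes T" "\<forall>a\<in>s ` I. l a = b a" "time_change_size T l \<le> ennreal (2 * \<rho>)"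
    by (elim exE conjE)
  show ?thesis by (rule that[of l]) (use l b in auto)
qed

text \<open>The integer n serves as a precision: for positive c, rounding at scale 1 / (n + 1) moves
  a point by at most the fraction 1 / c of the smallest gap.\<close>

lemma osc_partition_gap:
  assumes p: "osc_partition x e T k t"
  obtains n :: nat where "\<And>i j. i \<le> k \<Longrightarrow> j \<le> k \<Longrightarrow> i \<noteq> j \<Longrightarrow> c / real (Suc n) \<le> \<bar>t i - t j\<bar>"
proof -
  define G where "G = {\<bar>t i - t j\<bar> |i j. i \<le> k \<and> j \<le> k \<and> i \<noteq> j}"
  have "G \<subseteq> (\<lambda>(i, j). \<bar>t i - t j\<bar>) ` ({..k} \<times> {..k})" unfolding G_def by auto
  then have fin: "finite G" by (rule finite_subset) simp
  have pos: "0 < x" if "x \<in> G" for x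
  proof -
    obtain i j where ij: "x = \<bar>t i - t j\<bar>" "i \<le> k" "j \<le> k" "i \<noteq> j" using \<open>x \<in> G\<close> unfolding G_def by blast
    then have "t i \<noteq> t j" 
      using osc_partition_mono(2)[OF p, of i j] osc_partition_mono(2)[OF p, of j i] by (cases "i < j") auto
    then show ?thesis using ij by simp
  qed
  define g where "g = Min (insert 1 G)"
  have g: "0 < g" unfolding g_def using fin pos by simp
  obtain n where n: "c / real (Suc n) \<le> g" using exists_inverse_Suc_le[OF g, of c] by blast
  show ?thesis
  proof (rule that[of n])
    fix i j assume "i \<le> k" "j \<le> k" "i \<noteq> j"
    then have "\<bar>t i - t j\<bar> \<in> G" unfolding G_def by blast
    then have "g \<le> \<bar>t i - t j\<bar>" unfolding g_def using fin by simp
    then show "c / real (Suc n) \<le> \<bar>t i - t j\<bar>" using n by linarith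
  qed
qed

text \<open>The code records the number of pieces of an oscillation partition, a precision adapted
  to its gaps, and the rounded partition points and values there. Equal codes give two partitions
  whose points are matched by a small time change. On matching pieces the functions differ by two
  oscillations and one rounding error.\<close>

lemma cadlag_codes:
  assumes T: "0 \<le> T"
  shows "\<exists>c :: nat \<Rightarrow> (real \<Rightarrow> real) \<Rightarrow> nat. \<forall>e \<epsilon>. cadlag_on T e \<longrightarrow> 0 < \<epsilon> \<longrightarrow>
    (\<exists>j. \<forall>e'. cadlag_on T e' \<longrightarrow> c j e' = c j e \<longrightarrow>
      (\<exists>l\<in>time_changes T. time_change_size T l \<le> ennreal \<epsilon> \<and> (\<forall>t\<in>{0..T}. \<bar>e t - e' (l t)\<bar> \<le> \<epsilon>)))"
proof -
  \<comment> \<open>Each of the k + 1 points is displaced by up to 1 / (n + 1); the gap condition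
    makes the total at most 1 / (j + 1) times the gap, as \<open>time_change_of_close_points\<close>
    requires.\<close>
  define ok where "ok j e = (\<lambda>(k, t, n). osc_partition e (1 / real (Suc j)) T k t \<and>
    (\<forall>i\<le>k. \<forall>i'\<le>k. i \<noteq> i' \<longrightarrow> real (Suc k * Suc j) / real (Suc n) \<le> \<bar>t i - t i'\<bar>))"
    for j e
  have "\<exists>ktn. ok j e ktn" if e: "cadlag_on T e" for j e
  proof -
    obtain k t where p: "osc_partition e (1 / real (Suc j)) T k t"
      using cadlag_osc_partition[OF e T, of "1 / real (Suc j)"] by auto
    obtain n :: nat where "\<And>i i'. i \<le> k \<Longrightarrow> i' \<le> k \<Longrightarrow> i \<noteq> i' \<Longrightarrow> real (Suc k * Suc j) / real (Suc n) \<le> \<bar>t i - t i'\<bar>"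
      by (fact osc_partition_gap[OF p])
    then have "ok j e (k, t, n)" using p unfolding ok_def by simp
    then show ?thesis by blast
  qed
  note ex = this
  define w where "w j e = (SOME ktn. ok j e ktn)" for j e
  have w: "ok j e (w j e)" if "cadlag_on T e" for j e
    unfolding w_def by (rule someI_ex[OF ex[OF that]])
  define K where "K j e = fst (w j e)" for j e
  define P where "P j e = fst (snd (w j e))" for j e
  define N where "N j e = snd (snd (w j e))" for j e
  have p: "osc_partition e (1 / real (Suc j)) T (K j e) (P j e)"
    and gap: "\<And>i i'. i \<le> K j e \<Longrightarrow> i' \<le> K j e \<Longrightarrow> i \<noteq> i' \<Longrightarrow>
        real (Suc (K j e) * Suc j) / real (Suc (N j e)) \<le> \<bar>P j e i - P j e i'\<bar>"
    if "cadlag_on T e" for j e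
    using w[OF that, of j] unfolding ok_def K_def P_def N_def by (auto split: prod.splits)
  define c where "c j e = to_nat (K j e, N j e, map (\<lambda>i. \<lfloor>real (Suc (N j e)) * P j e i\<rfloor>) [0..<Suc (K j e)],
    map (\<lambda>i. \<lfloor>real (Suc j) * e (P j e i)\<rfloor>) [0..<Suc (K j e)])" for j e
  have "\<exists>j. \<forall>e'. cadlag_on T e' \<longrightarrow> c j e' = c j e \<longrightarrow>
      (\<exists>l\<in>time_changes T. time_change_size T l \<le> ennreal \<epsilon> \<and> (\<forall>t\<in>{0..T}. \<bar>e t - e' (l t)\<bar> \<le> \<epsilon>))"
    if e: "cadlag_on T e" and \<epsilon>: "0 < \<epsilon>" for e \<epsilon>
  proof -
    \<comment> \<open>Three errors of size 1 / (j + 1) have to fit into \<epsilon>; the minimum with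
      1 also yields 1 / (j + 1) <= 1 / 2.\<close>
    obtain j where j: "3 / real (Suc j) \<le> min \<epsilon> 1"
      using exists_inverse_Suc_le[of "min \<epsilon> 1" 3] \<epsilon> by auto
    define k t n where "k = K j e" and "t = P j e" and "n = N j e"
    have tp: "osc_partition e (1 / real (Suc j)) T k t" unfolding k_def t_def by (rule p[OF e])
    have "\<exists>l\<in>time_changes T. time_change_size T l \<le> ennreal \<epsilon> \<and> (\<forall>t\<in>{0..T}. \<bar>e t - e' (l t)\<bar> \<le> \<epsilon>)"
      if e': "cadlag_on T e'" and eq: "c j e' = c j e" for e'
    proof -
      define t' where "t' = P j e'"
      have codes: "K j e' = k" "N j e' = n"
        "map (\<lambda>i. \<lfloor>real (Suc (N j e')) * P j e' i\<rfloor>) [0..<Suc (K j e')] = map (\<lambda>i. \<lfloor>real (Suc (N j e)) * P j e i\<rfloor>) [0..<Suc (K j e)]"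
        "map (\<lambda>i. \<lfloor>real (Suc j) * e' (P j e' i)\<rfloor>) [0..<Suc (K j e')] = map (\<lambda>i. \<lfloor>real (Suc j) * e (P j e i)\<rfloor>) [0..<Suc (K j e)]"
        using eq unfolding c_def k_def n_def to_nat_split prod.inject by blast+
      have tp': "osc_partition e' (1 / real (Suc j)) T k t'" using p[OF e', of j] unfolding codes t'_def .
      have tt': "\<bar>t i - t' i\<bar> \<le> 1 / real (Suc n)" and ee': "\<bar>e (t i) - e' (t' i)\<bar> \<le> 1 / real (Suc j)"
        if "i \<le> k" for i
      proof -
        have i: "i \<in> set [0..<Suc k]" using that by (auto simp: le_less)
        have "\<lfloor>real (Suc n) * t' i\<rfloor> = \<lfloor>real (Suc n) * t i\<rfloor>" "\<lfloor>real (Suc j) * e' (t' i)\<rfloor> = \<lfloor>real (Suc j) * e (t i)\<rfloor>"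
          using codes(3,4) i unfolding codes(1,2) t_def t'_def k_def[symmetric] n_def[symmetric] by (simp_all only: map_eq_conv)
        then show "\<bar>t i - t' i\<bar> \<le> 1 / real (Suc n)" "\<bar>e (t i) - e' (t' i)\<bar> \<le> 1 / real (Suc j)"
          using floor_eq_imp_close by (metis abs_minus_commute)+
      qed
      have inj: "t i = t i' \<longleftrightarrow> i = i'" if "i \<le> k" "i' \<le> k" for i i'
        using osc_partition_mono(2)[OF tp, of i i'] osc_partition_mono(2)[OF tp, of i' i] that
        by (cases i i' rule: linorder_cases) auto
      have ends: "t 0 = 0" "t k = T" "t' 0 = 0" "t' k = T" using tp tp' unfolding osc_partition_def by auto
      obtain l where l: "l \<in> time_changes T" "\<And>i. i \<in> {..k} \<Longrightarrow> l (t i) = t' i"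
        "time_change_size T l \<le> ennreal (2 * (1 / real (Suc j)))"
      proof (rule time_change_of_close_points[of "{..k}" 0 t t' k T "real (Suc k * Suc j) / real (Suc n)" "1 / real (Suc n)" "1 / real (Suc j)"])
        show "t i \<in> {0..T}" if "i \<in> {..k}" for i
          using osc_partition_mono(1)[OF tp, of 0 i] osc_partition_mono(1)[OF tp, of i k] that ends by auto
        show "real (Suc k * Suc j) / real (Suc n) \<le> \<bar>t i - t i'\<bar>" if "i \<in> {..k}" "i' \<in> {..k}" "t i \<noteq> t i'" for i i'
          using gap[OF e, of i j i'] that unfolding k_def t_def n_def by auto
        show "1 / real (Suc j) \<le> 1 / 2" using j by (simp add: field_simps)
        show "real (card {..k}) * (1 / real (Suc n)) \<le> 1 / real (Suc j) * (real (Suc k * Suc j) / real (Suc n))"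
          by (simp del: of_nat_Suc mult_Suc mult_Suc_right)
        show "0 < real (Suc k * Suc j) / real (Suc n)"
          by (intro divide_pos_pos) (simp_all only: of_nat_0_less_iff zero_less_Suc nat_0_less_mult_iff simp_thms)
      qed (use ends inj tt' in auto)
      have "\<bar>e u - e' (l u)\<bar> \<le> \<epsilon>" if u: "u \<in> {0..T}" for u
      proof (cases "u = T")
        case True
        then have "\<bar>e u - e' (l u)\<bar> \<le> 1 / real (Suc j)" using ee'[of k] l(2)[of k] ends by simp
        moreover have "1 / real (Suc j) \<le> 3 / real (Suc j)" by (intro divide_right_mono) auto
        ultimately show ?thesis using j by linarith
      next
        case False
        with u have "0 \<le> u" "u < T" by auto
        then obtain i where i: "i < k" "u \<in> {t i..<t (Suc i)}" using osc_partition_mem[OF tp, of u] by blast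
        have ti: "t i \<in> {0..T}" "t (Suc i) \<in> {0..T}"
          using osc_partition_mono(1)[OF tp, of 0 i] osc_partition_mono(1)[OF tp, of i "Suc i"]
            osc_partition_mono(1)[OF tp, of "Suc i" k] i ends by auto
        \<comment> \<open>The time change carries piece i of the partition for e into piece i of the
          partition for e'.\<close>
        have "l (t i) \<le> l u" "l u < l (t (Suc i))"
          using i time_change_less_iff[OF l(1)] ti u by auto
        then have "l u \<in> {t' i..<t' (Suc i)}" using l(2) i by auto
        moreover have "t' i \<in> {t' i..<t' (Suc i)}" "t i \<in> {t i..<t (Suc i)}"
          using i tp tp' unfolding osc_partition_def by auto
        ultimately have "\<bar>e u - e (t i)\<bar> < 1 / real (Suc j)" "\<bar>e' (t' i) - e' (l u)\<bar> < 1 / real (Suc j)"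
          using tp tp' i unfolding osc_partition_def by blast+
        moreover have "3 / real (Suc j) = 1 / real (Suc j) + 1 / real (Suc j) + 1 / real (Suc j)" by simp
        ultimately show ?thesis using ee'[of i] i j by linarith
      qed
      moreover have "time_change_size T l \<le> ennreal \<epsilon>"
        using l(3) by (rule order_trans) (use j in \<open>auto intro!: ennreal_leI simp: field_simps\<close>)
      ultimately show ?thesis using l(1) by blast
    qed
    then show ?thesis by blast
  qed
  then show ?thesis by blast
qed

text \<open>A path of this form is given by a distribution and a real cadlag function, so the two
  kinds of codes combine; \<open>prod_decode\<close> lets their precisions vary
  independently.\<close>

lemma skorokhod_codes:
  assumes T: "0 \<le> T"
  shows "\<exists>c :: nat \<Rightarrow> (real \<Rightarrow> tempered) \<Rightarrow> nat. \<forall>x B \<epsilon>. x \<in> skorokhod_paths T \<longrightarrow>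
    (\<forall>t\<in>{0..T}. x t = x 0 + arrival_part m \<theta> x t *\<^sub>R m) \<longrightarrow> schwartz_bounded B \<longrightarrow> 0 < \<epsilon> \<longrightarrow>
    (\<exists>j. \<forall>y\<in>skorokhod_paths T. (\<forall>t\<in>{0..T}. y t = y 0 + arrival_part m \<theta> y t *\<^sub>R m) \<longrightarrow>
      c j y = c j x \<longrightarrow> skorokhod_gauge T B x y < \<epsilon>)"
proof -
  obtain c1 :: "nat \<Rightarrow> tempered \<Rightarrow> nat" where
    c1: "\<forall>\<mu> B \<epsilon>. schwartz_bounded B \<longrightarrow> 0 < \<epsilon> \<longrightarrow>
    (\<exists>j. \<forall>\<nu>. c1 j \<nu> = c1 j \<mu> \<longrightarrow> (\<forall>\<phi>\<in>B. \<bar>pairing \<mu> \<phi> - pairing \<nu> \<phi>\<bar> \<le> \<epsilon>))"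
    using tempered_codes by blast
  obtain c2 :: "nat \<Rightarrow> (real \<Rightarrow> real) \<Rightarrow> nat" where
    c2: "\<forall>e \<epsilon>. cadlag_on T e \<longrightarrow> 0 < \<epsilon> \<longrightarrow>
    (\<exists>j. \<forall>e'. cadlag_on T e' \<longrightarrow> c2 j e' = c2 j e \<longrightarrow>
      (\<exists>l\<in>time_changes T. time_change_size T l \<le> ennreal \<epsilon> \<and> (\<forall>t\<in>{0..T}. \<bar>e t - e' (l t)\<bar> \<le> \<epsilon>)))"
    using cadlag_codes[OF T] by blast
  define c where "c j x = prod_encode (c1 (fst (prod_decode j)) (x 0), c2 (snd (prod_decode j)) (arrival_part m \<theta> x))" for j x
  have "\<exists>j. \<forall>y\<in>skorokhod_paths T. (\<forall>t\<in>{0..T}. y t = y 0 + arrival_part m \<theta> y t *\<^sub>R m) \<longrightarrow>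
      c j y = c j x \<longrightarrow> skorokhod_gauge T B x y < \<epsilon>"
    if x: "x \<in> skorokhod_paths T" and xt: "\<forall>t\<in>{0..T}. x t = x 0 + arrival_part m \<theta> x t *\<^sub>R m"
      and B: "schwartz_bounded B" and \<epsilon>: "0 < \<epsilon>" for x B and \<epsilon> :: real
  proof -
    obtain K where K: "0 \<le> K" "\<And>\<phi> u. \<phi> \<in> B \<Longrightarrow> \<bar>u\<bar> \<le> 0 \<Longrightarrow> \<bar>pairing m (schwartz_shift u \<phi>)\<bar> \<le> K"
      using pairing_shift_bounded[OF B, of 0 m] by blast
    have K': "\<bar>pairing m \<phi>\<bar> \<le> K" if "\<phi> \<in> B" for \<phi> using K(2)[OF that, of 0] by (simp add: schwartz_shift_0)
    define \<delta> where "\<delta> = \<epsilon> / (K + 3)"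
    have \<delta>: "0 < \<delta>" using \<epsilon> K by (simp add: \<delta>_def)
    have \<delta>K: "\<delta> + \<delta> * K + \<delta> < \<epsilon>"
    proof -
      have "\<epsilon> = \<delta> * (K + 3)" using K by (simp add: \<delta>_def)
      then show ?thesis using \<delta> by (simp add: algebra_simps)
    qed
    obtain j1 where j1: "\<forall>\<nu>. c1 j1 \<nu> = c1 j1 (x 0) \<longrightarrow> (\<forall>\<phi>\<in>B. \<bar>pairing (x 0) \<phi> - pairing \<nu> \<phi>\<bar> \<le> \<delta>)"
      using c1 B \<delta> by blast
    have "cadlag_on T (arrival_part m \<theta> x)" by (intro cadlag_arrival_part skorokhod_paths_cadlag x)
    then obtain j2 where j2: "\<forall>e'. cadlag_on T e' \<longrightarrow> c2 j2 e' = c2 j2 (arrival_part m \<theta> x) \<longrightarrow>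
      (\<exists>l\<in>time_changes T. time_change_size T l \<le> ennreal \<delta> \<and> (\<forall>t\<in>{0..T}. \<bar>arrival_part m \<theta> x t - e' (l t)\<bar> \<le> \<delta>))"
      using c2 \<delta> by blast
    have "skorokhod_gauge T B x y < \<epsilon>" if y: "y \<in> skorokhod_paths T"
      and yt: "\<forall>t\<in>{0..T}. y t = y 0 + arrival_part m \<theta> y t *\<^sub>R m"
      and eq: "c (prod_encode (j1, j2)) y = c (prod_encode (j1, j2)) x" for y
    proof -
      have eq': "c1 j1 (y 0) = c1 j1 (x 0)" "c2 j2 (arrival_part m \<theta> y) = c2 j2 (arrival_part m \<theta> x)"
        using eq unfolding c_def by (simp_all add: prod_encode_eq)
      have "cadlag_on T (arrival_part m \<theta> y)" by (intro cadlag_arrival_part skorokhod_paths_cadlag y)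
      then obtain l where l: "l \<in> time_changes T" "time_change_size T l \<le> ennreal \<delta>"
        "\<forall>t\<in>{0..T}. \<bar>arrival_part m \<theta> x t - arrival_part m \<theta> y (l t)\<bar> \<le> \<delta>"
        using j2 eq'(2) by blast
      have "skorokhod_gauge T B x y \<le> (\<delta> + \<delta> * K) + \<delta>"
      proof (rule skorokhod_gauge_le[OF l(1) _ _ l(2)])
        fix t \<phi> assume t: "t \<in> {0..T}" and \<phi>: "\<phi> \<in> B"
        have "pairing (x t) \<phi> = pairing (x 0) \<phi> + arrival_part m \<theta> x t * pairing m \<phi>"
          using xt t by (metis plus_tempered.rep_eq scaleR_tempered.rep_eq)
        moreover have "pairing (y (l t)) \<phi> = pairing (y 0) \<phi> + arrival_part m \<theta> y (l t) * pairing m \<phi>"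
          using yt time_change_mem[OF l(1) t] by (metis plus_tempered.rep_eq scaleR_tempered.rep_eq)
        moreover have "\<bar>(arrival_part m \<theta> x t - arrival_part m \<theta> y (l t)) * pairing m \<phi>\<bar> \<le> \<delta> * K"
          unfolding abs_mult using l(3) t \<delta> K' \<phi> by (intro mult_mono) auto
        moreover have "\<bar>pairing (x 0) \<phi> - pairing (y 0) \<phi>\<bar> \<le> \<delta>" using j1 eq'(1) \<phi> by blast
        ultimately show "\<bar>pairing (x t) \<phi> - pairing (y (l t)) \<phi>\<bar> \<le> \<delta> + \<delta> * K"
          by (simp add: left_diff_distrib abs_le_iff)
      qed (use \<delta> K in auto)
      then show ?thesis using \<delta>K by linarith
    qed
    then show ?thesis by blast
  qed
  then show ?thesis by blast
qed

section \<open>Measurability\<close>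

text \<open>The preimage of an open set is the union of those sets {c j = v} that it contains, and
  there are only countably many pairs (j, v).\<close>

lemma measurable_borel_of_top_codes:
  fixes c :: "nat \<Rightarrow> 'a \<Rightarrow> nat"
  assumes Y: "\<And>\<omega>. \<omega> \<in> space M \<Longrightarrow> Y \<omega> \<in> topspace X"
    and c: "\<And>j. c j \<in> measurable M (count_space UNIV)"
    and sep: "\<And>\<omega> U. \<omega> \<in> space M \<Longrightarrow> openin X U \<Longrightarrow> Y \<omega> \<in> U \<Longrightarrow>
      \<exists>j. \<forall>\<omega>'\<in>space M. c j \<omega>' = c j \<omega> \<longrightarrow> Y \<omega>' \<in> U"
  shows "Y \<in> measurable M (borel_of_top X)"
  unfolding borel_of_top_def
proof (rule measurable_measure_of)
  show "{U. openin X U} \<subseteq> Pow (topspace X)" using openin_subset by blast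
  show "Y \<in> space M \<rightarrow> topspace X" using Y by blast
  fix U assume "U \<in> {U. openin X U}"
  then have U: "openin X U" by simp
  define I where "I = {(j, v). \<forall>\<omega>'\<in>space M. c j \<omega>' = v \<longrightarrow> Y \<omega>' \<in> U}"
  have "Y -` U \<inter> space M = (\<Union>(j, v)\<in>I. c j -` {v} \<inter> space M)"
  proof
    show "Y -` U \<inter> space M \<subseteq> (\<Union>(j, v)\<in>I. c j -` {v} \<inter> space M)"
    proof
      fix \<omega> assume \<omega>: "\<omega> \<in> Y -` U \<inter> space M"
      then obtain j where "\<forall>\<omega>'\<in>space M. c j \<omega>' = c j \<omega> \<longrightarrow> Y \<omega>' \<in> U" using sep[of \<omega> U] U by auto
      then have "(j, c j \<omega>) \<in> I" unfolding I_def by simp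
      then show "\<omega> \<in> (\<Union>(j, v)\<in>I. c j -` {v} \<inter> space M)" using \<omega> by (intro UN_I) auto
    qed
  qed (auto simp: I_def)
  also have "\<dots> \<in> sets M"
    using c by (intro sets.countable_UN') (auto intro: measurable_sets)
  finally show "Y -` U \<inter> space M \<in> sets M" .
qed

lemma measurable_map_count_space:
  fixes f :: "nat \<Rightarrow> 'a \<Rightarrow> 'b::countable"
  assumes f: "\<And>i. i \<in> set xs \<Longrightarrow> f i \<in> measurable M (count_space UNIV)"
  shows "(\<lambda>\<omega>. map (\<lambda>i. f i \<omega>) xs) \<in> measurable M (count_space UNIV)"
  using f
proof (induction xs)
  case (Cons x xs)
  then have "(\<lambda>\<omega>. map (\<lambda>i. f i \<omega>) xs) \<in> measurable M (count_space UNIV)" "f x \<in> measurable M (count_space UNIV)" by auto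
  then have "(\<lambda>\<omega>. f x \<omega> # map (\<lambda>i. f i \<omega>) xs) \<in> measurable M (count_space UNIV)"
    by (intro measurable_compose_countable[of "\<lambda>a \<omega>. a # map (\<lambda>i. f i \<omega>) xs" M "count_space UNIV" "f x"]
        measurable_compose[of _ M "count_space UNIV" "(#) a" for a]) auto
  then show ?case by simp
qed simp

lemma measurable_Pair_count_space:
  fixes f :: "'a \<Rightarrow> 'b::countable" and g :: "'a \<Rightarrow> 'c::countable"
  assumes "f \<in> measurable M (count_space UNIV)" "g \<in> measurable M (count_space UNIV)"
  shows "(\<lambda>\<omega>. (f \<omega>, g \<omega>)) \<in> measurable M (count_space UNIV)"
  by (rule measurable_compose_countable[OF _ assms(1)], rule measurable_compose[OF assms(2)]) simp

section \<open>Paths generated by finitely many customers\<close>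

definition dirac_dist :: "real \<Rightarrow> tempered" where
  "dirac_dist a = Abs_tempered (\<lambda>\<phi>. sfun \<phi> a)"

lemma pairing_dirac_dist: "pairing (dirac_dist a) \<phi> = sfun \<phi> a"
proof -
  have "linear (\<lambda>\<phi>. sfun \<phi> a)"
    by (rule linearI) (simp_all add: plus_schwartz.rep_eq scaleR_schwartz.rep_eq)
  moreover have "\<bar>sfun \<phi> a\<bar> \<le> 1 * schwartz_norm 0 \<phi>" for \<phi>
    using sderiv_le_norm[of 0 0 \<phi> a] by simp
  ultimately have "pairing (Abs_tempered (\<lambda>\<phi>. sfun \<phi> a)) = (\<lambda>\<phi>. sfun \<phi> a)" by (rule pairing_Abs_tempered)
  then show ?thesis unfolding dirac_dist_def by simp
qed

text \<open>The state at time \<open>t\<close> produced by \<open>n\<close> customers of weight \<open>w\<close>, the \<open>i\<close>-th arriving at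
  \<open>a i\<close> with service time \<open>s i\<close>.\<close>

definition customer_path :: "real \<Rightarrow> nat \<Rightarrow> (nat \<Rightarrow> real) \<Rightarrow> (nat \<Rightarrow> real) \<Rightarrow> real \<Rightarrow> tempered" where
  "customer_path w n a s t = Abs_tempered (\<lambda>\<phi>. w * (\<Sum>i<n. heaviside (a i) t * sfun \<phi> (s i - (t - a i))))"

lemma pairing_customer_path:
  "pairing (customer_path w n a s t) \<phi> = w * (\<Sum>i<n. heaviside (a i) t * sfun \<phi> (s i - (t - a i)))"
proof -
  let ?f = "\<lambda>\<phi>. w * (\<Sum>i<n. heaviside (a i) t * sfun \<phi> (s i - (t - a i)))"
  have "linear ?f"
  proof (rule linearI)
    show "?f (\<phi> + \<psi>) = ?f \<phi> + ?f \<psi>" for \<phi> \<psi>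
      unfolding plus_schwartz.rep_eq distrib_left sum.distrib ..
    show "?f (c *\<^sub>R \<phi>) = c *\<^sub>R ?f \<phi>" for c \<phi>
      unfolding scaleR_schwartz.rep_eq real_scaleR_def sum_distrib_left
      by (rule sum.cong[OF refl]) (simp only: mult_ac)
  qed
  moreover have "\<bar>?f \<phi>\<bar> \<le> (\<bar>w\<bar> * real n) * schwartz_norm 0 \<phi>" for \<phi>
  proof -
    have "\<bar>\<Sum>i<n. heaviside (a i) t * sfun \<phi> (s i - (t - a i))\<bar> \<le> (\<Sum>i<n. schwartz_norm 0 \<phi>)"
      using sderiv_le_norm[of 0 0 \<phi>] schwartz_norm_nonneg[of 0 \<phi>]
      by (intro order_trans[OF sum_abs] sum_mono) (auto simp: abs_mult)
    then show ?thesis unfolding abs_mult mult.assoc by (intro mult_left_mono) auto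
  qed
  ultimately have "pairing (Abs_tempered ?f) = ?f" by (rule pairing_Abs_tempered)
  then show ?thesis unfolding customer_path_def by (simp only:)
qed

lemma tendsto_tempered_add_scale:
  fixes x y :: "'a \<Rightarrow> tempered"
  assumes "(x \<longlongrightarrow> a) G" "(y \<longlongrightarrow> b) G"
  shows "((\<lambda>t. x t + w *\<^sub>R y t) \<longlongrightarrow> a + w *\<^sub>R b) G"
proof (rule tendsto_temperedI)
  fix B :: "schwartz set" and e :: real assume B: "schwartz_bounded B" and e: "0 < e"
  have "0 < e / (2 * (\<bar>w\<bar> + 1))" using e by simp
  from tendsto_temperedD[OF assms(1) B, of "e / 2"] tendsto_temperedD[OF assms(2) B this] e
  have "\<forall>\<^sub>F t in G. \<forall>\<phi>\<in>B. \<bar>pairing (x t) \<phi> - pairing a \<phi>\<bar> < e / 2"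
    "\<forall>\<^sub>F t in G. \<forall>\<phi>\<in>B. \<bar>pairing (y t) \<phi> - pairing b \<phi>\<bar> < e / (2 * (\<bar>w\<bar> + 1))" by simp_all
  then show "\<forall>\<^sub>F t in G. \<forall>\<phi>\<in>B. \<bar>pairing (x t + w *\<^sub>R y t) \<phi> - pairing (a + w *\<^sub>R b) \<phi>\<bar> \<le> e"
  proof eventually_elim
    case (elim t)
    show ?case
    proof
      fix \<phi> assume "\<phi> \<in> B"
      then have 1: "\<bar>pairing (x t) \<phi> - pairing a \<phi>\<bar> < e / 2"
        and 2: "\<bar>pairing (y t) \<phi> - pairing b \<phi>\<bar> < e / (2 * (\<bar>w\<bar> + 1))"
        using elim by auto
      have "\<bar>w * (pairing (y t) \<phi> - pairing b \<phi>)\<bar> \<le> (\<bar>w\<bar> + 1) * (e / (2 * (\<bar>w\<bar> + 1)))"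
        unfolding abs_mult using 2 by (intro mult_mono) auto
      also have "\<dots> = e / 2" by (simp add: field_simps)
      finally have "\<bar>w * (pairing (y t) \<phi> - pairing b \<phi>)\<bar> \<le> e / 2" .
      then show "\<bar>pairing (x t + w *\<^sub>R y t) \<phi> - pairing (a + w *\<^sub>R b) \<phi>\<bar> \<le> e"
        unfolding plus_tempered.rep_eq scaleR_tempered.rep_eq using 1 unfolding right_diff_distrib by linarith
    qed
  qed
qed

lemma cadlag_tempered_add_scale:
  fixes x y :: "real \<Rightarrow> tempered"
  assumes "cadlag_on T x" "cadlag_on T y"
  shows "cadlag_on T (\<lambda>t. x t + w *\<^sub>R y t)"
proof (rule cadlag_onI)
  fix t assume "0 \<le> t" "t < T"
  then show "((\<lambda>t. x t + w *\<^sub>R y t) \<longlongrightarrow> x t + w *\<^sub>R y t) (at_right t)"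
    using assms unfolding cadlag_on_def by (intro tendsto_tempered_add_scale) simp_all
next
  fix t assume "0 < t" "t \<le> T"
  then have t: "t \<in> {0<..T}" by simp
  obtain k where k: "(x \<longlongrightarrow> k) (at_left t)"
    using bspec[OF conjunct2[OF assms(1)[unfolded cadlag_on_def]] t] by (rule exE)
  obtain l where l: "(y \<longlongrightarrow> l) (at_left t)"
    using bspec[OF conjunct2[OF assms(2)[unfolded cadlag_on_def]] t] by (rule exE)
  from tendsto_tempered_add_scale[OF k l, of w]
  show "\<exists>l. ((\<lambda>t. x t + w *\<^sub>R y t) \<longlongrightarrow> l) (at_left t)" by (rule exI)
qed

lemma heaviside_tendsto_right: "(heaviside a \<longlongrightarrow> heaviside a t) (at_right t)"
proof -
  have "\<forall>\<^sub>F s in at_right t. heaviside a s = heaviside a t"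
  proof (cases "a \<le> t")
    case True
    then show ?thesis using eventually_at_right_less[of t] by (auto elim!: eventually_mono)
  next
    case False
    then show ?thesis using eventually_at_right_real[of t a] by (auto elim!: eventually_mono)
  qed
  then show ?thesis by (rule tendsto_eventually)
qed

lemma cadlag_heaviside: "cadlag_on T (heaviside a)"
proof (rule cadlag_onI)
  fix t :: real
  show "(heaviside a \<longlongrightarrow> heaviside a t) (at_right t)" by (rule heaviside_tendsto_right)
next
  fix t :: real
  show "\<exists>l. (heaviside a \<longlongrightarrow> l) (at_left t)"
  proof (cases "a < t")
    case True
    then have "\<forall>\<^sub>F s in at_left t. heaviside a s = 1"
      using eventually_at_left_real[of a t] by (auto elim!: eventually_mono)
    then show ?thesis by (intro exI[of _ 1] tendsto_eventually)
  next
    case False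
    then have "\<forall>\<^sub>F s in at_left t. heaviside a s = 0"
      using eventually_at_left_real[of "t - 1" t] by (auto elim!: eventually_mono)
    then show ?thesis by (intro exI[of _ 0] tendsto_eventually)
  qed
qed

text \<open>On [0, T] a single customer is a fluid path with a Dirac mass as its initial and jump
  direction replaced by one unit step, so its regularity is known from
  \<open>fluid_path_cadlag\<close>; customers are added one at a time.\<close>

lemma cadlag_customer_path:
  assumes "\<And>i. i < n \<Longrightarrow> 0 \<le> a i"
  shows "cadlag_on T (customer_path w n a s)"
proof -
  \<comment> \<open>The identification with fluid paths is made only at times in [0, T], hence the
    induction runs over restrictions.\<close>
  have "cadlag_on T (restrict (customer_path w n a s) {0..T})"
    using assms
  proof (induction n)
    case 0
    have "customer_path w 0 a s = (\<lambda>_. 0)"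
      by (rule ext, rule tempered_eqI) (simp add: pairing_customer_path zero_tempered.rep_eq)
    then show ?case by (intro cadlag_restrict) (auto simp: cadlag_on_def intro: tendsto_const)
  next
    case (Suc n)
    have "cadlag_on T (fluid_path (dirac_dist (s n)) 0 (step_fun 1 (\<lambda>_. a n) (\<lambda>_. 1)))"
      using cadlag_heaviside[of T "a n"] by (intro fluid_path_cadlag) (simp add: step_fun_def[abs_def])
    from cadlag_tempered_add_scale[OF Suc.IH this, of w]
    have "cadlag_on T (restrict (\<lambda>t. restrict (customer_path w n a s) {0..T} t
        + w *\<^sub>R fluid_path (dirac_dist (s n)) 0 (step_fun 1 (\<lambda>_. a n) (\<lambda>_. 1)) t) {0..T})"
      using Suc.prems by (intro cadlag_restrict) simp
    also have "restrict (\<lambda>t. restrict (customer_path w n a s) {0..T} t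
        + w *\<^sub>R fluid_path (dirac_dist (s n)) 0 (step_fun 1 (\<lambda>_. a n) (\<lambda>_. 1)) t) {0..T}
        = restrict (customer_path w (Suc n) a s) {0..T}"
    proof (rule restrict_ext, rule tempered_eqI)
      fix t \<phi> assume t: "t \<in> {0..T}"
      have "pairing (fluid_path (dirac_dist (s n)) 0 (step_fun 1 (\<lambda>_. a n) (\<lambda>_. 1)) t) \<phi>
          = heaviside (a n) t * sfun \<phi> (s n - (t - a n))"
        using pairing_fluid_path_step[of 1 "\<lambda>_. a n" t "dirac_dist (s n)" 0 "\<lambda>_. 1" \<phi>] Suc.prems t
        by (simp add: zero_tempered.rep_eq pairing_dirac_dist schwartz_shift.rep_eq)
      then show "pairing (restrict (customer_path w n a s) {0..T} t
        + w *\<^sub>R fluid_path (dirac_dist (s n)) 0 (step_fun 1 (\<lambda>_. a n) (\<lambda>_. 1)) t) \<phi>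
        = pairing (customer_path w (Suc n) a s t) \<phi>"
        using t by (simp add: plus_tempered.rep_eq scaleR_tempered.rep_eq pairing_customer_path distrib_left)
    qed
    finally show ?case .
  qed
  then have c: "cadlag_on T (restrict (customer_path w n a s) {0..T})" .
  show ?thesis
  proof (rule cadlag_onI)
    fix t assume t: "0 \<le> t" "t < T"
    have "\<forall>\<^sub>F u in at_right t. restrict (customer_path w n a s) {0..T} u = customer_path w n a s u"
      using eventually_at_right_real[of t T] t by (auto elim!: eventually_mono)
    moreover have "(restrict (customer_path w n a s) {0..T} \<longlongrightarrow> restrict (customer_path w n a s) {0..T} t) (at_right t)"
      using bspec[OF conjunct1[OF c[unfolded cadlag_on_def]], of t] t by simp
    ultimately show "(customer_path w n a s \<longlongrightarrow> customer_path w n a s t) (at_right t)"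
      using t by (subst (asm) tendsto_cong) simp_all
  next
    fix t assume t: "0 < t" "t \<le> T"
    have "\<forall>\<^sub>F u in at_left t. restrict (customer_path w n a s) {0..T} u = customer_path w n a s u"
      using eventually_at_left_real[of 0 t] t by (auto elim!: eventually_mono)
    moreover have "\<exists>l. (restrict (customer_path w n a s) {0..T} \<longlongrightarrow> l) (at_left t)"
      using bspec[OF conjunct2[OF c[unfolded cadlag_on_def]], of t] t by simp
    ultimately show "\<exists>l. (customer_path w n a s \<longlongrightarrow> l) (at_left t)"
      by (simp cong: tendsto_cong)
  qed
qed

text \<open>On each set of sample points where the number of customers and the pattern of ties among
  \<open>0\<close>, \<open>T\<close> and the arrival times are fixed, the path depends continuously on the arrival and service
  times; there are countably many such sets. The function \<open>tie_point\<close> lists \<open>0\<close>, \<open>T\<close> and the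
  arrival times.\<close>

definition tie_point :: "real \<Rightarrow> (nat \<Rightarrow> real) \<Rightarrow> nat \<Rightarrow> real" where
  "tie_point T a i = (if i = 0 then 0 else if i = 1 then T else a (i - 2))"

text \<open>The last list is the (n + 2) by (n + 2) table of ties, written row by row.\<close>

definition customer_code :: "real \<Rightarrow> nat \<Rightarrow> nat \<Rightarrow> (nat \<Rightarrow> real) \<Rightarrow> (nat \<Rightarrow> real) \<Rightarrow> nat" where
  "customer_code T j n a s = to_nat (n,
     map (\<lambda>i. \<lfloor>real (Suc j) * a i\<rfloor>) [0..<n], map (\<lambda>i. \<lfloor>real (Suc j) * s i\<rfloor>) [0..<n],
     map (\<lambda>i. tie_point T a (i div (n + 2)) = tie_point T a (i mod (n + 2))) [0..<(n + 2) * (n + 2)])"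

lemma customer_code_eqD:
  assumes "customer_code T j n' a' s' = customer_code T j n a s"
  shows "n' = n" "\<And>i. i < n \<Longrightarrow> \<bar>a i - a' i\<bar> \<le> 1 / real (Suc j)" "\<And>i. i < n \<Longrightarrow> \<bar>s i - s' i\<bar> \<le> 1 / real (Suc j)"
    "\<And>i i'. i < n + 2 \<Longrightarrow> i' < n + 2 \<Longrightarrow> tie_point T a' i = tie_point T a' i' \<longleftrightarrow> tie_point T a i = tie_point T a i'"
proof -
  show n: "n' = n" using assms unfolding customer_code_def to_nat_split prod.inject by blast
  have 1: "map (\<lambda>i. \<lfloor>real (Suc j) * a' i\<rfloor>) [0..<n] = map (\<lambda>i. \<lfloor>real (Suc j) * a i\<rfloor>) [0..<n]"
    and 2: "map (\<lambda>i. \<lfloor>real (Suc j) * s' i\<rfloor>) [0..<n] = map (\<lambda>i. \<lfloor>real (Suc j) * s i\<rfloor>) [0..<n]"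
    and 3: "map (\<lambda>i. tie_point T a' (i div (n + 2)) = tie_point T a' (i mod (n + 2))) [0..<(n + 2) * (n + 2)]
      = map (\<lambda>i. tie_point T a (i div (n + 2)) = tie_point T a (i mod (n + 2))) [0..<(n + 2) * (n + 2)]"
    using assms unfolding n customer_code_def to_nat_split prod.inject by blast+
  show "\<bar>a i - a' i\<bar> \<le> 1 / real (Suc j)" if "i < n" for i
  proof -
    have "\<lfloor>real (Suc j) * a i\<rfloor> = \<lfloor>real (Suc j) * a' i\<rfloor>" using 1[unfolded map_eq_conv] that by simp
    then show ?thesis by (rule floor_eq_imp_close)
  qed
  show "\<bar>s i - s' i\<bar> \<le> 1 / real (Suc j)" if "i < n" for i
  proof -
    have "\<lfloor>real (Suc j) * s i\<rfloor> = \<lfloor>real (Suc j) * s' i\<rfloor>" using 2[unfolded map_eq_conv] that by simp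
    then show ?thesis by (rule floor_eq_imp_close)
  qed
  show "tie_point T a' i = tie_point T a' i' \<longleftrightarrow> tie_point T a i = tie_point T a i'"
    if "i < n + 2" "i' < n + 2" for i i'
  proof -
    let ?m = "i * (n + 2) + i'"
    have "?m < (i + 1) * (n + 2)" using that(2) by simp
    also have "\<dots> \<le> (n + 2) * (n + 2)" using that(1) by (intro mult_right_mono) auto
    finally have "?m \<in> set [0..<(n + 2) * (n + 2)]"
      by (simp only: set_upt atLeastLessThan_iff le0 simp_thms)
    with 3[unfolded map_eq_conv] have "(tie_point T a' (?m div (n + 2)) = tie_point T a' (?m mod (n + 2)))
      = (tie_point T a (?m div (n + 2)) = tie_point T a (?m mod (n + 2)))" by blast
    moreover have "(i * m + i') div m = i" "(i * m + i') mod m = i'" if "i' < m" for m :: nat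
      using that by simp_all
    note this[OF that(2)]
    ultimately show ?thesis by (simp only:)
  qed
qed

text \<open>A time change is injective, so it can carry the points of one configuration to those of
  another only if coincidences agree; the tie table guarantees this. All indicators then switch at
  matched times, and what remains is the Lipschitz variation of \<phi> in the service and arrival
  times. The precision j may depend on the configuration, in particular on its size and its smallest
  gap.\<close>

lemma customer_code_separates:
  assumes a: "\<And>i. i < n \<Longrightarrow> a i \<in> {0..T}" and T: "0 \<le> T" and B: "schwartz_bounded B" and \<epsilon>: "0 < \<epsilon>"
  shows "\<exists>j. \<forall>n' a' s'. customer_code T j n' a' s' = customer_code T j n a s \<longrightarrow> (\<forall>i<n'. a' i \<in> {0..T}) \<longrightarrow>
    skorokhod_gauge T B (restrict (customer_path w n a s) {0..T}) (restrict (customer_path w n' a' s') {0..T}) < \<epsilon>"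
proof -
  let ?p = "tie_point T a"
  define I where "I = {..<n + 2}"
  have I: "finite I" "0 \<in> I" "1 \<in> I" "card I = n + 2" by (auto simp: I_def)
  define G where "G = {\<bar>?p i - ?p i'\<bar> |i i'. i \<in> I \<and> i' \<in> I \<and> ?p i \<noteq> ?p i'}"
  have "G \<subseteq> (\<lambda>(i, i'). \<bar>?p i - ?p i'\<bar>) ` (I \<times> I)" unfolding G_def by auto
  then have fin: "finite G" by (rule finite_subset) (use I in simp)
  define g where "g = Min (insert 1 G)"
  have g: "0 < g" unfolding g_def using fin by (auto simp: G_def)
  have gap: "g \<le> \<bar>?p i - ?p i'\<bar>" if "i \<in> I" "i' \<in> I" "?p i \<noteq> ?p i'" for i i'
  proof -
    have "\<bar>?p i - ?p i'\<bar> \<in> G" using that unfolding G_def by blast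
    then show ?thesis unfolding g_def using fin by simp
  qed
  obtain L where L: "0 < L" "\<And>\<phi>. \<phi> \<in> B \<Longrightarrow> schwartz_norm 1 \<phi> \<le> L"
    using schwartz_bounded_obtain[OF B, of 1] by blast
  \<comment> \<open>The factor \<open>2 + 4 * T\<close> bounds the displacement of the argument of
    \<phi> per unit of \<rho>: 1 for the service time, 1 for the arrival time, \<open>4 * T\<close>
    for the time change. The final 2 accounts for the size of the time change.\<close>
  define C where "C = \<bar>w\<bar> * real n * L * (2 + 4 * T) + 2"
  have C: "2 \<le> C" using L T by (simp add: C_def)
  define \<rho> where "\<rho> = min (1 / 2) (\<epsilon> / (2 * C))"
  have \<rho>: "0 < \<rho>" "\<rho> \<le> 1 / 2" "C * \<rho> < \<epsilon>"
  proof -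
    show "0 < \<rho>" "\<rho> \<le> 1 / 2" unfolding \<rho>_def using \<epsilon> C by auto
    have "C * \<rho> \<le> C * (\<epsilon> / (2 * C))" unfolding \<rho>_def using C by (intro mult_left_mono) auto
    also have "\<dots> < \<epsilon>" using C \<epsilon> by simp
    finally show "C * \<rho> < \<epsilon>" .
  qed
  \<comment> \<open>Capping the gap at 1 makes the rounding error itself at most \<rho>.\<close>
  define g' where "g' = min g 1"
  have g': "0 < g'" "g' \<le> g" "g' \<le> 1" using g by (auto simp: g'_def)
  obtain j where j: "real (n + 2) / real (Suc j) \<le> \<rho> * g'"
    using exists_inverse_Suc_le[of "\<rho> * g'" "real (n + 2)"] \<rho> g' by auto
  have j1: "1 / real (Suc j) \<le> \<rho>"
  proof -
    have "1 / real (Suc j) \<le> real (n + 2) / real (Suc j)" by (intro divide_right_mono) auto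
    also have "\<dots> \<le> \<rho> * 1" using \<rho> g' by (intro order_trans[OF j] mult_left_mono) auto
    finally show ?thesis by simp
  qed
  have "skorokhod_gauge T B (restrict (customer_path w n a s) {0..T}) (restrict (customer_path w n' a' s') {0..T}) < \<epsilon>"
    if eq: "customer_code T j n' a' s' = customer_code T j n a s" and a': "\<forall>i<n'. a' i \<in> {0..T}" for n' a' s'
  proof -
    have n: "n' = n" by (rule customer_code_eqD(1)[OF eq])
    let ?p' = "tie_point T a'"
    have pp': "\<bar>?p i - ?p' i\<bar> \<le> 1 / real (Suc j)" if "i \<in> I" for i
      using customer_code_eqD(2)[OF eq, of "i - 2"] that unfolding I_def tie_point_def by auto
    obtain l where l: "l \<in> time_changes T" "\<And>i. i \<in> I \<Longrightarrow> l (?p i) = ?p' i" "time_change_size T l \<le> ennreal (2 * \<rho>)"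
    proof (rule time_change_of_close_points[OF I(1,2), of ?p ?p' 1 T g "1 / real (Suc j)" \<rho>])
      show "?p i \<in> {0..T}" if "i \<in> I" for i
        using a[of "i - 2"] that T unfolding I_def tie_point_def by auto
      show "?p' i = ?p' i'" if "i \<in> I" "i' \<in> I" "?p i = ?p i'" for i i'
        using customer_code_eqD(4)[OF eq, of i i'] that unfolding I_def by auto
      have "\<rho> * g' \<le> \<rho> * g" using g' \<rho> by (intro mult_left_mono) auto
      then show "real (card I) * (1 / real (Suc j)) \<le> \<rho> * g" using j unfolding I(4) by simp
    qed (use I g gap pp' \<rho> in \<open>auto simp: tie_point_def\<close>)
    have la: "l (a i) = a' i" if "i < n" for i
      using l(2)[of "i + 2"] that unfolding I_def tie_point_def by auto
    have exp4: "exp (2 * \<rho>) - 1 \<le> 4 * \<rho>"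
    proof -
      have "exp (2 * \<rho>) \<le> 1 + 2 * \<rho> + (2 * \<rho>)\<^sup>2" using \<rho> by (intro exp_bound) auto
      moreover have "(2 * \<rho>) * (2 * \<rho>) \<le> (2 * \<rho>) * 1" using \<rho> by (intro mult_left_mono) auto
      ultimately show ?thesis unfolding power2_eq_square by linarith
    qed
    have lt: "\<bar>l t - t\<bar> \<le> 4 * T * \<rho>" if "t \<in> {0..T}" for t
    proof -
      have "\<bar>l t - t\<bar> \<le> T * (exp (2 * \<rho>) - 1)"
        using \<rho> by (intro time_change_close[OF l(1) _ l(3) that]) auto
      also have "\<dots> \<le> T * (4 * \<rho>)" using T exp4 by (intro mult_left_mono)
      finally show ?thesis by simp
    qed
    have "skorokhod_gauge T B (restrict (customer_path w n a s) {0..T}) (restrict (customer_path w n' a' s') {0..T})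
        \<le> \<bar>w\<bar> * (real n * (L * (2 * \<rho> + 4 * T * \<rho>))) + 2 * \<rho>"
    proof (rule skorokhod_gauge_le[OF l(1) _ _ l(3)])
      fix t \<phi> assume t: "t \<in> {0..T}" and \<phi>: "\<phi> \<in> B"
      have lT: "l t \<in> {0..T}" by (rule time_change_mem[OF l(1) t])
      have lip: "\<bar>sfun \<phi> x - sfun \<phi> y\<bar> \<le> L * \<bar>x - y\<bar>" for x y
      proof -
        have "norm (sfun \<phi> x - sfun \<phi> y) \<le> L * norm (x - y)"
        proof (rule field_differentiable_bound[of UNIV _ "sderiv 1 \<phi>"])
          fix z
          show "(sfun \<phi> has_field_derivative sderiv 1 \<phi> z) (at z within UNIV)"
            using sderiv_has_derivative[of 0 \<phi> z] by simp
          show "norm (sderiv 1 \<phi> z) \<le> L" using sderiv_le_norm[of 1 1 \<phi> z] L(2)[OF \<phi>] by simp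
        qed auto
        then show ?thesis by simp
      qed
      have summand: "\<bar>heaviside (a i) t * sfun \<phi> (s i - (t - a i)) - heaviside (a' i) (l t) * sfun \<phi> (s' i - (l t - a' i))\<bar>
          \<le> L * (2 * \<rho> + 4 * T * \<rho>)" if i: "i < n" for i
      proof -
        \<comment> \<open>The time change is increasing and maps \<open>a i\<close> to
          \<open>a' i\<close>, so both indicators switch on together.\<close>
        have "a i \<le> t \<longleftrightarrow> a' i \<le> l t"
          using time_change_less_iff(2)[OF l(1) a[OF i] t] la[OF i] by simp
        moreover have "\<bar>sfun \<phi> (s i - (t - a i)) - sfun \<phi> (s' i - (l t - a' i))\<bar> \<le> L * (2 * \<rho> + 4 * T * \<rho>)"
        proof (rule order_trans[OF lip], rule mult_left_mono)
          show "\<bar>s i - (t - a i) - (s' i - (l t - a' i))\<bar> \<le> 2 * \<rho> + 4 * T * \<rho>"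
            using lt[OF t] customer_code_eqD(2,3)[OF eq i] j1 by linarith
        qed (use L in simp)
        moreover have "0 \<le> L * (2 * \<rho> + 4 * T * \<rho>)" using L T \<rho> by simp
        ultimately show ?thesis by simp
      qed
      have eq: "pairing (customer_path w n a s t) \<phi> - pairing (customer_path w n' a' s' (l t)) \<phi>
          = w * (\<Sum>i<n. heaviside (a i) t * sfun \<phi> (s i - (t - a i)) - heaviside (a' i) (l t) * sfun \<phi> (s' i - (l t - a' i)))"
        unfolding pairing_customer_path n by (simp only: right_diff_distrib[symmetric] sum_subtractf)
      have "\<bar>pairing (customer_path w n a s t) \<phi> - pairing (customer_path w n' a' s' (l t)) \<phi>\<bar>
          \<le> \<bar>w\<bar> * (\<Sum>i<n. L * (2 * \<rho> + 4 * T * \<rho>))"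
        unfolding eq abs_mult[of w] by (intro mult_left_mono order_trans[OF sum_abs] sum_mono summand) auto
      then show "\<bar>pairing (restrict (customer_path w n a s) {0..T} t) \<phi> - pairing (restrict (customer_path w n' a' s') {0..T} (l t)) \<phi>\<bar>
          \<le> \<bar>w\<bar> * (real n * (L * (2 * \<rho> + 4 * T * \<rho>)))"
        using t lT by simp
    qed (use \<rho> L T in auto)
    also have "\<dots> = C * \<rho>" by (simp add: C_def algebra_simps)
    finally show ?thesis using \<rho> by linarith
  qed
  then show ?thesis by blast
qed

text \<open>Equal codes at a suitable precision keep the path inside a given open set, by
  \<open>customer_code_separates\<close>. Once the number of customers is fixed, a code is a
  measurable function of finitely many coordinates.\<close>

lemma measurable_customer_path:
  fixes n :: "'a \<Rightarrow> nat" and a s :: "nat \<Rightarrow> 'a \<Rightarrow> real"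
  assumes n: "n \<in> measurable M (count_space UNIV)"
    and am: "\<And>i. a i \<in> borel_measurable M" and sm: "\<And>i. s i \<in> borel_measurable M"
    and a: "\<And>\<omega> i. \<omega> \<in> space M \<Longrightarrow> i < n \<omega> \<Longrightarrow> a i \<omega> \<in> {0..T}" and T: "0 \<le> T"
  shows "(\<lambda>\<omega>. restrict (customer_path w (n \<omega>) (\<lambda>i. a i \<omega>) (\<lambda>i. s i \<omega>)) {0..T})
    \<in> measurable M (borel_of_top (skorokhod_topology T))"
proof (rule measurable_borel_of_top_codes)
  let ?Y = "\<lambda>\<omega>. restrict (customer_path w (n \<omega>) (\<lambda>i. a i \<omega>) (\<lambda>i. s i \<omega>)) {0..T}"
  let ?c = "\<lambda>j \<omega>. customer_code T j (n \<omega>) (\<lambda>i. a i \<omega>) (\<lambda>i. s i \<omega>)"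
  fix \<omega> assume \<omega>: "\<omega> \<in> space M"
  show paths: "?Y \<omega> \<in> topspace (skorokhod_topology T)"
    using a[OF \<omega>] by (auto simp: skorokhod_paths_def intro!: cadlag_restrict cadlag_customer_path)
  fix U assume U: "openin (skorokhod_topology T) U" "?Y \<omega> \<in> U"
  obtain B \<epsilon> where B: "schwartz_bounded B" "0 < \<epsilon>"
    "\<And>y. y \<in> skorokhod_paths T \<Longrightarrow> skorokhod_gauge T B (?Y \<omega>) y < \<epsilon> \<Longrightarrow> y \<in> U"
    using U unfolding openin_skorokhod_iff by meson
  obtain j where j: "\<forall>n' a' s'. customer_code T j n' a' s' = ?c j \<omega> \<longrightarrow> (\<forall>i<n'. a' i \<in> {0..T}) \<longrightarrow>
      skorokhod_gauge T B (?Y \<omega>) (restrict (customer_path w n' a' s') {0..T}) < \<epsilon>"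
    using customer_code_separates[where n="n \<omega>" and a="\<lambda>i. a i \<omega>" and s="\<lambda>i. s i \<omega>" and w=w,
        OF a[OF \<omega>] T B(1,2)] by blast
  have "?Y \<omega>' \<in> U" if "\<omega>' \<in> space M" "?c j \<omega>' = ?c j \<omega>" for \<omega>'
  proof (rule B(3))
    show "?Y \<omega>' \<in> skorokhod_paths T"
      using a[OF that(1)] by (auto simp: skorokhod_paths_def intro!: cadlag_restrict cadlag_customer_path)
    show "skorokhod_gauge T B (?Y \<omega>) (?Y \<omega>') < \<epsilon>"
      using j[rule_format, OF that(2)] a[OF that(1)] by simp
  qed
  then show "\<exists>j. \<forall>\<omega>'\<in>space M. ?c j \<omega>' = ?c j \<omega> \<longrightarrow> ?Y \<omega>' \<in> U" by blast
next
  fix j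
  have fl: "(\<lambda>\<omega>. \<lfloor>real (Suc j) * b i \<omega>\<rfloor>) \<in> measurable M (count_space UNIV)"
    if "\<And>i. b i \<in> borel_measurable M" for b :: "nat \<Rightarrow> 'a \<Rightarrow> real" and i
    using that by measurable
  have tp: "(\<lambda>\<omega>. tie_point T (\<lambda>i. a i \<omega>) i) \<in> borel_measurable M" for i
    unfolding tie_point_def using am by measurable
  have "(\<lambda>\<omega>. tie_point T (\<lambda>i. a i \<omega>) i = tie_point T (\<lambda>i. a i \<omega>) i') \<in> measurable M (count_space UNIV)" for i i'
    using tp[of i] tp[of i'] by measurable
  note meas = measurable_map_count_space[OF fl[OF am]] measurable_map_count_space[OF fl[OF sm]]
    measurable_map_count_space[OF this]
  have "(\<lambda>\<omega>. customer_code T j k (\<lambda>i. a i \<omega>) (\<lambda>i. s i \<omega>)) \<in> measurable M (count_space UNIV)" for k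
    unfolding customer_code_def
    by (rule measurable_compose[of _ M "count_space UNIV" to_nat])
      (intro measurable_Pair_count_space meas measurable_const, simp_all)
  then show "(\<lambda>\<omega>. customer_code T j (n \<omega>) (\<lambda>i. a i \<omega>) (\<lambda>i. s i \<omega>)) \<in> measurable M (count_space UNIV)"
    by (rule measurable_compose_countable[OF _ n])
qed

section \<open>Weak convergence in the Skorokhod space\<close>

lemma space_borel_of_top: "space (borel_of_top X) = topspace X"
  unfolding borel_of_top_def using openin_subset by (intro space_measure_of) blast

lemma openin_imp_sets_borel_of_top: "openin X U \<Longrightarrow> U \<in> sets (borel_of_top X)"
  unfolding borel_of_top_def using openin_subset
  by (subst sets_measure_of) (auto intro: sigma_sets.Basic)

lemma measurable_borel_of_top_real:
  assumes "continuous_map X euclideanreal g"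
  shows "g \<in> borel_measurable (borel_of_top X)"
proof (rule borel_measurableI)
  fix S :: "real set" assume "open S"
  then have "openin X {x \<in> topspace X. g x \<in> S}"
    by (intro openin_continuous_map_preimage[OF assms]) simp
  moreover have "g -` S \<inter> space (borel_of_top X) = {x \<in> topspace X. g x \<in> S}"
    by (auto simp: space_borel_of_top)
  ultimately show "g -` S \<inter> space (borel_of_top X) \<in> sets (borel_of_top X)"
    by (simp add: openin_imp_sets_borel_of_top)
qed

lemma measurable_borel_of_top_continuous_map:
  assumes "continuous_map X Y f"
  shows "f \<in> measurable (borel_of_top X) (borel_of_top Y)"
  unfolding borel_of_top_def[of Y]
proof (rule measurable_measure_of)
  show "{U. openin Y U} \<subseteq> Pow (topspace Y)" using openin_subset by blast
  show "f \<in> space (borel_of_top X) \<rightarrow> topspace Y"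
    using assms unfolding space_borel_of_top continuous_map_def by blast
  fix U assume "U \<in> {U. openin Y U}"
  then have "openin X {x \<in> topspace X. f x \<in> U}"
    by (intro openin_continuous_map_preimage[OF assms]) simp
  moreover have "f -` U \<inter> space (borel_of_top X) = {x \<in> topspace X. f x \<in> U}"
    by (auto simp: space_borel_of_top)
  ultimately show "f -` U \<inter> space (borel_of_top X) \<in> sets (borel_of_top X)"
    by (simp add: openin_imp_sets_borel_of_top)
qed

lemma converges_weakly_continuous_map:
  assumes Y: "converges_weakly X M Y N Z" and f: "continuous_map X X f"
  shows "converges_weakly X M (\<lambda>n \<omega>. f (Y n \<omega>)) N (\<lambda>\<omega>. f (Z \<omega>))"
proof -
  note m = measurable_compose[OF _ measurable_borel_of_top_continuous_map[OF f]]
  have "(\<lambda>n. \<integral>\<omega>. g (f (Y n \<omega>)) \<partial>M n) \<longlonglongrightarrow> (\<integral>\<omega>. g (f (Z \<omega>)) \<partial>N)"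
    if g: "continuous_map X euclideanreal g" "bounded (g ` topspace X)" for g
  proof -
    have "continuous_map X euclideanreal (g \<circ> f)" using f g(1) by (rule continuous_map_compose)
    moreover have "bounded ((g \<circ> f) ` topspace X)"
      by (rule bounded_subset[OF g(2)]) (use f in \<open>auto simp: continuous_map_def\<close>)
    ultimately have "(\<lambda>n. \<integral>\<omega>. (g \<circ> f) (Y n \<omega>) \<partial>M n) \<longlonglongrightarrow> (\<integral>\<omega>. (g \<circ> f) (Z \<omega>) \<partial>N)"
      using Y unfolding converges_weakly_def by blast
    then show ?thesis by simp
  qed
  moreover have "prob_space (M n)" "(\<lambda>\<omega>. f (Y n \<omega>)) \<in> measurable (M n) (borel_of_top X)" if "n \<ge> 1" for n
    using Y that unfolding converges_weakly_def by (auto intro!: m)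
  moreover have "prob_space N" "(\<lambda>\<omega>. f (Z \<omega>)) \<in> measurable N (borel_of_top X)"
    using Y unfolding converges_weakly_def by (auto intro!: m)
  ultimately show ?thesis
    unfolding converges_weakly_def by (intro conjI allI impI) simp_all
qed

lemma continuous_map_skorokhod_gauge:
  assumes "schwartz_bounded B"
  shows "continuous_map (skorokhod_topology T) euclideanreal (skorokhod_gauge T B x)"
proof (rule continuous_map_skorokhod_realI)
  fix y and e :: real assume e: "0 < e"
  have "\<bar>skorokhod_gauge T B x y - skorokhod_gauge T B x z\<bar> < e" if "skorokhod_gauge T B y z < e" for z
    using skorokhod_gauge_triangle[of T B x z y] skorokhod_gauge_triangle[of T B x y z]
      skorokhod_gauge_commute[of T B z y] that by (simp add: abs_less_iff)
  then show "\<exists>A d. schwartz_bounded A \<and> 0 < d \<and>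
      (\<forall>z\<in>skorokhod_paths T. skorokhod_gauge T A y z < d \<longrightarrow> \<bar>skorokhod_gauge T B x y - skorokhod_gauge T B x z\<bar> < e)"
    using assms e by blast
qed

lemma schwartz_bounded_UN: "finite I \<Longrightarrow> (\<And>i. i \<in> I \<Longrightarrow> schwartz_bounded (B i)) \<Longrightarrow> schwartz_bounded (\<Union>i\<in>I. B i)"
  by (induction I rule: finite_induct) (auto simp: schwartz_bounded_Un schwartz_bounded_finite)

text \<open>One representative is kept for each of the countably many attained pairs of a precision
  and a code value. A point and the representative of its own pair have the same code at the
  precision that works for the representative.\<close>

lemma countable_cover_of_codes:
  fixes c :: "nat \<Rightarrow> 'b \<Rightarrow> nat"
  assumes "S \<noteq> {}" and sep: "\<And>\<omega>. \<omega> \<in> S \<Longrightarrow> \<exists>j. \<forall>\<omega>'\<in>S. c j \<omega>' = c j \<omega> \<longrightarrow> P \<omega> \<omega>'"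
  obtains \<rho> :: "nat \<Rightarrow> 'b" where "\<And>i. \<rho> i \<in> S" "\<And>\<omega>'. \<omega>' \<in> S \<Longrightarrow> \<exists>i. P (\<rho> i) \<omega>'"
proof -
  obtain j where j: "\<And>\<omega> \<omega>'. \<omega> \<in> S \<Longrightarrow> \<omega>' \<in> S \<Longrightarrow> c (j \<omega>) \<omega>' = c (j \<omega>) \<omega> \<Longrightarrow> P \<omega> \<omega>'"
    using sep by metis
  define K where "K = (\<lambda>\<omega>. (j \<omega>, c (j \<omega>) \<omega>)) ` S"
  define r where "r v = (SOME \<omega>. \<omega> \<in> S \<and> (j \<omega>, c (j \<omega>) \<omega>) = v)" for v
  have r: "r v \<in> S \<and> (j (r v), c (j (r v)) (r v)) = v" if "v \<in> K" for v
    unfolding r_def using that unfolding K_def by (intro someI_ex[of "\<lambda>\<omega>. \<omega> \<in> S \<and> (j \<omega>, c (j \<omega>) \<omega>) = v"]) blast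
  have K: "K \<noteq> {}" "countable K" using assms(1) unfolding K_def by auto
  define \<rho> where "\<rho> i = r (from_nat_into K i)" for i
  show ?thesis
  proof (rule that[of \<rho>])
    show "\<rho> i \<in> S" for i unfolding \<rho>_def using r from_nat_into[OF K(1)] by blast
    fix \<omega>' assume \<omega>': "\<omega>' \<in> S"
    let ?v = "(j \<omega>', c (j \<omega>') \<omega>')"
    have "?v \<in> K" unfolding K_def using \<omega>' by blast
    then obtain i where i: "from_nat_into K i = ?v" using from_nat_into_surj[OF K(2)] by blast
    have "j (\<rho> i) = j \<omega>'" "c (j (\<rho> i)) (\<rho> i) = c (j \<omega>') \<omega>'" "\<rho> i \<in> S"
      using r[OF \<open>?v \<in> K\<close>] unfolding \<rho>_def i by auto
    then have "P (\<rho> i) \<omega>'" using j[of "\<rho> i" \<omega>'] \<omega>' by simp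
    then show "\<exists>i. P (\<rho> i) \<omega>'" by blast
  qed
qed

text \<open>The topology is not metrizable, so continuous functions cannot be replaced by uniformly
  continuous ones. Instead, the codes make the range of the limit Lindeloef: up to small
  probability, it is covered by finitely many balls on which the test function is almost constant,
  and by weak convergence so is the prelimit.\<close>

lemma converges_weakly_skorokhod_close:
  fixes c :: "nat \<Rightarrow> 'b \<Rightarrow> nat"
  assumes W: "converges_weakly (skorokhod_topology T) M W N Z"
    and Y: "\<And>n. n \<ge> 1 \<Longrightarrow> Y n \<in> measurable (M n) (borel_of_top (skorokhod_topology T))"
    and codes: "\<And>\<omega> U. \<omega> \<in> space N \<Longrightarrow> openin (skorokhod_topology T) U \<Longrightarrow> Z \<omega> \<in> U \<Longrightarrow>
      \<exists>j. \<forall>\<omega>'\<in>space N. c j \<omega>' = c j \<omega> \<longrightarrow> Z \<omega>' \<in> U"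
    and close: "\<And>B \<delta> \<epsilon>. schwartz_bounded B \<Longrightarrow> 0 < \<delta> \<Longrightarrow> 0 < \<epsilon> \<Longrightarrow> \<exists>n0. \<forall>n\<ge>n0. \<exists>A\<in>sets (M n).
      measure (M n) A \<le> \<epsilon> \<and> (\<forall>\<omega>\<in>space (M n) - A. skorokhod_gauge T B (W n \<omega>) (Y n \<omega>) < \<delta>)"
  shows "converges_weakly (skorokhod_topology T) M Y N Z"
proof -
  let ?X = "skorokhod_topology T"
  have prob: "prob_space (M n)" and Wm: "W n \<in> measurable (M n) (borel_of_top ?X)" if "n \<ge> 1" for n
    using W that unfolding converges_weakly_def by auto
  have N: "prob_space N" and Zm: "Z \<in> measurable N (borel_of_top ?X)"
    using W unfolding converges_weakly_def by auto
  interpret N: prob_space N by (rule N)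
  have Zp: "Z \<omega> \<in> skorokhod_paths T" if "\<omega> \<in> space N" for \<omega>
    using measurable_space[OF Zm that] by (simp add: space_borel_of_top)
  have Wp: "W n \<omega> \<in> skorokhod_paths T" and Yp: "Y n \<omega> \<in> skorokhod_paths T" if "n \<ge> 1" "\<omega> \<in> space (M n)" for n \<omega>
    using measurable_space[OF Wm that(2)] measurable_space[OF Y that(2)] that(1) by (auto simp: space_borel_of_top)
  have main: "(\<lambda>n. (\<integral>\<omega>. g (Y n \<omega>) \<partial>M n) - (\<integral>\<omega>. g (W n \<omega>) \<partial>M n)) \<longlonglongrightarrow> 0"
    if g: "continuous_map ?X euclideanreal g" "bounded (g ` topspace ?X)" for g
  proof (rule LIMSEQ_I)
    fix \<epsilon> :: real assume \<epsilon>: "0 < \<epsilon>"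
    obtain G where G: "0 < G" "\<And>x. x \<in> skorokhod_paths T \<Longrightarrow> \<bar>g x\<bar> \<le> G"
      using g(2) unfolding bounded_pos by auto
    \<comment> \<open>Outside an event of probability at most 2 \<eta> the values of g differ by
      less than 2 \<eta>, inside it by at most 2 G. The total \<open>2 * \<eta> * H\<close> equals
      \<epsilon> / 2.\<close>
    define H where "H = 1 + 2 * G"
    have H: "0 < H" using G by (simp add: H_def)
    define \<eta> where "\<eta> = \<epsilon> / (4 * H)"
    have \<eta>: "0 < \<eta>" using \<epsilon> H by (simp add: \<eta>_def)
    have \<eta>G: "2 * \<eta> + 2 * G * (2 * \<eta>) < \<epsilon>"
    proof -
      have "4 * (\<eta> * H) = \<epsilon>" using H by (simp add: \<eta>_def)
      then show ?thesis using \<epsilon> by (simp add: H_def algebra_simps)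
    qed
    \<comment> \<open>Radius 3 d leaves room for W within 2 d of the centre and Y within d of
      W.\<close>
    have "\<exists>B d. schwartz_bounded B \<and> 0 < d \<and> (\<forall>y\<in>skorokhod_paths T. skorokhod_gauge T B (Z \<omega>) y < 3 * d \<longrightarrow> \<bar>g (Z \<omega>) - g y\<bar> < \<eta>)"
      if \<omega>: "\<omega> \<in> space N" for \<omega>
    proof -
      obtain B d where "schwartz_bounded B" "0 < d"
        "\<forall>y\<in>skorokhod_paths T. skorokhod_gauge T B (Z \<omega>) y < d \<longrightarrow> \<bar>g (Z \<omega>) - g y\<bar> < \<eta>"
        using continuous_map_skorokhod_realD[OF g(1) Zp[OF \<omega>] \<eta>] by blast
      then show ?thesis by (intro exI[of _ B] exI[of _ "d / 3"]) auto
    qed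
    then obtain B d where Bd: "\<And>\<omega>. \<omega> \<in> space N \<Longrightarrow> schwartz_bounded (B \<omega>)" "\<And>\<omega>. \<omega> \<in> space N \<Longrightarrow> 0 < d \<omega>"
      "\<And>\<omega> y. \<omega> \<in> space N \<Longrightarrow> y \<in> skorokhod_paths T \<Longrightarrow> skorokhod_gauge T (B \<omega>) (Z \<omega>) y < 3 * d \<omega> \<Longrightarrow> \<bar>g (Z \<omega>) - g y\<bar> < \<eta>"
      by metis
    have ball: "openin ?X {y \<in> topspace ?X. skorokhod_gauge T (B \<omega>) (Z \<omega>) y \<in> {..<d \<omega>}}" if "\<omega> \<in> space N" for \<omega>
      by (intro openin_continuous_map_preimage[OF continuous_map_skorokhod_gauge] Bd that) simp
    let ?P = "\<lambda>\<omega> \<omega>'. skorokhod_gauge T (B \<omega>) (Z \<omega>) (Z \<omega>') < d \<omega>"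
    obtain \<rho> :: "nat \<Rightarrow> 'b" where \<rho>: "\<And>i. \<rho> i \<in> space N" "\<And>\<omega>'. \<omega>' \<in> space N \<Longrightarrow> \<exists>i. ?P (\<rho> i) \<omega>'"
    proof (rule countable_cover_of_codes[where S="space N" and c=c and P="?P"])
      show "space N \<noteq> {}" by (rule N.not_empty)
      fix \<omega> assume \<omega>: "\<omega> \<in> space N"
      have "Z \<omega> \<in> {y \<in> topspace ?X. skorokhod_gauge T (B \<omega>) (Z \<omega>) y \<in> {..<d \<omega>}}"
        using Zp[OF \<omega>] Bd(2)[OF \<omega>] by (simp add: skorokhod_gauge_self)
      from codes[OF \<omega> ball[OF \<omega>] this]
      show "\<exists>j. \<forall>\<omega>'\<in>space N. c j \<omega>' = c j \<omega> \<longrightarrow> ?P \<omega> \<omega>'" by auto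
    qed (rule that)
    define V where "V m = {\<omega> \<in> space N. \<exists>i<m. ?P (\<rho> i) \<omega>}" for m
    have Vs: "V m \<in> sets N" for m
    proof -
      have "V m = (\<Union>i<m. Z -` {y \<in> topspace ?X. skorokhod_gauge T (B (\<rho> i)) (Z (\<rho> i)) y \<in> {..<d (\<rho> i)}} \<inter> space N)"
        unfolding V_def using Zp by auto
      also have "\<dots> \<in> sets N"
        using \<rho>(1) by (intro sets.finite_UN ballI measurable_sets[OF Zm] openin_imp_sets_borel_of_top ball) auto
      finally show ?thesis .
    qed
    have "incseq V" unfolding V_def incseq_def by (auto intro: less_le_trans)
    then have "(\<lambda>m. N.prob (V m)) \<longlonglongrightarrow> N.prob (\<Union>m. V m)"
      using Vs by (intro N.finite_Lim_measure_incseq) auto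
    also have "(\<Union>m. V m) = space N"
      unfolding V_def using \<rho>(2) by (auto intro: lessI)
    finally have "(\<lambda>m. N.prob (V m)) \<longlonglongrightarrow> 1" by (simp add: N.prob_space)
    then have "\<forall>\<^sub>F m in sequentially. 1 - \<eta> < N.prob (V m)" using \<eta> by (intro order_tendstoD(1)) auto
    then obtain m where m: "1 - \<eta> < N.prob (V m)" using eventually_happens by fastforce
    \<comment> \<open>A continuous bump that is at least 1 on the ball of radius d and 0 outside the
      ball of radius 2 d. Weak convergence tests continuous functions only, so the sum of bumps
      stands in for the indicator of the union of balls.\<close>
    define b where "b i y = max 0 (2 - skorokhod_gauge T (B (\<rho> i)) (Z (\<rho> i)) y / d (\<rho> i))" for i y
    define k where "k y = min 1 (\<Sum>i<m. b i y)" for y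
    have b0: "0 \<le> b i y" for i y by (simp add: b_def)
    have k01: "0 \<le> k y" "k y \<le> 1" for y unfolding k_def by (auto simp: sum_nonneg b0)
    have kc: "continuous_map ?X euclideanreal k"
      unfolding k_def b_def divide_inverse using \<rho>(1) Bd(1)
      by (intro continuous_intros continuous_map_skorokhod_gauge) auto
    have kb: "bounded (k ` topspace ?X)"
      unfolding bounded_iff using k01 by (intro exI[of _ 1]) auto
    have km: "k \<in> borel_measurable (borel_of_top ?X)" by (rule measurable_borel_of_top_real[OF kc])
    have kZ: "1 - \<eta> < (\<integral>\<omega>. k (Z \<omega>) \<partial>N)"
    proof -
      have "N.prob (V m) = (\<integral>\<omega>. indicator (V m) \<omega> \<partial>N)" using Vs by simp
      also have "\<dots> \<le> (\<integral>\<omega>. k (Z \<omega>) \<partial>N)"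
      proof (rule integral_mono)
        show "integrable N (\<lambda>\<omega>. k (Z \<omega>))"
          using k01 by (intro N.integrable_const_bound[where B=1] measurable_compose[OF Zm km]) auto
        fix \<omega> assume \<omega>: "\<omega> \<in> space N"
        show "indicator (V m) \<omega> \<le> k (Z \<omega>)"
        proof (cases "\<omega> \<in> V m")
          case True
          then obtain i where i: "i < m" "?P (\<rho> i) \<omega>" unfolding V_def by blast
          have "skorokhod_gauge T (B (\<rho> i)) (Z (\<rho> i)) (Z \<omega>) / d (\<rho> i) \<le> 1"
            using i(2) Bd(2)[OF \<rho>(1)[of i]] by simp
          then have "1 \<le> b i (Z \<omega>)" unfolding b_def by linarith
          also have "\<dots> \<le> (\<Sum>i<m. b i (Z \<omega>))" using i(1) b0 by (intro member_le_sum) auto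
          finally have "k (Z \<omega>) = 1" unfolding k_def by simp
          then show ?thesis by (simp add: indicator_def)
        qed (use k01 in simp)
      next
        show "integrable N (indicat_real (V m))"
          using Vs by (intro integrable_real_indicator) (auto simp: N.emeasure_eq_measure)
      qed
      finally show ?thesis using m by linarith
    qed
    have "(\<lambda>n. \<integral>\<omega>. k (W n \<omega>) \<partial>M n) \<longlonglongrightarrow> (\<integral>\<omega>. k (Z \<omega>) \<partial>N)"
      using W kc kb unfolding converges_weakly_def by blast
    then have "\<forall>\<^sub>F n in sequentially. 1 - \<eta> < (\<integral>\<omega>. k (W n \<omega>) \<partial>M n)"
      using kZ by (rule order_tendstoD(1))
    then obtain n1 where n1: "\<And>n. n \<ge> n1 \<Longrightarrow> 1 - \<eta> < (\<integral>\<omega>. k (W n \<omega>) \<partial>M n)"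
      unfolding eventually_sequentially by blast
    \<comment> \<open>One gauge and one radius that serve for all m balls at once.\<close>
    define B' where "B' = (\<Union>i<m. B (\<rho> i))"
    define d' where "d' = Min (insert 1 ((\<lambda>i. d (\<rho> i)) ` {..<m}))"
    have B': "schwartz_bounded B'" unfolding B'_def using \<rho>(1) Bd(1) by (intro schwartz_bounded_UN) auto
    have d': "0 < d'" "\<And>i. i < m \<Longrightarrow> d' \<le> d (\<rho> i)"
      unfolding d'_def using \<rho>(1) Bd(2) by auto
    obtain n0 where n0: "\<And>n. n \<ge> n0 \<Longrightarrow> \<exists>A\<in>sets (M n). measure (M n) A \<le> \<eta> \<and>
        (\<forall>\<omega>\<in>space (M n) - A. skorokhod_gauge T B' (W n \<omega>) (Y n \<omega>) < d')"
      using close[OF B' d'(1) \<eta>] by blast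
    have "norm ((\<integral>\<omega>. g (Y n \<omega>) \<partial>M n) - (\<integral>\<omega>. g (W n \<omega>) \<partial>M n) - 0) < \<epsilon>" if n: "n \<ge> max 1 (max n0 n1)" for n
    proof -
      have n': "n \<ge> 1" "n \<ge> n0" "n \<ge> n1" using n by auto
      interpret M: prob_space "M n" by (rule prob[OF n'(1)])
      note Wm' = Wm[OF n'(1)] and Ym' = Y[OF n'(1)]
      obtain A where A: "A \<in> sets (M n)" "measure (M n) A \<le> \<eta>"
        "\<And>\<omega>. \<omega> \<in> space (M n) \<Longrightarrow> \<omega> \<notin> A \<Longrightarrow> skorokhod_gauge T B' (W n \<omega>) (Y n \<omega>) < d'"
        using n0[OF n'(2)] by blast
      \<comment> \<open>The event that W lies in none of the balls of radius 2 d; since k is at most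
        1 and vanishes there, the mean of k bounds its probability.\<close>
      define Q where "Q = {\<omega> \<in> space (M n). k (W n \<omega>) \<le> 0}"
      have kWm: "(\<lambda>\<omega>. k (W n \<omega>)) \<in> borel_measurable (M n)" by (rule measurable_compose[OF Wm' km])
      have Qs: "Q \<in> sets (M n)" unfolding Q_def using kWm by measurable
      have ind: "integrable (M n) (indicat_real S)" if "S \<in> sets (M n)" for S
        using that by (intro integrable_real_indicator) (auto simp: M.emeasure_eq_measure)
      have "(\<integral>\<omega>. k (W n \<omega>) \<partial>M n) \<le> (\<integral>\<omega>. 1 - indicator Q \<omega> \<partial>M n)"
      proof (rule integral_mono)
        show "integrable (M n) (\<lambda>\<omega>. k (W n \<omega>))"
          using k01 by (intro M.integrable_const_bound[where B=1] kWm) auto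
        show "integrable (M n) (\<lambda>\<omega>. 1 - indicator Q \<omega> :: real)"
          by (intro Bochner_Integration.integrable_diff ind Qs M.integrable_const)
        fix \<omega> show "k (W n \<omega>) \<le> 1 - indicator Q \<omega>"
          using k01[of "W n \<omega>"] by (auto simp: indicator_def Q_def)
      qed
      also have "\<dots> = (\<integral>\<omega>. 1 \<partial>M n) - (\<integral>\<omega>. indicator Q \<omega> \<partial>M n)"
        by (intro Bochner_Integration.integral_diff ind Qs M.integrable_const)
      also have "\<dots> = 1 - M.prob Q" using Qs by (simp add: M.prob_space)
      finally have PQ: "M.prob Q < \<eta>" using n1[OF n'(3)] by linarith
      have gm: "g \<in> borel_measurable (borel_of_top ?X)" by (rule measurable_borel_of_top_real[OF g(1)])
      have gi: "integrable (M n) (\<lambda>\<omega>. g (W n \<omega>))" "integrable (M n) (\<lambda>\<omega>. g (Y n \<omega>))"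
        using G(2) Wp[OF n'(1)] Yp[OF n'(1)]
        by (auto intro!: M.integrable_const_bound[where B=G] measurable_compose[OF Wm' gm] measurable_compose[OF Ym' gm])
      have le: "\<bar>g (Y n \<omega>) - g (W n \<omega>)\<bar> \<le> 2 * \<eta> + 2 * G * indicator (A \<union> Q) \<omega>" if \<omega>: "\<omega> \<in> space (M n)" for \<omega>
      proof (cases "\<omega> \<in> A \<union> Q")
        case True
        then show ?thesis using G(2)[OF Wp[OF n'(1) \<omega>]] G(2)[OF Yp[OF n'(1) \<omega>]] \<eta> by (simp add: abs_le_iff)
      next
        case False
        then have "0 < k (W n \<omega>)" using \<omega> by (auto simp: Q_def)
        then have "\<exists>i<m. 0 < b i (W n \<omega>)"
        proof (rule contrapos_pp)
          assume "\<not> (\<exists>i<m. 0 < b i (W n \<omega>))"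
          then have "(\<Sum>i<m. b i (W n \<omega>)) \<le> 0" by (intro sum_nonpos) (metis lessThan_iff not_less)
          then show "\<not> 0 < k (W n \<omega>)" unfolding k_def by simp
        qed
        then obtain i where i: "i < m" "0 < b i (W n \<omega>)" by blast
        note Bi = Bd[OF \<rho>(1)[of i]]
        have 1: "skorokhod_gauge T (B (\<rho> i)) (Z (\<rho> i)) (W n \<omega>) < 2 * d (\<rho> i)"
          using i(2) Bi(2) unfolding b_def by (simp add: less_max_iff_disj field_simps)
        have "skorokhod_gauge T (B (\<rho> i)) (W n \<omega>) (Y n \<omega>) \<le> skorokhod_gauge T B' (W n \<omega>) (Y n \<omega>)"
          unfolding B'_def using i(1) by (intro skorokhod_gauge_mono) auto
        also have "\<dots> < d (\<rho> i)" using A(3)[OF \<omega>] d'(2)[OF i(1)] False by simp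
        finally have "skorokhod_gauge T (B (\<rho> i)) (Z (\<rho> i)) (Y n \<omega>) < 3 * d (\<rho> i)"
          using 1 skorokhod_gauge_triangle[of T "B (\<rho> i)" "Z (\<rho> i)" "Y n \<omega>" "W n \<omega>"] by linarith
        then have "\<bar>g (Z (\<rho> i)) - g (Y n \<omega>)\<bar> < \<eta>" "\<bar>g (Z (\<rho> i)) - g (W n \<omega>)\<bar> < \<eta>"
          using 1 Bi(2) Bi(3)[OF Yp[OF n'(1) \<omega>]] Bi(3)[OF Wp[OF n'(1) \<omega>]] by auto
        then show ?thesis using False by (simp add: abs_le_iff abs_less_iff)
      qed
      have "\<bar>(\<integral>\<omega>. g (Y n \<omega>) \<partial>M n) - (\<integral>\<omega>. g (W n \<omega>) \<partial>M n)\<bar> = \<bar>\<integral>\<omega>. g (Y n \<omega>) - g (W n \<omega>) \<partial>M n\<bar>"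
        using gi by simp
      also have "\<dots> \<le> (\<integral>\<omega>. \<bar>g (Y n \<omega>) - g (W n \<omega>)\<bar> \<partial>M n)" by (rule integral_abs_bound)
      also have "\<dots> \<le> (\<integral>\<omega>. 2 * \<eta> + 2 * G * indicator (A \<union> Q) \<omega> \<partial>M n)"
      proof (rule integral_mono)
        show "integrable (M n) (\<lambda>\<omega>. \<bar>g (Y n \<omega>) - g (W n \<omega>)\<bar>)"
          by (intro integrable_abs Bochner_Integration.integrable_diff gi)
        show "integrable (M n) (\<lambda>\<omega>. 2 * \<eta> + 2 * G * indicator (A \<union> Q) \<omega>)"
          by (intro Bochner_Integration.integrable_add integrable_mult_right ind sets.Un A(1) Qs M.integrable_const)
      qed (rule le)
      also have "\<dots> = (\<integral>\<omega>. 2 * \<eta> \<partial>M n) + (\<integral>\<omega>. 2 * G * indicator (A \<union> Q) \<omega> \<partial>M n)"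
        by (intro Bochner_Integration.integral_add integrable_mult_right ind sets.Un A(1) Qs M.integrable_const)
      also have "(\<integral>\<omega>. 2 * G * indicator (A \<union> Q) \<omega> \<partial>M n) = 2 * G * M.prob (A \<union> Q)"
        using A(1) Qs by simp
      also have "(\<integral>\<omega>. 2 * \<eta> \<partial>M n) = 2 * \<eta>" by (simp add: M.prob_space)
      also have "2 * \<eta> + 2 * G * M.prob (A \<union> Q) \<le> 2 * \<eta> + 2 * G * (2 * \<eta>)"
      proof -
        have "M.prob (A \<union> Q) \<le> M.prob A + M.prob Q" by (rule measure_Un_le[OF A(1) Qs])
        then have "M.prob (A \<union> Q) \<le> 2 * \<eta>" using A(2) PQ by linarith
        then show ?thesis using G(1) by simp
      qed
      finally show ?thesis using \<eta>G by simp
    qed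
    then show "\<exists>no. \<forall>n\<ge>no. norm ((\<integral>\<omega>. g (Y n \<omega>) \<partial>M n) - (\<integral>\<omega>. g (W n \<omega>) \<partial>M n) - 0) < \<epsilon>" by blast
  qed
  show ?thesis
    unfolding converges_weakly_def
  proof (intro conjI allI impI)
    fix g assume g: "continuous_map ?X euclideanreal g \<and> bounded (g ` topspace ?X)"
    then have "(\<lambda>n. \<integral>\<omega>. g (W n \<omega>) \<partial>M n) \<longlonglongrightarrow> (\<integral>\<omega>. g (Z \<omega>) \<partial>N)"
      using W unfolding converges_weakly_def by blast
    from tendsto_add[OF main[OF conjunct1[OF g] conjunct2[OF g]] this]
    show "(\<lambda>n. \<integral>\<omega>. g (Y n \<omega>) \<partial>M n) \<longlonglongrightarrow> (\<integral>\<omega>. g (Z \<omega>) \<partial>N)" by simp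
  qed (use prob Y N Zm in auto)
qed

section \<open>A weak law of large numbers along the whole trajectory\<close>

text \<open>By independence the product of a new summand with the preceding sum has mean 0, so
  second moments add.\<close>

lemma (in prob_space) centred_sum_second_moment:
  fixes X :: "nat \<Rightarrow> 'a \<Rightarrow> real"
  assumes ind: "indep_vars (\<lambda>_. borel) X UNIV" and bd: "\<And>i. AE \<omega> in M. \<bar>X i \<omega>\<bar> \<le> c" and c: "0 \<le> c"
    and mean: "\<And>i. expectation (X i) = 0"
  shows "integrable M (\<lambda>\<omega>. (\<Sum>i<k. X i \<omega>)\<^sup>2)" "expectation (\<lambda>\<omega>. (\<Sum>i<k. X i \<omega>)\<^sup>2) \<le> real k * c\<^sup>2"
proof -
  have Xm: "X i \<in> borel_measurable M" for i using ind unfolding indep_vars_def by auto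
  have Sbd: "AE \<omega> in M. \<bar>\<Sum>i<k. X i \<omega>\<bar> \<le> real k * c" for k
  proof -
    have "AE \<omega> in M. \<forall>i. \<bar>X i \<omega>\<bar> \<le> c" using bd by (simp add: AE_all_countable)
    then show ?thesis
    proof eventually_elim
      case (elim \<omega>)
      have "\<bar>\<Sum>i<k. X i \<omega>\<bar> \<le> (\<Sum>i<k. c)" using elim by (intro order_trans[OF sum_abs] sum_mono) auto
      then show ?case by simp
    qed
  qed
  have Xi: "integrable M (X i)" for i using bd by (intro integrable_const_bound[where B=c] Xm) auto
  have Si: "integrable M (\<lambda>\<omega>. \<Sum>i<k. X i \<omega>)" for k by (intro Bochner_Integration.integrable_sum Xi)
  have sq: "x\<^sup>2 \<le> d\<^sup>2" if "\<bar>x\<bar> \<le> d" for x d :: real using power_mono[OF that, of 2] by simp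
  have X2i: "integrable M (\<lambda>\<omega>. (X i \<omega>)\<^sup>2)" for i
    using bd[of i] Xm by (intro integrable_const_bound[where B="c\<^sup>2"]) (auto elim!: eventually_mono intro!: sq)
  show S2i: "integrable M (\<lambda>\<omega>. (\<Sum>i<k. X i \<omega>)\<^sup>2)" for k
    using Sbd[of k] Xm by (intro integrable_const_bound[where B="(real k * c)\<^sup>2"]) (auto elim!: eventually_mono intro!: sq)
  show "expectation (\<lambda>\<omega>. (\<Sum>i<k. X i \<omega>)\<^sup>2) \<le> real k * c\<^sup>2"
  proof (induction k)
    case (Suc k)
    have ii: "indep_var borel (X k) borel (\<lambda>\<omega>. \<Sum>i<k. X i \<omega>)"
      by (rule indep_vars_sum) (auto intro: indep_vars_subset[OF ind])
    have prod: "integrable M (\<lambda>\<omega>. X k \<omega> * (\<Sum>i<k. X i \<omega>))" "expectation (\<lambda>\<omega>. X k \<omega> * (\<Sum>i<k. X i \<omega>)) = 0"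
      using indep_var_integrable[OF ii Xi Si] indep_var_lebesgue_integral[OF ii Xi Si] mean by auto
    have "expectation (\<lambda>\<omega>. (\<Sum>i<Suc k. X i \<omega>)\<^sup>2)
        = expectation (\<lambda>\<omega>. (\<Sum>i<k. X i \<omega>)\<^sup>2 + 2 * (X k \<omega> * (\<Sum>i<k. X i \<omega>)) + (X k \<omega>)\<^sup>2)"
      by (intro Bochner_Integration.integral_cong refl) (simp add: power2_eq_square algebra_simps)
    also have "\<dots> = expectation (\<lambda>\<omega>. (\<Sum>i<k. X i \<omega>)\<^sup>2) + expectation (\<lambda>\<omega>. (X k \<omega>)\<^sup>2)"
      using S2i X2i prod by simp
    also have "expectation (\<lambda>\<omega>. (X k \<omega>)\<^sup>2) \<le> expectation (\<lambda>_. c\<^sup>2)"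
      using bd[of k] X2i by (intro integral_mono_AE) (auto elim!: eventually_mono intro!: sq)
    finally show ?case using Suc.IH by (simp add: prob_space algebra_simps)
  qed simp
qed

lemma (in prob_space) centred_sum_tail:
  fixes X :: "nat \<Rightarrow> 'a \<Rightarrow> real"
  assumes ind: "indep_vars (\<lambda>_. borel) X UNIV" and bd: "\<And>i. AE \<omega> in M. \<bar>X i \<omega>\<bar> \<le> c" and c: "0 \<le> c"
    and mean: "\<And>i. expectation (X i) = 0" and a: "0 < a"
  shows "prob {\<omega> \<in> space M. a \<le> \<bar>\<Sum>i<k. X i \<omega>\<bar>} \<le> real k * c\<^sup>2 / a\<^sup>2"
proof -
  note S2 = centred_sum_second_moment[OF ind bd c mean, of k]
  have "{\<omega> \<in> space M. a \<le> \<bar>\<Sum>i<k. X i \<omega>\<bar>} = {\<omega> \<in> space M. a\<^sup>2 \<le> (\<Sum>i<k. X i \<omega>)\<^sup>2}"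
    using a by (auto simp: abs_le_square_iff[symmetric])
  also have "prob \<dots> \<le> expectation (\<lambda>\<omega>. (\<Sum>i<k. X i \<omega>)\<^sup>2) / a\<^sup>2"
    using a by (intro integral_Markov_inequality_measure[where A="{}"] S2) auto
  also have "\<dots> \<le> real k * c\<^sup>2 / a\<^sup>2" using S2(2) by (intro divide_right_mono) auto
  finally show ?thesis .
qed

text \<open>Chebyshev's inequality on a grid of \<open>O(1)\<close> times; between grid times the increments are
  bounded.\<close>

lemma (in prob_space) centred_sum_maximal:
  fixes X :: "nat \<Rightarrow> 'a \<Rightarrow> real"
  assumes ind: "indep_vars (\<lambda>_. borel) X UNIV" and bd: "\<And>i \<omega>. \<omega> \<in> space M \<Longrightarrow> \<bar>X i \<omega>\<bar> \<le> c" and c: "0 < c"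
    and mean: "\<And>i. expectation (X i) = 0" and \<kappa>: "0 < \<kappa>" and C: "0 \<le> C" and n: "2 * c \<le> \<kappa> * real n"
  shows "\<exists>A\<in>sets M. prob A \<le> (4 * C * c / \<kappa> + 1) * (4 * C * c\<^sup>2 / \<kappa>\<^sup>2) / real n \<and>
    (\<forall>\<omega>\<in>space M - A. \<forall>k. real k \<le> C * real n \<longrightarrow> \<bar>\<Sum>i<k. X i \<omega>\<bar> \<le> \<kappa> * real n)"
proof -
  have Xm: "X i \<in> borel_measurable M" for i using ind unfolding indep_vars_def by auto
  have n0: "0 < real n" using n c \<kappa> by (cases "n = 0") auto
  \<comment> \<open>The grid spacing d is the integer part of q, so that d increments of size c
    amount to at most \<kappa> n / 2. As d is at least q / 2, hence proportional to n, the number of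
    grid points up to C n is bounded independently of n.\<close>
  define q where "q = \<kappa> * real n / (2 * c)"
  have q: "1 \<le> q" using n c by (simp add: q_def field_simps)
  define d where "d = nat \<lfloor>q\<rfloor>"
  have d: "real d \<le> q" "q / 2 \<le> real d" "0 < d"
  proof -
    have "1 \<le> \<lfloor>q\<rfloor>" using q by simp
    then have "real d = of_int \<lfloor>q\<rfloor>" "1 \<le> real d" by (auto simp: d_def)
    then show "real d \<le> q" "q / 2 \<le> real d" "0 < d" by linarith+
  qed
  have dc: "real d * c \<le> \<kappa> * real n / 2"
  proof -
    have "real d * c \<le> q * c" using d c by (intro mult_right_mono) auto
    then show ?thesis using c by (simp add: q_def)
  qed
  define J where "J = {j. real (j * d) \<le> C * real n}"
  have J: "J \<subseteq> {..nat \<lfloor>4 * C * c / \<kappa>\<rfloor>}"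
  proof
    fix j assume "j \<in> J"
    then have "real j * real d \<le> C * real n" unfolding J_def by simp
    moreover have "real j * (q / 2) \<le> real j * real d" using d by (intro mult_left_mono) auto
    ultimately have "real j * (q / 2) \<le> C * real n" by linarith
    then have "real j * (\<kappa> * real n) \<le> 4 * C * c * real n" using c by (simp add: q_def field_simps)
    then have "real j * \<kappa> \<le> 4 * C * c" using n0 by (simp add: mult.assoc[symmetric])
    then have "real j \<le> 4 * C * c / \<kappa>" using \<kappa> by (simp add: field_simps)
    then have "int j \<le> \<lfloor>4 * C * c / \<kappa>\<rfloor>" by (simp add: le_floor_iff)
    then show "j \<in> {..nat \<lfloor>4 * C * c / \<kappa>\<rfloor>}" by simp
  qed
  then have fin: "finite J" by (rule finite_subset) simp
  have "card J \<le> card {..nat \<lfloor>4 * C * c / \<kappa>\<rfloor>}" using J by (intro card_mono) auto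
  then have "card J \<le> nat \<lfloor>4 * C * c / \<kappa>\<rfloor> + 1" by simp
  moreover have "0 \<le> 4 * C * c / \<kappa>" using C c \<kappa> by simp
  then have "real (nat \<lfloor>4 * C * c / \<kappa>\<rfloor>) \<le> 4 * C * c / \<kappa>" by simp
  ultimately have cardJ: "real (card J) \<le> 4 * C * c / \<kappa> + 1" by linarith
  define A where "A = (\<Union>j\<in>J. {\<omega> \<in> space M. \<kappa> * real n / 2 \<le> \<bar>\<Sum>i<j * d. X i \<omega>\<bar>})"
  have As: "{\<omega> \<in> space M. \<kappa> * real n / 2 \<le> \<bar>\<Sum>i<k. X i \<omega>\<bar>} \<in> sets M" for k
    using Xm by measurable
  have pj: "prob {\<omega> \<in> space M. \<kappa> * real n / 2 \<le> \<bar>\<Sum>i<j * d. X i \<omega>\<bar>} \<le> (4 * C * c\<^sup>2 / \<kappa>\<^sup>2) / real n" if "j \<in> J" for j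
  proof -
    have "prob {\<omega> \<in> space M. \<kappa> * real n / 2 \<le> \<bar>\<Sum>i<j * d. X i \<omega>\<bar>} \<le> real (j * d) * c\<^sup>2 / (\<kappa> * real n / 2)\<^sup>2"
      using c \<kappa> n0 bd by (intro centred_sum_tail[OF ind _ _ mean]) auto
    also have "\<dots> \<le> (C * real n) * c\<^sup>2 / (\<kappa> * real n / 2)\<^sup>2"
      using that unfolding J_def by (intro divide_right_mono mult_right_mono) auto
    also have "\<dots> = (4 * C * c\<^sup>2 / \<kappa>\<^sup>2) / real n"
      using n0 \<kappa> by (simp add: field_simps power2_eq_square)
    finally show ?thesis .
  qed
  have "prob A \<le> (\<Sum>j\<in>J. prob {\<omega> \<in> space M. \<kappa> * real n / 2 \<le> \<bar>\<Sum>i<j * d. X i \<omega>\<bar>})"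
    unfolding A_def using fin As by (intro measure_UNION_le) auto
  also have "\<dots> \<le> (\<Sum>j\<in>J. (4 * C * c\<^sup>2 / \<kappa>\<^sup>2) / real n)" by (rule sum_mono[OF pj])
  also have "\<dots> = real (card J) * ((4 * C * c\<^sup>2 / \<kappa>\<^sup>2) / real n)" by simp
  also have "\<dots> \<le> (4 * C * c / \<kappa> + 1) * ((4 * C * c\<^sup>2 / \<kappa>\<^sup>2) / real n)"
    using C n0 by (intro mult_right_mono cardJ) auto
  finally have "prob A \<le> (4 * C * c / \<kappa> + 1) * (4 * C * c\<^sup>2 / \<kappa>\<^sup>2) / real n" by simp
  moreover have "A \<in> sets M" unfolding A_def using fin As by (intro sets.finite_UN) auto
  moreover have "\<bar>\<Sum>i<k. X i \<omega>\<bar> \<le> \<kappa> * real n" if \<omega>: "\<omega> \<in> space M - A" and k: "real k \<le> C * real n" for \<omega> k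
  proof -
    define j where "j = k div d"
    have jk: "j * d \<le> k" "k < j * d + d"
      unfolding j_def using div_mult_mod_eq[of k d] mod_less_divisor[OF d(3), of k] by linarith+
    have "real (j * d) \<le> real k" using jk(1) by (rule of_nat_mono)
    then have "j \<in> J" unfolding J_def using k by simp
    then have 1: "\<bar>\<Sum>i<j * d. X i \<omega>\<bar> < \<kappa> * real n / 2" using \<omega> unfolding A_def by (auto simp: not_le)
    have "(\<Sum>i<k. X i \<omega>) = (\<Sum>i<j * d. X i \<omega>) + (\<Sum>i=j * d..<k. X i \<omega>)"
      using jk(1) by (metis sum.atLeastLessThan_concat atLeast0LessThan zero_le)
    moreover have "\<bar>\<Sum>i=j * d..<k. X i \<omega>\<bar> \<le> (\<Sum>i=j * d..<k. c)"
      using bd \<omega> by (intro order_trans[OF sum_abs] sum_mono) auto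
    moreover have "real (k - j * d) \<le> real d" using jk by (intro of_nat_mono) linarith
    then have "(\<Sum>i=j * d..<k. c) \<le> real d * c"
      using c by (simp add: mult_right_mono del: of_nat_diff)
    ultimately show ?thesis using 1 dc by linarith
  qed
  ultimately show ?thesis by blast
qed

text \<open>A relabelling: service times are numbered from 1, partial sums from 0.\<close>

lemma (in prob_space) indep_vars_Suc:
  assumes "indep_vars M' X {1..}"
  shows "indep_vars (\<lambda>i. M' (Suc i)) (\<lambda>i. X (Suc i)) UNIV"
  unfolding indep_vars_def2
proof
  show "\<forall>i\<in>UNIV. random_variable (M' (Suc i)) (X (Suc i))"
    using assms unfolding indep_vars_def2 by auto
  let ?F = "\<lambda>i. {X i -` A \<inter> space M |A. A \<in> sets (M' i)}"
  have F: "indep_sets ?F {1..}" using assms unfolding indep_vars_def2 by blast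
  show "indep_sets (\<lambda>i. ?F (Suc i)) UNIV"
  proof (rule indep_setsI)
    show "?F (Suc i) \<subseteq> events" for i using F unfolding indep_sets_def by auto
    fix A J assume J: "J \<noteq> {}" "finite J" "\<forall>j\<in>J. A j \<in> ?F (Suc j)"
    have "prob (\<Inter>j\<in>Suc ` J. A (j - 1)) = (\<Prod>j\<in>Suc ` J. prob (A (j - 1)))"
      by (rule indep_setsD[OF F]) (use J in auto)
    then show "prob (\<Inter>j\<in>J. A j) = (\<Prod>j\<in>J. prob (A j))"
      by (simp add: prod.reindex)
  qed
qed

section \<open>The queue as a superposition of customers\<close>

text \<open>The interval measure and the image of counting measure on J under z have the same
  distribution function, so they coincide.\<close>

lemma integral_interval_measure_heaviside:
  fixes z :: "'i \<Rightarrow> real"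
  assumes J: "finite J"
  shows "(\<integral>y. sfun \<phi> y \<partial>interval_measure (\<lambda>y. \<Sum>i\<in>J. heaviside (z i) y)) = (\<Sum>i\<in>J. sfun \<phi> (z i))"
proof -
  let ?F = "\<lambda>y. \<Sum>i\<in>J. heaviside (z i) y"
  let ?D = "distr (count_space J) borel z"
  have mono: "?F x \<le> ?F y" if "x \<le> y" for x y
    using that by (intro sum_mono) auto
  have right: "continuous (at_right x) ?F" for x
    unfolding continuous_within by (intro tendsto_sum heaviside_tendsto_right)
  have bot: "(?F \<longlongrightarrow> 0) at_bot"
  proof -
    have "\<forall>\<^sub>F y in at_bot. heaviside a y = 0" for a
      using eventually_at_bot_dense[of "\<lambda>y. heaviside a y = 0"] by (auto intro!: exI[of _ a])
    then have "(?F \<longlongrightarrow> (\<Sum>i\<in>J. 0)) at_bot" by (intro tendsto_sum tendsto_eventually)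
    then show ?thesis by simp
  qed
  have top: "(?F \<longlongrightarrow> (\<Sum>i\<in>J. 1)) at_top"
    by (intro tendsto_sum tendsto_eventually) (auto simp: eventually_at_top_linorder)
  have fin: "finite_borel_measure (interval_measure ?F)"
    by (rule finite_borel_measure_interval_measure[OF mono right bot top]) simp_all
  interpret C: finite_measure "count_space J" using J by (rule finite_measure_count_space)
  have zm: "z \<in> measurable (count_space J) borel" by simp
  have D: "finite_borel_measure ?D"
    by (intro finite_borel_measure.intro finite_borel_measure_axioms.intro C.finite_measure_distr) auto
  have "cdf ?D y = ?F y" for y
  proof -
    have "cdf ?D y = measure (count_space J) (z -` {..y} \<inter> J)"
      unfolding cdf_def by (subst measure_distr) auto
    also have "\<dots> = real (card (z -` {..y} \<inter> J))" using J by (simp add: measure_def emeasure_count_space_finite)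
    also have "\<dots> = ?F y" using J by (simp add: sum.If_cases vimage_def Int_commute)
    finally show ?thesis .
  qed
  then have "cdf ?D = ?F" by (rule ext)
  moreover have "cdf (interval_measure ?F) = ?F" by (rule cdf_interval_measure[OF mono right bot])
  ultimately have "interval_measure ?F = ?D" using cdf_unique'[OF fin D] by simp
  then show ?thesis
    using J by (simp add: integral_distr lebesgue_integral_count_space_finite)
qed

text \<open>The hypotheses make S a closed half line that starts at Inf S.\<close>

lemma Inf_le_iff_mem:
  fixes S :: "real set"
  assumes S: "S \<noteq> {}" "bdd_below S" and up: "\<And>y z. y \<in> S \<Longrightarrow> y \<le> z \<Longrightarrow> z \<in> S"
    and right: "\<And>y. y \<notin> S \<Longrightarrow> \<exists>d>y. \<forall>z\<in>{y..<d}. z \<notin> S"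
  shows "Inf S \<le> y \<longleftrightarrow> y \<in> S"
proof
  assume le: "Inf S \<le> y"
  show "y \<in> S"
  proof (rule ccontr)
    assume y: "y \<notin> S"
    then obtain d where d: "y < d" "\<forall>z\<in>{y..<d}. z \<notin> S" using right by blast
    have "d \<le> Inf S"
    proof (rule cInf_greatest[OF S(1)])
      fix z assume z: "z \<in> S"
      show "d \<le> z"
      proof (rule ccontr)
        assume "\<not> d \<le> z"
        then have "z < y" using d(2) z by (meson atLeastLessThan_iff linorder_not_le)
        then show False using up[OF z, of y] y by simp
      qed
    qed
    then show False using le d(1) by linarith
  qed
qed (rule cInf_lower[OF _ S(2)])

text \<open>An integer-valued function is constant just to the right of a point of right
  continuity.\<close>

lemma right_continuous_nat_less:
  fixes f :: "real \<Rightarrow> nat"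
  assumes "(f \<longlongrightarrow> f y) (at_right y)" "\<not> k \<le> f y"
  shows "\<exists>d>y. \<forall>z\<in>{y..<d}. \<not> k \<le> f z"
proof -
  have "\<forall>\<^sub>F z in at_right y. f z = f y" using assms(1) by (simp add: tendsto_discrete)
  then obtain d where d: "y < d" "\<And>z. y < z \<Longrightarrow> z < d \<Longrightarrow> f z = f y"
    unfolding eventually_at_right_field by blast
  have "\<not> k \<le> f z" if "z \<in> {y..<d}" for z
    using d(2)[of z] assms(2) that by (cases "z = y") auto
  then show ?thesis using d(1) by blast
qed

text \<open>For a monotone bounded r this is its limit at infinity, written with integer arguments
  only so that it is measurable in a random r.\<close>

definition initial_total :: "(real \<Rightarrow> nat) \<Rightarrow> nat" where
  "initial_total r = (LEAST n. \<forall>j::nat. r (real j) \<le> n)"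

text \<open>Generalized inverse of the counting function: the k-th smallest residual service time at
  time 0.\<close>

definition initial_time :: "(real \<Rightarrow> nat) \<Rightarrow> nat \<Rightarrow> real" where
  "initial_time r k = Inf {y. k \<le> r y}"

text \<open>The customers present at time \<open>0\<close> are listed first, as arrivals at time \<open>0\<close>. Beyond the
  customers arriving in \<open>[0,T]\<close> the arrival time takes the dummy value \<open>T\<close>.\<close>

definition customer_arrival :: "real \<Rightarrow> (real \<Rightarrow> nat) \<Rightarrow> (real \<Rightarrow> nat) \<Rightarrow> nat \<Rightarrow> real" where
  "customer_arrival T e r i = (if i < initial_total r then 0
     else if Suc i - initial_total r \<le> e T then arrival_time e (Suc i - initial_total r) else T)"

text \<open>Positions start at 0 and ranks at 1: position i holds the initial customer of rank i +
  1, or else arrival number i + 1 - K, where K is the number of initial customers.\<close>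

definition customer_service :: "(real \<Rightarrow> nat) \<Rightarrow> (nat \<Rightarrow> real) \<Rightarrow> nat \<Rightarrow> real" where
  "customer_service r s i = (if i < initial_total r then initial_time r (Suc i) else s (Suc i - initial_total r))"

lemma sum_lessThan_add: "(\<Sum>i<m + n. f i) = (\<Sum>i<m. f i) + (\<Sum>j<n. f (m + j))"
  for f :: "nat \<Rightarrow> real"
  by (induction n) simp_all

context G_GI_infinity_queue
begin

lemma initial_total_upper:
  assumes \<omega>: "\<omega> \<in> space M"
  shows "R0 \<omega> y \<le> initial_total (R0 \<omega>)"
proof -
  obtain K where "\<forall>y. R0 \<omega> y \<le> K" using R0_finite[OF \<omega>] by blast
  then have "\<forall>j::nat. R0 \<omega> (real j) \<le> K" by blast
  then have *: "\<forall>j::nat. R0 \<omega> (real j) \<le> initial_total (R0 \<omega>)"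
    unfolding initial_total_def by (rule LeastI)
  obtain j :: nat where "y \<le> real j" using real_arch_simple by blast
  then have "R0 \<omega> y \<le> R0 \<omega> (real j)" by (rule monoD[OF R0_mono[OF \<omega>]])
  then show ?thesis using *[rule_format, of j] by simp
qed

text \<open>The set under the infimum is nonempty because k is below the total, and bounded below
  because R0 vanishes near minus infinity; \<open>Inf_le_iff_mem\<close> then applies.\<close>

lemma initial_time_le_iff:
  assumes \<omega>: "\<omega> \<in> space M" and k: "k < initial_total (R0 \<omega>)"
  shows "initial_time (R0 \<omega>) (Suc k) \<le> y \<longleftrightarrow> Suc k \<le> R0 \<omega> y"
proof -
  let ?S = "{y. Suc k \<le> R0 \<omega> y}"
  have "\<not> (\<forall>j::nat. R0 \<omega> (real j) \<le> k)"
    using not_less_Least[of k "\<lambda>n. \<forall>j::nat. R0 \<omega> (real j) \<le> n"] k unfolding initial_total_def by blast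
  then have ne: "?S \<noteq> {}" by (auto simp: not_le Suc_le_eq)
  have "\<forall>\<^sub>F y in at_bot. R0 \<omega> y = 0" using R0_at_bot[OF \<omega>] by (simp add: tendsto_discrete)
  then obtain b where b: "\<And>y. y \<le> b \<Longrightarrow> R0 \<omega> y = 0" unfolding eventually_at_bot_linorder by blast
  have "bdd_below ?S"
  proof (rule bdd_belowI[of _ b])
    fix y assume "y \<in> ?S"
    then show "b \<le> y" using b[of y] by (cases "y \<le> b") auto
  qed
  moreover have "z \<in> ?S" if "y \<in> ?S" "y \<le> z" for y z
    using that monoD[OF R0_mono[OF \<omega>] that(2)] by simp
  moreover have "\<exists>d>y. \<forall>z\<in>{y..<d}. z \<notin> ?S" if "y \<notin> ?S" for y
  proof -
    have "(R0 \<omega> \<longlongrightarrow> R0 \<omega> y) (at_right y)"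
      using R0_right_continuous[OF \<omega>, of y] by (simp add: continuous_within)
    from right_continuous_nat_less[OF this, of "Suc k"] show ?thesis using that by simp
  qed
  ultimately have "Inf ?S \<le> y \<longleftrightarrow> y \<in> ?S" using ne by (intro Inf_le_iff_mem)
  then show ?thesis unfolding initial_time_def by simp
qed

text \<open>The integer \<open>R0 \<omega> y\<close> counts the ranks k + 1 that do not exceed it,
  and by \<open>initial_time_le_iff\<close> these belong to the customers with residual time at most
  y.\<close>

lemma R0_eq_sum:
  assumes \<omega>: "\<omega> \<in> space M"
  shows "real (R0 \<omega> y) = (\<Sum>k<initial_total (R0 \<omega>). heaviside (initial_time (R0 \<omega>) (Suc k)) y)"
proof -
  let ?K = "initial_total (R0 \<omega>)"
  have "(\<Sum>k<?K. heaviside (initial_time (R0 \<omega>) (Suc k)) y) = (\<Sum>k<?K. if k \<in> {..<R0 \<omega> y} then 1 else 0)"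
    using initial_time_le_iff[OF \<omega>] by (intro sum.cong refl) (auto simp: Suc_le_eq)
  also have "\<dots> = (\<Sum>k\<in>{..<?K} \<inter> {..<R0 \<omega> y}. 1)" by (rule sum.inter_restrict[symmetric]) simp
  also have "{..<?K} \<inter> {..<R0 \<omega> y} = {..<R0 \<omega> y}"
    using initial_total_upper[OF \<omega>, of y] by auto
  finally show ?thesis by simp
qed

text \<open>By monotonicity and right continuity, the times at which at least i customers have
  arrived form a closed half line that begins at the arrival time.\<close>

lemma arrival_time_le_iff:
  assumes \<omega>: "\<omega> \<in> space M" and i: "1 \<le> i" "i \<le> E \<omega> T" and T: "0 \<le> T"
  shows "0 \<le> t \<Longrightarrow> arrival_time (E \<omega>) i \<le> t \<longleftrightarrow> i \<le> E \<omega> t" "arrival_time (E \<omega>) i \<in> {0..T}"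
proof -
  let ?S = "{t. 0 \<le> t \<and> i \<le> E \<omega> t}"
  have ne: "?S \<noteq> {}" using i T by auto
  have bdd: "bdd_below ?S" by (rule bdd_belowI[of _ 0]) simp
  have up: "z \<in> ?S" if "y \<in> ?S" "y \<le> z" for y z
    using that mono_onD[OF E_mono[OF \<omega>], of y z] by auto
  have right: "\<exists>d>y. \<forall>z\<in>{y..<d}. z \<notin> ?S" if y: "y \<notin> ?S" for y
  proof (cases "0 \<le> y")
    case True
    have "(E \<omega> \<longlongrightarrow> E \<omega> y) (at_right y)"
      using E_cadlag[OF \<omega>, of "y + 1"] True unfolding cadlag_on_def by auto
    moreover have "\<not> i \<le> E \<omega> y" using y True by simp
    ultimately obtain d where "y < d" "\<forall>z\<in>{y..<d}. \<not> i \<le> E \<omega> z"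
      using right_continuous_nat_less[of "E \<omega>" y i] by blast
    then show ?thesis by (intro exI[of _ d]) simp
  qed (auto intro!: exI[of _ 0])
  have iff: "arrival_time (E \<omega>) i \<le> t \<longleftrightarrow> t \<in> ?S" for t
    unfolding arrival_time_def by (rule Inf_le_iff_mem[OF ne bdd up right])
  show "0 \<le> t \<Longrightarrow> arrival_time (E \<omega>) i \<le> t \<longleftrightarrow> i \<le> E \<omega> t" using iff[of t] by simp
  have "0 \<le> arrival_time (E \<omega>) i" using iff[of "arrival_time (E \<omega>) i"] by simp
  moreover have "arrival_time (E \<omega>) i \<le> T" using iff[of T] i T by simp
  ultimately show "arrival_time (E \<omega>) i \<in> {0..T}" by simp
qed

lemma customer_arrival_range:
  assumes "\<omega> \<in> space M" "0 \<le> T"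
  shows "customer_arrival T (E \<omega>) (R0 \<omega>) i \<in> {0..T}"
  using assms arrival_time_le_iff(2)[OF assms(1) _ _ assms(2), of "Suc i - initial_total (R0 \<omega>)"]
  unfolding customer_arrival_def by (auto simp: not_less)

lemma E_le: "\<omega> \<in> space M \<Longrightarrow> 0 \<le> t \<Longrightarrow> t \<le> T \<Longrightarrow> E \<omega> t \<le> E \<omega> T"
  using mono_onD[OF E_mono, of \<omega> t T] by auto

text \<open>A customer with arrival time a and service time s is a unit mass at s - (t - a) from
  time a on. Initial customers arrive at time 0, so at time t their masses sit at the initial
  residual times moved by -t, which accounts for R0 at t + y.\<close>

lemma residual_dist_eq_customer_path:
  assumes \<omega>: "\<omega> \<in> space M" and t: "t \<in> {0..T}"
  shows "w *\<^sub>R residual_dist (E \<omega>) (R0 \<omega>) (\<lambda>i. \<eta> i \<omega>) t = customer_path w (initial_total (R0 \<omega>) + E \<omega> T)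
    (customer_arrival T (E \<omega>) (R0 \<omega>)) (customer_service (R0 \<omega>) (\<lambda>i. \<eta> i \<omega>)) t"
proof (rule tempered_eqI)
  fix \<phi>
  let ?K = "initial_total (R0 \<omega>)" and ?a = "customer_arrival T (E \<omega>) (R0 \<omega>)"
    and ?s = "customer_service (R0 \<omega>) (\<lambda>i. \<eta> i \<omega>)"
  let ?z = "\<lambda>i. ?s i - (t - ?a i)"
  have T: "0 \<le> T" using t by simp
  have Et: "E \<omega> t \<le> E \<omega> T" using E_le[OF \<omega>] t by auto
  \<comment> \<open>The positions present at time t form an initial segment; the list itself runs to
    \<open>E \<omega> T\<close> so that it does not depend on t.\<close>
  have J: "{i \<in> {..<?K + E \<omega> T}. ?a i \<le> t} = {..<?K + E \<omega> t}"
  proof (rule set_eqI)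
    fix i
    show "i \<in> {i \<in> {..<?K + E \<omega> T}. ?a i \<le> t} \<longleftrightarrow> i \<in> {..<?K + E \<omega> t}"
    proof (cases "i < ?K")
      case True
      then show ?thesis using t by (simp add: customer_arrival_def)
    next
      case False
      then obtain j where j: "i = ?K + j" by (metis le_add_diff_inverse not_less)
      show ?thesis
      proof (cases "j < E \<omega> T")
        case True
        then have "?a i = arrival_time (E \<omega>) (Suc j)" unfolding j customer_arrival_def by simp
        then show ?thesis using arrival_time_le_iff(1)[OF \<omega> _ _ T, of "Suc j" t] True t j by (auto simp: Suc_le_eq)
      next
        case False
        then show ?thesis using j Et by auto
      qed
    qed
  qed
  have "residual_count (E \<omega>) (R0 \<omega>) (\<lambda>i. \<eta> i \<omega>) t = (\<lambda>y. \<Sum>i\<in>{..<?K + E \<omega> t}. heaviside (?z i) y)"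
  proof
    fix y
    have "(\<Sum>i<?K + E \<omega> t. heaviside (?z i) y) = (\<Sum>i<?K. heaviside (?z i) y) + (\<Sum>j<E \<omega> t. heaviside (?z (?K + j)) y)"
      by (rule sum_lessThan_add)
    also have "(\<Sum>i<?K. heaviside (?z i) y) = (\<Sum>i<?K. heaviside (initial_time (R0 \<omega>) (Suc i)) (t + y))"
      by (rule sum.cong[OF refl]) (auto simp: customer_arrival_def customer_service_def)
    also have "\<dots> = real (R0 \<omega> (t + y))" by (rule R0_eq_sum[OF \<omega>, symmetric])
    also have "(\<Sum>j<E \<omega> t. heaviside (?z (?K + j)) y)
        = (\<Sum>j<E \<omega> t. if \<eta> (Suc j) \<omega> - (t - arrival_time (E \<omega>) (Suc j)) \<le> y then 1 else 0)"
      using Et by (intro sum.cong refl) (simp add: customer_arrival_def customer_service_def)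
    also have "\<dots> = (\<Sum>i=1..E \<omega> t. if \<eta> i \<omega> - (t - arrival_time (E \<omega>) i) \<le> y then 1 else 0)"
      using sum.atLeast1_atMost_eq[of "\<lambda>i. if \<eta> i \<omega> - (t - arrival_time (E \<omega>) i) \<le> y then 1 else (0::real)" "E \<omega> t"] by simp
    finally show "residual_count (E \<omega>) (R0 \<omega>) (\<lambda>i. \<eta> i \<omega>) t y = (\<Sum>i\<in>{..<?K + E \<omega> t}. heaviside (?z i) y)"
      unfolding residual_count_def by simp
  qed
  then have "pairing (residual_dist (E \<omega>) (R0 \<omega>) (\<lambda>i. \<eta> i \<omega>) t) \<phi> = (\<Sum>i\<in>{..<?K + E \<omega> t}. sfun \<phi> (?z i))"
    unfolding pairing_residual_dist[OF \<omega>] by (simp only: integral_interval_measure_heaviside finite_lessThan)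
  also have "\<dots> = (\<Sum>i\<in>{..<?K + E \<omega> T}. if ?a i \<le> t then sfun \<phi> (?z i) else 0)"
    unfolding J[symmetric] by (rule sum.inter_filter) simp
  also have "\<dots> = (\<Sum>i<?K + E \<omega> T. heaviside (?a i) t * sfun \<phi> (?z i))"
    by (rule sum.cong[OF refl]) simp
  finally show "pairing (w *\<^sub>R residual_dist (E \<omega>) (R0 \<omega>) (\<lambda>i. \<eta> i \<omega>) t) \<phi>
      = pairing (customer_path w (?K + E \<omega> T) ?a ?s t) \<phi>"
    unfolding scaleR_tempered.rep_eq pairing_customer_path by simp
qed

section \<open>Borel measurability of the residual process\<close>

lemma initial_total_measurable: "(\<lambda>\<omega>. initial_total (R0 \<omega>)) \<in> measurable M (count_space UNIV)"
proof -
  have "Measurable.pred M (\<lambda>\<omega>. \<forall>j::nat. R0 \<omega> (real j) \<le> n)" for n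
    using R0_measurable by measurable
  then show ?thesis unfolding initial_total_def by (rule measurable_Least)
qed

lemma customer_service_measurable:
  "(\<lambda>\<omega>. customer_service (R0 \<omega>) (\<lambda>i. \<eta> i \<omega>) i) \<in> borel_measurable M"
proof -
  note K = initial_total_measurable
  have \<eta>m: "\<eta> i \<in> borel_measurable M" if "1 \<le> i" for i
    using distributed_measurable[OF \<eta>_density[OF that]] by simp
  have "(\<lambda>\<omega>. if i < initial_total (R0 \<omega>) then initial_time (R0 \<omega>) (Suc i) else 0) \<in> borel_measurable M"
    unfolding borel_measurable_iff_le
  proof
    fix a :: real
    have "{\<omega> \<in> space M. (if i < initial_total (R0 \<omega>) then initial_time (R0 \<omega>) (Suc i) else 0) \<le> a}
        = {\<omega> \<in> space M. if i < initial_total (R0 \<omega>) then Suc i \<le> R0 \<omega> a else 0 \<le> a}"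
      using initial_time_le_iff[of _ i a] by auto
    also have "\<dots> \<in> sets M" using K R0_measurable[of a] by measurable
    finally show "{\<omega> \<in> space M. (if i < initial_total (R0 \<omega>) then initial_time (R0 \<omega>) (Suc i) else 0) \<le> a} \<in> sets M" .
  qed
  note f = this
  \<comment> \<open>With the number of initial customers frozen at k the outer branch is
    deterministic; the random number is put back by
    \<open>measurable_compose_countable\<close>.\<close>
  have "(\<lambda>\<omega>. if i < k then if i < initial_total (R0 \<omega>) then initial_time (R0 \<omega>) (Suc i) else 0 else \<eta> (Suc i - k) \<omega>) \<in> borel_measurable M" for k
    using f \<eta>m[of "Suc i - k"] by (cases "i < k") simp_all
  from measurable_compose_countable[OF this K]
  have "(\<lambda>\<omega>. if i < initial_total (R0 \<omega>) then if i < initial_total (R0 \<omega>) then initial_time (R0 \<omega>) (Suc i) else 0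
      else \<eta> (Suc i - initial_total (R0 \<omega>)) \<omega>) \<in> borel_measurable M" .
  then show ?thesis
    unfolding customer_service_def by (rule measurable_cong[THEN iffD1, rotated]) simp
qed

lemma customer_arrival_measurable:
  assumes T: "0 \<le> T"
  shows "(\<lambda>\<omega>. customer_arrival T (E \<omega>) (R0 \<omega>) i) \<in> borel_measurable M"
proof -
  note K = initial_total_measurable
  have f: "(\<lambda>\<omega>. if i \<le> E \<omega> T then arrival_time (E \<omega>) i else T) \<in> borel_measurable M" if i: "1 \<le> i" for i
    unfolding borel_measurable_iff_le
  proof
    fix a :: real
    show "{\<omega> \<in> space M. (if i \<le> E \<omega> T then arrival_time (E \<omega>) i else T) \<le> a} \<in> sets M"
    proof (cases "a < 0")
      case True
      have "\<not> (if i \<le> E \<omega> T then arrival_time (E \<omega>) i else T) \<le> a" if "\<omega> \<in> space M" for \<omega>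
        using arrival_time_le_iff(2)[OF that i _ T] T True by auto
      then have "{\<omega> \<in> space M. (if i \<le> E \<omega> T then arrival_time (E \<omega>) i else T) \<le> a} = {}" by blast
      then show ?thesis by (simp only: sets.empty_sets)
    next
      case False
      then have "{\<omega> \<in> space M. (if i \<le> E \<omega> T then arrival_time (E \<omega>) i else T) \<le> a}
          = {\<omega> \<in> space M. if i \<le> E \<omega> T then i \<le> E \<omega> a else T \<le> a}"
        using arrival_time_le_iff(1)[OF _ i _ T, of _ a] by auto
      also have "\<dots> \<in> sets M"
      proof -
        have [measurable]: "(\<lambda>\<omega>. E \<omega> T) \<in> measurable M (count_space UNIV)" "(\<lambda>\<omega>. E \<omega> a) \<in> measurable M (count_space UNIV)"
          using False T by (auto intro: E_measurable)
        show ?thesis by measurable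
      qed
      finally show ?thesis .
    qed
  qed
  have "(\<lambda>\<omega>. if i < k then 0 else if Suc i - k \<le> E \<omega> T then arrival_time (E \<omega>) (Suc i - k) else T) \<in> borel_measurable M" for k
    using f[of "Suc i - k"] by (cases "i < k") simp_all
  from measurable_compose_countable[OF this K] show ?thesis unfolding customer_arrival_def .
qed

text \<open>By the superposition formula the path depends only on the random number of customers and
  on their arrival and service times, so \<open>measurable_customer_path\<close> applies.\<close>

lemma residual_path_measurable:
  assumes T: "0 \<le> T"
  shows "(\<lambda>\<omega>. \<lambda>t\<in>{0..T}. w *\<^sub>R residual_dist (E \<omega>) (R0 \<omega>) (\<lambda>i. \<eta> i \<omega>) t)
    \<in> measurable M (borel_of_top (skorokhod_topology T))"
proof -
  have n: "(\<lambda>\<omega>. initial_total (R0 \<omega>) + E \<omega> T) \<in> measurable M (count_space UNIV)"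
    using initial_total_measurable E_measurable[OF T] by measurable
  have "(\<lambda>\<omega>. restrict (customer_path w (initial_total (R0 \<omega>) + E \<omega> T)
      (\<lambda>i. customer_arrival T (E \<omega>) (R0 \<omega>) i) (\<lambda>i. customer_service (R0 \<omega>) (\<lambda>i. \<eta> i \<omega>) i)) {0..T})
      \<in> measurable M (borel_of_top (skorokhod_topology T))"
    by (intro measurable_customer_path n customer_arrival_measurable customer_service_measurable customer_arrival_range T)
  then show ?thesis
    by (rule measurable_cong[THEN iffD1, rotated])
      (auto intro!: restrict_ext simp: residual_dist_eq_customer_path)
qed

section \<open>Pairings with the service distribution\<close>

lemma interval_measure_service: "i \<ge> 1 \<Longrightarrow> interval_measure F = distr M borel (\<eta> i)"
proof -
  assume i: "i \<ge> 1"
  let ?D = "distr M borel (\<eta> i)"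
  have \<eta>_meas: "\<eta> i \<in> borel_measurable M"
    using distributed_measurable[OF \<eta>_density[OF i]] by simp
  interpret D: real_distribution ?D
    using \<eta>_meas by (rule real_distribution_distr)
  have F: "F = cdf ?D"
    using \<eta>_cdf[OF i] by simp
  have "real_distribution (interval_measure F)"
    unfolding F by (intro real_distribution_interval_measure D.cdf_nondecreasing
        D.cdf_is_right_cont D.cdf_lim_at_bot D.cdf_lim_at_top_prob)
  moreover have "cdf (interval_measure F) = cdf ?D"
    unfolding F by (intro cdf_interval_measure D.cdf_nondecreasing
        D.cdf_is_right_cont D.cdf_lim_at_bot)
  ultimately show "interval_measure F = ?D"
    by (rule cdf_unique[OF _ D.real_distribution_axioms])
qed

lemma pairing_service_dist_expectation:
  assumes "i \<ge> 1"
  shows "pairing (service_dist F) \<phi> = expectation (\<lambda>\<omega>. sfun \<phi> (\<eta> i \<omega>))"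
proof -
  have \<eta>_meas: "\<eta> i \<in> borel_measurable M"
    using distributed_measurable[OF \<eta>_density[OF assms]] by simp
  interpret D: prob_space "distr M borel (\<eta> i)" using \<eta>_meas by (rule prob_space_distr)
  have "pairing (service_dist F) \<phi> = (\<integral>y. sfun \<phi> y \<partial>distr M borel (\<eta> i))"
    unfolding service_dist_def interval_measure_service[OF assms]
    by (intro pairing_dist_of_measure D.finite_measure_axioms) simp
  also have "\<dots> = expectation (\<lambda>\<omega>. sfun \<phi> (\<eta> i \<omega>))"
    using \<eta>_meas by (intro integral_distr) auto
  finally show ?thesis .
qed

lemma service_dist_bound: "\<bar>pairing (service_dist F) \<phi>\<bar> \<le> schwartz_norm 0 \<phi>"
proof -
  have bd: "\<bar>sfun \<phi> x\<bar> \<le> schwartz_norm 0 \<phi>" for x using sderiv_le_norm[of 0 0 \<phi> x] by simp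
  have \<eta>_meas: "\<eta> 1 \<in> borel_measurable M"
    using distributed_measurable[OF \<eta>_density[of 1]] by simp
  have int: "integrable M (\<lambda>\<omega>. sfun \<phi> (\<eta> 1 \<omega>))"
    using bd \<eta>_meas by (intro integrable_const_bound[where B="schwartz_norm 0 \<phi>"]) auto
  have "\<bar>expectation (\<lambda>\<omega>. sfun \<phi> (\<eta> 1 \<omega>))\<bar> \<le> expectation (\<lambda>\<omega>. \<bar>sfun \<phi> (\<eta> 1 \<omega>)\<bar>)"
    by (rule integral_abs_bound)
  also have "\<dots> \<le> expectation (\<lambda>_. schwartz_norm 0 \<phi>)"
    using int bd by (intro integral_mono) auto
  finally show ?thesis by (simp add: pairing_service_dist_expectation[of 1] prob_space)
qed

text \<open>A vanishing mean would force the Gaussian to vanish almost surely. The pairing being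
  nonzero, \<open>gaussian\<close> can serve as \<theta> in the fluid map.\<close>

lemma pairing_service_dist_gaussian: "0 < pairing (service_dist F) gaussian"
proof -
  have \<eta>_meas: "\<eta> 1 \<in> borel_measurable M"
    using distributed_measurable[OF \<eta>_density[of 1]] by simp
  have int: "integrable M (\<lambda>\<omega>. exp (- (\<eta> 1 \<omega>)\<^sup>2))"
    using \<eta>_meas by (intro integrable_const_bound[where B=1]) auto
  have "expectation (\<lambda>\<omega>. exp (- (\<eta> 1 \<omega>)\<^sup>2)) \<noteq> 0"
  proof
    assume "expectation (\<lambda>\<omega>. exp (- (\<eta> 1 \<omega>)\<^sup>2)) = 0"
    then have "AE \<omega> in M. exp (- (\<eta> 1 \<omega>)\<^sup>2) = 0"
      using integral_nonneg_eq_0_iff_AE[OF int] by simp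
    then show False by simp
  qed
  moreover have "0 \<le> expectation (\<lambda>\<omega>. exp (- (\<eta> 1 \<omega>)\<^sup>2))" by (rule Bochner_Integration.integral_nonneg) simp
  ultimately have "0 < expectation (\<lambda>\<omega>. exp (- (\<eta> 1 \<omega>)\<^sup>2))" by (metis less_le)
  then show ?thesis
    by (simp add: pairing_service_dist_expectation[of 1] gaussian.rep_eq)
qed

end

section \<open>Comparison of the queue with its fluid equation\<close>

text \<open>As in the fluid equation, the transported sum is the untransported one minus the time integral
  of its shifts.\<close>

lemma delayed_sum_bound:
  fixes N :: nat and a :: "nat \<Rightarrow> real" and m :: "nat \<Rightarrow> tempered"
  assumes a: "\<And>j. j < N \<Longrightarrow> 0 \<le> a j" and t: "t \<in> {0..T}" and \<phi>: "\<phi> \<in> B"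
    and small: "\<And>s \<psi>. s \<in> {0..T} \<Longrightarrow> \<psi> \<in> B \<union> {schwartz_shift u \<phi> |u \<phi>. \<phi> \<in> schwartz_deriv ` B \<and> \<bar>u\<bar> \<le> T} \<Longrightarrow>
      \<bar>w * (\<Sum>j<N. heaviside (a j) s * pairing (m j) \<psi>)\<bar> \<le> \<kappa>"
  shows "\<bar>w * (\<Sum>j<N. heaviside (a j) t * pairing (m j) (schwartz_shift (t - a j) \<phi>))\<bar> \<le> (1 + T) * \<kappa>"
proof -
  let ?g = "\<lambda>j s. heaviside (a j) s * pairing (m j) (schwartz_shift (t - s) (schwartz_deriv \<phi>))"
  have int: "?g j integrable_on {0..t}" for j
    by (intro integrable_heaviside continuous_on_pairing_shift_diff)
  have ints: "(\<lambda>s. \<Sum>j<N. ?g j s) integrable_on {0..t}" by (intro integrable_sum int) auto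
  have "integral {0..t} (\<lambda>s. \<Sum>j<N. ?g j s) = (\<Sum>j<N. integral {0..t} (?g j))"
    by (rule integral_sum[OF finite_lessThan int])
  also have "\<dots> = (\<Sum>j<N. heaviside (a j) t * (pairing (m j) \<phi> - pairing (m j) (schwartz_shift (t - a j) \<phi>)))"
    using a by (intro sum.cong refl fluid_integral_heaviside) simp
  also have "\<dots> = (\<Sum>j<N. heaviside (a j) t * pairing (m j) \<phi>) - (\<Sum>j<N. heaviside (a j) t * pairing (m j) (schwartz_shift (t - a j) \<phi>))"
    by (simp only: right_diff_distrib sum_subtractf)
  finally have eq: "(\<Sum>j<N. heaviside (a j) t * pairing (m j) (schwartz_shift (t - a j) \<phi>))
      = (\<Sum>j<N. heaviside (a j) t * pairing (m j) \<phi>) - integral {0..t} (\<lambda>s. \<Sum>j<N. ?g j s)" by simp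
  have eq': "w * (\<Sum>j<N. heaviside (a j) t * pairing (m j) (schwartz_shift (t - a j) \<phi>))
      = w * (\<Sum>j<N. heaviside (a j) t * pairing (m j) \<phi>) - integral {0..t} (\<lambda>s. w * (\<Sum>j<N. ?g j s))"
    unfolding eq right_diff_distrib integral_mult_right ..
  have 1: "\<bar>w * (\<Sum>j<N. heaviside (a j) t * pairing (m j) \<phi>)\<bar> \<le> \<kappa>" using t \<phi> by (intro small) auto
  then have \<kappa>: "0 \<le> \<kappa>" by linarith
  have "\<bar>integral {0..t} (\<lambda>s. w * (\<Sum>j<N. ?g j s))\<bar> \<le> \<kappa> * (t - 0)"
  proof (rule integral_abs_le_const)
    show "(\<lambda>s. w * (\<Sum>j<N. ?g j s)) integrable_on {0..t}" by (intro integrable_on_mult_right ints)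
    fix s assume s: "s \<in> {0..t}"
    have "schwartz_shift (t - s) (schwartz_deriv \<phi>) \<in> {schwartz_shift u \<phi> |u \<phi>. \<phi> \<in> schwartz_deriv ` B \<and> \<bar>u\<bar> \<le> T}"
      using s t \<phi> by (intro CollectI exI[of _ "t - s"] exI[of _ "schwartz_deriv \<phi>"]) auto
    then show "\<bar>w * (\<Sum>j<N. ?g j s)\<bar> \<le> \<kappa>" using s t by (intro small) auto
  qed (use t in simp)
  also have "\<kappa> * (t - 0) \<le> \<kappa> * T" using \<kappa> t by (intro mult_left_mono) auto
  finally show ?thesis unfolding eq' using 1 by (simp add: algebra_simps abs_le_iff)
qed

lemma fluid_path_cong:
  assumes "\<And>s. s \<in> {0..t} \<Longrightarrow> e s = e' s" "0 \<le> t"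
  shows "fluid_path m r e t = fluid_path m r e' t"
proof -
  have "integral {0..t} (\<lambda>s. e s * pairing m (schwartz_shift (t - s) (schwartz_deriv \<phi>)))
      = integral {0..t} (\<lambda>s. e' s * pairing m (schwartz_shift (t - s) (schwartz_deriv \<phi>)))" for \<phi>
    using assms(1) by (intro integral_cong) simp
  then show ?thesis unfolding fluid_path_def using assms by simp
qed

context G_GI_infinity_queue
begin

text \<open>Arrivals up to time t are the first \<open>E \<omega> t\<close> ones, so a sum over
  customers with a time cut-off is a partial sum. A bound that is uniform in the number of summands
  is thereby uniform in time.\<close>

lemma sum_arrivals:
  assumes \<omega>: "\<omega> \<in> space M" and t: "t \<in> {0..T}"
  shows "(\<Sum>j<E \<omega> T. heaviside (arrival_time (E \<omega>) (Suc j)) t * x j) = (\<Sum>j<E \<omega> t. x j)"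
proof -
  have T: "0 \<le> T" using t by simp
  have "(\<Sum>j<E \<omega> T. heaviside (arrival_time (E \<omega>) (Suc j)) t * x j) = (\<Sum>j<E \<omega> T. if j \<in> {..<E \<omega> t} then x j else 0)"
  proof (rule sum.cong[OF refl])
    fix j assume "j \<in> {..<E \<omega> T}"
    then have "arrival_time (E \<omega>) (Suc j) \<le> t \<longleftrightarrow> Suc j \<le> E \<omega> t"
      using arrival_time_le_iff(1)[OF \<omega> _ _ T, of "Suc j" t] t by simp
    then show "heaviside (arrival_time (E \<omega>) (Suc j)) t * x j = (if j \<in> {..<E \<omega> t} then x j else 0)"
      by (simp add: Suc_le_eq)
  qed
  also have "\<dots> = (\<Sum>j\<in>{..<E \<omega> T} \<inter> {..<E \<omega> t}. x j)" by (rule sum.inter_restrict[symmetric]) simp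
  also have "{..<E \<omega> T} \<inter> {..<E \<omega> t} = {..<E \<omega> t}" using E_le[OF \<omega>, of t T] t by auto
  finally show ?thesis .
qed

text \<open>Initial customers move deterministically and cancel against the transported initial
  value. Each arrival remains, as a unit mass at its service time in the queue and as the service
  distribution in the fluid path. \<open>E \<omega> 0 = 0\<close> keeps arrivals out of the residual
  distribution at time 0.\<close>

lemma residual_minus_fluid:
  assumes \<omega>: "\<omega> \<in> space M" and E0: "E \<omega> 0 = 0" and t: "t \<in> {0..T}" and \<theta>: "pairing (service_dist F) \<theta> \<noteq> 0"
    and x: "x = (\<lambda>t\<in>{0..T}. w *\<^sub>R residual_dist (E \<omega>) (R0 \<omega>) (\<lambda>i. \<eta> i \<omega>) 0 + (w * real (E \<omega> t)) *\<^sub>R service_dist F)"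
  shows "pairing (w *\<^sub>R residual_dist (E \<omega>) (R0 \<omega>) (\<lambda>i. \<eta> i \<omega>) t) \<phi> - pairing (fluid_map T (service_dist F) \<theta> x t) \<phi>
    = w * (\<Sum>j<E \<omega> T. heaviside (arrival_time (E \<omega>) (Suc j)) t *
        pairing (dirac_dist (\<eta> (Suc j) \<omega>) - service_dist F) (schwartz_shift (t - arrival_time (E \<omega>) (Suc j)) \<phi>))"
proof -
  let ?m = "service_dist F" and ?\<tau> = "\<lambda>j. arrival_time (E \<omega>) (Suc j)" and ?K = "initial_total (R0 \<omega>)"
  let ?r = "w *\<^sub>R residual_dist (E \<omega>) (R0 \<omega>) (\<lambda>i. \<eta> i \<omega>) 0"
  let ?a = "customer_arrival T (E \<omega>) (R0 \<omega>)" and ?s = "customer_service (R0 \<omega>) (\<lambda>i. \<eta> i \<omega>)"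
  have T: "0 \<le> T" using t by simp
  have \<tau>0: "0 \<le> ?\<tau> j" if "j < E \<omega> T" for j using arrival_time_le_iff(2)[OF \<omega> _ _ T, of "Suc j"] that by simp
  have \<tau>pos: "\<not> ?\<tau> j \<le> 0" if "j < E \<omega> T" for j
    using arrival_time_le_iff(1)[OF \<omega> _ _ T, of "Suc j" 0] that E0 by simp
  have aK: "?a i = 0" if "i < ?K" for i using that by (simp add: customer_arrival_def)
  have aN: "?a (?K + j) = ?\<tau> j" "?s (?K + j) = \<eta> (Suc j) \<omega>" if "j < E \<omega> T" for j
    using that by (simp_all add: customer_arrival_def customer_service_def)
  have x0: "x 0 = ?r" unfolding x using T E0 by (intro tempered_eqI) (simp add: plus_tempered.rep_eq scaleR_tempered.rep_eq)
  have "arrival_part ?m \<theta> x u = step_fun (E \<omega> T) ?\<tau> (\<lambda>_. w) u" if u: "u \<in> {0..T}" for u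
  proof -
    have "pairing (x u) \<theta> - pairing (x 0) \<theta> = w * real (E \<omega> u) * pairing ?m \<theta>"
      unfolding x0 using u by (simp add: x plus_tempered.rep_eq scaleR_tempered.rep_eq)
    then have "arrival_part ?m \<theta> x u = w * real (E \<omega> u)" unfolding arrival_part_def using \<theta> by simp
    also have "\<dots> = (\<Sum>j<E \<omega> u. w)" by simp
    also have "\<dots> = (\<Sum>j<E \<omega> T. heaviside (?\<tau> j) u * w)" by (rule sum_arrivals[OF \<omega> u, symmetric])
    finally show ?thesis by (simp only: step_fun_def mult.commute)
  qed
  then have "fluid_path ?m ?r (arrival_part ?m \<theta> x) t = fluid_path ?m ?r (step_fun (E \<omega> T) ?\<tau> (\<lambda>_. w)) t"
    by (rule fluid_path_cong) (use t in auto)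
  then have "fluid_map T ?m \<theta> x t = fluid_path ?m ?r (step_fun (E \<omega> T) ?\<tau> (\<lambda>_. w)) t"
    unfolding fluid_map_def x0 using t by simp
  then have fluid: "pairing (fluid_map T ?m \<theta> x t) \<phi> = pairing ?r (schwartz_shift t \<phi>)
      + (\<Sum>j<E \<omega> T. w * heaviside (?\<tau> j) t * pairing ?m (schwartz_shift (t - ?\<tau> j) \<phi>))"
    using pairing_fluid_path_step[of "E \<omega> T" ?\<tau> t ?m ?r "\<lambda>_. w" \<phi>] \<tau>0 t by simp
  have "pairing ?r (schwartz_shift t \<phi>)
      = w * (\<Sum>i<?K + E \<omega> T. heaviside (?a i) 0 * sfun (schwartz_shift t \<phi>) (?s i - (0 - ?a i)))"
    using T by (subst residual_dist_eq_customer_path[OF \<omega>, of 0 T]) (simp_all only: pairing_customer_path atLeastAtMost_iff order_refl simp_thms)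
  also have "(\<Sum>i<?K + E \<omega> T. heaviside (?a i) 0 * sfun (schwartz_shift t \<phi>) (?s i - (0 - ?a i)))
      = (\<Sum>i<?K. sfun \<phi> (?s i - t)) + (\<Sum>j<E \<omega> T. 0)"
    unfolding sum_lessThan_add
    by (intro arg_cong2[where f="(+)"] sum.cong refl) (use aK aN \<tau>pos in \<open>simp_all add: schwartz_shift.rep_eq\<close>)
  finally have r: "pairing ?r (schwartz_shift t \<phi>) = w * (\<Sum>i<?K. sfun \<phi> (?s i - t))" by simp
  have "pairing (w *\<^sub>R residual_dist (E \<omega>) (R0 \<omega>) (\<lambda>i. \<eta> i \<omega>) t) \<phi>
      = w * (\<Sum>i<?K + E \<omega> T. heaviside (?a i) t * sfun \<phi> (?s i - (t - ?a i)))"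
    unfolding residual_dist_eq_customer_path[OF \<omega> t] pairing_customer_path ..
  also have "(\<Sum>i<?K + E \<omega> T. heaviside (?a i) t * sfun \<phi> (?s i - (t - ?a i)))
      = (\<Sum>i<?K. sfun \<phi> (?s i - t)) + (\<Sum>j<E \<omega> T. heaviside (?\<tau> j) t * sfun \<phi> (\<eta> (Suc j) \<omega> - (t - ?\<tau> j)))"
    unfolding sum_lessThan_add
    by (intro arg_cong2[where f="(+)"] sum.cong refl) (use aK aN t in simp_all)
  finally have "pairing (w *\<^sub>R residual_dist (E \<omega>) (R0 \<omega>) (\<lambda>i. \<eta> i \<omega>) t) \<phi>
      = pairing ?r (schwartz_shift t \<phi>) + w * (\<Sum>j<E \<omega> T. heaviside (?\<tau> j) t * sfun \<phi> (\<eta> (Suc j) \<omega> - (t - ?\<tau> j)))"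
    unfolding r by (simp only: distrib_left)
  then have "pairing (w *\<^sub>R residual_dist (E \<omega>) (R0 \<omega>) (\<lambda>i. \<eta> i \<omega>) t) \<phi> - pairing (fluid_map T ?m \<theta> x t) \<phi>
      = w * (\<Sum>j<E \<omega> T. heaviside (?\<tau> j) t * sfun \<phi> (\<eta> (Suc j) \<omega> - (t - ?\<tau> j)))
        - w * (\<Sum>j<E \<omega> T. heaviside (?\<tau> j) t * pairing ?m (schwartz_shift (t - ?\<tau> j) \<phi>))"
    unfolding fluid by (simp add: sum_distrib_left mult.assoc)
  also have "\<dots> = w * (\<Sum>j<E \<omega> T. heaviside (?\<tau> j) t *
        pairing (dirac_dist (\<eta> (Suc j) \<omega>) - ?m) (schwartz_shift (t - ?\<tau> j) \<phi>))"
    unfolding right_diff_distrib[symmetric] sum_subtractf[symmetric] minus_tempered.rep_eq pairing_dirac_dist schwartz_shift.rep_eq ..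
  finally show ?thesis .
qed

text \<open>\<open>centred_sum_maximal\<close> for \<theta> at the service times minus its mean.
  These variables are bounded by twice the sup norm of \<theta>; the added 1 makes the bound c
  positive.\<close>

lemma service_maximal:
  fixes \<theta> :: schwartz
  defines "c \<equiv> 2 * schwartz_norm 0 \<theta> + 1"
  assumes \<kappa>: "0 < \<kappa>" and C: "0 \<le> C" and n: "2 * c \<le> \<kappa> * real n"
  shows "\<exists>A\<in>sets M. prob A \<le> (4 * C * c / \<kappa> + 1) * (4 * C * c\<^sup>2 / \<kappa>\<^sup>2) / real n \<and>
    (\<forall>\<omega>\<in>space M - A. \<forall>k. real k \<le> C * real n \<longrightarrow>
      \<bar>\<Sum>j<k. pairing (dirac_dist (\<eta> (Suc j) \<omega>) - service_dist F) \<theta>\<bar> \<le> \<kappa> * real n)"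
proof (rule centred_sum_maximal[OF _ _ _ _ \<kappa> C n])
  let ?X = "\<lambda>i \<omega>. pairing (dirac_dist (\<eta> (Suc i) \<omega>) - service_dist F) \<theta>"
  have X: "?X = (\<lambda>i \<omega>. sfun \<theta> (\<eta> (Suc i) \<omega>) - pairing (service_dist F) \<theta>)"
    by (simp add: minus_tempered.rep_eq pairing_dirac_dist)
  show "indep_vars (\<lambda>_. borel) ?X UNIV"
    unfolding X by (rule indep_vars_compose2[OF indep_vars_Suc[OF \<eta>_indep], of "\<lambda>_ y. sfun \<theta> y - pairing (service_dist F) \<theta>" "\<lambda>_. borel"]) measurable
  have bd: "\<bar>sfun \<theta> y\<bar> \<le> schwartz_norm 0 \<theta>" for y using sderiv_le_norm[of 0 0 \<theta> y] by simp
  show "0 < c" unfolding c_def using schwartz_norm_nonneg[of 0 \<theta>] by simp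
  show "\<bar>?X i \<omega>\<bar> \<le> c" for i \<omega>
    unfolding minus_tempered.rep_eq pairing_dirac_dist c_def using bd[of "\<eta> (Suc i) \<omega>"] service_dist_bound[of \<theta>] by linarith
  show "expectation (?X i) = 0" for i
  proof -
    have \<eta>_meas: "\<eta> (Suc i) \<in> borel_measurable M"
      using distributed_measurable[OF \<eta>_density[of "Suc i"]] by simp
    have int: "integrable M (\<lambda>\<omega>. sfun \<theta> (\<eta> (Suc i) \<omega>))"
      using bd \<eta>_meas by (intro integrable_const_bound[where B="schwartz_norm 0 \<theta>"]) auto
    have "expectation (?X i) = expectation (\<lambda>\<omega>. sfun \<theta> (\<eta> (Suc i) \<omega>)) - expectation (\<lambda>_. pairing (service_dist F) \<theta>)"
      unfolding minus_tempered.rep_eq pairing_dirac_dist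
      by (intro Bochner_Integration.integral_diff int integrable_const)
    then show ?thesis using pairing_service_dist_expectation[of "Suc i" \<theta>] by (simp add: prob_space)
  qed
qed

end

text \<open>The threshold does not depend on the queue, so it applies to a sequence of queues on different
  probability spaces.\<close>

lemma service_law_of_large_numbers:
  assumes B: "schwartz_bounded B" and \<kappa>: "0 < \<kappa>" and C: "0 \<le> C" and \<epsilon>: "0 < \<epsilon>"
  shows "\<exists>n0\<ge>1. \<forall>n\<ge>n0. \<forall>(M :: 'a measure) E R0 \<eta>. G_GI_infinity_queue M E R0 \<eta> F f \<longrightarrow>
    (\<exists>A\<in>sets M. measure M A \<le> \<epsilon> \<and> (\<forall>\<omega>\<in>space M - A. \<forall>\<psi>\<in>B. \<forall>k. real k \<le> C * real n \<longrightarrow>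
      \<bar>\<Sum>j<k. pairing (dirac_dist (\<eta> (Suc j) \<omega>) - service_dist F) \<psi>\<bar> \<le> \<kappa> * real n))"
proof -
  obtain L where L: "0 < L" "\<And>\<phi>. \<phi> \<in> B \<Longrightarrow> schwartz_norm (Suc 0) \<phi> \<le> L"
    using schwartz_bounded_obtain[OF B, of "Suc 0"] by blast
  \<comment> \<open>Replacing a test function by a point of the net costs
    \<open>2 * \<delta>\<close> per customer before scaling by L, hence at most 2 L \<delta> C n in
    total; this choice makes it at most half of \<kappa> n.\<close>
  define \<delta> where "\<delta> = \<kappa> / (4 * L * (C + 1))"
  have \<delta>: "0 < \<delta>" using \<kappa> L C by (simp add: \<delta>_def)
  have \<delta>C: "2 * L * \<delta> * C \<le> \<kappa> / 2"
  proof -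
    have "4 * L * (C + 1) * \<delta> = \<kappa>" using L C by (simp add: \<delta>_def)
    moreover have "4 * L * C * \<delta> \<le> 4 * L * (C + 1) * \<delta>" using L \<delta> by (intro mult_right_mono mult_left_mono) auto
    ultimately show ?thesis by (simp add: mult_ac)
  qed
  obtain \<Phi> where \<Phi>: "finite \<Phi>" "\<And>\<phi>. schwartz_norm (Suc 0) \<phi> \<le> 1 \<Longrightarrow> \<exists>\<theta>\<in>\<Phi>. schwartz_norm 0 (\<phi> - \<theta>) < \<delta>"
    using schwartz_norm_totally_bounded[OF \<delta>, of 0] by blast
  define c where "c \<theta> = 2 * schwartz_norm 0 \<theta> + 1" for \<theta>
  \<comment> \<open>The other half of \<kappa> goes to the functions of the net, after scaling by
    L.\<close>
  define \<kappa>1 where "\<kappa>1 = \<kappa> / (2 * L)"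
  have \<kappa>1: "0 < \<kappa>1" "L * \<kappa>1 = \<kappa> / 2" using \<kappa> L by (simp_all add: \<kappa>1_def)
  \<comment> \<open>The exceptional event for \<theta> has probability at most D \<theta> / n, and
    the net is finite.\<close>
  define D where "D \<theta> = (4 * C * c \<theta> / \<kappa>1 + 1) * (4 * C * (c \<theta>)\<^sup>2 / \<kappa>1\<^sup>2)" for \<theta>
  obtain n1 :: nat where n1: "(\<Sum>\<theta>\<in>\<Phi>. 2 * c \<theta>) / \<kappa>1 \<le> real n1" using real_arch_simple by blast
  obtain n2 :: nat where n2: "(\<Sum>\<theta>\<in>\<Phi>. D \<theta>) / \<epsilon> \<le> real n2" using real_arch_simple by blast
  have c0: "0 \<le> c \<theta>" for \<theta> unfolding c_def using schwartz_norm_nonneg[of 0 \<theta>] by simp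
  have "\<exists>A\<in>sets M. measure M A \<le> \<epsilon> \<and> (\<forall>\<omega>\<in>space M - A. \<forall>\<psi>\<in>B. \<forall>k. real k \<le> C * real n \<longrightarrow>
      \<bar>\<Sum>j<k. pairing (dirac_dist (\<eta> (Suc j) \<omega>) - service_dist F) \<psi>\<bar> \<le> \<kappa> * real n)"
    if n: "n \<ge> max 1 (max n1 n2)" and q: "G_GI_infinity_queue M E R0 \<eta> F f" for n and M :: "'a measure" and E R0 \<eta>
  proof -
    interpret q: G_GI_infinity_queue M E R0 \<eta> F f by (rule q)
    have n': "1 \<le> n" "real n1 \<le> real n" "real n2 \<le> real n" using n by auto
    have "\<exists>A\<in>sets M. measure M A \<le> D \<theta> / real n \<and> (\<forall>\<omega>\<in>space M - A. \<forall>k. real k \<le> C * real n \<longrightarrow>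
        \<bar>\<Sum>j<k. pairing (dirac_dist (\<eta> (Suc j) \<omega>) - service_dist F) \<theta>\<bar> \<le> \<kappa>1 * real n)" if \<theta>: "\<theta> \<in> \<Phi>" for \<theta>
      unfolding D_def c_def
    proof (rule q.service_maximal[OF \<kappa>1(1) C])
      have "2 * c \<theta> \<le> (\<Sum>\<theta>\<in>\<Phi>. 2 * c \<theta>)" using \<Phi>(1) \<theta> c0 by (intro member_le_sum) auto
      also have "\<dots> \<le> \<kappa>1 * real n1" using n1 \<kappa>1 by (simp add: field_simps)
      also have "\<dots> \<le> \<kappa>1 * real n" using n' \<kappa>1 by (intro mult_left_mono) auto
      finally show "2 * (2 * schwartz_norm 0 \<theta> + 1) \<le> \<kappa>1 * real n" unfolding c_def .
    qed
    then obtain A where A: "\<And>\<theta>. \<theta> \<in> \<Phi> \<Longrightarrow> A \<theta> \<in> sets M" "\<And>\<theta>. \<theta> \<in> \<Phi> \<Longrightarrow> measure M (A \<theta>) \<le> D \<theta> / real n"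
      "\<And>\<theta> \<omega> k. \<theta> \<in> \<Phi> \<Longrightarrow> \<omega> \<in> space M - A \<theta> \<Longrightarrow> real k \<le> C * real n \<Longrightarrow>
        \<bar>\<Sum>j<k. pairing (dirac_dist (\<eta> (Suc j) \<omega>) - service_dist F) \<theta>\<bar> \<le> \<kappa>1 * real n"
      by metis
    define A' where "A' = (\<Union>\<theta>\<in>\<Phi>. A \<theta>)"
    have "measure M A' \<le> (\<Sum>\<theta>\<in>\<Phi>. measure M (A \<theta>))"
      unfolding A'_def using \<Phi>(1) A(1) by (intro measure_UNION_le) auto
    also have "\<dots> \<le> (\<Sum>\<theta>\<in>\<Phi>. D \<theta> / real n)" by (rule sum_mono[OF A(2)])
    also have "\<dots> = (\<Sum>\<theta>\<in>\<Phi>. D \<theta>) / real n" by (rule sum_divide_distrib[symmetric])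
    also have "\<dots> \<le> \<epsilon>"
    proof -
      have "(\<Sum>\<theta>\<in>\<Phi>. D \<theta>) \<le> real n2 * \<epsilon>" using n2 \<epsilon> by (simp add: field_simps)
      also have "\<dots> \<le> real n * \<epsilon>" using n' \<epsilon> by (intro mult_right_mono) auto
      finally show ?thesis using n'(1) by (simp add: field_simps)
    qed
    finally have "measure M A' \<le> \<epsilon>" .
    moreover have "A' \<in> sets M" unfolding A'_def using \<Phi>(1) A(1) by (intro sets.finite_UN) auto
    moreover have "\<bar>\<Sum>j<k. pairing (dirac_dist (\<eta> (Suc j) \<omega>) - service_dist F) \<psi>\<bar> \<le> \<kappa> * real n"
      if \<omega>: "\<omega> \<in> space M - A'" and \<psi>: "\<psi> \<in> B" and k: "real k \<le> C * real n" for \<omega> \<psi> k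
    proof -
      define \<psi>' where "\<psi>' = (1 / L) *\<^sub>R \<psi>"
      have \<psi>\<psi>': "\<psi> = L *\<^sub>R \<psi>'" using L by (simp add: \<psi>'_def)
      have "schwartz_norm (Suc 0) \<psi>' \<le> \<bar>1 / L\<bar> * schwartz_norm (Suc 0) \<psi>"
        unfolding \<psi>'_def by (rule schwartz_norm_scaleR_le)
      also have "\<dots> \<le> \<bar>1 / L\<bar> * L" using L(2)[OF \<psi>] by (intro mult_left_mono) auto
      also have "\<dots> = 1" using L by simp
      finally obtain \<theta> where \<theta>: "\<theta> \<in> \<Phi>" "schwartz_norm 0 (\<psi>' - \<theta>) < \<delta>" using \<Phi>(2) by blast
      let ?m = "\<lambda>j. dirac_dist (\<eta> (Suc j) \<omega>) - service_dist F"
      have md: "\<bar>pairing (?m j) (\<psi>' - \<theta>)\<bar> \<le> 2 * \<delta>" for j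
        using sderiv_le_norm[of 0 0 "\<psi>' - \<theta>" "\<eta> (Suc j) \<omega>"] q.service_dist_bound[of "\<psi>' - \<theta>"] \<theta>(2)
        unfolding minus_tempered.rep_eq pairing_dirac_dist by simp
      have "\<bar>\<Sum>j<k. pairing (?m j) (\<psi>' - \<theta>)\<bar> \<le> (\<Sum>j<k. 2 * \<delta>)"
        by (intro order_trans[OF sum_abs] sum_mono md)
      also have "\<dots> = real k * (2 * \<delta>)" by simp
      also have "\<dots> \<le> C * real n * (2 * \<delta>)" using k \<delta> by (intro mult_right_mono) auto
      finally have 1: "\<bar>\<Sum>j<k. pairing (?m j) (\<psi>' - \<theta>)\<bar> \<le> C * real n * (2 * \<delta>)" .
      have "\<omega> \<in> space M - A \<theta>" using \<omega> \<theta>(1) unfolding A'_def by blast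
      then have 2: "\<bar>\<Sum>j<k. pairing (?m j) \<theta>\<bar> \<le> \<kappa>1 * real n" using A(3) \<theta>(1) k by blast
      have "(\<Sum>j<k. pairing (?m j) \<psi>') = (\<Sum>j<k. pairing (?m j) (\<psi>' - \<theta>)) + (\<Sum>j<k. pairing (?m j) \<theta>)"
        unfolding pairing_diff sum.distrib[symmetric] by simp
      then have "\<bar>\<Sum>j<k. pairing (?m j) \<psi>'\<bar> \<le> C * real n * (2 * \<delta>) + \<kappa>1 * real n" using 1 2 by linarith
      then have "L * \<bar>\<Sum>j<k. pairing (?m j) \<psi>'\<bar> \<le> L * (C * real n * (2 * \<delta>) + \<kappa>1 * real n)"
        using L by (intro mult_left_mono) auto
      also have "\<dots> = (2 * L * \<delta> * C + L * \<kappa>1) * real n" by (simp add: algebra_simps)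
      also have "\<dots> \<le> \<kappa> * real n" using \<delta>C \<kappa>1(2) by (intro mult_right_mono) auto
      finally have "L * \<bar>\<Sum>j<k. pairing (?m j) \<psi>'\<bar> \<le> \<kappa> * real n" .
      moreover have "(\<Sum>j<k. pairing (?m j) \<psi>) = L * (\<Sum>j<k. pairing (?m j) \<psi>')"
        unfolding \<psi>\<psi>' pairing_scaleR sum_distrib_left ..
      ultimately show ?thesis using L(1) by (simp add: abs_mult)
    qed
    ultimately show ?thesis by blast
  qed
  then show ?thesis by (intro exI[of _ "max 1 (max n1 n2)"]) auto
qed

text \<open>Time changes fix the end points 0 and T, so evaluation there is continuous, and the real
  variables \<open>arrival_part\<close> at T inherit tightness from weak convergence.\<close>

lemma arrivals_tight:
  assumes T: "0 \<le> T" and W: "converges_weakly (skorokhod_topology T) M X N Z" and \<epsilon>: "0 < \<epsilon>"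
  shows "\<exists>C\<ge>0. \<exists>n0\<ge>1. \<forall>n\<ge>n0. \<exists>A\<in>sets (M n). measure (M n) A \<le> \<epsilon> \<and>
    (\<forall>\<omega>\<in>space (M n) - A. \<bar>arrival_part m \<theta> (X n \<omega>) T\<bar> < C)"
proof -
  let ?X = "skorokhod_topology T"
  define e where "e x = arrival_part m \<theta> x T" for x
  \<comment> \<open>A continuous substitute for an indicator: 0 as long as |e x| is at most C, and 1
    from C + 1 on.\<close>
  define k where "k C x = min 1 (max 0 (\<bar>e x\<bar> - C))" for C x
  have N: "prob_space N" and Zm: "Z \<in> measurable N (borel_of_top ?X)"
    using W unfolding converges_weakly_def by auto
  interpret N: prob_space N by (rule N)
  have ev: "continuous_map ?X euclideanreal (\<lambda>x. pairing (x u) \<theta>)" if u: "u = 0 \<or> u = T" for u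
  proof (rule continuous_map_skorokhod_realI)
    fix x and d :: real assume d: "0 < d"
    have "\<bar>pairing (x u) \<theta> - pairing (y u) \<theta>\<bar> < d" if y: "skorokhod_gauge T {\<theta>} x y < min d 1" for y
    proof -
      obtain l a c where l: "l \<in> time_changes T" "0 \<le> a" "0 \<le> c" "a + c < min d 1" "time_change_size T l \<le> ennreal c"
        "\<And>t \<phi>. t \<in> {0..T} \<Longrightarrow> \<phi> \<in> {\<theta>} \<Longrightarrow> \<bar>pairing (x t) \<phi> - pairing (y (l t)) \<phi>\<bar> \<le> a"
        by (fact skorokhod_gauge_lessE[OF y min.cobounded2])
      have "l u = u" "u \<in> {0..T}" using u time_change_0[OF l(1) T] time_change_T[OF l(1) T] T by auto
      then show ?thesis using l(6)[of u \<theta>] l by auto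
    qed
    then show "\<exists>B e. schwartz_bounded B \<and> 0 < e \<and>
        (\<forall>y\<in>skorokhod_paths T. skorokhod_gauge T B x y < e \<longrightarrow> \<bar>pairing (x u) \<theta> - pairing (y u) \<theta>\<bar> < d)"
      using d schwartz_bounded_finite[of "{\<theta>}"] by (intro exI[of _ "{\<theta>}"] exI[of _ "min d 1"]) auto
  qed
  have kc: "continuous_map ?X euclideanreal (k C)" for C
    unfolding k_def e_def arrival_part_def divide_inverse
    by (intro continuous_intros continuous_map_real_abs ev) auto
  have k01: "0 \<le> k C x" "k C x \<le> 1" for C x by (auto simp: k_def)
  have kb: "bounded (k C ` topspace ?X)" for C
    unfolding bounded_iff using k01 by (intro exI[of _ 1]) auto
  have km: "k C \<in> borel_measurable (borel_of_top ?X)" for C by (rule measurable_borel_of_top_real[OF kc])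
  have "(\<lambda>i. \<integral>\<omega>. k (real i) (Z \<omega>) \<partial>N) \<longlonglongrightarrow> (\<integral>\<omega>. 0 \<partial>N)"
  proof (rule integral_dominated_convergence[where w="\<lambda>_. 1"])
    show "(\<lambda>\<omega>. k (real i) (Z \<omega>)) \<in> borel_measurable N" for i by (rule measurable_compose[OF Zm km])
    show "AE \<omega> in N. (\<lambda>i. k (real i) (Z \<omega>)) \<longlonglongrightarrow> 0"
    proof (rule AE_I2)
      fix \<omega>
      obtain i0 :: nat where "\<bar>e (Z \<omega>)\<bar> \<le> real i0" using real_arch_simple by blast
      then have "\<forall>\<^sub>F i in sequentially. k (real i) (Z \<omega>) = 0"
        unfolding eventually_sequentially k_def by (intro exI[of _ i0]) auto
      then show "(\<lambda>i. k (real i) (Z \<omega>)) \<longlonglongrightarrow> 0" by (rule tendsto_eventually)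
    qed
  qed (use k01 in auto)
  then have "(\<lambda>i. \<integral>\<omega>. k (real i) (Z \<omega>) \<partial>N) \<longlonglongrightarrow> 0" by simp
  then have "\<forall>\<^sub>F i in sequentially. (\<integral>\<omega>. k (real i) (Z \<omega>) \<partial>N) < \<epsilon>" using \<epsilon> by (rule order_tendstoD(2))
  then obtain i where i: "(\<integral>\<omega>. k (real i) (Z \<omega>) \<partial>N) < \<epsilon>" using eventually_happens by fastforce
  have "(\<lambda>n. \<integral>\<omega>. k (real i) (X n \<omega>) \<partial>M n) \<longlonglongrightarrow> (\<integral>\<omega>. k (real i) (Z \<omega>) \<partial>N)"
    using W kc kb unfolding converges_weakly_def by blast
  then have "\<forall>\<^sub>F n in sequentially. (\<integral>\<omega>. k (real i) (X n \<omega>) \<partial>M n) < \<epsilon>" using i by (rule order_tendstoD(2))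
  then obtain n0 where n0: "\<And>n. n \<ge> n0 \<Longrightarrow> (\<integral>\<omega>. k (real i) (X n \<omega>) \<partial>M n) < \<epsilon>"
    unfolding eventually_sequentially by blast
  have "\<exists>A\<in>sets (M n). measure (M n) A \<le> \<epsilon> \<and> (\<forall>\<omega>\<in>space (M n) - A. \<bar>arrival_part m \<theta> (X n \<omega>) T\<bar> < real i + 1)"
    if n: "n \<ge> max 1 n0" for n
  proof -
    have n': "n \<ge> 1" "n \<ge> n0" using n by auto
    have Xm: "X n \<in> measurable (M n) (borel_of_top ?X)" and prob: "prob_space (M n)"
      using W n' unfolding converges_weakly_def by auto
    interpret M: prob_space "M n" by (rule prob)
    let ?A = "{\<omega> \<in> space (M n). 1 \<le> k (real i) (X n \<omega>)}"
    have kXm: "(\<lambda>\<omega>. k (real i) (X n \<omega>)) \<in> borel_measurable (M n)" by (rule measurable_compose[OF Xm km])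
    then have A: "?A \<in> sets (M n)" by measurable
    have "integrable (M n) (\<lambda>\<omega>. k (real i) (X n \<omega>))"
      using k01 kXm by (intro M.integrable_const_bound[where B=1]) auto
    then have "measure (M n) ?A \<le> (\<integral>\<omega>. k (real i) (X n \<omega>) \<partial>M n) / 1"
      using k01 by (intro integral_Markov_inequality_measure[where A="{}"]) auto
    then have "measure (M n) ?A \<le> \<epsilon>" using n0[OF n'(2)] by simp
    moreover have "\<bar>arrival_part m \<theta> (X n \<omega>) T\<bar> < real i + 1" if "\<omega> \<in> space (M n) - ?A" for \<omega>
      using that unfolding k_def e_def by auto
    ultimately show ?thesis using A by blast
  qed
  then show ?thesis by (intro exI[of _ "real i + 1"] conjI exI[of _ "max 1 n0"]) auto
qed

theorem theorem5p6:
  fixes T :: real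
    and M :: "nat \<Rightarrow> 'a measure"
    and E R0 :: "nat \<Rightarrow> 'a \<Rightarrow> real \<Rightarrow> nat"
    and \<eta> :: "nat \<Rightarrow> nat \<Rightarrow> 'a \<Rightarrow> real"
    and F f :: "real \<Rightarrow> real"
    and N :: "'b measure"
    and R0bar :: "'b \<Rightarrow> tempered"
    and Ebar :: "'b \<Rightarrow> real \<Rightarrow> real"
  assumes T: "T > 0"
    and queue: "\<And>n. n \<ge> 1 \<Longrightarrow> G_GI_infinity_queue (M n) (E n) (R0 n) (\<eta> n) F f"
    and initial_and_arrivals: "converges_weakly (skorokhod_topology T)
          M (\<lambda>n \<omega>. \<lambda>t\<in>{0..T}.
               (1 / real n) *\<^sub>R residual_dist (E n \<omega>) (R0 n \<omega>) (\<lambda>i. \<eta> n i \<omega>) 0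
               + (real (E n \<omega> t) / real n) *\<^sub>R service_dist F)
          N (\<lambda>\<omega>. \<lambda>t\<in>{0..T}. R0bar \<omega> + Ebar \<omega> t *\<^sub>R service_dist F)"
  shows "\<exists>Rbar :: 'b \<Rightarrow> real \<Rightarrow> tempered.
      (\<forall>\<omega>\<in>space N.
          Rbar \<omega> \<in> skorokhod_paths T \<and>
          solves_fluid_equation T F (R0bar \<omega>) (Ebar \<omega>) (Rbar \<omega>) \<and>
          (\<forall>x\<in>skorokhod_paths T.
             solves_fluid_equation T F (R0bar \<omega>) (Ebar \<omega>) x \<longrightarrow> x = Rbar \<omega>)) \<and>
      converges_weakly (skorokhod_topology T)
          M (\<lambda>n \<omega>. \<lambda>t\<in>{0..T}.
               (1 / real n) *\<^sub>R residual_dist (E n \<omega>) (R0 n \<omega>) (\<lambda>i. \<eta> n i \<omega>) t)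
          N Rbar"
proof -
  let ?m = "service_dist F" and ?X = "skorokhod_topology T"
  define X where "X n \<omega> = (\<lambda>t\<in>{0..T}. (1 / real n) *\<^sub>R residual_dist (E n \<omega>) (R0 n \<omega>) (\<lambda>i. \<eta> n i \<omega>) 0
               + (real (E n \<omega> t) / real n) *\<^sub>R ?m)" for n \<omega>
  define Y where "Y n \<omega> = (\<lambda>t\<in>{0..T}. (1 / real n) *\<^sub>R residual_dist (E n \<omega>) (R0 n \<omega>) (\<lambda>i. \<eta> n i \<omega>) t)" for n \<omega>
  define Z where "Z \<omega> = (\<lambda>t\<in>{0..T}. R0bar \<omega> + Ebar \<omega> t *\<^sub>R ?m)" for \<omega>
  have X: "converges_weakly ?X M X N Z"
    using initial_and_arrivals unfolding X_def[abs_def] Z_def[abs_def] .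
  have T0: "0 \<le> T" using T by simp
  have m0: "pairing ?m gaussian \<noteq> 0"
    using G_GI_infinity_queue.pairing_service_dist_gaussian[OF queue[of 1]] by simp
  define \<Psi> where "\<Psi> = fluid_map T ?m gaussian"
  have \<Psi>: "continuous_map ?X ?X \<Psi>" unfolding \<Psi>_def by (rule continuous_map_fluid_map[OF T0 m0])
  define Rbar where "Rbar \<omega> = \<Psi> (Z \<omega>)" for \<omega>
  have Zp: "Z \<omega> \<in> skorokhod_paths T" if "\<omega> \<in> space N" for \<omega>
    using X that unfolding converges_weakly_def by (auto dest: measurable_space simp: space_borel_of_top)
  \<comment> \<open>\<open>Ebar \<omega> 0\<close> may differ from 0; it is then part of
    \<open>Z \<omega> 0\<close> and is taken out of the arrival part.\<close>
  have Zpart: "arrival_part ?m gaussian (Z \<omega>) t = Ebar \<omega> t - Ebar \<omega> 0" if "t \<in> {0..T}" for \<omega> t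
    using that T0 m0 unfolding arrival_part_def Z_def
    by (simp add: plus_tempered.rep_eq scaleR_tempered.rep_eq left_diff_distrib[symmetric])
  have Z0: "Z \<omega> 0 = R0bar \<omega> + Ebar \<omega> 0 *\<^sub>R ?m" for \<omega> using T0 by (simp add: Z_def)
  have Zform: "\<forall>t\<in>{0..T}. Z \<omega> t = Z \<omega> 0 + arrival_part ?m gaussian (Z \<omega>) t *\<^sub>R ?m" for \<omega>
  proof
    fix t assume t: "t \<in> {0..T}"
    have "Z \<omega> t = R0bar \<omega> + Ebar \<omega> t *\<^sub>R ?m" using t by (simp add: Z_def)
    then show "Z \<omega> t = Z \<omega> 0 + arrival_part ?m gaussian (Z \<omega>) t *\<^sub>R ?m"
      unfolding Zpart[OF t] Z0 by (simp add: scaleR_left_diff_distrib)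
  qed
  have solution: "Rbar \<omega> \<in> skorokhod_paths T \<and> solves_fluid_equation T F (R0bar \<omega>) (Ebar \<omega>) (Rbar \<omega>) \<and>
      (\<forall>x\<in>skorokhod_paths T. solves_fluid_equation T F (R0bar \<omega>) (Ebar \<omega>) x \<longrightarrow> x = Rbar \<omega>)"
    if \<omega>: "\<omega> \<in> space N" for \<omega>
  proof (intro conjI ballI impI)
    show R: "Rbar \<omega> \<in> skorokhod_paths T"
      unfolding Rbar_def \<Psi>_def by (rule fluid_map_paths[OF Zp[OF \<omega>]])
    show sol: "solves_fluid_equation T F (R0bar \<omega>) (Ebar \<omega>) (Rbar \<omega>)"
      unfolding solves_fluid_equation_def
    proof (intro ballI allI)
      fix t \<phi> assume t: "t \<in> {0..T}"
      let ?z = "fluid_path ?m (Z \<omega> 0) (arrival_part ?m gaussian (Z \<omega>))"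
      have Rz: "Rbar \<omega> s = ?z s" if "s \<in> {0..T}" for s using that by (simp add: Rbar_def \<Psi>_def fluid_map_def)
      have "pairing (?z t) \<phi> = pairing (Z \<omega> 0) \<phi> + arrival_part ?m gaussian (Z \<omega>) t * pairing ?m \<phi>
          - integral {0..t} (\<lambda>s. pairing (?z s) (schwartz_deriv \<phi>))"
        by (rule fluid_equation[OF cadlag_arrival_part[OF skorokhod_paths_cadlag[OF Zp[OF \<omega>]]] t])
      also have "pairing (Z \<omega> 0) \<phi> + arrival_part ?m gaussian (Z \<omega>) t * pairing ?m \<phi> = pairing (R0bar \<omega>) \<phi> + Ebar \<omega> t * pairing ?m \<phi>"
        unfolding Zpart[OF t] Z0 by (simp add: plus_tempered.rep_eq scaleR_tempered.rep_eq left_diff_distrib)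
      also have "integral {0..t} (\<lambda>s. pairing (?z s) (schwartz_deriv \<phi>)) = integral {0..t} (\<lambda>s. pairing (Rbar \<omega> s) (schwartz_deriv \<phi>))"
        using t by (intro integral_cong) (simp add: Rz)
      finally show "pairing (Rbar \<omega> t) \<phi> = pairing (R0bar \<omega>) \<phi> + Ebar \<omega> t * pairing ?m \<phi>
          - integral {0..t} (\<lambda>s. pairing (Rbar \<omega> s) (schwartz_deriv \<phi>))"
        unfolding Rz[OF t] .
    qed
    fix x assume x: "x \<in> skorokhod_paths T" and xs: "solves_fluid_equation T F (R0bar \<omega>) (Ebar \<omega>) x"
    show "x = Rbar \<omega>"
    proof (rule extensionalityI[of _ "{0..T}"])
      show "x \<in> extensional {0..T}" "Rbar \<omega> \<in> extensional {0..T}" using x R unfolding skorokhod_paths_def by auto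
      fix t assume "t \<in> {0..T}"
      then show "x t = Rbar \<omega> t"
        using xs sol unfolding solves_fluid_equation_def
        by (intro fluid_equation_unique[OF skorokhod_paths_cadlag[OF x] skorokhod_paths_cadlag[OF R],
              where b="\<lambda>t \<phi>. pairing (R0bar \<omega>) \<phi> + Ebar \<omega> t * pairing ?m \<phi>"]) auto
    qed
  qed
  obtain c :: "nat \<Rightarrow> (real \<Rightarrow> tempered) \<Rightarrow> nat" where
    c: "\<forall>x B \<epsilon>. x \<in> skorokhod_paths T \<longrightarrow>
    (\<forall>t\<in>{0..T}. x t = x 0 + arrival_part ?m gaussian x t *\<^sub>R ?m) \<longrightarrow> schwartz_bounded B \<longrightarrow> 0 < \<epsilon> \<longrightarrow>
    (\<exists>j. \<forall>y\<in>skorokhod_paths T. (\<forall>t\<in>{0..T}. y t = y 0 + arrival_part ?m gaussian y t *\<^sub>R ?m) \<longrightarrow>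
      c j y = c j x \<longrightarrow> skorokhod_gauge T B x y < \<epsilon>)"
    using skorokhod_codes[OF T0, of ?m gaussian] by blast
  have "converges_weakly ?X M Y N Rbar"
  proof (rule converges_weakly_skorokhod_close[where c="\<lambda>j \<omega>. c j (Z \<omega>)"])
    show "converges_weakly ?X M (\<lambda>n \<omega>. \<Psi> (X n \<omega>)) N Rbar"
      using converges_weakly_continuous_map[OF X \<Psi>] unfolding Rbar_def[abs_def] .
    show "Y n \<in> measurable (M n) (borel_of_top ?X)" if "n \<ge> 1" for n
      unfolding Y_def[abs_def] by (rule G_GI_infinity_queue.residual_path_measurable[OF queue[OF that] T0])
  next
    fix \<omega> U assume \<omega>: "\<omega> \<in> space N" and U: "openin ?X U" "Rbar \<omega> \<in> U"
    \<comment> \<open>Codes for Z serve for \<open>Rbar\<close> as well, because the preimage of U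
      under the continuous map \<Psi> is open.\<close>
    have "openin ?X {x \<in> topspace ?X. \<Psi> x \<in> U}" by (rule openin_continuous_map_preimage[OF \<Psi> U(1)])
    moreover have "Z \<omega> \<in> {x \<in> topspace ?X. \<Psi> x \<in> U}" using Zp[OF \<omega>] U(2) by (simp add: Rbar_def)
    ultimately have "\<exists>B e. schwartz_bounded B \<and> 0 < e \<and>
      (\<forall>y\<in>skorokhod_paths T. skorokhod_gauge T B (Z \<omega>) y < e \<longrightarrow> y \<in> {x \<in> topspace ?X. \<Psi> x \<in> U})"
      unfolding openin_skorokhod_iff[of T "{x \<in> topspace ?X. \<Psi> x \<in> U}"] by (elim conjE bspec)
    then obtain B e where B: "schwartz_bounded B" "0 < e"
      "\<forall>y\<in>skorokhod_paths T. skorokhod_gauge T B (Z \<omega>) y < e \<longrightarrow> y \<in> {x \<in> topspace ?X. \<Psi> x \<in> U}"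
      by (elim exE conjE)
    obtain j where j: "\<forall>y\<in>skorokhod_paths T. (\<forall>t\<in>{0..T}. y t = y 0 + arrival_part ?m gaussian y t *\<^sub>R ?m) \<longrightarrow>
      c j y = c j (Z \<omega>) \<longrightarrow> skorokhod_gauge T B (Z \<omega>) y < e"
      using c[rule_format, OF Zp[OF \<omega>] bspec[OF Zform] B(1,2)] by blast
    have "Rbar \<omega>' \<in> U" if "\<omega>' \<in> space N" "c j (Z \<omega>') = c j (Z \<omega>)" for \<omega>'
    proof -
      have "skorokhod_gauge T B (Z \<omega>) (Z \<omega>') < e" using j Zp[OF that(1)] Zform that(2) by blast
      then have "Z \<omega>' \<in> {x \<in> topspace ?X. \<Psi> x \<in> U}" using B(3) Zp[OF that(1)] by blast
      then show ?thesis unfolding Rbar_def by blast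
    qed
    then show "\<exists>j. \<forall>\<omega>'\<in>space N. c j (Z \<omega>') = c j (Z \<omega>) \<longrightarrow> Rbar \<omega>' \<in> U" by blast
  next
    fix B and \<delta> \<epsilon> :: real assume B: "schwartz_bounded B" and \<delta>: "0 < \<delta>" and \<epsilon>: "0 < \<epsilon>"
    \<comment> \<open>The integration by parts in \<open>delayed_sum_bound\<close> brings in shifts
      of \<phi>', so the law of large numbers is applied on this larger bounded set.\<close>
    define B' where "B' = B \<union> {schwartz_shift u \<phi> |u \<phi>. \<phi> \<in> schwartz_deriv ` B \<and> \<bar>u\<bar> \<le> T}"
    have B': "schwartz_bounded B'"
      unfolding B'_def by (intro schwartz_bounded_Un schwartz_bounded_shift schwartz_bounded_deriv B)
    define \<kappa> where "\<kappa> = (\<delta> / 2) / (1 + T)"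
    have \<kappa>: "0 < \<kappa>" "(1 + T) * \<kappa> < \<delta>"
    proof -
      show "0 < \<kappa>" using \<delta> T by (simp add: \<kappa>_def)
      have "1 + T \<noteq> 0" using T by simp
      from nonzero_mult_div_cancel_left[OF this, of "\<delta> / 2"]
      have "(1 + T) * \<kappa> = \<delta> / 2" by (simp only: \<kappa>_def times_divide_eq_right)
      then show "(1 + T) * \<kappa> < \<delta>" using \<delta> by linarith
    qed
    have \<epsilon>2: "0 < \<epsilon> / 2" using \<epsilon> by simp
    \<comment> \<open>C bounds the scaled number of arrivals, so that control of the partial sums up
      to C n reaches all arrivals in [0, T].\<close>
    obtain C n1 where C: "0 \<le> C" and n1: "n1 \<ge> 1" "\<forall>n\<ge>n1. \<exists>A\<in>sets (M n). measure (M n) A \<le> \<epsilon> / 2 \<and>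
        (\<forall>\<omega>\<in>space (M n) - A. \<bar>arrival_part ?m gaussian (X n \<omega>) T\<bar> < C)"
      using arrivals_tight[OF T0 X \<epsilon>2, of ?m gaussian] by blast
    obtain n2 where n2: "n2 \<ge> 1" "\<forall>n\<ge>n2. \<forall>(M :: 'a measure) E R0 \<eta>. G_GI_infinity_queue M E R0 \<eta> F f \<longrightarrow>
        (\<exists>A\<in>sets M. measure M A \<le> \<epsilon> / 2 \<and> (\<forall>\<omega>\<in>space M - A. \<forall>\<psi>\<in>B'. \<forall>k. real k \<le> C * real n \<longrightarrow>
          \<bar>\<Sum>j<k. pairing (dirac_dist (\<eta> (Suc j) \<omega>) - ?m) \<psi>\<bar> \<le> \<kappa> * real n))"
      using service_law_of_large_numbers[OF B' \<kappa>(1) C \<epsilon>2, of F f] by blast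
    have "\<exists>A\<in>sets (M n). measure (M n) A \<le> \<epsilon> \<and> (\<forall>\<omega>\<in>space (M n) - A. skorokhod_gauge T B (\<Psi> (X n \<omega>)) (Y n \<omega>) < \<delta>)"
      if n: "n \<ge> max n1 n2" for n
    proof -
      have n': "n \<ge> n1" "n \<ge> n2" "n \<ge> 1" using n n1(1) by auto
      interpret q: G_GI_infinity_queue "M n" "E n" "R0 n" "\<eta> n" F f by (rule queue[OF n'(3)])
      obtain A1 where A1: "A1 \<in> sets (M n)" "measure (M n) A1 \<le> \<epsilon> / 2"
        "\<forall>\<omega>\<in>space (M n) - A1. \<bar>arrival_part ?m gaussian (X n \<omega>) T\<bar> < C"
        using n1(2) n'(1) by blast
      obtain A2 where A2: "A2 \<in> sets (M n)" "measure (M n) A2 \<le> \<epsilon> / 2"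
        "\<forall>\<omega>\<in>space (M n) - A2. \<forall>\<psi>\<in>B'. \<forall>k. real k \<le> C * real n \<longrightarrow>
          \<bar>\<Sum>j<k. pairing (dirac_dist (\<eta> n (Suc j) \<omega>) - ?m) \<psi>\<bar> \<le> \<kappa> * real n"
        using n2(2)[rule_format, OF n'(2) queue[OF n'(3)]] by blast
      \<comment> \<open>The absence of arrivals at time 0 holds only almost surely.\<close>
      obtain A3 where A3: "A3 \<in> null_sets (M n)" "{\<omega> \<in> space (M n). \<not> E n \<omega> 0 = 0} \<subseteq> A3"
        using q.E_0 by (auto elim!: AE_E simp: null_sets_def)
      have A3': "A3 \<in> sets (M n)" "measure (M n) A3 = 0" using A3(1) by (auto simp: measure_def)
      let ?A = "A1 \<union> A2 \<union> A3"
      have "measure (M n) ?A \<le> measure (M n) (A1 \<union> A2) + measure (M n) A3"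
        using A1(1) A2(1) A3' by (intro measure_Un_le) auto
      also have "\<dots> \<le> measure (M n) A1 + measure (M n) A2"
        using measure_Un_le[OF A1(1) A2(1)] A3'(2) by simp
      also have "\<dots> \<le> \<epsilon>" using A1(2) A2(2) by simp
      finally have "measure (M n) ?A \<le> \<epsilon>" .
      moreover have "?A \<in> sets (M n)" using A1(1) A2(1) A3'(1) by auto
      moreover have "skorokhod_gauge T B (\<Psi> (X n \<omega>)) (Y n \<omega>) < \<delta>" if \<omega>A: "\<omega> \<in> space (M n) - ?A" for \<omega>
      proof -
        have \<omega>: "\<omega> \<in> space (M n)" using \<omega>A by simp
        have E0: "E n \<omega> 0 = 0" using \<omega>A A3(2) by blast
        let ?w = "1 / real n"
        have Xeq: "X n \<omega> = (\<lambda>t\<in>{0..T}. ?w *\<^sub>R residual_dist (E n \<omega>) (R0 n \<omega>) (\<lambda>i. \<eta> n i \<omega>) 0 + (?w * real (E n \<omega> t)) *\<^sub>R ?m)"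
          by (simp add: X_def)
        have "pairing (X n \<omega> T) gaussian - pairing (X n \<omega> 0) gaussian = real (E n \<omega> T) / real n * pairing ?m gaussian"
          unfolding X_def using T0 E0 by (simp add: plus_tempered.rep_eq scaleR_tempered.rep_eq)
        then have "arrival_part ?m gaussian (X n \<omega>) T = real (E n \<omega> T) / real n"
          unfolding arrival_part_def using m0 by simp
        moreover have "\<bar>arrival_part ?m gaussian (X n \<omega>) T\<bar> < C" using A1(3) \<omega>A by blast
        ultimately have "real (E n \<omega> T) / real n < C" by simp
        then have ET: "real (E n \<omega> T) \<le> C * real n" using n'(3) by (simp add: pos_divide_less_eq)
        have small: "\<bar>?w * (\<Sum>j<E n \<omega> T. heaviside (arrival_time (E n \<omega>) (Suc j)) s * pairing (dirac_dist (\<eta> n (Suc j) \<omega>) - ?m) \<psi>)\<bar> \<le> \<kappa>"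
          if s: "s \<in> {0..T}" and \<psi>: "\<psi> \<in> B'" for s \<psi>
        proof -
          have "real (E n \<omega> s) \<le> C * real n" using ET q.E_le[OF \<omega>, of s T] s by simp
          then have "\<bar>\<Sum>j<E n \<omega> s. pairing (dirac_dist (\<eta> n (Suc j) \<omega>) - ?m) \<psi>\<bar> \<le> \<kappa> * real n"
            using A2(3) \<omega>A \<psi> by blast
          then show ?thesis
            unfolding q.sum_arrivals[OF \<omega> s] abs_mult using n'(3) by (simp add: pos_divide_le_eq)
        qed
        \<comment> \<open>Queue and fluid path are driven by the same arrivals and are uniformly
          close, so the identity serves as time change.\<close>
        have "skorokhod_gauge T B (\<Psi> (X n \<omega>)) (Y n \<omega>) \<le> (1 + T) * \<kappa> + 0"
        proof (rule skorokhod_gauge_le[OF id_in_time_changes])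
          fix t \<phi> assume t: "t \<in> {0..T}" and \<phi>: "\<phi> \<in> B"
          have "\<bar>pairing (?w *\<^sub>R residual_dist (E n \<omega>) (R0 n \<omega>) (\<lambda>i. \<eta> n i \<omega>) t) \<phi> - pairing (\<Psi> (X n \<omega>) t) \<phi>\<bar> \<le> (1 + T) * \<kappa>"
            unfolding \<Psi>_def q.residual_minus_fluid[OF \<omega> E0 t m0 Xeq]
          proof (rule delayed_sum_bound[OF _ t \<phi>])
            show "0 \<le> arrival_time (E n \<omega>) (Suc j)" if "j < E n \<omega> T" for j
              using q.arrival_time_le_iff(2)[OF \<omega> _ _ T0, of "Suc j"] that by simp
          qed (rule small, auto simp: B'_def)
          then show "\<bar>pairing (\<Psi> (X n \<omega>) t) \<phi> - pairing (Y n \<omega> t) \<phi>\<bar> \<le> (1 + T) * \<kappa>"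
            using t by (simp add: Y_def abs_minus_commute)
        qed (use T \<kappa> in \<open>auto simp: time_change_size_id\<close>)
        then show ?thesis using \<kappa>(2) by linarith
      qed
      ultimately show ?thesis by blast
    qed
    then show "\<exists>n0. \<forall>n\<ge>n0. \<exists>A\<in>sets (M n). measure (M n) A \<le> \<epsilon> \<and>
        (\<forall>\<omega>\<in>space (M n) - A. skorokhod_gauge T B (\<Psi> (X n \<omega>)) (Y n \<omega>) < \<delta>)" by blast
  qed
  then have "converges_weakly ?X M (\<lambda>n \<omega>. \<lambda>t\<in>{0..T}.
      (1 / real n) *\<^sub>R residual_dist (E n \<omega>) (R0 n \<omega>) (\<lambda>i. \<eta> n i \<omega>) t) N Rbar"
    unfolding Y_def[abs_def] .
  with solution show ?thesis by (intro exI[of _ Rbar] conjI ballI) auto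
qed

end
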